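(* Let $D$ and $n$ be as in the context. Let $(\eta_m)_{m\in\mathbb{N}}$ be admissible conductivities (in the sense of the context) with $\|\eta_m\|_{L^\infty(\partial D)}\to0$, and for each $m$ let $(k_{\eta_m},u_{\eta_m})\in\mathbb{R}^+\times \big(H^2(D)\cap H^1_0(D)\big)$ be an eigenpair for $\eta_m$ with $\|u_{\eta_m}\|_{H^1(D)}=1$. If the sequence $(k_{\eta_m})_m$ is bounded, then there is a subsequence along which $k_{\eta_m}\to k_0$ and $u_{\eta_m}$ converges strongly to $u_0$ in $H^2(D)$, where $(k_0,u_0)\in\mathbb{R}^+\times H^2_0(D)$ is an eigenpair for $\eta=0$.
   Context: Let $d\in\{2,3\}$ and let $D\subset\mathbb{R}^d$ be a bounded simply connected open set with $\mathcal{C}^2$ boundary and unit outward normal $\nu$. The refractive index $n\in L^\infty(D)$ is real-valued with $n_{min}=\operatorname{ess\,inf}_D n>1$. An admissible conductivity is a real-valued $\eta\in L^\infty(\partial D)$ with $\operatorname{ess\,inf}_{\partial D}\eta>0$. $H^2(D)\cap H^1_0(D)=\{u\in H^2(D):u=0\text{ on }\partial D\}$ and $H^2_0(D)=\{u\in H^2(D):u=\partial_\nu u=0\text{ on }\partial D\}$, both with the $H^2(D)$ norm. $\mathbb{R}^+=(0,\infty)$. For $k>0$ define $$\mathcal{A}_{0,k}(u,\varphi)=\int_D\frac{1}{n-1}(\Delta u+k^2u)(\Delta\overline\varphi+k^2\overline\varphi)+k^4u\overline\varphi\,dx,\qquad \mathcal{B}(u,\varphi)=\int_D\nabla u\cdot\nabla\overline\varphi\,dx,$$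 and, for an admissible conductivity $\eta$, $$\mathcal{A}_{\eta,k}(u,\varphi)=\mathcal{A}_{0,k}(u,\varphi)+\int_{\partial D}\frac{k^2}{\eta}\frac{\partial u}{\partial\nu}\frac{\partial\overline\varphi}{\partial\nu}\,ds.$$ For an admissible $\eta$, $(k_\eta,u_\eta)\in\mathbb{R}^+\times (H^2(D)\cap H^1_0(D))$ with $u_\eta\ne0$ is an eigenpair for $\eta$ if $\mathcal{A}_{\eta,k_\eta}(u_\eta,\varphi)-k_\eta^2\mathcal{B}(u_\eta,\varphi)=0$ for all $\varphi\in H^2(D)\cap H^1_0(D)$. $(k_0,u_0)\in\mathbb{R}^+\times H^2_0(D)$ with $u_0\neq0$ is an eigenpair for $\eta=0$ if $\mathcal{A}_{0,k_0}(u_0,\varphi)-k_0^2\mathcal{B}(u_0,\varphi)=0$ for all $\varphi\in H^2_0(D)$. *)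

theory Defs
  imports "HOL-Analysis.Analysis" "HOL-Probability.Essential_Supremum"
begin

section \<open>Smooth functions\<close>

definition partial :: "'n \<Rightarrow> (real^'n \<Rightarrow> 'b) \<Rightarrow> real^'n \<Rightarrow> 'b::real_normed_vector" where
  "partial i f x = frechet_derivative f (at x) (axis i 1)"

definition grad :: "(real^'n \<Rightarrow> real) \<Rightarrow> real^'n \<Rightarrow> real^'n" where
  "grad f x = (\<chi> i. partial i f x)"

primrec Ck :: "nat \<Rightarrow> (real^'n \<Rightarrow> 'b::real_normed_vector) \<Rightarrow> bool" where
  "Ck 0 f \<longleftrightarrow> continuous_on UNIV f"
| "Ck (Suc k) f \<longleftrightarrow> (\<forall>x. f differentiable (at x)) \<and> (\<forall>i. Ck k (partial i f))"

definition smooth :: "(real^'n \<Rightarrow> 'b::real_normed_vector) \<Rightarrow> bool" where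
  "smooth f \<longleftrightarrow> (\<forall>k. Ck k f)"

definition test_function :: "(real^'n) set \<Rightarrow> (real^'n \<Rightarrow> real) \<Rightarrow> bool" where
  "test_function D \<phi> \<longleftrightarrow>
     smooth \<phi> \<and> compact (closure {x. \<phi> x \<noteq> 0}) \<and> closure {x. \<phi> x \<noteq> 0} \<subseteq> D"


section \<open>Lebesgue spaces\<close>

text \<open>Elements of Lebesgue and Sobolev spaces are represented by functions; equality in these
  spaces is equality almost everywhere.\<close>

definition L2 :: "'a measure \<Rightarrow> ('a \<Rightarrow> complex) set" where
  "L2 M = {f \<in> borel_measurable M. integrable M (\<lambda>x. (norm (f x))\<^sup>2)}"

definition L2_norm :: "'a measure \<Rightarrow> ('a \<Rightarrow> complex) \<Rightarrow> real" where
  "L2_norm M f = sqrt (\<integral>x. (norm (f x))\<^sup>2 \<partial>M)"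

definition Linf_norm :: "'a measure \<Rightarrow> ('a \<Rightarrow> real) \<Rightarrow> ereal" where
  "Linf_norm M f = esssup M (\<lambda>x. ereal \<bar>f x\<bar>)"

definition Linf :: "'a measure \<Rightarrow> ('a \<Rightarrow> real) set" where
  "Linf M = {f \<in> borel_measurable M. Linf_norm M f < \<infinity>}"

definition essinf :: "'a measure \<Rightarrow> ('a \<Rightarrow> real) \<Rightarrow> ereal" where
  "essinf M f = - esssup M (\<lambda>x. - ereal (f x))"


section \<open>Sobolev spaces\<close>

definition is_weak_partial ::
    "(real^'n) set \<Rightarrow> 'n \<Rightarrow> (real^'n \<Rightarrow> complex) \<Rightarrow> (real^'n \<Rightarrow> complex) \<Rightarrow> bool" where
  "is_weak_partial D i u v \<longleftrightarrow> v \<in> L2 (lebesgue_on D) \<and>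
     (\<forall>\<phi>. test_function D \<phi> \<longrightarrow>
        (\<integral>x. partial i \<phi> x *\<^sub>R u x \<partial>lebesgue_on D) = - (\<integral>x. \<phi> x *\<^sub>R v x \<partial>lebesgue_on D))"

text \<open>A representative of the weak partial derivative, which is unique up to null sets.\<close>

definition wpartial ::
    "(real^'n) set \<Rightarrow> 'n \<Rightarrow> (real^'n \<Rightarrow> complex) \<Rightarrow> real^'n \<Rightarrow> complex" where
  "wpartial D i u = (SOME v. is_weak_partial D i u v)"

definition H1 :: "(real^'n) set \<Rightarrow> (real^'n \<Rightarrow> complex) set" where
  "H1 D = {u \<in> L2 (lebesgue_on D). \<forall>i. \<exists>v. is_weak_partial D i u v}"

definition H2 :: "(real^'n) set \<Rightarrow> (real^'n \<Rightarrow> complex) set" where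
  "H2 D = {u \<in> H1 D. \<forall>i. wpartial D i u \<in> H1 D}"

definition H1_norm :: "(real^'n) set \<Rightarrow> (real^'n \<Rightarrow> complex) \<Rightarrow> real" where
  "H1_norm D u = sqrt ((L2_norm (lebesgue_on D) u)\<^sup>2
     + (\<Sum>i\<in>UNIV. (L2_norm (lebesgue_on D) (wpartial D i u))\<^sup>2))"

definition H2_norm :: "(real^'n) set \<Rightarrow> (real^'n \<Rightarrow> complex) \<Rightarrow> real" where
  "H2_norm D u = sqrt ((L2_norm (lebesgue_on D) u)\<^sup>2
     + (\<Sum>i\<in>UNIV. (L2_norm (lebesgue_on D) (wpartial D i u))\<^sup>2)
     + (\<Sum>i\<in>UNIV. \<Sum>j\<in>UNIV. (L2_norm (lebesgue_on D) (wpartial D j (wpartial D i u)))\<^sup>2))"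

definition laplacian :: "(real^'n) set \<Rightarrow> (real^'n \<Rightarrow> complex) \<Rightarrow> real^'n \<Rightarrow> complex" where
  "laplacian D u x = (\<Sum>i\<in>UNIV. wpartial D i (wpartial D i u) x)"


section \<open>Boundaries of class C2\<close>

text \<open>Within the given ball, \<open>D\<close> is the part above the graph of \<open>\<gamma>\<close> in the direction of the unit
  vector \<open>e\<close>. A function on the hyperplane orthogonal to \<open>e\<close> is encoded as a function on the
  whole space that is constant along \<open>e\<close>.\<close>

definition C2_graph ::
    "(real^'n) set \<Rightarrow> real^'n \<Rightarrow> real \<Rightarrow> real^'n \<Rightarrow> (real^'n \<Rightarrow> real) \<Rightarrow> bool" where
  "C2_graph D c r e \<gamma> \<longleftrightarrow> r > 0 \<and> norm e = 1 \<and> Ck 2 \<gamma> \<and> (\<forall>x t. \<gamma> (x + t *\<^sub>R e) = \<gamma> x) \<and>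
     D \<inter> ball c r = {x \<in> ball c r. \<gamma> x < x \<bullet> e}"

definition C2_boundary :: "(real^'n) set \<Rightarrow> bool" where
  "C2_boundary D \<longleftrightarrow> (\<forall>c\<in>frontier D. \<exists>r e \<gamma>. C2_graph D c r e \<gamma>)"

text \<open>Since \<open>grad \<gamma>\<close> is orthogonal to \<open>e\<close>, the vector below has length one; it points downwards,
  that is, out of \<open>D\<close>.\<close>

definition outward_normal :: "(real^'n) set \<Rightarrow> real^'n \<Rightarrow> real^'n" where
  "outward_normal D x = (THE \<nu>. \<exists>r e \<gamma>. C2_graph D x r e \<gamma> \<and>
     \<nu> = (1 / sqrt (1 + (norm (grad \<gamma> x))\<^sup>2)) *\<^sub>R (grad \<gamma> x - e))"

text \<open>The area of the part \<open>A\<close> of the graph of \<open>\<gamma>\<close>: the integral of the area element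
  \<open>sqrt (1 + (norm (grad \<gamma>))\<^sup>2)\<close> over the projection of \<open>A\<close> to the hyperplane orthogonal to \<open>e\<close>.
  The integrand is constant along \<open>e\<close>, so by Fubini the integral over the hyperplane equals the
  integral over the slab of thickness one. The point \<open>x + (\<gamma> x - x \<bullet> e) *\<^sub>R e\<close> is the point of
  the graph on the line through \<open>x\<close> in direction \<open>e\<close>.\<close>

definition graph_area :: "real^'n \<Rightarrow> (real^'n \<Rightarrow> real) \<Rightarrow> (real^'n) set \<Rightarrow> ennreal" where
  "graph_area e \<gamma> A =
     (\<integral>\<^sup>+x. ennreal (sqrt (1 + (norm (grad \<gamma> x))\<^sup>2))
        * indicator A (x + (\<gamma> x - x \<bullet> e) *\<^sub>R e) * indicator {x. 0 \<le> x \<bullet> e \<and> x \<bullet> e \<le> 1} x \<partial>lborel)"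

text \<open>The surface measure is the (completed) Borel measure on the boundary that is given by the
  area formula in every local graph representation.\<close>

definition surface_measure :: "(real^'n) set \<Rightarrow> (real^'n) measure" where
  "surface_measure D = completion
     (THE M. sets M = sets (restrict_space borel (frontier D)) \<and>
        (\<forall>c r e \<gamma>. C2_graph D c r e \<gamma> \<longrightarrow>
           (\<forall>A\<in>sets borel. A \<subseteq> frontier D \<inter> ball c r \<longrightarrow> emeasure M A = graph_area e \<gamma> A)))"


section \<open>Traces\<close>

text \<open>The trace operator is the continuous extension of the restriction to the boundary from
  functions that are smooth up to the boundary.\<close>

definition is_trace ::
    "(real^'n) set \<Rightarrow> (real^'n \<Rightarrow> complex) \<Rightarrow> (real^'n \<Rightarrow> complex) \<Rightarrow> bool" where
  "is_trace D u g \<longleftrightarrow> g \<in> L2 (surface_measure D) \<and>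
     (\<exists>\<phi>. (\<forall>j::nat. smooth (\<phi> j)) \<and>
        (\<lambda>j. H1_norm D (\<lambda>x. \<phi> j x - u x)) \<longlonglongrightarrow> 0 \<and>
        (\<lambda>j. L2_norm (surface_measure D) (\<lambda>x. \<phi> j x - g x)) \<longlonglongrightarrow> 0)"

definition trace :: "(real^'n) set \<Rightarrow> (real^'n \<Rightarrow> complex) \<Rightarrow> real^'n \<Rightarrow> complex" where
  "trace D u = (SOME g. is_trace D u g)"

definition normal_deriv :: "(real^'n) set \<Rightarrow> (real^'n \<Rightarrow> complex) \<Rightarrow> real^'n \<Rightarrow> complex" where
  "normal_deriv D u x = (\<Sum>i\<in>UNIV. (outward_normal D x $ i) *\<^sub>R trace D (wpartial D i u) x)"

text \<open>The spaces \<open>H\<^sup>2(D) \<inter> H\<^sup>1\<^sub>0(D)\<close> and \<open>H\<^sup>2\<^sub>0(D)\<close>.\<close>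

definition H2_H10 :: "(real^'n) set \<Rightarrow> (real^'n \<Rightarrow> complex) set" where
  "H2_H10 D = {u \<in> H2 D. AE x in surface_measure D. trace D u x = 0}"

definition H20 :: "(real^'n) set \<Rightarrow> (real^'n \<Rightarrow> complex) set" where
  "H20 D = {u \<in> H2 D. (AE x in surface_measure D. trace D u x = 0) \<and>
                       (AE x in surface_measure D. normal_deriv D u x = 0)}"


section \<open>The transmission eigenvalue problem\<close>

definition form_A0 ::
    "(real^'n) set \<Rightarrow> (real^'n \<Rightarrow> real) \<Rightarrow> real \<Rightarrow>
     (real^'n \<Rightarrow> complex) \<Rightarrow> (real^'n \<Rightarrow> complex) \<Rightarrow> complex" where
  "form_A0 D n k u \<phi> =
     (\<integral>x. of_real (1 / (n x - 1)) * (laplacian D u x + of_real (k\<^sup>2) * u x)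
            * (cnj (laplacian D \<phi> x) + of_real (k\<^sup>2) * cnj (\<phi> x))
          + of_real (k^4) * u x * cnj (\<phi> x) \<partial>lebesgue_on D)"

definition form_B ::
    "(real^'n) set \<Rightarrow> (real^'n \<Rightarrow> complex) \<Rightarrow> (real^'n \<Rightarrow> complex) \<Rightarrow> complex" where
  "form_B D u \<phi> = (\<integral>x. (\<Sum>i\<in>UNIV. wpartial D i u x * cnj (wpartial D i \<phi> x)) \<partial>lebesgue_on D)"

definition form_A ::
    "(real^'n) set \<Rightarrow> (real^'n \<Rightarrow> real) \<Rightarrow> (real^'n \<Rightarrow> real) \<Rightarrow> real \<Rightarrow>
     (real^'n \<Rightarrow> complex) \<Rightarrow> (real^'n \<Rightarrow> complex) \<Rightarrow> complex" where
  "form_A D n \<eta> k u \<phi> = form_A0 D n k u \<phi> +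
     (\<integral>x. of_real (k\<^sup>2 / \<eta> x) * normal_deriv D u x * cnj (normal_deriv D \<phi> x) \<partial>surface_measure D)"

definition admissible :: "(real^'n) set \<Rightarrow> (real^'n \<Rightarrow> real) \<Rightarrow> bool" where
  "admissible D \<eta> \<longleftrightarrow> \<eta> \<in> Linf (surface_measure D) \<and> essinf (surface_measure D) \<eta> > 0"

definition eigenpair ::
    "(real^'n) set \<Rightarrow> (real^'n \<Rightarrow> real) \<Rightarrow> (real^'n \<Rightarrow> real) \<Rightarrow> real \<Rightarrow> (real^'n \<Rightarrow> complex) \<Rightarrow> bool"
  where
  "eigenpair D n \<eta> k u \<longleftrightarrow> k > 0 \<and> u \<in> H2_H10 D \<and> \<not> (AE x in lebesgue_on D. u x = 0) \<and>
     (\<forall>\<phi>\<in>H2_H10 D. form_A D n \<eta> k u \<phi> - of_real (k\<^sup>2) * form_B D u \<phi> = 0)"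

text \<open>The case \<open>\<eta> = 0\<close>, which is not an instance of the previous definition.\<close>

definition eigenpair0 ::
    "(real^'n) set \<Rightarrow> (real^'n \<Rightarrow> real) \<Rightarrow> real \<Rightarrow> (real^'n \<Rightarrow> complex) \<Rightarrow> bool" where
  "eigenpair0 D n k u \<longleftrightarrow> k > 0 \<and> u \<in> H20 D \<and> \<not> (AE x in lebesgue_on D. u x = 0) \<and>
     (\<forall>\<phi>\<in>H20 D. form_A0 D n k u \<phi> - of_real (k\<^sup>2) * form_B D u \<phi> = 0)"

end

(* Testing the equation for u_m with u_m itself bounds Laplacian(u_m) + k_m^2 u_m in L2 and shows
   that the squared L2 norm of the normal derivative is at most the supremum norm of eta_m, because
   the boundary term carries the weight k^2 / eta. The H2 estimate
   |D^2 u| <= C (|Laplacian u| + |grad u|) for functions with zero trace turns this into a bound in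
   H2. It holds because the gradient of such a function is normal to the boundary, so that both
   integrals differ by terms of lower order. By Rellich's theorem a subsequence converges in L2,
   and, integrating by parts, in H1; the second derivatives converge weakly. The limit u_0 has
   zero normal derivative, and since the boundary terms vanish against test functions in H^2_0, it
   solves the limit equation. If k_0 = 0, then u_0 is harmonic with zero trace, hence zero, against
   the normalization. Finally, u_m - u_0 is admissible in the equation for u_m and its boundary
   term is nonnegative, so that Laplacian(u_m - u_0) converges to zero in L2, and the H2 estimate
   gives strong convergence. Weak limits are obtained from strongly convergent convex combinations.
   The trace and the Gauss-Green formula are reduced to graphs by a partition of unity. *)
theory Submission
  imports Defs "HOL-Complex_Analysis.Great_Picard" "HOL-Library.Diagonal_Subsequence"
begin


subsection \<open>Functions of class \<open>Ck\<close>\<close>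

text \<open>The normal of a C2 domain is only C1, so the H2 estimate avoids third derivatives and
  smooth approximations with zero trace. It rests on one identity: for \<open>z\<close> with zero
  trace and any H1 function \<open>a\<close>, the pairing of the j-th derivative of \<open>a\<close>
  with the i-th derivative of \<open>z\<close> is symmetric in i and j. It is applied to the
  gradient minus its extended normal part, and it compares the Hessian with the Laplacian. The
  leading error \<open>nuc i * Gd j\<close> has rank one and cancels in the sum over all pairs; what
  is left has a first derivative as a factor. The surface measure is given by a definite
  description, so existence and independence of the charts must be proved. Instead of a change of
  variables between two graphs, the divergence of \<open>h\<close> times the unit normal is
  integrated over \<open>D\<close>: either chart yields its flux, and so both graph measures give
  the same integral of \<open>h\<close>. Weak derivatives and traces are chosen representatives; the
  proofs run on triples of function, gradient and boundary values obtained as L2 limits, and only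
  then return to the chosen ones.\<close>

lemma partial_eqI:
  assumes "(f has_derivative f') (at x)"
  shows "partial i f x = f' (axis i 1)" using frechet_derivative_at[OF assms] by (simp add: partial_def)

lemma linear_axis_expansion:
  fixes L :: "real^'n \<Rightarrow> 'b::real_normed_vector"
  assumes "linear L"
  shows "L h = (\<Sum>i\<in>UNIV. h $ i *\<^sub>R L (axis i 1))"
proof -
  have "L h = L (\<Sum>i\<in>UNIV. h $ i *\<^sub>R axis i 1)" using basis_expansion[of h] by (simp add: scalar_mult_eq_scaleR)
  then show ?thesis using assms by (simp add: linear_sum linear_cmul)
qed

lemma has_derivative_partial:
  fixes f :: "real^'n \<Rightarrow> 'b::real_normed_vector"
  assumes "f differentiable (at x)"
  shows "(f has_derivative (\<lambda>h. \<Sum>i\<in>UNIV. h $ i *\<^sub>R partial i f x)) (at x)"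
proof -
  have d: "(f has_derivative frechet_derivative f (at x)) (at x)" using assms frechet_derivative_works by blast
  have "frechet_derivative f (at x) = (\<lambda>h. \<Sum>i\<in>UNIV. h $ i *\<^sub>R partial i f x)" unfolding partial_def
    using linear_axis_expansion[OF linear_frechet_derivative[OF assms]] by blast
  with d show ?thesis by simp
qed

lemma partial_along_line:
  fixes f :: "real^'n \<Rightarrow> 'b::real_normed_vector"
  assumes "\<And>x. f differentiable (at x)"
  shows "((\<lambda>t. f (x + t *\<^sub>R v)) has_vector_derivative
           (\<Sum>i\<in>UNIV. v $ i *\<^sub>R partial i f (x + t *\<^sub>R v))) (at t within T)"
proof -
  have "((\<lambda>t. f (x + t *\<^sub>R v)) has_derivative
          (\<lambda>h. \<Sum>i\<in>UNIV. (h *\<^sub>R v) $ i *\<^sub>R partial i f (x + t *\<^sub>R v))) (at t within T)"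
    by (rule has_derivative_compose[OF _ has_derivative_partial[OF assms]])
       (auto intro!: derivative_eq_intros)
  then show ?thesis by (simp add: has_vector_derivative_def scaleR_sum_right)
qed

lemma Ck_Suc_imp: "Ck (Suc k) f \<Longrightarrow> Ck k f"
proof (induction k arbitrary: f)
  case 0
  then have "\<forall>x. continuous (at x) f" by (auto intro: differentiable_imp_continuous_within)
  then show ?case by (simp add: continuous_at_imp_continuous_on)
next
  case (Suc k)
  then show ?case by auto
qed

lemma Ck_mono: "Ck k f \<Longrightarrow> j \<le> k \<Longrightarrow> Ck j f" by (induction k) (auto simp: le_Suc_eq dest: Ck_Suc_imp simp del: Ck.simps(2))

lemma Ck_continuous: "Ck k f \<Longrightarrow> continuous_on S f" using Ck_mono[of k f 0] by (auto intro: continuous_on_subset)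

lemma Ck_differentiable: "Ck (Suc k) f \<Longrightarrow> f differentiable (at x)" by simp

lemma Ck_partial: "Ck (Suc k) f \<Longrightarrow> Ck k (partial i f)" by simp

lemma partial_const [simp]: "partial i (\<lambda>x. c) = (\<lambda>x. 0)" by (auto simp: partial_def)

lemma Ck_const: "Ck k (\<lambda>x. c)" by (induction k arbitrary: c) auto

lemma partial_add:
  assumes "f differentiable (at x)" "g differentiable (at x)"
  shows "partial i (\<lambda>x. f x + g x) x = partial i f x + partial i g x"
  by (rule trans[OF partial_eqI[OF has_derivative_add[OF has_derivative_partial has_derivative_partial]]])
     (use assms in \<open>auto simp: partial_def linear_axis_expansion[OF linear_frechet_derivative, symmetric]\<close>)

lemma Ck_add: "Ck k f \<Longrightarrow> Ck k g \<Longrightarrow> Ck k (\<lambda>x. f x + g x)"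
proof (induction k arbitrary: f g)
  case 0
  then show ?case by (auto intro: continuous_intros)
next
  case (Suc k)
  have "partial i (\<lambda>x. f x + g x) = (\<lambda>x. partial i f x + partial i g x)" for i using Suc.prems by (auto simp: partial_add)
  then show ?case using Suc by (auto intro!: Suc.IH differentiable_add)
qed

lemma partial_bounded_linear:
  assumes "bounded_linear L" "f differentiable (at x)"
  shows "partial i (\<lambda>x. L (f x)) x = L (partial i f x)"
  using partial_eqI[OF bounded_linear.has_derivative[OF assms(1) has_derivative_partial[OF assms(2)]]]
  by (simp add: partial_def linear_axis_expansion[OF linear_frechet_derivative[OF assms(2)], symmetric])

lemma Ck_bounded_linear: "bounded_linear L \<Longrightarrow> Ck k f \<Longrightarrow> Ck k (\<lambda>x. L (f x))"
proof (induction k arbitrary: f)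
  case 0
  then show ?case by (auto intro: bounded_linear.continuous_on)
next
  case (Suc k)
  have "partial i (\<lambda>x. L (f x)) = (\<lambda>x. L (partial i f x))" for i using Suc.prems by (auto simp: partial_bounded_linear)
  then show ?case using Suc differentiable_chain_at[of f _ L, unfolded o_def] bounded_linear_imp_differentiable[of L] by auto
qed

lemma partial_bounded_bilinear:
  assumes "bounded_bilinear pr" "f differentiable (at x)" "g differentiable (at x)"
  shows "partial i (\<lambda>x. pr (f x) (g x)) x = pr (f x) (partial i g x) + pr (partial i f x) (g x)"
  using partial_eqI[OF bounded_bilinear.FDERIV[OF assms(1) has_derivative_partial[OF assms(2)]
    has_derivative_partial[OF assms(3)]]]
  by (simp add: partial_def linear_axis_expansion[OF linear_frechet_derivative[OF assms(2)], symmetric]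
     linear_axis_expansion[OF linear_frechet_derivative[OF assms(3)], symmetric])

lemma Ck_bounded_bilinear:
  "bounded_bilinear pr \<Longrightarrow> Ck k f \<Longrightarrow> Ck k g \<Longrightarrow> Ck k (\<lambda>x. pr (f x) (g x))"
proof (induction k arbitrary: f g)
  case 0
  then show ?case by (auto intro: bounded_bilinear.continuous_on)
next
  case (Suc k)
  have p: "partial i (\<lambda>x. pr (f x) (g x)) = (\<lambda>x. pr (f x) (partial i g x) + pr (partial i f x) (g x))" for i
    using Suc.prems by (auto simp: partial_bounded_bilinear)
  have "Ck k (\<lambda>x. pr (f x) (partial i g x) + pr (partial i f x) (g x))" for i
    using Suc.prems by (intro Ck_add Suc.IH) (auto intro: Ck_Suc_imp simp del: Ck.simps intro: Ck_partial)
  moreover have "(\<lambda>x. pr (f x) (g x)) differentiable (at x)" for x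
    using Suc.prems bounded_bilinear.FDERIV[OF Suc.prems(1) has_derivative_partial has_derivative_partial, of f x g]
    unfolding differentiable_def[of "\<lambda>x. pr (f x) (g x)"] by auto
  ultimately show ?case unfolding Ck.simps p by blast
qed

lemmas Ck_scaleR = Ck_bounded_bilinear[OF bounded_bilinear_scaleR]
lemmas Ck_mult = Ck_bounded_bilinear[OF bounded_bilinear_mult]
lemmas partial_scaleR = partial_bounded_bilinear[OF bounded_bilinear_scaleR]
lemmas partial_mult = partial_bounded_bilinear[OF bounded_bilinear_mult]

lemma Ck_uminus: "Ck k f \<Longrightarrow> Ck k (\<lambda>x. - f x)" by (rule Ck_bounded_linear) (auto intro: bounded_linear_minus bounded_linear_ident)

lemma Ck_diff: "Ck k f \<Longrightarrow> Ck k g \<Longrightarrow> Ck k (\<lambda>x. f x - g x)" using Ck_add[of k f "\<lambda>x. - g x"] by (auto intro: Ck_uminus)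

lemma partial_uminus:
  assumes "f differentiable (at x)"
  shows "partial i (\<lambda>x. - f x) x = - partial i f x"
  by (rule partial_bounded_linear) (auto intro: bounded_linear_minus bounded_linear_ident assms)

lemma partial_diff:
  assumes "f differentiable (at x)" "g differentiable (at x)"
  shows "partial i (\<lambda>x. f x - g x) x = partial i f x - partial i g x"
  using partial_add[of f x "\<lambda>x. - g x" i] partial_uminus[of g x i] assms by simp

lemma Ck_sum: "(\<And>a. a \<in> A \<Longrightarrow> Ck k (f a)) \<Longrightarrow> Ck k (\<lambda>x. \<Sum>a\<in>A. f a x)"
  by (induction A rule: infinite_finite_induct) (auto intro!: Ck_const Ck_add)

lemma partial_sum:
  assumes "\<And>a. a \<in> A \<Longrightarrow> f a differentiable (at x)"
  shows "partial i (\<lambda>x. \<Sum>a\<in>A. f a x) x = (\<Sum>a\<in>A. partial i (f a) x)" using assms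
proof (induction A rule: infinite_finite_induct)
  case (insert a A)
  then show ?case by (simp add: partial_add[of "f a" x "\<lambda>x. \<Sum>a\<in>A. f a x" i] differentiable_sum)
qed auto

lemma Ck_prod:
  fixes f :: "'a \<Rightarrow> real^'n \<Rightarrow> 'b::{real_normed_field}"
  shows "(\<And>a. a \<in> A \<Longrightarrow> Ck k (f a)) \<Longrightarrow> Ck k (\<lambda>x. \<Prod>a\<in>A. f a x)"
  by (induction A rule: infinite_finite_induct) (auto intro!: Ck_const Ck_mult)

lemma Ck_linear:
  fixes L :: "real^'n \<Rightarrow> 'b::real_normed_vector"
  assumes "bounded_linear L"
  shows "Ck k L"
proof (cases k)
  case 0
  then show ?thesis using assms by (auto intro: linear_continuous_on)
next
  case (Suc k')
  have "partial i L = (\<lambda>x. L (axis i 1))" for i using partial_eqI[OF bounded_linear_imp_has_derivative[OF assms]] by auto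
  then show ?thesis using assms Suc by (auto intro: Ck_const bounded_linear_imp_differentiable)
qed

lemma Ck_component: "Ck k (\<lambda>x. x $ i)" by (rule Ck_linear) (rule bounded_linear_vec_nth)

lemma Ck_norm_squared_diff: "Ck k (\<lambda>x::real^'n. (norm (x - c))^2)"
proof -
  have "Ck k (\<lambda>x. (x - c) \<bullet> (x - c))" by (intro Ck_bounded_bilinear[OF bounded_bilinear_inner] Ck_diff Ck_const
        Ck_linear[OF bounded_linear_ident])
  then show ?thesis by (simp add: power2_norm_eq_inner)
qed

lemma has_derivative_compose_real:
  fixes f :: "real^'n \<Rightarrow> real"
  assumes "f differentiable (at x)" "(\<phi> has_vector_derivative \<phi>' (f x)) (at (f x))"
  shows "((\<lambda>x. \<phi> (f x)) has_derivative (\<lambda>h. \<Sum>i\<in>UNIV. h $ i *\<^sub>R (partial i f x *\<^sub>R \<phi>' (f x)))) (at x)"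
  using has_derivative_compose[OF has_derivative_partial[OF assms(1)] assms(2)[unfolded has_vector_derivative_def]]
  by (simp add: scaleR_sum_left)

lemma partial_compose_real:
  fixes f :: "real^'n \<Rightarrow> real"
  assumes "f differentiable (at x)" "(\<phi> has_vector_derivative \<phi>' (f x)) (at (f x))"
  shows "partial i (\<lambda>x. \<phi> (f x)) x = partial i f x *\<^sub>R \<phi>' (f x)"
proof -
  have "partial i (\<lambda>x. \<phi> (f x)) x = (\<Sum>j\<in>UNIV. axis i 1 $ j *\<^sub>R (partial j f x *\<^sub>R \<phi>' (f x)))"
    by (rule partial_eqI[OF has_derivative_compose_real[of f x \<phi> \<phi>', OF assms]])
  also have "\<dots> = (\<Sum>j\<in>UNIV. if j = i then partial j f x *\<^sub>R \<phi>' (f x) else 0)" by (intro sum.cong) (auto simp: axis_def)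
  also have "\<dots> = partial i f x *\<^sub>R \<phi>' (f x)" by simp
  finally show ?thesis .
qed

text \<open>\<open>H\<close> lists a function together with all its derivatives, so that the
  induction can pass from \<open>H j\<close> to \<open>H (Suc j)\<close> when the chain rule
  differentiates the outer function.\<close>

lemma Ck_compose_real:
  fixes f :: "real^'n \<Rightarrow> real" and H :: "nat \<Rightarrow> real \<Rightarrow> 'b::real_normed_vector"
  assumes H: "\<And>j t. (H j has_vector_derivative H (Suc j) t) (at t)" and f: "Ck k f"
  shows "Ck k (\<lambda>x. H j (f x))" using f
proof (induction k arbitrary: j)
  case 0
  have "continuous_on UNIV (H j)" using has_vector_derivative_continuous[OF H] by (intro continuous_at_imp_continuous_on) auto
  then show ?case using 0 continuous_on_compose2[of UNIV "H j" UNIV f] by auto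
next
  case (Suc k)
  have *: "partial i (\<lambda>x. H j (f x)) = (\<lambda>x. partial i f x *\<^sub>R H (Suc j) (f x))" for i
    using Suc.prems H by (intro ext partial_compose_real) auto
  have "Ck k (\<lambda>x. partial i f x *\<^sub>R H (Suc j) (f x))" for i
    using Suc.prems Suc_leD by (intro Ck_scaleR Suc.IH) (auto intro: Ck_Suc_imp simp del: Ck.simps intro: Ck_partial)
  moreover have "(\<lambda>x. H j (f x)) differentiable (at x)" for x
    using has_derivative_compose_real[of f x "H j" "H (Suc j)"] Suc.prems H by (auto simp: differentiable_def)
  ultimately show ?case unfolding Ck.simps * by blast
qed

text \<open>The derivative of the outer function is asked for only on the range of \<open>f\<close>,
  which admits \<open>1 / sqrt\<close> on positive values.\<close>

lemma C1_compose_real: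
  fixes f :: "real^'n \<Rightarrow> real" and \<phi> :: "real \<Rightarrow> real"
  assumes f: "Ck 1 f" and \<phi>: "\<And>x. (\<phi> has_real_derivative \<phi>' (f x)) (at (f x))"
    and c: "continuous_on (range f) \<phi>'"
  shows "Ck 1 (\<lambda>x. \<phi> (f x))"
proof -
  have fd: "f differentiable (at x)" for x using f by auto
  have v: "(\<phi> has_vector_derivative \<phi>' (f x)) (at (f x))" for x
    using \<phi> by (simp add: has_real_derivative_iff_has_vector_derivative)
  have *: "partial i (\<lambda>x. \<phi> (f x)) = (\<lambda>x. partial i f x *\<^sub>R \<phi>' (f x))" for i by (intro ext partial_compose_real v fd)
  have "continuous_on UNIV (\<lambda>x. partial i f x *\<^sub>R \<phi>' (f x))" for i
    using f continuous_on_compose2[OF c, of UNIV f] Ck_continuous[OF f, of UNIV] by (auto intro!: continuous_intros)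
  moreover have "(\<lambda>x. \<phi> (f x)) differentiable (at x)" for x
    using has_derivative_compose_real[of f x \<phi> \<phi>', OF fd v] by (auto simp: differentiable_def)
  ultimately show ?thesis unfolding One_nat_def Ck.simps * by blast
qed

lemma smooth_Ck: "smooth f \<Longrightarrow> Ck k f" by (simp add: smooth_def)

lemma smooth_partial: "smooth f \<Longrightarrow> smooth (partial i f)" unfolding smooth_def using Ck_partial by blast

lemma smooth_differentiable: "smooth f \<Longrightarrow> f differentiable (at x)" using smooth_Ck Ck_differentiable by blast

lemma partial_eq_0:
  assumes "\<And>y. y \<in> U \<Longrightarrow> f y = 0" "open U" "x \<in> U"
  shows "partial i f x = 0" by (rule trans[OF partial_eqI[of f "\<lambda>h. 0"]])
     (use has_derivative_transform_within_open[OF has_derivative_const[of 0 "at x"] assms(2,3)] assms in auto)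

text \<open>The second difference is compared with the mixed derivative by two mean value bounds:
  along the \<open>j\<close> axis for \<open>partial i f\<close>, then along the \<open>i\<close>
  axis for the difference of \<open>f\<close> over the \<open>j\<close> step.\<close>

lemma mixed_partial_close:
  fixes f :: "real^'n \<Rightarrow> 'b::real_normed_vector"
  assumes f: "Ck 2 f" and e: "e > 0"
  shows "\<exists>d>0. \<forall>h. 0 < h \<longrightarrow> h < d \<longrightarrow>
     norm (f (x + h *\<^sub>R axis i 1 + h *\<^sub>R axis j 1) - f (x + h *\<^sub>R axis i 1)
       - f (x + h *\<^sub>R axis j 1) + f x - (h * h) *\<^sub>R partial j (partial i f) x) \<le> h * h * e"
proof -
  define D where "D = partial j (partial i f) x"
  have f1: "Ck 1 (partial i f)" and df: "\<And>y. f differentiable (at y)" using f by (auto simp: numeral_2_eq_2)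
  have df1: "\<And>y. partial i f differentiable (at y)" and c: "continuous_on UNIV (partial j (partial i f))" using f1 by auto
  obtain d where d: "d > 0" "\<And>y. dist y x < d \<Longrightarrow> dist (partial j (partial i f) y) D < e"
    using c e unfolding continuous_on_iff D_def by (metis UNIV_I)
  have ax: "(\<Sum>k\<in>UNIV. axis l (1::real) $ k *\<^sub>R F k) = F l" for l and F :: "'n \<Rightarrow> 'b"
  proof -
    have "(\<Sum>k\<in>UNIV. axis l (1::real) $ k *\<^sub>R F k) = (\<Sum>k\<in>UNIV. if k = l then F k else 0)" by (intro sum.cong) (auto simp: axis_def)
    then show ?thesis by simp
  qed
  have line: "((\<lambda>t. F (y + t *\<^sub>R axis l 1)) has_vector_derivative partial l F (y + t *\<^sub>R axis l 1)) (at t within T)"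
    if "\<And>y. F differentiable (at y)" for F :: "real^'n \<Rightarrow> 'b" and y l t T
    using partial_along_line[OF that, of y "axis l 1" t T] by (simp add: ax)
  have "norm (f (x + h *\<^sub>R axis i 1 + h *\<^sub>R axis j 1) - f (x + h *\<^sub>R axis i 1)
       - f (x + h *\<^sub>R axis j 1) + f x - (h * h) *\<^sub>R D) \<le> h * h * e" if h: "0 < h" "h < d / 2" for h
  proof -
    \<comment> \<open>The \<open>j\<close> direction comes first, with \<open>s\<close> fixed. The
      linear term \<open>t *\<^sub>R D\<close> is subtracted so that the derivative stays below
      \<open>e\<close>.\<close>
    have inner: "norm (partial i f (x + s *\<^sub>R axis i 1 + h *\<^sub>R axis j 1) - partial i f (x + s *\<^sub>R axis i 1) - h *\<^sub>R D)
        \<le> h * e" if s: "0 \<le> s" "s \<le> h" for s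
    proof -
      let ?psi = "\<lambda>t. partial i f (x + s *\<^sub>R axis i 1 + t *\<^sub>R axis j 1) - t *\<^sub>R D"
      have 1: "(?psi has_derivative (\<lambda>r. r *\<^sub>R (partial j (partial i f) (x + s *\<^sub>R axis i 1 + t *\<^sub>R axis j 1) - D)))
           (at t within {0..h})" for t using line[OF df1, of "x + s *\<^sub>R axis i 1" j t "{0..h}"]
        by (auto intro!: derivative_eq_intros simp: has_vector_derivative_def algebra_simps)
      have 2: "onorm (\<lambda>r::real. r *\<^sub>R (partial j (partial i f) (x + s *\<^sub>R axis i 1 + t *\<^sub>R axis j 1) - D)) \<le> e"
        if "t \<in> {0..h}" for t
      proof -
        have "dist (x + s *\<^sub>R axis i 1 + t *\<^sub>R axis j 1) x \<le> \<bar>s\<bar> + \<bar>t\<bar>"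
          by (simp add: dist_norm) (rule order_trans[OF norm_triangle_ineq], simp)
        also have "\<dots> < d" using that s h by auto
        finally have "norm (partial j (partial i f) (x + s *\<^sub>R axis i 1 + t *\<^sub>R axis j 1) - D) < e"
          using d(2) by (auto simp: dist_norm)
        then show ?thesis by (intro onorm_bound) (use e in \<open>auto simp: mult.commute[of e] intro!: mult_left_mono\<close>)
      qed
      have "norm (?psi h - ?psi 0) \<le> e * norm (h - 0)" by (rule differentiable_bound[of "{0..h}" ?psi, OF _ 1 2]) (use h in auto)
      then show ?thesis using h by (simp add: mult.commute diff_diff_eq add.commute)
    qed
    let ?phi = "\<lambda>s. f (x + h *\<^sub>R axis j 1 + s *\<^sub>R axis i 1) - f (x + s *\<^sub>R axis i 1) - s *\<^sub>R (h *\<^sub>R D)"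
    have 1: "(?phi has_derivative (\<lambda>r. r *\<^sub>R (partial i f (x + h *\<^sub>R axis j 1 + s *\<^sub>R axis i 1)
          - partial i f (x + s *\<^sub>R axis i 1) - h *\<^sub>R D))) (at s within {0..h})" for s
      using line[OF df, of "x + h *\<^sub>R axis j 1" i s "{0..h}"] line[OF df, of x i s "{0..h}"]
      by (auto intro!: derivative_eq_intros simp: has_vector_derivative_def algebra_simps)
    have 2: "onorm (\<lambda>r::real. r *\<^sub>R (partial i f (x + h *\<^sub>R axis j 1 + s *\<^sub>R axis i 1)
          - partial i f (x + s *\<^sub>R axis i 1) - h *\<^sub>R D)) \<le> h * e" if "s \<in> {0..h}" for s using inner[of s] that
      by (intro onorm_bound) (use e h in \<open>auto simp: mult.commute add_ac intro!: mult_left_mono\<close>)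
    have "norm (?phi h - ?phi 0) \<le> (h * e) * norm (h - 0)"
      by (rule differentiable_bound[of "{0..h}" ?phi, OF _ 1 2]) (use h in auto)
    then show ?thesis using h by (simp add: algebra_simps)
  qed
  then show ?thesis using d(1) unfolding D_def by (intro exI[of _ "d / 2"]) auto
qed

text \<open>The second difference is symmetric in the two steps, so after division by
  \<open>h * h\<close> both mixed derivatives are within \<open>e\<close> of the same
  quotient.\<close>

lemma partial_commute:
  fixes f :: "real^'n \<Rightarrow> 'b::real_normed_vector"
  assumes f: "Ck 2 f"
  shows "partial i (partial j f) x = partial j (partial i f) x"
proof -
  define a where "a = partial i (partial j f) x"
  define b where "b = partial j (partial i f) x"
  have "norm (a - b) \<le> 2 * e" if e: "e > 0" for e
  proof -
    obtain d1 where d1: "d1 > 0" "\<And>h. 0 < h \<Longrightarrow> h < d1 \<Longrightarrow>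
     norm (f (x + h *\<^sub>R axis i 1 + h *\<^sub>R axis j 1) - f (x + h *\<^sub>R axis i 1)
       - f (x + h *\<^sub>R axis j 1) + f x - (h * h) *\<^sub>R b) \<le> h * h * e"
      using mixed_partial_close[OF f e, of x i j] unfolding b_def by blast
    obtain d2 where d2: "d2 > 0" "\<And>h. 0 < h \<Longrightarrow> h < d2 \<Longrightarrow>
     norm (f (x + h *\<^sub>R axis j 1 + h *\<^sub>R axis i 1) - f (x + h *\<^sub>R axis j 1)
       - f (x + h *\<^sub>R axis i 1) + f x - (h * h) *\<^sub>R a) \<le> h * h * e"
      using mixed_partial_close[OF f e, of x j i] unfolding a_def by blast
    define h where "h = min d1 d2 / 2"
    have h: "0 < h" "h < d1" "h < d2" using d1(1) d2(1) by (auto simp: h_def)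
    define s where "s = f (x + h *\<^sub>R axis i 1 + h *\<^sub>R axis j 1) - f (x + h *\<^sub>R axis i 1)
       - f (x + h *\<^sub>R axis j 1) + f x"
    have "norm (s - (h * h) *\<^sub>R b) \<le> h * h * e" "norm (s - (h * h) *\<^sub>R a) \<le> h * h * e"
      using d1(2)[of h] d2(2)[of h] h unfolding s_def by (auto simp: algebra_simps)
    then have "norm ((h * h) *\<^sub>R (a - b)) \<le> h * h * (2 * e)" using norm_triangle_ineq4[of "s - (h * h) *\<^sub>R b" "s - (h * h) *\<^sub>R a"]
      by (auto simp: algebra_simps)
    then show ?thesis using h by simp
  qed
  then have "norm (a - b) \<le> 0 + e" if "e > 0" for e using that by (metis add_0 field_sum_of_halves half_gt_zero mult_2)
  then have "norm (a - b) \<le> 0" by (rule field_le_epsilon)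
  then show ?thesis by (simp add: a_def b_def)
qed

subsection \<open>Bump functions\<close>

text \<open>The polynomial factor makes the family closed under differentiation: the derivative of
  the member for q is the member for X^2 (q - q'). For q = 1 it is the classical flat function
  exp(-1/t).\<close>

definition exp_flat :: "real poly \<Rightarrow> real \<Rightarrow> real" where
  "exp_flat q t = (if t > 0 then poly q (1 / t) * exp (- (1 / t)) else 0)"

lemma poly_times_exp_tendsto_0: "((\<lambda>s. poly q s * exp (- s)) \<longlongrightarrow> (0::real)) at_top"
proof -
  have "((\<lambda>s. \<Sum>i\<le>degree q. coeff q i * (s ^ i / exp s)) \<longlongrightarrow> (\<Sum>i\<le>degree q. coeff q i * 0)) at_top"
    by (intro tendsto_sum tendsto_mult tendsto_const tendsto_power_div_exp_0)
  then show ?thesis by (simp add: poly_altdef sum_distrib_right exp_minus divide_inverse mult.assoc)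
qed

lemma exp_flat_tendsto_0: "(exp_flat q \<longlongrightarrow> 0) (at 0)"
proof -
  have "((\<lambda>t. poly q (inverse t) * exp (- inverse t)) \<longlongrightarrow> 0) (at_right 0)"
    by (rule filterlim_compose[OF poly_times_exp_tendsto_0 filterlim_inverse_at_top_right])
  then have r: "(exp_flat q \<longlongrightarrow> 0) (at_right 0)" by (rule Lim_transform_eventually)
       (auto simp: exp_flat_def eventually_at_filter inverse_eq_divide)
  have l: "(exp_flat q \<longlongrightarrow> 0) (at_left 0)" by (rule Lim_transform_eventually[OF tendsto_const])
       (auto simp: exp_flat_def eventually_at_filter)
  from l r show ?thesis by (simp add: filterlim_split_at)
qed

lemma exp_flat_has_derivative:
  "(exp_flat q has_real_derivative exp_flat ([:0,0,1:] * (q - pderiv q)) t) (at t)"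
proof -
  consider "t > 0" | "t < 0" | "t = 0" by linarith
  then show ?thesis
  proof cases
    case 1
    have "((\<lambda>t. poly q (1 / t) * exp (- (1 / t))) has_real_derivative
        exp_flat ([:0,0,1:] * (q - pderiv q)) t) (at t)"
    proof -
      have d: "((\<lambda>t. 1 / t) has_real_derivative - (1 / t) * (1 / t)) (at t)"
        using 1 by (auto intro!: derivative_eq_intros simp: field_simps)
      have p: "((\<lambda>t. poly q (1 / t)) has_real_derivative poly (pderiv q) (1 / t) * (- (1 / t) * (1 / t))) (at t)"
        by (rule DERIV_chain2[OF poly_DERIV d])
      have e: "((\<lambda>t. exp (- (1 / t))) has_real_derivative exp (- (1 / t)) * - (- (1 / t) * (1 / t))) (at t)"
        by (rule DERIV_chain2[OF DERIV_exp DERIV_minus[OF d]])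
      show ?thesis using DERIV_mult[OF p e] 1 by (simp add: exp_flat_def algebra_simps)
    qed
    then show ?thesis by (rule has_field_derivative_transform_within_open[where S="{0<..}"])
         (use 1 in \<open>auto simp: exp_flat_def\<close>)
  next
    case 2
    have "((\<lambda>t. 0) has_real_derivative exp_flat ([:0,0,1:] * (q - pderiv q)) t) (at t)" using 2 by (auto simp: exp_flat_def)
    then show ?thesis by (rule has_field_derivative_transform_within_open[where S="{..<0}"])
         (use 2 in \<open>auto simp: exp_flat_def\<close>)
  next
    case 3
    \<comment> \<open>The difference quotient at 0 belongs to the family again, with
      \<open>q\<close> multiplied by the variable, so its limit is already known.\<close>
    have "((\<lambda>h. (exp_flat q (0 + h) - exp_flat q 0) / h) \<longlongrightarrow> 0) (at 0)" using exp_flat_tendsto_0[of "pCons 0 q"]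
      by (rule Lim_transform_eventually) (auto simp: exp_flat_def eventually_at_filter)
    then show ?thesis using 3 by (simp add: DERIV_def exp_flat_def)
  qed
qed

lemma Ck_exp_flat:
  fixes f :: "real^'n \<Rightarrow> real"
  assumes "Ck k f"
  shows "Ck k (\<lambda>x. exp_flat q (f x))"
proof -
  define H where "H j = exp_flat (((\<lambda>q. [:0,0,1:] * (q - pderiv q)) ^^ j) q)" for j
  have "(H j has_vector_derivative H (Suc j) t) (at t)" for j t unfolding H_def using exp_flat_has_derivative
    by (simp add: has_real_derivative_iff_has_vector_derivative)
  from Ck_compose_real[of H, OF this assms, of 0] show ?thesis by (simp add: H_def)
qed

text \<open>The normalised flat function e exp(-1/t) is at least 1 for t at least 1. Nesting it
  once, with the argument reversed inside, gives a step that is exactly 0 for t at most 0 and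
  exactly 1 for t at least 1, without a quotient of smooth functions.\<close>

definition smooth_step :: "real \<Rightarrow> real" where
  "smooth_step t = exp 1 * exp_flat 1 (1 - exp 1 * exp_flat 1 (1 - t))"

lemma exp_flat_1_bounds: "0 \<le> exp_flat 1 t" "t \<le> 1 \<Longrightarrow> exp_flat 1 t \<le> exp (- 1)" by (auto simp: exp_flat_def)

lemma smooth_step_0: "t \<le> 0 \<Longrightarrow> smooth_step t = 0" by (auto simp: smooth_step_def exp_flat_def exp_add[symmetric] field_simps)

lemma smooth_step_1: "t \<ge> 1 \<Longrightarrow> smooth_step t = 1" by (auto simp: smooth_step_def exp_flat_def exp_add[symmetric])

lemma smooth_step_bounds: "0 \<le> smooth_step t" "smooth_step t \<le> 1"
proof -
  show "0 \<le> smooth_step t" by (simp add: smooth_step_def exp_flat_1_bounds)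
  have "exp_flat 1 (1 - exp 1 * exp_flat 1 (1 - t)) \<le> exp (- 1)" by (rule exp_flat_1_bounds) (simp add: exp_flat_1_bounds)
  then have "smooth_step t \<le> exp 1 * exp (- 1)" unfolding smooth_step_def by (intro mult_left_mono) auto
  then show "smooth_step t \<le> 1" by (simp add: exp_add[symmetric])
qed

lemma Ck_smooth_step:
  fixes f :: "real^'n \<Rightarrow> real"
  shows "Ck k f \<Longrightarrow> Ck k (\<lambda>x. smooth_step (f x))" unfolding smooth_step_def by (intro Ck_mult Ck_const Ck_exp_flat Ck_diff)

text \<open>Squared distances are polynomial, so the function is smooth at the centre
  \<open>c\<close> as well. The quotient runs from 0 at radius \<open>r2\<close> to 1 at radius
  \<open>r1\<close>.\<close>

definition bump :: "real^'n \<Rightarrow> real \<Rightarrow> real \<Rightarrow> real^'n \<Rightarrow> real" where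
  "bump c r1 r2 x = smooth_step ((r2^2 - (norm (x - c))^2) / (r2^2 - r1^2))"

lemma smooth_bump: "smooth (bump c r1 r2)"
proof -
  have "Ck k (\<lambda>x. smooth_step (inverse (r2^2 - r1^2) * (r2^2 - (norm (x - c))^2)))" for k
    by (intro Ck_smooth_step Ck_mult Ck_const Ck_diff Ck_norm_squared_diff)
  then show ?thesis unfolding smooth_def bump_def by (simp add: divide_inverse mult.commute)
qed

lemma bump_bounds: "0 \<le> bump c r1 r2 x" "bump c r1 r2 x \<le> 1" by (auto simp: bump_def smooth_step_bounds)

lemma bump_eq_1:
  assumes "0 \<le> r1" "r1 < r2" "norm (x - c) \<le> r1"
  shows "bump c r1 r2 x = 1" unfolding bump_def
proof (rule smooth_step_1)
  have "(norm (x - c))^2 \<le> r1^2" "r1\<^sup>2 < r2^2" using assms by (auto intro: power_mono power_strict_mono)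
  then show "1 \<le> (r2^2 - (norm (x - c))^2) / (r2^2 - r1^2)" by (simp add: field_simps)
qed

lemma bump_eq_0:
  assumes "0 \<le> r1" "r1 < r2" "r2 \<le> norm (x - c)"
  shows "bump c r1 r2 x = 0" unfolding bump_def
proof (rule smooth_step_0)
  have "r2\<^sup>2 \<le> (norm (x - c))^2" "r1\<^sup>2 < r2^2" using assms by (auto intro: power_mono power_strict_mono)
  then show "(r2^2 - (norm (x - c))^2) / (r2^2 - r1^2) \<le> 0" by (simp add: field_simps)
qed

text \<open>Taking \<open>b l\<close> times the product of \<open>1 - b j\<close> over the earlier
  indices makes the sum telescope to one minus the product of all \<open>1 - b j\<close>. This is 1
  wherever some bump equals 1, and nothing is divided by a sum of bumps.\<close>

lemma smooth_partition_of_unity: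
  fixes c :: "nat \<Rightarrow> real^'n" and r :: "nat \<Rightarrow> real"
  assumes "\<And>l. l < L \<Longrightarrow> r l > 0"
  shows "\<exists>\<psi>. (\<forall>l. smooth (\<psi> l)) \<and> (\<forall>l<L. \<forall>x. x \<notin> ball (c l) (3 / 4 * r l) \<longrightarrow> \<psi> l x = (0::real)) \<and>
    (\<forall>x\<in>(\<Union>l<L. ball (c l) (r l / 2)). (\<Sum>l<L. \<psi> l x) = 1)"
proof -
  define b where "b l = bump (c l) (r l / 2) (3 / 4 * r l)" for l
  define \<psi> where "\<psi> l x = b l x * (\<Prod>j<l. (1 - b j x))" for l x
  have sb: "Ck k (b l)" for k l by (simp add: b_def smooth_Ck smooth_bump)
  have sum: "(\<Sum>l<m. \<psi> l x) = 1 - (\<Prod>j<m. (1 - b j x))" for m x by (induction m) (auto simp: \<psi>_def algebra_simps)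
  show ?thesis
  proof (intro exI[of _ \<psi>] conjI allI impI ballI)
    show "smooth (\<psi> l)" for l unfolding smooth_def \<psi>_def by (auto intro!: Ck_mult Ck_prod Ck_diff Ck_const sb)
    show "\<psi> l x = 0" if "l < L" "x \<notin> ball (c l) (3 / 4 * r l)" for l x
      using assms[OF that(1)] that(2) bump_eq_0[of "r l / 2" "3 / 4 * r l" x "c l"]
      by (auto simp: \<psi>_def b_def dist_norm norm_minus_commute)
    show "(\<Sum>l<L. \<psi> l x) = 1" if x: "x \<in> (\<Union>l<L. ball (c l) (r l / 2))" for x
    proof -
      obtain l where l: "l < L" "x \<in> ball (c l) (r l / 2)" using x by auto
      have "b l x = 1" using assms[OF l(1)] l(2) unfolding b_def by (intro bump_eq_1) (auto simp: dist_norm norm_minus_commute)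
      then have "(\<Prod>j<L. (1 - b j x)) = 0" using l(1) by (subst prod_zero_iff) auto
      then show ?thesis by (simp add: sum)
    qed
  qed
qed


subsection \<open>Integration along a direction\<close>

abbreviation slab :: "real^'n \<Rightarrow> (real^'n) set" where
  "slab e \<equiv> {x. 0 \<le> x \<bullet> e \<and> x \<bullet> e \<le> 1}"

lemma slab_borel [measurable]: "slab e \<in> sets borel"
proof -
  have "closed {x. 0 \<le> x \<bullet> e}" "closed {x. x \<bullet> e \<le> 1}" by (auto intro!: closed_Collect_le continuous_intros)
  then show ?thesis by (simp add: Collect_conj_eq borel_closed)
qed

text \<open>By Fubini and translation invariance: for each \<open>y\<close> the parameters
  \<open>t\<close> with \<open>y - t *\<^sub>R e\<close> in the slab form an interval of length
  one.\<close>

lemma nn_integral_slab: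
  fixes e :: "real^'n"
  assumes e: "norm e = 1" and [measurable]: "g \<in> borel_measurable borel"
  shows "(\<integral>\<^sup>+x. (\<integral>\<^sup>+t. g (x + t *\<^sub>R e) * indicator (slab e) x \<partial>lborel) \<partial>lborel) = (\<integral>\<^sup>+x. g x \<partial>lborel)"
proof -
  have ee: "e \<bullet> e = 1" using e by (simp add: norm_eq_1)
  have "(\<integral>\<^sup>+x. (\<integral>\<^sup>+t. g (x + t *\<^sub>R e) * indicator (slab e) x \<partial>lborel) \<partial>lborel)
     = (\<integral>\<^sup>+t. (\<integral>\<^sup>+x. g (x + t *\<^sub>R e) * indicator (slab e) x \<partial>lborel) \<partial>lborel)" by (rule lborel_pair.Fubini'[symmetric]) measurable
  \<comment> \<open>Substituting \<open>y = x + t *\<^sub>R e\<close> moves the slab instead of the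
    argument of \<open>g\<close>.\<close>
  also have "\<dots> = (\<integral>\<^sup>+t. (\<integral>\<^sup>+y. g y * indicator (slab e) (y - t *\<^sub>R e) \<partial>lborel) \<partial>lborel)"
  proof (rule nn_integral_cong)
    fix t :: real
    have "(\<integral>\<^sup>+y. g y * indicator (slab e) (y - t *\<^sub>R e) \<partial>lborel)
       = (\<integral>\<^sup>+y. g y * indicator (slab e) (y - t *\<^sub>R e) \<partial>distr lborel borel ((+) (t *\<^sub>R e)))" by (simp add: lborel_distr_plus)
    also have "\<dots> = (\<integral>\<^sup>+x. g (x + t *\<^sub>R e) * indicator (slab e) x \<partial>lborel)" by (subst nn_integral_distr) (auto simp: add.commute)
    finally show "(\<integral>\<^sup>+x. g (x + t *\<^sub>R e) * indicator (slab e) x \<partial>lborel)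
      = (\<integral>\<^sup>+y. g y * indicator (slab e) (y - t *\<^sub>R e) \<partial>lborel)" ..
  qed
  also have "\<dots> = (\<integral>\<^sup>+y. (\<integral>\<^sup>+t. g y * indicator (slab e) (y - t *\<^sub>R e) \<partial>lborel) \<partial>lborel)" by (rule lborel_pair.Fubini') measurable
  also have "\<dots> = (\<integral>\<^sup>+y. g y \<partial>lborel)"
  proof (rule nn_integral_cong)
    fix y
    have "(\<integral>\<^sup>+t. g y * indicator (slab e) (y - t *\<^sub>R e) \<partial>lborel)
      = (\<integral>\<^sup>+t. g y * indicator {y \<bullet> e - 1..y \<bullet> e} t \<partial>lborel)"
      by (intro nn_integral_cong) (auto simp: indicator_def inner_diff_left ee)
    then show "(\<integral>\<^sup>+t. g y * indicator (slab e) (y - t *\<^sub>R e) \<partial>lborel) = g y" by (simp add: nn_integral_cmult)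
  qed
  finally show ?thesis .
qed

text \<open>The formula for nonnegative integrals is recast as an image measure, so that integrals
  of vector-valued functions can be transported too.\<close>

lemma distr_slab:
  fixes e :: "real^'n"
  assumes e: "norm e = 1"
  shows "distr (density (lborel \<Otimes>\<^sub>M lborel) (\<lambda>p. ennreal (indicator (slab e) (fst p)))) borel
           (\<lambda>(x, t). x + t *\<^sub>R e) = lborel"
    (is "distr ?P _ ?T = _")
proof (rule measure_eqI)
  have T [measurable]: "?T \<in> (lborel \<Otimes>\<^sub>M lborel) \<rightarrow>\<^sub>M borel" by measurable
  fix A assume "A \<in> sets (distr ?P borel ?T)"
  then have [measurable]: "A \<in> sets borel" by simp
  have "emeasure (distr ?P borel ?T) A = (\<integral>\<^sup>+p. indicator A p \<partial>distr ?P borel ?T)" by simp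
  also have "\<dots> = (\<integral>\<^sup>+p. indicator A (?T p) \<partial>?P)" by (rule nn_integral_distr) simp_all
  also have "\<dots> = (\<integral>\<^sup>+p. ennreal (indicator (slab e) (fst p)) * indicator A (?T p) \<partial>(lborel \<Otimes>\<^sub>M lborel))"
    by (subst nn_integral_density) (auto simp: case_prod_beta)
  also have "\<dots> = (\<integral>\<^sup>+x. (\<integral>\<^sup>+t. ennreal (indicator (slab e) x) * indicator A (x + t *\<^sub>R e) \<partial>lborel) \<partial>lborel)"
    by (subst lborel.nn_integral_fst[symmetric]) (auto simp: case_prod_beta)
  also have "\<dots> = (\<integral>\<^sup>+x. (\<integral>\<^sup>+t. indicator A (x + t *\<^sub>R e) * indicator (slab e) x \<partial>lborel) \<partial>lborel)"
    by (intro nn_integral_cong) (auto simp: indicator_def)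
  also have "\<dots> = emeasure lborel A" by (subst nn_integral_slab[OF e]) auto
  finally show "emeasure (distr ?P borel ?T) A = emeasure lborel A" .
qed simp

lemma integral_slab:
  fixes e :: "real^'n" and g :: "real^'n \<Rightarrow> 'b::{banach, second_countable_topology}"
  assumes e: "norm e = 1" and g: "integrable lborel g"
  shows "(\<integral>x. g x \<partial>lborel) = (\<integral>x. indicator (slab e) x *\<^sub>R (\<integral>t. g (x + t *\<^sub>R e) \<partial>lborel) \<partial>lborel)"
proof -
  let ?P = "density (lborel \<Otimes>\<^sub>M lborel) (\<lambda>p. ennreal (indicator (slab e) (fst p)))"
  let ?T = "\<lambda>(x, t). x + t *\<^sub>R e"
  have [measurable]: "g \<in> borel_measurable borel" using g by auto
  have T [measurable]: "?T \<in> (lborel \<Otimes>\<^sub>M lborel) \<rightarrow>\<^sub>M borel" by measurable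
  have "integrable (distr ?P borel ?T) g" unfolding distr_slab[OF e] by (rule g)
  then have "integrable ?P (\<lambda>p. g (?T p))" by (subst (asm) integrable_distr_eq) auto
  then have i: "integrable (lborel \<Otimes>\<^sub>M lborel) (\<lambda>p. indicator (slab e) (fst p) *\<^sub>R g (?T p))"
    by (subst (asm) integrable_density) (auto simp: indicator_def)
  have "(\<integral>x. g x \<partial>lborel) = (\<integral>x. g x \<partial>distr ?P borel ?T)" unfolding distr_slab[OF e] ..
  also have "\<dots> = (\<integral>p. g (?T p) \<partial>?P)" by (rule integral_distr) auto
  also have "\<dots> = (\<integral>p. indicator (slab e) (fst p) *\<^sub>R g (?T p) \<partial>(lborel \<Otimes>\<^sub>M lborel))"
    by (rule integral_density) (auto simp: indicator_def)
  also have "\<dots> = (\<integral>x. (\<integral>t. indicator (slab e) (fst (x, t)) *\<^sub>R g (?T (x, t)) \<partial>lborel) \<partial>lborel)"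
    by (rule lborel_pair.integral_fst'[OF i, symmetric])
  finally show ?thesis by simp
qed

text \<open>Along each line in direction \<open>e\<close> the map is a translation, because
  \<open>gr\<close> is constant there.\<close>

lemma distr_shear:
  fixes e :: "real^'n"
  assumes e: "norm e = 1" and [measurable]: "gr \<in> borel_measurable borel"
    and inv: "\<And>x t. gr (x + t *\<^sub>R e) = gr x"
  shows "distr lborel borel (\<lambda>y. y + gr y *\<^sub>R e) = lborel"
proof (rule measure_eqI)
  fix A assume "A \<in> sets (distr lborel borel (\<lambda>y. y + gr y *\<^sub>R e))"
  then have [measurable]: "A \<in> sets borel" by simp
  have "emeasure (distr lborel borel (\<lambda>y. y + gr y *\<^sub>R e)) A
      = (\<integral>\<^sup>+y. indicator A (y + gr y *\<^sub>R e) \<partial>lborel)"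
    by (subst nn_integral_indicator[symmetric], simp) (subst nn_integral_distr, auto)
  also have "\<dots> = (\<integral>\<^sup>+x. (\<integral>\<^sup>+t. indicator A (x + t *\<^sub>R e + gr x *\<^sub>R e) * indicator (slab e) x \<partial>lborel) \<partial>lborel)"
    by (subst nn_integral_slab[OF e, symmetric]) (simp_all add: inv)
  also have "\<dots> = (\<integral>\<^sup>+x. (\<integral>\<^sup>+t. indicator A (x + t *\<^sub>R e) * indicator (slab e) x \<partial>lborel) \<partial>lborel)"
  proof (rule nn_integral_cong)
    fix x
    show "(\<integral>\<^sup>+t. indicator A (x + t *\<^sub>R e + gr x *\<^sub>R e) * indicator (slab e) x \<partial>lborel)
        = (\<integral>\<^sup>+t. indicator A (x + t *\<^sub>R e) * indicator (slab e) x \<partial>lborel)"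
      using nn_integral_real_affine[of "\<lambda>t. indicator A (x + t *\<^sub>R e) * indicator (slab e) x" 1 "gr x"]
      by (simp add: algebra_simps)
  qed
  also have "\<dots> = emeasure lborel A" by (subst nn_integral_slab[OF e]) auto
  finally show "emeasure (distr lborel borel (\<lambda>y. y + gr y *\<^sub>R e)) A = emeasure lborel A" .
qed simp

lemma integrable_compact_support:
  fixes f :: "'a::euclidean_space \<Rightarrow> 'b::{banach, second_countable_topology}"
  assumes "continuous_on UNIV f" "compact K" "\<And>x. x \<notin> K \<Longrightarrow> f x = 0"
  shows "integrable lborel f"
proof -
  have "integrable lborel (\<lambda>x. indicator K x *\<^sub>R f x)"
    using assms by (intro borel_integrable_compact) (auto intro: continuous_on_subset)
  also have "(\<lambda>x. indicator K x *\<^sub>R f x) = f" using assms(3) by (auto simp: indicator_def)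
  finally show ?thesis .
qed

lemma integral_derivative_ray:
  fixes g :: "real \<Rightarrow> 'b::euclidean_space"
  assumes d: "\<And>t. (g has_vector_derivative g' t) (at t)" and c: "continuous_on UNIV g'"
    and z: "\<And>t. \<bar>t\<bar> \<ge> R \<Longrightarrow> g t = 0"
  shows "(\<integral>t. indicator {s<..} t *\<^sub>R g' t \<partial>lborel) = - g s"
    and "(\<integral>t. g' t \<partial>lborel) = 0"
proof -
  have g'0: "g' t = 0" if "\<bar>t\<bar> > R" for t
  proof -
    have "(g has_vector_derivative 0) (at t)" using that z
      by (intro has_vector_derivative_transform_within_open[OF has_vector_derivative_const, where S="{t. \<bar>t\<bar> > R}"])
         (auto intro!: open_Collect_less continuous_intros)
    then show ?thesis using d vector_derivative_unique_at by blast
  qed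
  have ftc: "(\<integral>t. indicator {a..b} t *\<^sub>R g' t \<partial>lborel) = g b - g a" if "a \<le> b" for a b
    using that by (intro integral_FTC_Icc) (auto intro: has_vector_derivative_at_within d continuous_on_subset[OF c])
  let ?b = "\<bar>R\<bar> + \<bar>s\<bar> + 1"
  have "(\<integral>t. indicator {s<..} t *\<^sub>R g' t \<partial>lborel) = (\<integral>t. indicator {s..?b} t *\<^sub>R g' t \<partial>lborel)"
  proof (rule integral_cong_AE)
    have [measurable]: "g' \<in> borel_measurable borel" using c by (rule borel_measurable_continuous_onI)
    show "(\<lambda>t. indicator {s<..} t *\<^sub>R g' t) \<in> borel_measurable lborel"
      "(\<lambda>t. indicator {s..?b} t *\<^sub>R g' t) \<in> borel_measurable lborel" by measurable
    have "AE t in lborel. t \<noteq> s" by (rule AE_lborel_singleton)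
    then show "AE t in lborel. indicator {s<..} t *\<^sub>R g' t = indicator {s..?b} t *\<^sub>R g' t"
      by eventually_elim (auto simp: indicator_def intro!: g'0)
  qed
  then show "(\<integral>t. indicator {s<..} t *\<^sub>R g' t \<partial>lborel) = - g s" using ftc[of s ?b] z[of ?b] by auto
  let ?c = "\<bar>R\<bar> + 1"
  have "(\<integral>t. g' t \<partial>lborel) = (\<integral>t. indicator {-?c..?c} t *\<^sub>R g' t \<partial>lborel)"
    by (intro Bochner_Integration.integral_cong) (auto simp: indicator_def intro!: g'0)
  then show "(\<integral>t. g' t \<partial>lborel) = 0" using ftc[of "-?c" ?c] z[of ?c] z[of "-?c"] by auto
qed

lemma line_escapes_ball:
  fixes x e :: "real^'n"
  assumes "norm e = 1" "\<bar>t\<bar> \<ge> norm x + R + 1"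
  shows "x + t *\<^sub>R e \<notin> cball 0 R"
proof -
  have "\<bar>t\<bar> = norm (t *\<^sub>R e)" using assms by simp
  also have "\<dots> \<le> norm (x + t *\<^sub>R e) + norm x" using norm_triangle_ineq4[of "x + t *\<^sub>R e" x] by simp
  finally show ?thesis using assms(2) by auto
qed

context
  fixes F :: "real^'n \<Rightarrow> 'b::euclidean_space" and DF :: "real^'n \<Rightarrow> real^'n \<Rightarrow> 'b" and R :: real
  assumes dF: "\<And>y. (F has_derivative DF y) (at y)" and cF: "\<And>v. continuous_on UNIV (\<lambda>y. DF y v)"
    and F0: "\<And>y. y \<notin> cball 0 R \<Longrightarrow> F y = 0"
begin

lemma derivative_support: "y \<notin> cball 0 R \<Longrightarrow> DF y v = 0"
proof -
  assume y: "y \<notin> cball 0 R"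
  have "(F has_derivative (\<lambda>h. 0)) (at y)"
    using y F0 by (intro has_derivative_transform_within_open[OF has_derivative_const, where s="- cball 0 R"]) auto
  then show ?thesis using dF has_derivative_unique by metis
qed

lemma derivative_along_line:
  "((\<lambda>t. F (x + t *\<^sub>R v)) has_vector_derivative DF (x + t *\<^sub>R v) v) (at t)"
proof -
  have "((\<lambda>t. F (x + t *\<^sub>R v)) has_derivative (\<lambda>h. DF (x + t *\<^sub>R v) (h *\<^sub>R v))) (at t)"
    by (rule has_derivative_compose[OF _ dF]) (auto intro!: derivative_eq_intros)
  then show ?thesis using dF[of "x + t *\<^sub>R v"] has_derivative_bounded_linear[THEN bounded_linear.linear, THEN linear_cmul]
    by (fastforce simp: has_vector_derivative_def)
qed

lemma integrable_derivative: "integrable lborel (\<lambda>y. DF y v)"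
  by (rule integrable_compact_support[OF cF, of "cball 0 R"]) (auto intro: derivative_support)

lemma continuous_derivative_line: "continuous_on UNIV (\<lambda>t. DF (x + t *\<^sub>R e) v)"
  by (rule continuous_on_compose2[OF cF[of v]]) (auto intro!: continuous_intros)

text \<open>A line orthogonal to \<open>e\<close> lies entirely inside or entirely outside the
  half-space, and on each line the derivative of a compactly supported function integrates to
  zero.\<close>

lemma integral_halfspace_tangential:
  assumes v: "v \<bullet> e = 0"
  shows "(\<integral>y. indicator {y. 0 < y \<bullet> e} y *\<^sub>R DF y v \<partial>lborel) = 0"
proof (cases "v = 0")
  case True
  then have "DF y v = 0" for y using dF[of y] has_derivative_bounded_linear[THEN bounded_linear.linear, THEN linear_0] by blast
  then show ?thesis by simp
next
  case False
  define w where "w = v /\<^sub>R norm v"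
  have w: "norm w = 1" "v = norm v *\<^sub>R w" using False by (auto simp: w_def)
  have we: "w \<bullet> e = 0" using v by (simp add: w_def)
  have [measurable]: "{y. 0 < y \<bullet> e} \<in> sets borel" by (auto intro!: borel_open open_Collect_less continuous_intros)
  have i: "integrable lborel (\<lambda>y. indicator {y. 0 < y \<bullet> e} y *\<^sub>R DF y w)"
    using integrable_mult_indicator[OF _ integrable_derivative[of w], of "{y. 0 < y \<bullet> e}"] by simp
  have "(\<integral>t. DF (x + t *\<^sub>R w) w \<partial>lborel) = 0" for x
    by (rule integral_derivative_ray(2)[OF derivative_along_line continuous_derivative_line, of "norm x + R + 1"])
       (use line_escapes_ball[OF w(1)] F0 in auto)
  then have "(\<integral>y. indicator {y. 0 < y \<bullet> e} y *\<^sub>R DF y w \<partial>lborel) = 0"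
    by (subst integral_slab[OF w(1) i]) (simp add: inner_add_left we indicator_def)
  moreover have "DF y v = norm v *\<^sub>R DF y w" for y
    using w(2) dF[of y] has_derivative_bounded_linear[THEN bounded_linear.linear, THEN linear_cmul] by metis
  ultimately show ?thesis by (simp add: scaleR_left_commute[of _ "norm v"] del: scaleR_scaleR)
qed

text \<open>\<open>b\<close> is constant along \<open>e\<close> and leaves the inner integral. The
  ray starts where the line crosses the boundary hyperplane, at parameter
  \<open>- (x \<bullet> e)\<close>.\<close>

lemma integral_halfspace_normal:
  assumes e: "norm e = 1" and b: "continuous_on UNIV b" "\<And>x t. b (x + t *\<^sub>R e) = (b x :: real)"
  shows "(\<integral>y. indicator {y. 0 < y \<bullet> e} y *\<^sub>R b y *\<^sub>R DF y e \<partial>lborel)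
    = - (\<integral>x. indicator (slab e) x *\<^sub>R b x *\<^sub>R F (x - (x \<bullet> e) *\<^sub>R e) \<partial>lborel)"
proof -
  have ee: "e \<bullet> e = 1" using e by (simp add: norm_eq_1)
  have [measurable]: "{y. 0 < y \<bullet> e} \<in> sets borel" by (auto intro!: borel_open open_Collect_less continuous_intros)
  have "integrable lborel (\<lambda>y. b y *\<^sub>R DF y e)"
    by (rule integrable_compact_support[of _ "cball 0 R"]) (auto intro!: continuous_intros b cF derivative_support)
  then have i: "integrable lborel (\<lambda>y. indicator {y. 0 < y \<bullet> e} y *\<^sub>R b y *\<^sub>R DF y e)"
    using integrable_mult_indicator[of "{y. 0 < y \<bullet> e}" lborel] by (simp del: scaleR_scaleR)
  have "(\<integral>t. indicator {- (x \<bullet> e)<..} t *\<^sub>R DF (x + t *\<^sub>R e) e \<partial>lborel) = - F (x + (- (x \<bullet> e)) *\<^sub>R e)" for x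
    by (rule integral_derivative_ray(1)[OF derivative_along_line continuous_derivative_line, of "norm x + R + 1"])
       (use line_escapes_ball[OF e] F0 in auto)
  moreover have "indicator {y. 0 < y \<bullet> e} (x + t *\<^sub>R e) *\<^sub>R b (x + t *\<^sub>R e) *\<^sub>R DF (x + t *\<^sub>R e) e
      = b x *\<^sub>R (indicator {- (x \<bullet> e)<..} t *\<^sub>R DF (x + t *\<^sub>R e) e)" for x t by (auto simp: b(2) inner_add_left ee indicator_def)
  ultimately have "(\<integral>t. indicator {y. 0 < y \<bullet> e} (x + t *\<^sub>R e) *\<^sub>R b (x + t *\<^sub>R e) *\<^sub>R DF (x + t *\<^sub>R e) e \<partial>lborel)
      = - (b x *\<^sub>R F (x - (x \<bullet> e) *\<^sub>R e))" for x by (simp del: scaleR_scaleR)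
  then show ?thesis by (subst integral_slab[OF e i]) (simp only: scaleR_minus_right Bochner_Integration.integral_minus)
qed

text \<open>Splitting \<open>v\<close> into its part along \<open>e\<close> and its tangential part
  reduces this to the two preceding cases. The weight \<open>b\<close> will be a partial derivative
  of the graph function, which the chain rule produces when a graph is flattened by a shear.\<close>

lemma integral_halfspace:
  assumes e: "norm e = 1" and b: "continuous_on UNIV b" "\<And>x t. b (x + t *\<^sub>R e) = (b x :: real)"
  shows "(\<integral>y. indicator {y. 0 < y \<bullet> e} y *\<^sub>R (DF y v - b y *\<^sub>R DF y e) \<partial>lborel)
    = (\<integral>x. indicator (slab e) x *\<^sub>R (b x - v \<bullet> e) *\<^sub>R F (x - (x \<bullet> e) *\<^sub>R e) \<partial>lborel)"
proof -
  have ee: "e \<bullet> e = 1" using e by (simp add: norm_eq_1)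
  define v' where "v' = v - (v \<bullet> e) *\<^sub>R e"
  define b' where "b' x = b x - v \<bullet> e" for x
  have v': "v' \<bullet> e = 0" by (simp add: v'_def inner_diff_left ee)
  have b': "continuous_on UNIV b'" "b' (x + t *\<^sub>R e) = b' x" for x t by (auto simp: b'_def b intro!: continuous_intros)
  have l: "linear (DF y)" for y using dF[of y] has_derivative_bounded_linear bounded_linear.linear by blast
  have split: "DF y v - b y *\<^sub>R DF y e = DF y v' - b' y *\<^sub>R DF y e" for y
    by (simp add: v'_def b'_def linear_diff[OF l] linear_cmul[OF l] algebra_simps)
  have [measurable]: "{y. 0 < y \<bullet> e} \<in> sets borel" by (auto intro!: borel_open open_Collect_less continuous_intros)
  have "integrable lborel (\<lambda>y. b' y *\<^sub>R DF y e)"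
    by (rule integrable_compact_support[of _ "cball 0 R"]) (auto intro!: continuous_intros b' cF derivative_support)
  then have i: "integrable lborel (\<lambda>y. indicator {y. 0 < y \<bullet> e} y *\<^sub>R b' y *\<^sub>R DF y e)"
    using integrable_mult_indicator[of "{y. 0 < y \<bullet> e}" lborel] by (simp del: scaleR_scaleR)
  have i': "integrable lborel (\<lambda>y. indicator {y. 0 < y \<bullet> e} y *\<^sub>R DF y v')"
    using integrable_mult_indicator[OF _ integrable_derivative[of v'], of "{y. 0 < y \<bullet> e}"] by simp
  have "(\<integral>y. indicator {y. 0 < y \<bullet> e} y *\<^sub>R (DF y v - b y *\<^sub>R DF y e) \<partial>lborel)
    = (\<integral>y. indicator {y. 0 < y \<bullet> e} y *\<^sub>R DF y v' \<partial>lborel)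
      - (\<integral>y. indicator {y. 0 < y \<bullet> e} y *\<^sub>R b' y *\<^sub>R DF y e \<partial>lborel)"
    unfolding split scaleR_diff_right by (rule Bochner_Integration.integral_diff[OF i' i])
  then show ?thesis using integral_halfspace_tangential[OF v'] integral_halfspace_normal[OF e b'] by (simp add: b'_def)
qed

end


subsection \<open>Graphs of functions of class C2\<close>

lemma integral_lebesgue_on_open:
  fixes f :: "'a::euclidean_space \<Rightarrow> 'b::{banach, second_countable_topology}"
  assumes "open D" "f \<in> borel_measurable borel"
  shows "(\<integral>x. f x \<partial>lebesgue_on D) = (\<integral>x. indicator D x *\<^sub>R f x \<partial>lborel)"
proof -
  have "(\<integral>x. f x \<partial>lebesgue_on D) = (\<integral>x. indicator D x *\<^sub>R f x \<partial>lebesgue)" using assms by (intro integral_restrict_space) auto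
  also have "\<dots> = (\<integral>x. indicator D x *\<^sub>R f x \<partial>lborel)" using assms by (intro integral_completion) measurable
  finally show ?thesis .
qed

lemma continuous_on_compact_bound:
  fixes f :: "'a::topological_space \<Rightarrow> 'b::real_normed_vector"
  assumes "continuous_on K f" "compact K"
  obtains C where "C \<ge> 0" "\<And>x. x \<in> K \<Longrightarrow> norm (f x) \<le> C"
proof -
  have "bounded (f ` K)" using assms by (intro compact_imp_bounded compact_continuous_image)
  then obtain C where "C > 0" "\<forall>y\<in>f ` K. norm y \<le> C" unfolding bounded_pos by auto
  then show ?thesis using that[of C] by auto
qed

lemma partial_shift:
  assumes "f differentiable (at (x + a))"
  shows "partial i (\<lambda>y. f (y + a)) x = partial i f (x + a)"
proof -
  have "((\<lambda>y. f (y + a)) has_derivative frechet_derivative f (at (x + a))) (at x)" using assms frechet_derivative_works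
    by (intro has_derivative_compose[of "\<lambda>y. y + a" "\<lambda>h. h" x UNIV f]) (auto intro!: derivative_eq_intros)
  from partial_eqI[OF this, of i] show ?thesis by (simp only: partial_def[of i f])
qed

definition graph_proj :: "real^'n \<Rightarrow> (real^'n \<Rightarrow> real) \<Rightarrow> real^'n \<Rightarrow> real^'n" where
  "graph_proj e gr x = x + (gr x - x \<bullet> e) *\<^sub>R e"

definition graph_normal :: "real^'n \<Rightarrow> (real^'n \<Rightarrow> real) \<Rightarrow> real^'n \<Rightarrow> real^'n" where
  "graph_normal e gr x = (1 / sqrt (1 + (norm (grad gr x))^2)) *\<^sub>R (grad gr x - e)"

definition graph_measure :: "real^'n \<Rightarrow> (real^'n \<Rightarrow> real) \<Rightarrow> (real^'n) measure" where
  "graph_measure e gr =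
     distr (density lborel (\<lambda>x. ennreal (sqrt (1 + (norm (grad gr x))^2) * indicator (slab e) x)))
       borel (graph_proj e gr)"

locale graph_function =
  fixes e :: "real^'n" and gr :: "real^'n \<Rightarrow> real"
  assumes norm_e: "norm e = 1" and C2: "Ck 2 gr" and along_e: "\<And>x t. gr (x + t *\<^sub>R e) = gr x"
begin

lemma e_e: "e \<bullet> e = 1" using norm_e by (simp add: norm_eq_1)

lemma diff: "gr differentiable (at x)"
  and C1_partial: "Ck 1 (partial i gr)" using C2 by (auto simp: numeral_2_eq_2)

lemma cont: "continuous_on S gr" using C2 by (rule Ck_continuous)

lemma partial_along_e: "partial i gr (x + t *\<^sub>R e) = partial i gr x"
  using partial_shift[where x=x and a="t *\<^sub>R e" and f=gr and i=i, OF diff] by (simp add: along_e)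

lemma grad_along_e: "grad gr (x + t *\<^sub>R e) = grad gr x" by (simp add: grad_def partial_along_e)

lemma graph_normal_along_e: "graph_normal e gr (x + t *\<^sub>R e) = graph_normal e gr x" by (simp add: graph_normal_def grad_along_e)

lemma grad_orth: "grad gr x \<bullet> e = 0" "e \<bullet> grad gr x = 0"
proof -
  have "((\<lambda>t. gr (x + t *\<^sub>R e)) has_vector_derivative (\<Sum>i\<in>UNIV. e $ i *\<^sub>R partial i gr (x + 0 *\<^sub>R e))) (at 0)"
    by (rule partial_along_line[OF diff])
  then have "((\<lambda>t. gr x) has_vector_derivative (\<Sum>i\<in>UNIV. e $ i * partial i gr x)) (at (0::real))" by (simp add: along_e)
  then have "(\<Sum>i\<in>UNIV. e $ i * partial i gr x) = 0" using vector_derivative_unique_at[OF _ has_vector_derivative_const] by blast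
  then show "e \<bullet> grad gr x = 0" by (simp add: inner_vec_def grad_def)
  then show "grad gr x \<bullet> e = 0" by (simp add: inner_commute)
qed

lemma norm_grad_diff_e: "(norm (grad gr x - e))^2 = 1 + (norm (grad gr x))^2"
  by (simp add: power2_norm_eq_inner inner_diff_left inner_diff_right grad_orth e_e)

lemma norm_graph_normal: "norm (graph_normal e gr x) = 1"
proof -
  have "norm (grad gr x - e) = sqrt (1 + (norm (grad gr x))^2)"
    using norm_grad_diff_e[of x] by (metis norm_ge_zero real_sqrt_unique)
  moreover have "sqrt (1 + (norm (grad gr x))^2) > 0" by (simp add: add_pos_nonneg)
  ultimately show ?thesis by (simp add: graph_normal_def)
qed

lemma sqrt_graph_normal:
  "sqrt (1 + (norm (grad gr x))^2) * graph_normal e gr x $ i = partial i gr x - e $ i"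
proof -
  have "sqrt (1 + (norm (grad gr x))^2) > 0" by (simp add: add_pos_nonneg)
  then show ?thesis by (simp add: graph_normal_def grad_def)
qed

text \<open>One derivative is lost, since the graph function is C2. The square root is taken of
  values that stay positive, so the composition rule for C1 functions applies.\<close>

lemma C1_graph_normal: "Ck 1 (\<lambda>x. graph_normal e gr x $ i)"
proof -
  have *: "Ck 1 (\<lambda>x. 1 + (\<Sum>i\<in>UNIV. partial i gr x * partial i gr x))" by (intro Ck_add Ck_const Ck_sum Ck_mult C1_partial)
  have pos: "1 + (\<Sum>i\<in>UNIV. partial i gr x * partial i gr x) > 0" for x by (simp add: add_pos_nonneg sum_nonneg)
  have "Ck 1 (\<lambda>x. 1 / sqrt (1 + (\<Sum>i\<in>UNIV. partial i gr x * partial i gr x)))"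
  proof (rule C1_compose_real[OF *])
    have "((\<lambda>s. 1 / sqrt s) has_real_derivative - 1 / (2 * sqrt s * s)) (at s)" if "s > 0" for s
      using that by (auto intro!: derivative_eq_intros simp: field_simps)
    from this[OF pos] show "((\<lambda>s. 1 / sqrt s) has_real_derivative
        - 1 / (2 * sqrt (1 + (\<Sum>i\<in>UNIV. partial i gr x * partial i gr x))
            * (1 + (\<Sum>i\<in>UNIV. partial i gr x * partial i gr x))))
       (at (1 + (\<Sum>i\<in>UNIV. partial i gr x * partial i gr x)))" for x .
    show "continuous_on (range (\<lambda>x. 1 + (\<Sum>i\<in>UNIV. partial i gr x * partial i gr x)))
       (\<lambda>s. - 1 / (2 * sqrt s * s))"
    proof (intro continuous_intros ballI)
      fix s assume "s \<in> range (\<lambda>x. 1 + (\<Sum>i\<in>UNIV. partial i gr x * partial i gr x))"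
      then obtain x where "s = 1 + (\<Sum>i\<in>UNIV. partial i gr x * partial i gr x)" by auto
      with pos[of x] show "2 * sqrt s * s \<noteq> 0" by auto
    qed
  qed
  then have "Ck 1 (\<lambda>x. 1 / sqrt (1 + (\<Sum>i\<in>UNIV. partial i gr x * partial i gr x)) * (partial i gr x - e $ i))"
    by (intro Ck_mult Ck_diff Ck_const C1_partial)
  then show ?thesis by (simp add: graph_normal_def grad_def power2_norm_eq_inner inner_vec_def)
qed

lemma cont_grad: "continuous_on S (grad gr)" unfolding grad_def by (intro continuous_on_vec_lambda Ck_continuous[OF C1_partial])

lemma measurable_chart [measurable]:
  "gr \<in> borel_measurable borel" "grad gr \<in> borel_measurable borel"
  "graph_proj e gr \<in> borel_measurable borel" "graph_normal e gr \<in> borel_measurable borel"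
proof -
  show 1 [measurable]: "gr \<in> borel_measurable borel" and 2 [measurable]: "grad gr \<in> borel_measurable borel"
    by (auto intro!: borel_measurable_continuous_onI cont cont_grad)
  show "graph_proj e gr \<in> borel_measurable borel" "graph_normal e gr \<in> borel_measurable borel"
    unfolding graph_proj_def[abs_def] graph_normal_def[abs_def] by measurable
qed

lemma measurable_graph_normal_nth [measurable]: "(\<lambda>x. graph_normal e gr x $ i) \<in> borel_measurable borel"
  by (rule borel_measurable_continuous_onI) (rule Ck_continuous[OF C1_graph_normal])

lemma sets_graph_measure [simp, measurable_cong]: "sets (graph_measure e gr) = sets borel"
  and space_graph_measure [simp]: "space (graph_measure e gr) = UNIV" by (auto simp: graph_measure_def)

lemma emeasure_graph_measure:
  assumes [measurable]: "A \<in> sets borel"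
  shows "emeasure (graph_measure e gr) A = graph_area e gr A"
proof -
  have "emeasure (graph_measure e gr) A = (\<integral>\<^sup>+x. indicator A x \<partial>graph_measure e gr)" using assms by simp
  also have "\<dots> = (\<integral>\<^sup>+x. ennreal (sqrt (1 + (norm (grad gr x))^2) * indicator (slab e) x)
      * indicator A (graph_proj e gr x) \<partial>lborel)"
    unfolding graph_measure_def by (subst nn_integral_distr, simp, simp) (subst nn_integral_density, auto)
  also have "\<dots> = graph_area e gr A" unfolding graph_area_def graph_proj_def by (intro nn_integral_cong) (auto simp: indicator_def)
  finally show ?thesis .
qed

lemma integral_graph_measure:
  fixes f :: "real^'n \<Rightarrow> 'b::{banach, second_countable_topology}"
  assumes [measurable]: "f \<in> borel_measurable borel"
  shows "(\<integral>x. f x \<partial>graph_measure e gr)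
    = (\<integral>x. (sqrt (1 + (norm (grad gr x))^2) * indicator (slab e) x) *\<^sub>R f (graph_proj e gr x) \<partial>lborel)"
  unfolding graph_measure_def by (subst integral_distr, simp, simp) (subst integral_density, auto simp: indicator_def)

lemma AE_graph_measure: "AE x in graph_measure e gr. gr x = x \<bullet> e"
proof -
  have "gr (graph_proj e gr x) = graph_proj e gr x \<bullet> e" for x by (simp add: graph_proj_def along_e inner_add_left e_e)
  moreover have "{x \<in> space borel. gr x = x \<bullet> e} \<in> sets borel" by measurable
  ultimately show ?thesis unfolding graph_measure_def by (subst AE_distr_iff) auto
qed

lemma along_proj: "gr (graph_proj e gr x) = gr x" by (simp add: graph_proj_def along_e)

text \<open>A point \<open>x\<close> of the slab is recovered from its image \<open>y\<close> on the
  graph as \<open>y + (x \<bullet> e - gr y) *\<^sub>R e\<close>. For bounded \<open>y\<close> the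
  coefficient is bounded, and so is the preimage.\<close>

lemma emeasure_graph_measure_bounded:
  assumes B: "bounded B" and [measurable]: "B \<in> sets borel"
  shows "emeasure (graph_measure e gr) B < \<infinity>"
proof -
  obtain R where R: "B \<subseteq> cball 0 R" "R \<ge> 0" using B unfolding bounded_pos by (force intro: less_imp_le)
  obtain C where C: "C \<ge> 0" "\<And>x. x \<in> cball 0 R \<Longrightarrow> norm (gr x) \<le> C"
    by (rule continuous_on_compact_bound[OF cont compact_cball]) blast
  define R' where "R' = R + (1 + C)"
  have cs: "continuous_on S (\<lambda>x. sqrt (1 + (norm (grad gr x))^2))" for S by (intro continuous_intros cont_grad)
  obtain C' where "C' \<ge> 0" "\<And>x. x \<in> cball 0 R' \<Longrightarrow> norm (sqrt (1 + (norm (grad gr x))^2)) \<le> C'"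
    by (rule continuous_on_compact_bound[OF cs compact_cball]) blast
  then have C': "C' \<ge> 0" "\<And>x. x \<in> cball 0 R' \<Longrightarrow> sqrt (1 + (norm (grad gr x))^2) \<le> C'" by auto
  have in_ball: "x \<in> cball 0 R'" if "graph_proj e gr x \<in> B" "x \<in> slab e" for x
  proof -
    let ?y = "graph_proj e gr x"
    have y: "norm ?y \<le> R" "norm (gr ?y) \<le> C" using that R C(2)[of ?y] by auto
    have x: "x = ?y + (x \<bullet> e - gr ?y) *\<^sub>R e"  unfolding along_proj by (simp add: graph_proj_def algebra_simps)
    have "norm x \<le> norm ?y + norm ((x \<bullet> e - gr ?y) *\<^sub>R e)" using norm_triangle_ineq[of ?y "(x \<bullet> e - gr ?y) *\<^sub>R e"] x by simp
    also have "norm ((x \<bullet> e - gr ?y) *\<^sub>R e) \<le> 1 + C" using that(2) y(2) norm_e by auto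
    finally show ?thesis using y(1) by (simp add: R'_def)
  qed
  have "emeasure (graph_measure e gr) B \<le> (\<integral>\<^sup>+x. ennreal C' * indicator (cball 0 R') (x::real^'n) \<partial>lborel)"
    unfolding emeasure_graph_measure[OF assms(2)] graph_area_def
  proof (rule nn_integral_mono)
    fix x
    show "ennreal (sqrt (1 + (norm (grad gr x))^2)) * indicator B (x + (gr x - x \<bullet> e) *\<^sub>R e) * indicator (slab e) x
        \<le> ennreal C' * indicator (cball 0 R') x"
    proof (cases "graph_proj e gr x \<in> B \<and> x \<in> slab e")
      case True
      then show ?thesis using in_ball[of x] C'(2)[of x] by (auto simp: graph_proj_def indicator_def intro!: ennreal_leI)
    qed (auto simp: graph_proj_def)
  qed
  also have "\<dots> < \<infinity>" using emeasure_compact_finite[of "cball (0::real^'n) R'"]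
    by (simp add: nn_integral_cmult_indicator ennreal_mult_less_top)
  finally show ?thesis .
qed

text \<open>The shear \<open>\<Phi>\<close> straightens the graph and preserves volume. By the chain
  rule the pulled back \<open>partial i f\<close> is the derivative of \<open>F\<close> along
  \<open>axis i 1\<close> minus \<open>partial i gr\<close> times its derivative along
  \<open>e\<close>. The boundary factor \<open>partial i gr x - e $ i\<close> that arises is the
  area element times the component of the normal.\<close>

lemma halfspace_gauss_green:
  fixes f :: "real^'n \<Rightarrow> 'b::euclidean_space"
  assumes f: "Ck 1 f" and K: "compact K" "\<And>x. x \<notin> K \<Longrightarrow> f x = 0"
  shows "(\<integral>x. indicator {x. gr x < x \<bullet> e} x *\<^sub>R partial i f x \<partial>lborel)
     = (\<integral>x. graph_normal e gr x $ i *\<^sub>R f x \<partial>graph_measure e gr)"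
proof -
  have df: "f differentiable (at x)" and cpf: "continuous_on UNIV (partial j f)" for x j using f by auto
  define Df where "Df x w = (\<Sum>j\<in>UNIV. w $ j *\<^sub>R partial j f x)" for x w
  have Df: "(f has_derivative Df x) (at x)" for x unfolding Df_def by (rule has_derivative_partial[OF df])
  have Df_lin: "linear (Df x)" for x using Df has_derivative_bounded_linear bounded_linear.linear by blast
  have Df_axis: "Df x (axis i 1) = partial i f x" for x using partial_eqI[OF Df] by simp
  define Dg where "Dg y v = (\<Sum>l\<in>UNIV. v $ l *\<^sub>R partial l gr y)" for y v
  have Dg: "(gr has_derivative Dg y) (at y)" for y unfolding Dg_def by (rule has_derivative_partial[OF diff])
  have Dg_axis: "Dg y (axis i 1) = partial i gr y" for y using partial_eqI[OF Dg] by simp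
  have Dg_e: "Dg y e = 0" for y using grad_orth[of y] by (simp add: Dg_def inner_vec_def grad_def)
  define \<Phi> where "\<Phi> y = y + gr y *\<^sub>R e" for y
  have c\<Phi>: "continuous_on S \<Phi>" for S unfolding \<Phi>_def by (intro continuous_intros cont)
  define F where "F y = f (\<Phi> y)" for y
  define DF where "DF y v = Df (\<Phi> y) (v + Dg y v *\<^sub>R e)" for y v
  have DF: "(F has_derivative DF y) (at y)" for y unfolding F_def[abs_def] DF_def[abs_def]
    by (rule has_derivative_compose[OF _ Df]) (auto simp: \<Phi>_def intro!: derivative_eq_intros Dg)
  have cDF: "continuous_on UNIV (\<lambda>y. DF y v)" for v unfolding DF_def Df_def Dg_def
    by (intro continuous_intros continuous_on_compose2[OF cpf c\<Phi>] Ck_continuous[OF C1_partial]) auto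
  obtain R0 where R0: "\<And>x. x \<in> K \<Longrightarrow> norm x \<le> R0" using compact_imp_bounded[OF K(1)] unfolding bounded_pos by auto
  obtain C where C: "\<And>x. x \<in> K \<Longrightarrow> norm (gr x) \<le> C" using compact_imp_bounded[OF compact_continuous_image[OF cont K(1)]]
    unfolding bounded_pos by auto
  have F0: "F y = 0" if "y \<notin> cball 0 (R0 + C)" for y
  proof (rule ccontr)
    assume "F y \<noteq> 0"
    then have k: "\<Phi> y \<in> K" using K(2) by (auto simp: F_def)
    have y: "y = \<Phi> y - gr (\<Phi> y) *\<^sub>R e" by (simp add: \<Phi>_def along_e)
    have "norm y \<le> norm (\<Phi> y) + norm (gr (\<Phi> y) *\<^sub>R e)" using norm_triangle_ineq4[of "\<Phi> y" "gr (\<Phi> y) *\<^sub>R e"] y by simp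
    also have "\<dots> \<le> R0 + C" using R0[OF k] C[OF k] norm_e by auto
    finally show False using that by simp
  qed
  have [measurable]: "f \<in> borel_measurable borel" "partial i f \<in> borel_measurable borel"
    "\<Phi> \<in> borel_measurable borel" using Ck_continuous[OF f] cpf c\<Phi> by (auto intro!: borel_measurable_continuous_onI)
  have set_m [measurable]: "{x. gr x < x \<bullet> e} \<in> sets borel" by (auto intro!: borel_open open_Collect_less continuous_intros cont)
  have "(\<integral>x. indicator {x. gr x < x \<bullet> e} x *\<^sub>R partial i f x \<partial>lborel)
     = (\<integral>x. indicator {x. gr x < x \<bullet> e} x *\<^sub>R partial i f x \<partial>distr lborel borel \<Phi>)"
    using distr_shear[OF norm_e measurable_chart(1) along_e] by (simp add: \<Phi>_def[abs_def])
  also have "\<dots> = (\<integral>y. indicator {x. gr x < x \<bullet> e} (\<Phi> y) *\<^sub>R partial i f (\<Phi> y) \<partial>lborel)" by (rule integral_distr) auto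
  also have "\<dots> = (\<integral>y. indicator {y. 0 < y \<bullet> e} y *\<^sub>R (DF y (axis i 1) - partial i gr y *\<^sub>R DF y e) \<partial>lborel)"
    by (intro Bochner_Integration.integral_cong)
       (auto simp: \<Phi>_def along_e inner_add_left e_e indicator_def DF_def Dg_e Dg_axis
          linear_add[OF Df_lin] linear_cmul[OF Df_lin] Df_axis)
  also have "\<dots> = (\<integral>x. indicator (slab e) x *\<^sub>R (partial i gr x - axis i 1 \<bullet> e) *\<^sub>R F (x - (x \<bullet> e) *\<^sub>R e) \<partial>lborel)"
    by (rule integral_halfspace[OF DF cDF F0 norm_e])
       (auto simp: partial_along_e intro!: Ck_continuous[OF C1_partial])
  also have "\<dots> = (\<integral>x. (sqrt (1 + (norm (grad gr x))^2) * indicator (slab e) x) *\<^sub>R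
      (graph_normal e gr (graph_proj e gr x) $ i *\<^sub>R f (graph_proj e gr x)) \<partial>lborel)"
  proof (intro Bochner_Integration.integral_cong refl)
    fix x
    have "gr (x - (x \<bullet> e) *\<^sub>R e) = gr x" using along_e[of x "- (x \<bullet> e)"] by simp
    then have "F (x - (x \<bullet> e) *\<^sub>R e) = f (graph_proj e gr x)" by (simp add: F_def \<Phi>_def graph_proj_def algebra_simps)
    moreover have "graph_normal e gr (graph_proj e gr x) = graph_normal e gr x"
      unfolding graph_proj_def by (rule graph_normal_along_e)
    moreover have "axis i 1 \<bullet> e = e $ i" by (simp add: inner_axis_axis inner_axis' )
    ultimately show "indicator (slab e) x *\<^sub>R (partial i gr x - axis i 1 \<bullet> e) *\<^sub>R F (x - (x \<bullet> e) *\<^sub>R e)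
      = (sqrt (1 + (norm (grad gr x))^2) * indicator (slab e) x) *\<^sub>R
      (graph_normal e gr (graph_proj e gr x) $ i *\<^sub>R f (graph_proj e gr x))" by (simp add: sqrt_graph_normal[symmetric] mult_ac)
  qed
  also have "\<dots> = (\<integral>x. graph_normal e gr x $ i *\<^sub>R f x \<partial>graph_measure e gr)" by (rule integral_graph_measure[symmetric]) measurable
  finally show ?thesis .
qed

end


subsection \<open>The surface measure\<close>

lemma C2_graph_function:
  assumes "C2_graph D c r e gr"
  shows "graph_function e gr" using assms by unfold_locales (auto simp: C2_graph_def)

lemma C2_graph_mem_iff:
  assumes "C2_graph D c r e gr" "x \<in> ball c r"
  shows "x \<in> D \<longleftrightarrow> gr x < x \<bullet> e"
proof -
  have "x \<in> D \<inter> ball c r \<longleftrightarrow> x \<in> {x \<in> ball c r. gr x < x \<bullet> e}" using assms(1) by (simp add: C2_graph_def)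
  then show ?thesis using assms(2) by simp
qed

lemma C2_graph_recenter:
  assumes g: "C2_graph D c r e gr" and x: "x \<in> ball c r"
  obtains r' where "C2_graph D x r' e gr"
proof -
  have sub: "ball x (r - dist c x) \<subseteq> ball c r"
  proof
    fix y assume "y \<in> ball x (r - dist c x)"
    then show "y \<in> ball c r" using dist_triangle[of c y x] by auto
  qed
  have D: "D \<inter> ball c r = {y \<in> ball c r. gr y < y \<bullet> e}" using g by (auto simp: C2_graph_def)
  have "D \<inter> ball x (r - dist c x) = {y \<in> ball x (r - dist c x). gr y < y \<bullet> e}" using sub D by blast
  then have "C2_graph D x (r - dist c x) e gr" using g x by (auto simp: C2_graph_def)
  then show ?thesis using that by blast
qed

text \<open>Strictly above the graph a point is interior, strictly below it is exterior, and a point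
  on the graph is approached from \<open>D\<close> by moving up along \<open>e\<close>.\<close>

lemma frontier_iff_graph:
  assumes g: "C2_graph D c r e gr" and x: "x \<in> ball c r"
  shows "x \<in> frontier D \<longleftrightarrow> gr x = x \<bullet> e"
proof -
  interpret graph_function e gr by (rule C2_graph_function[OF g])
  have D: "D \<inter> ball c r = {y \<in> ball c r. gr y < y \<bullet> e}" using g by (auto simp: C2_graph_def)
  have above: "open ({y. gr y < y \<bullet> e} \<inter> ball c r)" and below: "open ({y. gr y > y \<bullet> e} \<inter> ball c r)"
    by (auto intro!: open_Int open_Collect_less continuous_intros cont)
  show ?thesis
  proof
    assume f: "x \<in> frontier D"
    have "\<not> gr x < x \<bullet> e"
    proof
      assume "gr x < x \<bullet> e"
      then have "x \<in> interior D" using interior_maximal[OF _ above, of D] D x by blast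
      then show False using f by (simp add: frontier_def)
    qed
    moreover have "\<not> gr x > x \<bullet> e"
    proof
      assume "gr x > x \<bullet> e"
      then have "x \<in> {y. gr y > y \<bullet> e} \<inter> ball c r" using x by auto
      moreover have "({y. gr y > y \<bullet> e} \<inter> ball c r) \<inter> D = {}" using D by force
      ultimately have "x \<notin> closure D" using below open_Int_closure_eq_empty by blast
      then show False using f by (simp add: frontier_def)
    qed
    ultimately show "gr x = x \<bullet> e" by simp
  next
    assume eq: "gr x = x \<bullet> e"
    then have "x \<notin> D" using D x by force
    then have "x \<notin> interior D" using interior_subset by blast
    moreover have "x \<in> closure D" unfolding closure_approachable
    proof (intro allI impI)
      fix eps :: real assume eps: "eps > 0"
      define t where "t = min eps (r - dist c x) / 2"
      have t: "t > 0" "t < eps" "t < r - dist c x" using eps x by (auto simp: t_def)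
      have "dist c (x + t *\<^sub>R e) \<le> dist c x + t" using dist_triangle[of c "x + t *\<^sub>R e" x] t norm_e by (simp add: dist_norm)
      then have "x + t *\<^sub>R e \<in> ball c r" using t by simp
      moreover have "gr (x + t *\<^sub>R e) < (x + t *\<^sub>R e) \<bullet> e" using eq t by (simp add: along_e inner_add_left e_e)
      ultimately have "x + t *\<^sub>R e \<in> D" using D by blast
      moreover have "dist (x + t *\<^sub>R e) x < eps" using t norm_e by (simp add: dist_norm)
      ultimately show "\<exists>y\<in>D. dist y x < eps" by blast
    qed
    ultimately show "x \<in> frontier D" by (simp add: frontier_def)
  qed
qed

text \<open>If the normals differed, a short move from \<open>x\<close> along their difference
  \<open>v\<close> would enter the epigraph of the first chart and leave that of the second,
  although both describe \<open>D\<close> near \<open>x\<close>.\<close>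

lemma graph_normal_unique:
  assumes g: "C2_graph D c r e gr" and g': "C2_graph D c' r' e' gr'"
    and x: "x \<in> frontier D" "x \<in> ball c r" "x \<in> ball c' r'"
  shows "graph_normal e gr x = graph_normal e' gr' x"
proof (rule ccontr)
  assume ne: "graph_normal e gr x \<noteq> graph_normal e' gr' x"
  interpret a: graph_function e gr by (rule C2_graph_function[OF g])
  interpret b: graph_function e' gr' by (rule C2_graph_function[OF g'])
  define v where "v = graph_normal e' gr' x - graph_normal e gr x"
  have nn: "graph_normal e gr x \<bullet> graph_normal e gr x = 1" "graph_normal e' gr' x \<bullet> graph_normal e' gr' x = 1"
    using a.norm_graph_normal b.norm_graph_normal norm_eq_1 by blast+
  have lt: "graph_normal e gr x \<bullet> graph_normal e' gr' x < 1"
  proof -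
    have "0 < (norm v)^2" using ne by (simp add: v_def)
    also have "(norm v)^2 = 2 - 2 * (graph_normal e gr x \<bullet> graph_normal e' gr' x)"
      using nn by (simp add: v_def power2_norm_eq_inner inner_diff_left inner_diff_right inner_commute)
    finally show ?thesis by simp
  qed
  have dir: "((\<lambda>t. \<theta> (x + t *\<^sub>R v) - (x + t *\<^sub>R v) \<bullet> d) has_real_derivative (grad \<theta> x - d) \<bullet> v) (at 0)"
    if "graph_function d \<theta>" for d \<theta>
  proof -
    interpret graph_function d \<theta> by fact
    have "((\<lambda>t. \<theta> (x + t *\<^sub>R v)) has_vector_derivative (\<Sum>i\<in>UNIV. v $ i *\<^sub>R partial i \<theta> (x + 0 *\<^sub>R v))) (at 0)"
      by (rule partial_along_line[OF diff])
    then have "((\<lambda>t. \<theta> (x + t *\<^sub>R v)) has_real_derivative grad \<theta> x \<bullet> v) (at 0)"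
      by (simp add: has_real_derivative_iff_has_vector_derivative inner_vec_def grad_def mult.commute)
    then show ?thesis by (auto intro!: derivative_eq_intros simp: inner_diff_left inner_add_left inner_commute[of v d])
  qed
  have sign: "(grad \<theta> x - d) \<bullet> v = sqrt (1 + (norm (grad \<theta> x))^2) * (graph_normal d \<theta> x \<bullet> v)" for d \<theta>
  proof -
    have "sqrt (1 + (norm (grad \<theta> x))^2) > 0" by (simp add: add_pos_nonneg)
    then show ?thesis by (simp add: graph_normal_def)
  qed
  have pos: "sqrt (1 + (norm (grad \<theta> x))^2) > 0" for \<theta> by (simp add: add_pos_nonneg)
  have "graph_normal e gr x \<bullet> v < 0" "graph_normal e' gr' x \<bullet> v > 0"
    using lt nn by (simp_all add: v_def inner_diff_right inner_commute)
  then have "(grad gr x - e) \<bullet> v < 0" "(grad gr' x - e') \<bullet> v > 0"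
    unfolding sign using pos by (auto simp: mult_less_0_iff zero_less_mult_iff)
  from DERIV_neg_dec_right[OF dir[OF a.graph_function_axioms] this(1)]
    DERIV_pos_inc_right[OF dir[OF b.graph_function_axioms] this(2)]
  obtain d1 d2 where d: "d1 > 0" "d2 > 0"
    "\<And>h. 0 < h \<Longrightarrow> h < d1 \<Longrightarrow> gr (x + h *\<^sub>R v) - (x + h *\<^sub>R v) \<bullet> e < gr x - x \<bullet> e"
    "\<And>h. 0 < h \<Longrightarrow> h < d2 \<Longrightarrow> gr' (x + h *\<^sub>R v) - (x + h *\<^sub>R v) \<bullet> e' > gr' x - x \<bullet> e'" by auto
  have "open ((\<lambda>h. x + h *\<^sub>R v) -` (ball c r \<inter> ball c' r'))" by (intro open_vimage continuous_intros) auto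
  moreover have "0 \<in> (\<lambda>h. x + h *\<^sub>R v) -` (ball c r \<inter> ball c' r')" using x by simp
  ultimately obtain d3 where d3': "d3 > 0" "ball 0 d3 \<subseteq> (\<lambda>h. x + h *\<^sub>R v) -` (ball c r \<inter> ball c' r')"
    unfolding open_contains_ball by blast
  have d3: "d3 > 0" "x + h *\<^sub>R v \<in> ball c r \<inter> ball c' r'" if "\<bar>h\<bar> < d3" for h using d3'(1) subsetD[OF d3'(2), of h] that by auto
  define h where "h = min d1 (min d2 d3) / 2"
  have h: "0 < h" "h < d1" "h < d2" "\<bar>h\<bar> < d3" using d d3'(1) by (auto simp: h_def)
  have "gr x = x \<bullet> e" "gr' x = x \<bullet> e'" using frontier_iff_graph[OF g] frontier_iff_graph[OF g'] x by auto
  then have "gr (x + h *\<^sub>R v) < (x + h *\<^sub>R v) \<bullet> e" "gr' (x + h *\<^sub>R v) > (x + h *\<^sub>R v) \<bullet> e'" using d(3,4)[of h] h by auto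
  moreover have "x + h *\<^sub>R v \<in> ball c r" "x + h *\<^sub>R v \<in> ball c' r'" using d3(2) h by auto
  ultimately have "x + h *\<^sub>R v \<in> D" "x + h *\<^sub>R v \<notin> D"
    using C2_graph_mem_iff[OF g, of "x + h *\<^sub>R v"] C2_graph_mem_iff[OF g', of "x + h *\<^sub>R v"] by linarith+
  then show False by blast
qed

lemma outward_normal_eq:
  assumes g: "C2_graph D c r e gr" and x: "x \<in> frontier D" "x \<in> ball c r"
  shows "outward_normal D x = graph_normal e gr x" unfolding outward_normal_def graph_normal_def[symmetric]
proof (rule the_equality)
  obtain r0 where "C2_graph D x r0 e gr" using C2_graph_recenter[OF g x(2)] .
  then show "\<exists>r e' gr'. C2_graph D x r e' gr' \<and> graph_normal e gr x = graph_normal e' gr' x"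
    by (intro exI conjI) (assumption, rule refl)
  fix \<nu> assume "\<exists>r e' gr'. C2_graph D x r e' gr' \<and> \<nu> = graph_normal e' gr' x"
  then obtain r' e' gr' where g': "C2_graph D x r' e' gr'" "\<nu> = graph_normal e' gr' x" by blast
  then have "x \<in> ball x r'" by (simp add: C2_graph_def)
  then show "\<nu> = graph_normal e gr x" using graph_normal_unique[OF g g'(1) x] g'(2) by simp
qed

lemma integral_partial_chart:
  fixes f :: "real^'n \<Rightarrow> 'b::euclidean_space"
  assumes D: "open D" and g: "C2_graph D c r e gr" and f: "Ck 1 f"
    and K: "compact K" "K \<subseteq> ball c r" "\<And>x. x \<notin> K \<Longrightarrow> f x = 0"
  shows "(\<integral>x. partial i f x \<partial>lebesgue_on D) = (\<integral>x. graph_normal e gr x $ i *\<^sub>R f x \<partial>graph_measure e gr)"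
proof -
  interpret graph_function e gr by (rule C2_graph_function[OF g])
  have [measurable]: "partial i f \<in> borel_measurable borel" using f by (auto intro!: borel_measurable_continuous_onI)
  have p0: "partial i f x = 0" if "x \<notin> K" for x
    using that K by (intro partial_eq_0[of "- K"]) (auto simp: compact_imp_closed open_Compl)
  have eq: "indicator D x *\<^sub>R partial i f x = indicator {x. gr x < x \<bullet> e} x *\<^sub>R partial i f x" for x
    using p0[of x] K(2) C2_graph_mem_iff[OF g, of x] by (cases "x \<in> K") (auto simp: indicator_def)
  then show ?thesis using halfspace_gauss_green[OF f K(1,3), where i=i]
    by (simp add: integral_lebesgue_on_open[OF D] eq del: scaleR_cancel_right)
qed

lemma integrable_graph_measure:
  fixes f :: "real^'n \<Rightarrow> 'b::{banach, second_countable_topology}"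
  assumes "graph_function e gr" "continuous_on UNIV f" "compact K" "\<And>x. x \<notin> K \<Longrightarrow> f x = 0"
  shows "integrable (graph_measure e gr) f"
proof -
  interpret graph_function e gr by fact
  obtain C where C: "\<And>x. x \<in> K \<Longrightarrow> norm (f x) \<le> C"
    by (rule continuous_on_compact_bound[OF continuous_on_subset[OF assms(2)] assms(3)]) auto
  show ?thesis
  proof (rule integrableI_bounded_set[of K _ _ C])
    show "K \<in> sets (graph_measure e gr)" using assms by (simp add: borel_compact)
    show "f \<in> borel_measurable (graph_measure e gr)"
      using assms(2) by (simp add: borel_measurable_continuous_onI cong: measurable_cong_sets)
    show "emeasure (graph_measure e gr) K < \<infinity>"
      using assms by (intro emeasure_graph_measure_bounded compact_imp_bounded) (auto simp: borel_compact)
    show "AE x in graph_measure e gr. x \<in> K \<longrightarrow> norm (f x) \<le> C" using C by simp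
  qed (use assms in auto)
qed

text \<open>Both integrals equal the integral over \<open>D\<close> of the divergence of
  \<open>h\<close> times the normal field of the first chart: each chart supplies a flux formula,
  and on the frontier the two normals agree and have length one. No change of variables between the
  graphs is involved.\<close>

lemma graph_measure_integral_unique:
  fixes h :: "real^'n \<Rightarrow> real"
  assumes D: "open D" and g: "C2_graph D c r e gr" and g': "C2_graph D c' r' e' gr'"
    and h: "Ck 1 h" and K: "compact K" "K \<subseteq> ball c r \<inter> ball c' r'" "\<And>x. x \<notin> K \<Longrightarrow> h x = 0"
  shows "(\<integral>x. h x \<partial>graph_measure e gr) = (\<integral>x. h x \<partial>graph_measure e' gr')"
proof -
  interpret a: graph_function e gr by (rule C2_graph_function[OF g])
  interpret b: graph_function e' gr' by (rule C2_graph_function[OF g'])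
  let ?N = "graph_normal e gr" and ?N' = "graph_normal e' gr'"
  have nn: "(\<Sum>i\<in>UNIV. ?N x $ i * ?N x $ i) = 1" for x using a.norm_graph_normal[of x] by (simp add: norm_eq_1 inner_vec_def)
  have C1: "Ck 1 (\<lambda>x. h x * ?N x $ i)" for i by (intro Ck_mult h a.C1_graph_normal)
  have 1: "(\<integral>x. partial i (\<lambda>x. h x * ?N x $ i) x \<partial>lebesgue_on D) = (\<integral>x. ?N x $ i * (h x * ?N x $ i) \<partial>graph_measure e gr)" for i
    using integral_partial_chart[OF D g C1 K(1), of i] K by simp
  have 2: "(\<integral>x. partial i (\<lambda>x. h x * ?N x $ i) x \<partial>lebesgue_on D) = (\<integral>x. ?N' x $ i * (h x * ?N x $ i) \<partial>graph_measure e' gr')" for i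
    using integral_partial_chart[OF D g' C1 K(1), of i] K by simp
  have "(\<integral>x. h x \<partial>graph_measure e gr) = (\<integral>x. (\<Sum>i\<in>UNIV. ?N x $ i * (h x * ?N x $ i)) \<partial>graph_measure e gr)"
  proof (intro Bochner_Integration.integral_cong refl)
    fix x
    have "(\<Sum>i\<in>UNIV. ?N x $ i * (h x * ?N x $ i)) = h x * (\<Sum>i\<in>UNIV. ?N x $ i * ?N x $ i)" by (simp add: sum_distrib_left mult_ac)
    then show "h x = (\<Sum>i\<in>UNIV. ?N x $ i * (h x * ?N x $ i))" by (simp add: nn)
  qed
  also have "\<dots> = (\<Sum>i\<in>UNIV. (\<integral>x. ?N x $ i * (h x * ?N x $ i) \<partial>graph_measure e gr))"
    by (intro Bochner_Integration.integral_sum integrable_graph_measure[OF a.graph_function_axioms _ K(1)])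
       (auto intro!: continuous_intros Ck_continuous[OF h] Ck_continuous[OF a.C1_graph_normal] simp: K(3))
  also have "\<dots> = (\<Sum>i\<in>UNIV. (\<integral>x. ?N' x $ i * (h x * ?N x $ i) \<partial>graph_measure e' gr'))" using 1 2 by simp
  also have "\<dots> = (\<integral>x. (\<Sum>i\<in>UNIV. ?N' x $ i * (h x * ?N x $ i)) \<partial>graph_measure e' gr')"
    by (intro Bochner_Integration.integral_sum[symmetric] integrable_graph_measure[OF b.graph_function_axioms _ K(1)])
       (auto intro!: continuous_intros Ck_continuous[OF h] Ck_continuous[OF a.C1_graph_normal]
          Ck_continuous[OF b.C1_graph_normal] simp: K(3))
  also have "\<dots> = (\<integral>x. h x \<partial>graph_measure e' gr')"
  proof (rule integral_cong_AE)
    have [measurable]: "h \<in> borel_measurable borel" by (intro borel_measurable_continuous_onI Ck_continuous[OF h])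
    show "h \<in> borel_measurable (graph_measure e' gr')"
      "(\<lambda>x. \<Sum>i\<in>UNIV. ?N' x $ i * (h x * ?N x $ i)) \<in> borel_measurable (graph_measure e' gr')" by measurable
    \<comment> \<open>This measure is concentrated on its graph, whose points in \<open>K\<close>
      lie on the frontier, where the normals of both charts coincide.\<close>
    show "AE x in graph_measure e' gr'. (\<Sum>i\<in>UNIV. ?N' x $ i * (h x * ?N x $ i)) = h x" using b.AE_graph_measure
    proof eventually_elim
      case (elim x)
      show ?case
      proof (cases "x \<in> K")
        case True
        then have x: "x \<in> ball c r" "x \<in> ball c' r'" using K by auto
        have "x \<in> frontier D" using frontier_iff_graph[OF g' x(2)] elim by simp
        then have "?N' x = ?N x" using graph_normal_unique[OF g g' _ x] by simp
        moreover have "(\<Sum>i\<in>UNIV. ?N x $ i * (h x * ?N x $ i)) = h x * (\<Sum>i\<in>UNIV. ?N x $ i * ?N x $ i)"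
          by (simp add: sum_distrib_left mult_ac)
        ultimately show ?thesis by (simp add: nn)
      qed (simp add: K(3))
    qed
  qed
  finally show ?thesis .
qed

text \<open>With offset \<open>a = 0\<close> these functions cut out boxes. With
  \<open>a = 1\<close> they vanish already a little inside the boundary, which gives compact support
  in an open ball.\<close>

lemma smooth_step_indicator_tendsto:
  "(\<lambda>k. smooth_step (real (Suc k) * t - a)) \<longlonglongrightarrow> indicator {0<..} t" if "a \<ge> 0"
proof (cases "t > 0")
  case True
  obtain N where N: "real N * t > 1 + a" using reals_Archimedean3[OF True] by blast
  have "eventually (\<lambda>k. smooth_step (real (Suc k) * t - a) = 1) sequentially"
  proof (rule eventually_sequentiallyI[of N])
    fix k assume "k \<ge> N"
    then have "real N * t \<le> real (Suc k) * t" using True by (intro mult_right_mono) auto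
    then show "smooth_step (real (Suc k) * t - a) = 1" using N by (intro smooth_step_1) linarith
  qed
  then show ?thesis using True by (auto intro: tendsto_eventually)
next
  case False
  then have "smooth_step (real (Suc k) * t - a) = 0" for k
    using that mult_nonneg_nonpos[of "real (Suc k)" t] by (intro smooth_step_0) auto
  then show ?thesis using False by simp
qed

text \<open>Indicators of boxes intersected with the common part \<open>U\<close> of the balls are
  pointwise limits of the compactly supported C1 functions \<open>h u v k\<close>, for which the two
  integrals agree. Boxes form a generator stable under intersection.\<close>

lemma graph_measure_unique:
  fixes D :: "(real^'n) set"
  assumes D: "open D" and g: "C2_graph D c r e gr" and g': "C2_graph D c' r' e' gr'"
    and A: "A \<in> sets borel" "A \<subseteq> ball c r \<inter> ball c' r'"
  shows "emeasure (graph_measure e gr) A = emeasure (graph_measure e' gr') A"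
proof -
  interpret a: graph_function e gr by (rule C2_graph_function[OF g])
  interpret b: graph_function e' gr' by (rule C2_graph_function[OF g'])
  define U where "U = ball c r \<inter> ball c' r'"
  have U [measurable]: "U \<in> sets borel" "bounded U" by (auto simp: U_def bounded_Int)
  define h where "h u v k x = (\<Prod>i\<in>UNIV. smooth_step (real (Suc k) * (x $ i - u $ i) - 0) *
      smooth_step (real (Suc k) * (v $ i - x $ i) - 0)) * (smooth_step (real (Suc k) * (r^2 - (norm (x - c))^2) - 1)
      * smooth_step (real (Suc k) * (r'\<^sup>2 - (norm (x - c'))^2) - 1))" for u v :: "real^'n" and k x
  have C1: "Ck 1 (h u v k)" for u v k
    unfolding h_def by (intro Ck_mult Ck_prod Ck_smooth_step Ck_diff Ck_const Ck_component Ck_norm_squared_diff)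
  have bnd: "0 \<le> h u v k x" "h u v k x \<le> 1" for u v k x
    unfolding h_def by (auto intro!: mult_nonneg_nonneg prod_nonneg mult_le_one prod_le_1 simp: smooth_step_bounds)
  have rpos: "r > 0" "r' > 0" using g g' by (auto simp: C2_graph_def)
  have ball: "x \<in> ball d s \<longleftrightarrow> s^2 - (norm (x - d))^2 > 0" if "s > 0" for x d :: "real^'n" and s
    using that abs_le_square_iff[of s "norm (x - d)"] by (auto simp: dist_norm norm_minus_commute not_le[symmetric])
  have lim: "(\<lambda>k. h u v k x) \<longlonglongrightarrow> indicator (box u v \<inter> U) x" for u v x
  proof -
    have "(\<lambda>k. h u v k x) \<longlonglongrightarrow> (\<Prod>i\<in>UNIV. indicator {0<..} (x $ i - u $ i) * indicator {0<..} (v $ i - x $ i))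
       * (indicator {0<..} (r^2 - (norm (x - c))^2) * indicator {0<..} (r'\<^sup>2 - (norm (x - c'))^2))"
      unfolding h_def by (intro tendsto_mult tendsto_prod smooth_step_indicator_tendsto) auto
    also have "(\<Prod>i\<in>UNIV. indicator {0<..} (x $ i - u $ i) * indicator {0<..} (v $ i - x $ i))
       = (indicator (box u v) x :: real)" by (auto simp: indicator_def mem_box_cart prod.neutral intro!: prod_zero)
    also have "indicator {0<..} (r^2 - (norm (x - c))^2) * indicator {0<..} (r'\<^sup>2 - (norm (x - c'))^2)
       = (indicator U x :: real)" using ball[OF rpos(1), of x c] ball[OF rpos(2), of x c'] by (auto simp: indicator_def U_def)
    also have "indicator (box u v) x * (indicator U x :: real) = indicator (box u v \<inter> U) x" by (simp add: indicator_inter_arith)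
    finally show ?thesis .
  qed
  have h0: "h u v k x = 0" if "x \<notin> U" for u v k x
  proof -
    have "\<not> (r^2 - (norm (x - c))^2 > 0 \<and> r'\<^sup>2 - (norm (x - c'))^2 > 0)"
      using that ball[OF rpos(1), of x c] ball[OF rpos(2), of x c'] by (auto simp: U_def)
    then have "real (Suc k) * (r^2 - (norm (x - c))^2) - 1 \<le> 0 \<or> real (Suc k) * (r'\<^sup>2 - (norm (x - c'))^2) - 1 \<le> 0"
      using mult_nonneg_nonpos[of "real (Suc k)"] by (smt (verit) of_nat_0_le_iff)
    then show ?thesis by (auto simp: h_def smooth_step_0)
  qed
  \<comment> \<open>The offset 1 in the two radial factors makes \<open>h u v k\<close> vanish off
    this compact subset of \<open>U\<close>.\<close>
  define K where "K k = {x. real (Suc k) * (r^2 - (norm (x - c))^2) - 1 \<ge> 0 \<and> real (Suc k) * (r'\<^sup>2 - (norm (x - c'))^2) - 1 \<ge> 0}" for k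
  have K_U: "K k \<subseteq> U" for k
  proof
    fix x assume "x \<in> K k"
    then have "real (Suc k) * (r^2 - (norm (x - c))^2) > 0" "real (Suc k) * (r'\<^sup>2 - (norm (x - c'))^2) > 0" by (auto simp: K_def)
    then have "r\<^sup>2 - (norm (x - c))^2 > 0 \<and> r'\<^sup>2 - (norm (x - c'))^2 > 0" by (simp add: zero_less_mult_iff)
    then show "x \<in> U" using ball[OF rpos(1), of x c] ball[OF rpos(2), of x c'] by (auto simp: U_def)
  qed
  have K: "compact (K k)" for k
  proof -
    have "closed (K k)" unfolding K_def by (intro closed_Collect_conj closed_Collect_le continuous_intros)
    moreover have "bounded (K k)" using K_U U(2) bounded_subset by blast
    ultimately show ?thesis by (simp add: compact_eq_bounded_closed)
  qed
  have hK: "h u v k x = 0" if "x \<notin> K k" for u v k x using that by (auto simp: h_def K_def smooth_step_0)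
  have conv: "(\<lambda>k. \<integral>x. h u v k x \<partial>graph_measure d \<theta>) \<longlonglongrightarrow> (\<integral>x. indicator (box u v \<inter> U) x \<partial>graph_measure d \<theta>)"
    if "graph_function d \<theta>" for u v d \<theta>
  proof -
    interpret graph_function d \<theta> by fact
    have [measurable]: "h u v k \<in> borel_measurable borel" for k by (intro borel_measurable_continuous_onI Ck_continuous[OF C1])
    show ?thesis
    proof (rule integral_dominated_convergence[where w="indicator U"])
      show "integrable (graph_measure d \<theta>) (indicator U :: _ \<Rightarrow> real)"
        using emeasure_graph_measure_bounded[OF U(2,1)] by (intro integrable_real_indicator) auto
      show "AE x in graph_measure d \<theta>. norm (h u v k x) \<le> indicator U x" for k using bnd h0 by (auto simp: indicator_def)
    qed (use lim in auto)
  qed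
  have fin: "emeasure (graph_measure d \<theta>) (B \<inter> U) < \<infinity>" if "graph_function d \<theta>" "B \<in> sets borel" for B d \<theta>
  proof -
    interpret graph_function d \<theta> by fact
    show ?thesis using that(2) U by (intro emeasure_graph_measure_bounded) (auto intro: bounded_subset)
  qed
  have eq_box: "emeasure (graph_measure e gr) (box u v \<inter> U) = emeasure (graph_measure e' gr') (box u v \<inter> U)" for u v
  proof -
    have "(\<integral>x. h u v k x \<partial>graph_measure e gr) = (\<integral>x. h u v k x \<partial>graph_measure e' gr')" for k
      by (rule graph_measure_integral_unique[OF D g g' C1 K]) (use K_U[of k] hK in \<open>auto simp: U_def\<close>)
    then have "(\<integral>x. indicator (box u v \<inter> U) x \<partial>graph_measure e gr) = (\<integral>x. indicator (box u v \<inter> U) x \<partial>graph_measure e' gr' :: real)"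
      using LIMSEQ_unique[OF conv[OF a.graph_function_axioms, of u v]] conv[OF b.graph_function_axioms, of u v] by simp
    then have "measure (graph_measure e gr) (box u v \<inter> U) = measure (graph_measure e' gr') (box u v \<inter> U)" by simp
    then show ?thesis using fin[OF a.graph_function_axioms, of "box u v"] fin[OF b.graph_function_axioms, of "box u v"]
      by (simp add: emeasure_eq_ennreal_measure less_top)
  qed
  let ?M = "\<lambda>d \<theta>. density (graph_measure d \<theta>) (indicator U)"
  have em: "emeasure (?M d \<theta>) B = emeasure (graph_measure d \<theta>) (B \<inter> U)" if "graph_function d \<theta>" "B \<in> sets borel" for B d \<theta>
  proof -
    interpret graph_function d \<theta> by fact
    show ?thesis using that(2) by (subst emeasure_density) (auto simp: indicator_inter_arith[symmetric] Int_commute)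
  qed
  have "?M e gr = ?M e' gr'"
  proof (rule measure_eqI_generator_eq)
    let ?E = "range (\<lambda>(a, b). box a b :: (real^'n) set)"
    show "Int_stable ?E" by (auto simp: Int_stable_def box_Int_box)
    show "?E \<subseteq> Pow UNIV" "sets (?M e gr) = sigma_sets UNIV ?E" "sets (?M e' gr') = sigma_sets UNIV ?E"
      by (simp_all add: borel_eq_box)
    let ?A = "\<lambda>n::nat. box (- (real n *\<^sub>R One)) (real n *\<^sub>R One) :: (real^'n) set"
    show "range ?A \<subseteq> ?E" "(\<Union>i. ?A i) = UNIV" unfolding UN_box_eq_UNIV by auto
    show "emeasure (?M e gr) (?A i) \<noteq> \<infinity>" for i
      using fin[OF a.graph_function_axioms] by (simp add: em[OF a.graph_function_axioms] less_top)
    show "emeasure (?M e gr) X = emeasure (?M e' gr') X" if "X \<in> ?E" for X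
      using that eq_box by (auto simp: em[OF a.graph_function_axioms] em[OF b.graph_function_axioms])
  qed
  then have "emeasure (?M e gr) A = emeasure (?M e' gr') A" by simp
  moreover have "A \<inter> U = A" using A by (auto simp: U_def)
  ultimately show ?thesis using A by (simp add: em[OF a.graph_function_axioms] em[OF b.graph_function_axioms])
qed


section \<open>The surface measure of a C2 domain and the global Gauss-Green formula\<close>

locale C2_domain =
  fixes D :: "(real^'n) set"
  assumes bounded_D: "bounded D" and open_D: "open D" and C2_bd: "C2_boundary D"
begin

lemma compact_closure_D: "compact (closure D)" using bounded_D by (simp add: compact_closure)

lemma bounded_frontier: "bounded (frontier D)"
  by (rule bounded_subset[OF compact_imp_bounded[OF compact_closure_D]]) (auto simp: frontier_def)

text \<open>An interior point also has a chart, the graph being far below the ball. This treats the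
  interior and the boundary alike.\<close>

lemma chart_exists:
  assumes c: "c \<in> closure D"
  shows "\<exists>r e gr. C2_graph D c r e gr"
proof (cases "c \<in> D")
  case True
  obtain r where r: "r > 0" "ball c r \<subseteq> D" using open_D True unfolding open_contains_ball by blast
  obtain k :: 'n where True by blast
  define e :: "real^'n" where "e = axis k 1"
  have e: "norm e = 1" by (simp add: e_def norm_eq_1 inner_axis_axis)
  have "- (norm c + r) < x \<bullet> e" if "x \<in> ball c r" for x
  proof -
    have "\<bar>x \<bullet> e\<bar> \<le> norm x" using Cauchy_Schwarz_ineq2[of x e] e by simp
    also have "norm x < norm c + r" using that norm_triangle_sub[of x c] by (simp add: dist_norm norm_minus_commute)
    finally show ?thesis by linarith
  qed
  then have "C2_graph D c r e (\<lambda>x. - (norm c + r))" using r e by (auto simp: C2_graph_def intro: Ck_const)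
  then show ?thesis by blast
next
  case False
  then have "c \<in> frontier D" using c open_D by (simp add: frontier_def interior_open)
  then show ?thesis using C2_bd by (simp add: C2_boundary_def)
qed

text \<open>The balls of half the radius already cover, which leaves room for cutoffs supported in
  three quarters of the radius.\<close>

lemma finite_atlas:
  obtains L :: nat and c r e gr where "\<And>l. l < L \<Longrightarrow> C2_graph D (c l) (r l) (e l) (gr l)"
    "closure D \<subseteq> (\<Union>l<L. ball (c l) (r l / 2))"
proof -
  obtain R E G where ch: "\<And>c. c \<in> closure D \<Longrightarrow> C2_graph D c (R c) (E c) (G c)" using chart_exists by metis
  have "c \<in> ball c (R c / 2)" if "c \<in> closure D" for c using ch[OF that] by (simp add: C2_graph_def)
  then have cov: "closure D \<subseteq> (\<Union>c\<in>closure D. ball c (R c / 2))" by blast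
  obtain C where C: "C \<subseteq> closure D" "finite C" "closure D \<subseteq> (\<Union>c\<in>C. ball c (R c / 2))"
    by (rule compactE_image[OF compact_closure_D _ cov]) auto
  obtain cs where cs: "set cs = C" using finite_list[OF C(2)] by blast
  have "closure D \<subseteq> (\<Union>l<length cs. ball (cs ! l) (R (cs ! l) / 2))"
  proof
    fix x assume "x \<in> closure D"
    then obtain c where c: "c \<in> set cs" "x \<in> ball c (R c / 2)" using C(3) cs by blast
    then obtain l where "l < length cs" "cs ! l = c" by (auto simp: in_set_conv_nth)
    then show "x \<in> (\<Union>l<length cs. ball (cs ! l) (R (cs ! l) / 2))" using c(2) by (intro UN_I[of l]) auto
  qed
  moreover have "C2_graph D (cs ! l) (R (cs ! l)) (E (cs ! l)) (G (cs ! l))" if "l < length cs" for l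
    using ch[of "cs ! l"] C(1) cs nth_mem[OF that] by auto
  ultimately show ?thesis using that[of "length cs" "\<lambda>l. cs ! l" "\<lambda>l. R (cs ! l)" "\<lambda>l. E (cs ! l)" "\<lambda>l. G (cs ! l)"] by simp
qed

definition is_surface_measure :: "(real^'n) measure \<Rightarrow> bool" where
  "is_surface_measure M \<longleftrightarrow> sets M = sets (restrict_space borel (frontier D)) \<and>
        (\<forall>c r e gr. C2_graph D c r e gr \<longrightarrow>
           (\<forall>A\<in>sets borel. A \<subseteq> frontier D \<inter> ball c r \<longrightarrow> emeasure M A = graph_area e gr A))"

lemma sets_frontier: "A \<in> sets (restrict_space borel (frontier D)) \<longleftrightarrow> A \<subseteq> frontier D \<and> A \<in> sets borel"
  by (auto simp: sets_restrict_space_iff borel_closed)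

text \<open>Disjoint Borel pieces, each inside a single chart, allow a measure on the frontier to be
  written as a finite sum of graph measures.\<close>

lemma frontier_pieces:
  obtains L :: nat and c r e gr P where "\<And>l. l < L \<Longrightarrow> C2_graph D (c l) (r l) (e l) (gr l)"
    "\<And>l. P l \<in> sets borel" "disjoint_family P" "(\<Union>l<L. P l) = frontier D"
    "\<And>l. l < L \<Longrightarrow> P l \<subseteq> frontier D \<inter> ball (c l) (r l)"
proof -
  obtain L c r e gr where ch: "\<And>l. l < (L::nat) \<Longrightarrow> C2_graph D (c l) (r l) (e l) (gr l)"
    and cov: "closure D \<subseteq> (\<Union>l<L. ball (c l) (r l / 2))" by (rule finite_atlas) blast
  define B where "B l = frontier D \<inter> ball (c l) (r l)" for l
  have "(\<Union>l<L. disjointed B l) = (\<Union>l<L. B l)" using finite_UN_disjointed_eq[of B L] by (simp add: lessThan_atLeast0)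
  also have "\<dots> = frontier D"
  proof
    show "frontier D \<subseteq> (\<Union>l<L. B l)"
    proof
      fix x assume x: "x \<in> frontier D"
      then obtain l where l: "l < L" "x \<in> ball (c l) (r l / 2)" using cov by (auto simp: frontier_def)
      then have "x \<in> ball (c l) (r l)" using ch[OF l(1)] by (auto simp: C2_graph_def)
      then show "x \<in> (\<Union>l<L. B l)" using l(1) x by (auto simp: B_def)
    qed
  qed (auto simp: B_def)
  finally have un: "(\<Union>l<L. disjointed B l) = frontier D" .
  have sub: "disjointed B l \<subseteq> frontier D \<inter> ball (c l) (r l)" for l using disjointed_subset[of B l] by (simp add: B_def)
  have "disjointed B l \<in> sets borel" for l unfolding disjointed_def by (auto simp: B_def intro!: borel_closed)
  then show ?thesis using that[of L c r e gr "disjointed B"] ch un sub disjoint_family_disjointed by metis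
qed

text \<open>The graph measures of the charts are glued along disjoint pieces of the frontier.
  Comparison with an arbitrary chart is then a sum over the pieces, on each of which the two graph
  measures agree.\<close>

lemma ex_surface_measure: "\<exists>M. is_surface_measure M \<and> finite_measure M"
proof -
  obtain L c r e gr P where ch: "\<And>l. l < (L::nat) \<Longrightarrow> C2_graph D (c l) (r l) (e l) (gr l)"
    and P: "\<And>l. P l \<in> sets borel" "disjoint_family P" "(\<Union>l<L. P l) = frontier D"
    "\<And>l. l < L \<Longrightarrow> P l \<subseteq> frontier D \<inter> ball (c l) (r l)" by (rule frontier_pieces) (rule that)
  define \<mu> where "\<mu> A = (\<Sum>l<L. emeasure (graph_measure (e l) (gr l)) (A \<inter> P l))" for A
  define R where "R = restrict_space borel (frontier D)"
  define M where "M = measure_of (space R) (sets R) \<mu>"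
  have gf: "graph_function (e l) (gr l)" if "l < L" for l by (rule C2_graph_function[OF ch[OF that]])
  have sets_M: "sets M = sets R" by (simp add: M_def sets.sets_measure_of_eq)
  have ca: "countably_additive (sets M) \<mu>"
  proof (rule countably_additiveI)
    fix A :: "nat \<Rightarrow> (real^'n) set"
    assume A: "range A \<subseteq> sets M" "disjoint_family A"
    have Ab: "A i \<in> sets borel" for i using A(1) sets_frontier by (auto simp: sets_M R_def)
    have "(\<Sum>i. \<mu> (A i)) = (\<Sum>l<L. \<Sum>i. emeasure (graph_measure (e l) (gr l)) (A i \<inter> P l))"
      unfolding \<mu>_def by (rule suminf_sum) (rule summableI)
    also have "\<dots> = (\<Sum>l<L. emeasure (graph_measure (e l) (gr l)) (\<Union>i. A i \<inter> P l))"
    proof (intro sum.cong refl)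
      fix l assume "l \<in> {..<L}"
      then interpret graph_function "e l" "gr l" using gf by simp
      show "(\<Sum>i. emeasure (graph_measure (e l) (gr l)) (A i \<inter> P l))
        = emeasure (graph_measure (e l) (gr l)) (\<Union>i. A i \<inter> P l)"
        using A(2) Ab P(1) by (intro suminf_emeasure) (auto simp: disjoint_family_on_def)
    qed
    also have "\<dots> = \<mu> (\<Union>i. A i)" by (simp add: \<mu>_def)
    finally show "(\<Sum>i. \<mu> (A i)) = \<mu> (\<Union>i. A i)" .
  qed
  have em: "emeasure M A = \<mu> A" if "A \<in> sets M" for A
    by (rule emeasure_measure_of[OF M_def sets.space_closed _ ca that]) (simp add: positive_def \<mu>_def)
  have "emeasure M A = graph_area d \<theta> A"
    if g: "C2_graph D b s d \<theta>" and A: "A \<in> sets borel" "A \<subseteq> frontier D \<inter> ball b s" for b s d \<theta> A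
  proof -
    interpret graph_function d \<theta> by (rule C2_graph_function[OF g])
    have "A \<in> sets M" using A by (simp add: sets_M R_def sets_frontier)
    then have "emeasure M A = \<mu> A" by (rule em)
    also have "\<dots> = (\<Sum>l<L. emeasure (graph_measure d \<theta>) (A \<inter> P l))" unfolding \<mu>_def
    proof (intro sum.cong refl graph_measure_unique[OF open_D ch g])
      fix l assume "l \<in> {..<L}"
      then show l: "l < L" and "A \<inter> P l \<in> sets borel" using A P by auto
      show "A \<inter> P l \<subseteq> ball (c l) (r l) \<inter> ball b s" using A(2) P(4)[OF l] by blast
    qed
    also have "\<dots> = emeasure (graph_measure d \<theta>) (\<Union>l<L. A \<inter> P l)"
      using A(1) P(1,2) by (intro sum_emeasure) (auto simp: disjoint_family_on_def)
    also have "(\<Union>l<L. A \<inter> P l) = A" using A(2) P(3) by blast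
    finally show ?thesis using A(1) by (simp add: emeasure_graph_measure)
  qed
  then have 1: "is_surface_measure M" by (auto simp: is_surface_measure_def sets_M R_def)
  have spM: "space M = frontier D" using sets_eq_imp_space_eq[OF sets_M] by (simp add: R_def)
  have "emeasure M (space M) = \<mu> (frontier D)" using em[OF sets.top] by (simp add: spM)
  also have "\<dots> < \<infinity>" unfolding \<mu>_def infinity_ennreal_def
  proof (subst ennreal_sum_less_top, simp, intro ballI)
    fix l assume "l \<in> {..<L}"
    then interpret graph_function "e l" "gr l" using gf by simp
    show "emeasure (graph_measure (e l) (gr l)) (frontier D \<inter> P l) < top"
      using emeasure_graph_measure_bounded[of "frontier D \<inter> P l"] bounded_frontier P(1)
      by (auto simp: borel_closed intro: bounded_subset)
  qed
  finally have "finite_measure M" by (intro finite_measureI) auto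
  with 1 show ?thesis by blast
qed

text \<open>Every measurable set splits along the pieces, and on each piece the measure is
  prescribed by a chart.\<close>

lemma surface_measure_unique:
  assumes "is_surface_measure M" "is_surface_measure M'"
  shows "M = M'"
proof -
  obtain L c r e gr P where ch: "\<And>l. l < (L::nat) \<Longrightarrow> C2_graph D (c l) (r l) (e l) (gr l)"
    and P: "\<And>l. P l \<in> sets borel" "disjoint_family P" "(\<Union>l<L. P l) = frontier D"
    "\<And>l. l < L \<Longrightarrow> P l \<subseteq> frontier D \<inter> ball (c l) (r l)" by (rule frontier_pieces) (rule that)
  have em: "emeasure N A = (\<Sum>l<L. graph_area (e l) (gr l) (A \<inter> P l))"
    if N: "is_surface_measure N" and A: "A \<in> sets N" for N A
  proof -
    have Ab: "A \<subseteq> frontier D" "A \<in> sets borel" using A N by (auto simp: is_surface_measure_def sets_frontier)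
    then have "A = (\<Union>l<L. A \<inter> P l)" using P(3) by blast
    then have "emeasure N A = emeasure N (\<Union>l<L. A \<inter> P l)" by simp
    also have "\<dots> = (\<Sum>l<L. emeasure N (A \<inter> P l))"
    proof (rule sum_emeasure[symmetric])
      show "(\<lambda>l. A \<inter> P l) ` {..<L} \<subseteq> sets N" using Ab P(1) N by (auto simp: is_surface_measure_def sets_frontier)
      show "disjoint_family_on (\<lambda>l. A \<inter> P l) {..<L}" using P(2) by (auto simp: disjoint_family_on_def)
    qed simp
    also have "\<dots> = (\<Sum>l<L. graph_area (e l) (gr l) (A \<inter> P l))"
    proof (intro sum.cong refl)
      fix l assume l: "l \<in> {..<L}"
      have "A \<inter> P l \<in> sets borel" using Ab P(1) by auto
      moreover have "A \<inter> P l \<subseteq> frontier D \<inter> ball (c l) (r l)" using P(4)[of l] l by auto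
      ultimately show "emeasure N (A \<inter> P l) = graph_area (e l) (gr l) (A \<inter> P l)"
        using N ch[of l] l unfolding is_surface_measure_def by blast
    qed
    finally show ?thesis .
  qed
  have "sets M = sets M'" using assms by (simp add: is_surface_measure_def)
  then show ?thesis using em assms by (intro measure_eqI) auto
qed

definition base_surface :: "(real^'n) measure" where
  "base_surface = (THE M. is_surface_measure M)"

lemma surface_measure_eq: "surface_measure D = completion base_surface"
  by (simp add: surface_measure_def base_surface_def is_surface_measure_def)

lemma base_surface: "is_surface_measure base_surface" "finite_measure base_surface"
proof -
  obtain M where M: "is_surface_measure M" "finite_measure M" using ex_surface_measure by blast
  then have "base_surface = M" unfolding base_surface_def by (intro the_equality) (auto intro: surface_measure_unique)
  then show "is_surface_measure base_surface" "finite_measure base_surface" using M by auto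
qed

lemma sets_base_surface: "sets base_surface = sets (restrict_space borel (frontier D))"
  using base_surface(1) by (simp add: is_surface_measure_def)

lemma space_base_surface: "space base_surface = frontier D" using sets_eq_imp_space_eq[OF sets_base_surface] by simp

lemma space_surface_measure: "space (surface_measure D) = frontier D" by (simp add: surface_measure_eq space_base_surface)

lemma finite_surface_measure: "finite_measure (surface_measure D)"
proof (rule finite_measureI)
  interpret finite_measure base_surface by (rule base_surface(2))
  show "emeasure (surface_measure D) (space (surface_measure D)) \<noteq> \<infinity>" by (simp add: surface_measure_eq)
qed

lemma measurable_base_surface: "f \<in> borel_measurable borel \<Longrightarrow> f \<in> borel_measurable base_surface"
  unfolding measurable_cong_sets[OF sets_base_surface refl] by (rule measurable_restrict_space1)

lemma measurable_surface_measure: "f \<in> borel_measurable borel \<Longrightarrow> f \<in> borel_measurable (surface_measure D)"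
  unfolding surface_measure_eq by (rule measurable_completion) (rule measurable_base_surface)

text \<open>The two measures agree on Borel subsets of the frontier inside the ball. The graph
  measure is concentrated on the graph, which inside the ball is the frontier, and \<open>g\<close>
  vanishes elsewhere.\<close>

lemma integral_surface_chart:
  fixes g :: "real^'n \<Rightarrow> 'b::{banach, second_countable_topology}"
  assumes ch: "C2_graph D c r e gr" and g: "continuous_on UNIV g"
    and g0: "\<And>x. x \<notin> ball c r \<Longrightarrow> g x = 0"
  shows "(\<integral>x. g x \<partial>surface_measure D) = (\<integral>x. g x \<partial>graph_measure e gr)"
proof -
  interpret graph_function e gr by (rule C2_graph_function[OF ch])
  define \<Omega> where "\<Omega> = frontier D \<inter> ball c r"
  have [measurable]: "g \<in> borel_measurable borel" using g by (rule borel_measurable_continuous_onI)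
  have \<Omega> [measurable]: "\<Omega> \<in> sets borel" by (auto simp: \<Omega>_def intro!: borel_closed)
  have sub: "\<Omega> \<subseteq> frontier D" by (simp add: \<Omega>_def)
  have \<Omega>': "\<Omega> \<in> sets base_surface" using \<Omega> by (auto simp: sets_base_surface sets_frontier \<Omega>_def)
  have eq: "restrict_space base_surface \<Omega> = restrict_space (graph_measure e gr) \<Omega>"
  proof (rule measure_eqI)
    have s1: "sets (restrict_space base_surface \<Omega>) = {A \<in> sets borel. A \<subseteq> \<Omega>}"
       using sets_restrict_space_iff[of \<Omega> base_surface] \<Omega>' sets.Int_space_eq2[OF \<Omega>'] sets_base_surface sets_frontier sub by auto
    have s2: "sets (restrict_space (graph_measure e gr) \<Omega>) = {A \<in> sets borel. A \<subseteq> \<Omega>}"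
      using \<Omega> by (auto simp: sets_restrict_space_iff)
    show "sets (restrict_space base_surface \<Omega>) = sets (restrict_space (graph_measure e gr) \<Omega>)" unfolding s1 s2 ..
    fix A assume "A \<in> sets (restrict_space base_surface \<Omega>)"
    then have A: "A \<subseteq> \<Omega>" "A \<in> sets borel" unfolding s1 by auto
    have "emeasure base_surface A = graph_area e gr A" using base_surface(1) ch A unfolding is_surface_measure_def \<Omega>_def by blast
    then show "emeasure (restrict_space base_surface \<Omega>) A = emeasure (restrict_space (graph_measure e gr) \<Omega>) A"
      using A \<Omega>' \<Omega> by (simp add: emeasure_restrict_space emeasure_graph_measure)
  qed
  have "(\<integral>x. g x \<partial>surface_measure D) = (\<integral>x. g x \<partial>base_surface)"
    unfolding surface_measure_eq by (intro integral_completion measurable_base_surface) simp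
  also have "\<dots> = (\<integral>x. indicator \<Omega> x *\<^sub>R g x \<partial>base_surface)" by (intro Bochner_Integration.integral_cong refl)
       (auto simp: space_base_surface \<Omega>_def indicator_def g0)
  also have "\<dots> = (\<integral>x. g x \<partial>restrict_space base_surface \<Omega>)"
    using \<Omega>' by (intro integral_restrict_space[symmetric]) (auto simp: sets.Int_space_eq2)
  also have "\<dots> = (\<integral>x. indicator \<Omega> x *\<^sub>R g x \<partial>graph_measure e gr)" unfolding eq by (intro integral_restrict_space) auto
  also have "\<dots> = (\<integral>x. g x \<partial>graph_measure e gr)"
  proof (rule integral_cong_AE)
    show "AE x in graph_measure e gr. indicator \<Omega> x *\<^sub>R g x = g x" using AE_graph_measure
      by eventually_elim (use frontier_iff_graph[OF ch] g0 in \<open>auto simp: \<Omega>_def indicator_def\<close>)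
  qed measurable
  finally show ?thesis .
qed

lemma integrable_surface_continuous:
  fixes g :: "real^'n \<Rightarrow> 'b::{banach, second_countable_topology}"
  assumes "continuous_on UNIV g"
  shows "integrable (surface_measure D) g"
proof -
  interpret finite_measure "surface_measure D" by (rule finite_surface_measure)
  obtain C where C: "\<And>x. x \<in> closure D \<Longrightarrow> norm (g x) \<le> C"
    by (rule continuous_on_compact_bound[OF continuous_on_subset[OF assms] compact_closure_D]) auto
  show ?thesis
    using C by (intro integrable_const_bound[where B=C] measurable_surface_measure borel_measurable_continuous_onI[OF assms])
      (auto simp: space_surface_measure frontier_def)
qed

lemma integrable_continuous_D:
  fixes g :: "real^'n \<Rightarrow> 'b::{banach, second_countable_topology}"
  assumes "continuous_on UNIV g"
  shows "integrable (lebesgue_on D) g"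
proof -
  have m: "g \<in> borel_measurable borel" using assms by (rule borel_measurable_continuous_onI)
  have "integrable lborel (\<lambda>x. indicator (closure D) x *\<^sub>R g x)"
    using assms by (intro borel_integrable_compact compact_closure_D) (auto intro: continuous_on_subset)
  then have "integrable lborel (\<lambda>x. indicator D x *\<^sub>R indicator (closure D) x *\<^sub>R g x)"
    by (rule integrable_mult_indicator[rotated]) (use open_D in auto)
  also have "(\<lambda>x. indicator D x *\<^sub>R indicator (closure D) x *\<^sub>R g x) = (\<lambda>x. indicator D x *\<^sub>R g x)"
    using closure_subset by (auto simp: indicator_def fun_eq_iff)
  finally have "integrable lebesgue (\<lambda>x. indicator D x *\<^sub>R g x)" using m open_D by (subst integrable_completion) auto
  then show ?thesis using open_D by (subst integrable_restrict_space) auto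
qed

text \<open>\<open>N\<close> averages the chart normals with a partition of unity. On the frontier
  these all equal the outward normal, hence so does the average; off the frontier it is merely some
  C1 field.\<close>

lemma gauss_green:
  obtains N :: "real^'n \<Rightarrow> real^'n" where "\<And>i. Ck 1 (\<lambda>x. N x $ i)"
    "\<And>x. x \<in> frontier D \<Longrightarrow> outward_normal D x = N x" "\<And>x. x \<in> frontier D \<Longrightarrow> norm (N x) = 1"
    "\<And>(f :: real^'n \<Rightarrow> complex) i. Ck 1 f \<Longrightarrow>
       (\<integral>x. partial i f x \<partial>lebesgue_on D) = (\<integral>x. N x $ i *\<^sub>R f x \<partial>surface_measure D)"
proof -
  obtain L c r e gr where ch: "\<And>l. l < (L::nat) \<Longrightarrow> C2_graph D (c l) (r l) (e l) (gr l)"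
    and cov: "closure D \<subseteq> (\<Union>l<L. ball (c l) (r l / 2))" by (rule finite_atlas) blast
  have rpos: "r l > 0" if "l < L" for l using ch[OF that] by (simp add: C2_graph_def)
  have "\<exists>\<psi>. (\<forall>l. smooth (\<psi> l)) \<and> (\<forall>l<L. \<forall>x. x \<notin> ball (c l) (3 / 4 * r l) \<longrightarrow> \<psi> l x = (0::real)) \<and>
      (\<forall>x\<in>(\<Union>l<L. ball (c l) (r l / 2)). (\<Sum>l<L. \<psi> l x) = 1)" by (rule smooth_partition_of_unity) (rule rpos)
  then obtain \<psi> where "(\<forall>l. smooth (\<psi> l)) \<and> (\<forall>l<L. \<forall>x. x \<notin> ball (c l) (3 / 4 * r l) \<longrightarrow> \<psi> l x = (0::real)) \<and>
      (\<forall>x\<in>(\<Union>l<L. ball (c l) (r l / 2)). (\<Sum>l<L. \<psi> l x) = 1)" ..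
  then have \<psi>: "\<And>l. smooth (\<psi> l)" "\<And>l x. l < L \<Longrightarrow> x \<notin> ball (c l) (3 / 4 * r l) \<Longrightarrow> \<psi> l x = 0"
    "\<And>x. x \<in> (\<Union>l<L. ball (c l) (r l / 2)) \<Longrightarrow> (\<Sum>l<L. \<psi> l x) = 1" by blast+
  have C1\<psi>: "Ck 1 (\<psi> l)" for l using \<psi>(1) by (rule smooth_Ck)
  have sum1: "(\<Sum>l<L. \<psi> l x) = 1" if "x \<in> closure D" for x using \<psi>(3) cov that by blast
  have supp: "cball (c l) (3 / 4 * r l) \<subseteq> ball (c l) (r l)" if "l < L" for l using rpos[OF that] by auto
  have \<psi>0: "\<psi> l x = 0" if "l < L" "x \<notin> cball (c l) (3 / 4 * r l)" for l x using \<psi>(2)[of l x] that by auto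
  define N where "N x = (\<Sum>l<L. \<psi> l x *\<^sub>R graph_normal (e l) (gr l) x)" for x
  have N: "N x = outward_normal D x" if x: "x \<in> frontier D" for x
  proof -
    have "\<psi> l x *\<^sub>R graph_normal (e l) (gr l) x = \<psi> l x *\<^sub>R outward_normal D x" if "l < L" for l
      using outward_normal_eq[OF ch[OF that] x] \<psi>0[OF that, of x] supp[OF that] by (cases "x \<in> cball (c l) (3 / 4 * r l)") auto
    then have "N x = (\<Sum>l<L. \<psi> l x) *\<^sub>R outward_normal D x" unfolding N_def scaleR_sum_left by (intro sum.cong) auto
    then show ?thesis using sum1[of x] x by (simp add: frontier_def)
  qed
  have C1N: "Ck 1 (\<lambda>x. N x $ i)" for i unfolding N_def sum_component vector_scaleR_component
    using graph_function.C1_graph_normal[OF C2_graph_function[OF ch]] by (intro Ck_sum Ck_scaleR C1\<psi>) auto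
  show ?thesis
  proof (rule that[of N])
    show "Ck 1 (\<lambda>x. N x $ i)" for i by (rule C1N)
    show "outward_normal D x = N x" if "x \<in> frontier D" for x using N[OF that] ..
    show "norm (N x) = 1" if x: "x \<in> frontier D" for x
    proof -
      obtain l where l: "l < L" "x \<in> ball (c l) (r l / 2)" using cov x by (auto simp: frontier_def)
      then have "x \<in> ball (c l) (r l)" using rpos[of l] by auto
      then show ?thesis using N[OF x] outward_normal_eq[OF ch[OF l(1)] x]
          graph_function.norm_graph_normal[OF C2_graph_function[OF ch[OF l(1)]]] by simp
    qed
    show "(\<integral>x. partial i f x \<partial>lebesgue_on D) = (\<integral>x. N x $ i *\<^sub>R f x \<partial>surface_measure D)"
      if f: "Ck 1 f" for f :: "real^'n \<Rightarrow> complex" and i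
    proof -
      have C1l: "Ck 1 (\<lambda>x. \<psi> l x *\<^sub>R f x)" for l by (intro Ck_scaleR C1\<psi> f)
      then have df: "(\<lambda>x. \<psi> l x *\<^sub>R f x) differentiable (at x)" for l x by auto
      have local: "(\<integral>x. partial i (\<lambda>x. \<psi> l x *\<^sub>R f x) x \<partial>lebesgue_on D)
          = (\<integral>x. N x $ i *\<^sub>R \<psi> l x *\<^sub>R f x \<partial>surface_measure D)" if l: "l < L" for l
      proof -
        interpret graph_function "e l" "gr l" by (rule C2_graph_function[OF ch[OF l]])
        have "(\<integral>x. partial i (\<lambda>x. \<psi> l x *\<^sub>R f x) x \<partial>lebesgue_on D)
          = (\<integral>x. graph_normal (e l) (gr l) x $ i *\<^sub>R \<psi> l x *\<^sub>R f x \<partial>graph_measure (e l) (gr l))"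
          by (rule integral_partial_chart[OF open_D ch[OF l] C1l compact_cball supp[OF l]]) (simp add: \<psi>0[OF l])
        also have "\<dots> = (\<integral>x. graph_normal (e l) (gr l) x $ i *\<^sub>R \<psi> l x *\<^sub>R f x \<partial>surface_measure D)"
        proof (rule integral_surface_chart[OF ch[OF l], symmetric])
          show "continuous_on UNIV (\<lambda>x. graph_normal (e l) (gr l) x $ i *\<^sub>R \<psi> l x *\<^sub>R f x)"
            by (intro continuous_on_scaleR Ck_continuous[OF C1_graph_normal] Ck_continuous[OF C1\<psi>] Ck_continuous[OF f])
          show "graph_normal (e l) (gr l) x $ i *\<^sub>R \<psi> l x *\<^sub>R f x = 0" if "x \<notin> ball (c l) (r l)" for x
            using \<psi>0[OF l, of x] subsetD[OF supp[OF l], of x] that by (simp del: mem_ball mem_cball) blast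
        qed
        also have "\<dots> = (\<integral>x. N x $ i *\<^sub>R \<psi> l x *\<^sub>R f x \<partial>surface_measure D)"
        proof (intro Bochner_Integration.integral_cong refl)
          fix x assume "x \<in> space (surface_measure D)"
          then have x: "x \<in> frontier D" by (simp add: space_surface_measure)
          show "graph_normal (e l) (gr l) x $ i *\<^sub>R \<psi> l x *\<^sub>R f x = N x $ i *\<^sub>R \<psi> l x *\<^sub>R f x"
            using outward_normal_eq[OF ch[OF l] x] N[OF x] \<psi>0[OF l, of x] supp[OF l]
            by (cases "x \<in> cball (c l) (3 / 4 * r l)") auto
        qed
        finally show ?thesis .
      qed
      \<comment> \<open>On the open set \<open>D\<close> the cutoffs add up to 1, so
        \<open>f\<close> and the sum of its pieces have the same derivative there.\<close>
      have "(\<integral>x. partial i f x \<partial>lebesgue_on D)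
          = (\<integral>x. (\<Sum>l<L. partial i (\<lambda>x. \<psi> l x *\<^sub>R f x) x) \<partial>lebesgue_on D)"
      proof (intro Bochner_Integration.integral_cong refl)
        fix x assume "x \<in> space (lebesgue_on D)"
        then have x: "x \<in> D" by simp
        have "((\<lambda>x. \<Sum>l<L. \<psi> l x *\<^sub>R f x) has_derivative frechet_derivative (\<lambda>x. \<Sum>l<L. \<psi> l x *\<^sub>R f x) (at x)) (at x)"
          using df by (intro frechet_derivative_works[THEN iffD1] differentiable_sum) auto
        then have "(f has_derivative frechet_derivative (\<lambda>x. \<Sum>l<L. \<psi> l x *\<^sub>R f x) (at x)) (at x)"
          by (rule has_derivative_transform_within_open[OF _ open_D x])
             (simp add: scaleR_sum_left[symmetric] sum1 closure_subset[THEN subsetD])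
        then have "partial i f x = partial i (\<lambda>x. \<Sum>l<L. \<psi> l x *\<^sub>R f x) x"
          by (simp add: partial_eqI partial_def[of i "\<lambda>x. \<Sum>l<L. \<psi> l x *\<^sub>R f x"])
        then show "partial i f x = (\<Sum>l<L. partial i (\<lambda>x. \<psi> l x *\<^sub>R f x) x)" using df by (simp add: partial_sum)
      qed
      also have "\<dots> = (\<Sum>l<L. \<integral>x. partial i (\<lambda>x. \<psi> l x *\<^sub>R f x) x \<partial>lebesgue_on D)"
        using C1l by (intro Bochner_Integration.integral_sum integrable_continuous_D) auto
      also have "\<dots> = (\<Sum>l<L. \<integral>x. N x $ i *\<^sub>R \<psi> l x *\<^sub>R f x \<partial>surface_measure D)" by (simp add: local)
      also have "\<dots> = (\<integral>x. (\<Sum>l<L. N x $ i *\<^sub>R \<psi> l x *\<^sub>R f x) \<partial>surface_measure D)"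
        by (intro Bochner_Integration.integral_sum[symmetric] integrable_surface_continuous continuous_intros
            Ck_continuous[OF C1N] Ck_continuous[OF C1\<psi>] Ck_continuous[OF f])
      also have "\<dots> = (\<integral>x. N x $ i *\<^sub>R f x \<partial>surface_measure D)"
      proof (intro Bochner_Integration.integral_cong refl)
        fix x assume "x \<in> space (surface_measure D)"
        then have "x \<in> closure D" by (simp add: space_surface_measure frontier_def)
        then show "(\<Sum>l<L. N x $ i *\<^sub>R \<psi> l x *\<^sub>R f x) = N x $ i *\<^sub>R f x"
          by (simp only: scaleR_sum_right[symmetric] scaleR_sum_left[symmetric] sum1 scaleR_one)
      qed
      finally show ?thesis .
    qed
  qed
qed

end


subsection \<open>The space L2\<close>

abbreviation "L2_dist M f g \<equiv> L2_norm M (\<lambda>x. f x - g x)"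
abbreviation "nR \<equiv> L2_norm lborel"
abbreviation "dR \<equiv> L2_dist lborel"

lemma L2_measurable: "f \<in> L2 M \<Longrightarrow> f \<in> borel_measurable M"
  and L2_integrable: "f \<in> L2 M \<Longrightarrow> integrable M (\<lambda>x. (norm (f x))^2)" by (auto simp: L2_def)

lemma L2_norm_nonneg [simp]: "0 \<le> L2_norm M f" by (simp add: L2_norm_def)

lemma L2_norm_squared: "(L2_norm M f)^2 = (\<integral>x. (norm (f x))^2 \<partial>M)" by (simp add: L2_norm_def)

lemma L2_dominated:
  assumes "f \<in> borel_measurable M" "g \<in> L2 M" "AE x in M. norm (f x) \<le> C * norm (g x)"
  shows "f \<in> L2 M"
proof -
  have "integrable M (\<lambda>x. C\<^sup>2 * (norm (g x))^2)" using L2_integrable[OF assms(2)] by simp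
  then have "integrable M (\<lambda>x. (norm (f x))^2)"
  proof (rule Bochner_Integration.integrable_bound)
    show "AE x in M. norm ((norm (f x))^2) \<le> norm (C^2 * (norm (g x))^2)" using assms(3)
    proof eventually_elim
      case (elim x)
      then have "(norm (f x))^2 \<le> (C * norm (g x))^2" by (intro power_mono) auto
      then show ?case by (simp add: power_mult_distrib)
    qed
  qed (use assms(1) in measurable)
  then show ?thesis using assms(1) by (simp add: L2_def)
qed

lemma L2_add:
  assumes "f \<in> L2 M" "g \<in> L2 M"
  shows "(\<lambda>x. f x + g x) \<in> L2 M"
proof -
  have [measurable]: "f \<in> borel_measurable M" "g \<in> borel_measurable M" using assms by (auto dest: L2_measurable)
  have "integrable M (\<lambda>x. 2 * (norm (f x))^2 + 2 * (norm (g x))^2)"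
    by (intro Bochner_Integration.integrable_add integrable_mult_right L2_integrable assms)
  then have "integrable M (\<lambda>x. (norm (f x + g x))^2)"
  proof (rule Bochner_Integration.integrable_bound)
    have "(norm (a + b))^2 \<le> 2 * (norm a)^2 + 2 * (norm b)^2" for a b :: complex
    proof -
      have "(norm (a + b))^2 \<le> (norm a + norm b)^2" by (intro power_mono norm_triangle_ineq) auto
      also have "\<dots> \<le> 2 * (norm a)^2 + 2 * (norm b)^2" using sum_squares_bound[of "norm a" "norm b"] by (simp add: power2_sum)
      finally show ?thesis .
    qed
    then show "AE x in M. norm ((norm (f x + g x))^2) \<le> norm (2 * (norm (f x))^2 + 2 * (norm (g x))^2)" by (auto intro!: AE_I2)
  qed measurable
  then show ?thesis by (simp add: L2_def)
qed

lemma L2_cmult: "f \<in> L2 M \<Longrightarrow> (\<lambda>x. c * f x) \<in> L2 M"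
  by (rule L2_dominated[of _ _ f "norm c"]) (auto simp: norm_mult dest: L2_measurable)

lemma L2_scaleR: "f \<in> L2 M \<Longrightarrow> (\<lambda>x. c *\<^sub>R f x) \<in> L2 M" using L2_cmult[of f M "of_real c"] by (simp add: scaleR_conv_of_real)

lemma L2_cnj: "f \<in> L2 M \<Longrightarrow> (\<lambda>x. cnj (f x)) \<in> L2 M" by (rule L2_dominated[of _ _ f 1])
     (auto intro: measurable_compose[OF L2_measurable borel_measurable_continuous_onI[OF continuous_on_cnj[OF continuous_on_id]]])

lemma L2_zero: "(\<lambda>x. 0) \<in> L2 M" by (simp add: L2_def)

lemma L2_uminus: "f \<in> L2 M \<Longrightarrow> (\<lambda>x. - f x) \<in> L2 M" using L2_cmult[of f M "-1"] by simp

lemma L2_diff: "f \<in> L2 M \<Longrightarrow> g \<in> L2 M \<Longrightarrow> (\<lambda>x. f x - g x) \<in> L2 M" using L2_add[of f M "\<lambda>x. - g x"] by (simp add: L2_uminus)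

lemma L2_sum: "(\<And>a. a \<in> A \<Longrightarrow> f a \<in> L2 M) \<Longrightarrow> (\<lambda>x. \<Sum>a\<in>A. f a x) \<in> L2 M"
  by (induction A rule: infinite_finite_induct) (auto intro: L2_zero L2_add)

lemma L2_integrable_norm_mult:
  assumes "f \<in> L2 M" "g \<in> L2 M"
  shows "integrable M (\<lambda>x. norm (f x) * norm (g x))"
proof (rule Bochner_Integration.integrable_bound)
  show "integrable M (\<lambda>x. (norm (f x))^2 + (norm (g x))^2)" by (intro Bochner_Integration.integrable_add L2_integrable assms)
  show "(\<lambda>x. norm (f x) * norm (g x)) \<in> borel_measurable M" using assms by (auto dest!: L2_measurable)
  show "AE x in M. norm (norm (f x) * norm (g x)) \<le> norm ((norm (f x))^2 + (norm (g x))^2)"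
  proof (intro AE_I2)
    fix x
    have "2 * (norm (f x) * norm (g x)) \<le> (norm (f x))^2 + (norm (g x))^2"
      using sum_squares_bound[of "norm (f x)" "norm (g x)"] by (simp only: mult.assoc)
    moreover have "0 \<le> norm (f x) * norm (g x)" by simp
    ultimately have "norm (f x) * norm (g x) \<le> (norm (f x))^2 + (norm (g x))^2" by linarith
    then show "norm (norm (f x) * norm (g x)) \<le> norm ((norm (f x))^2 + (norm (g x))^2)" by (simp add: abs_mult)
  qed
qed

lemma L2_integrable_mult:
  assumes "f \<in> L2 M" "g \<in> L2 M"
  shows "integrable M (\<lambda>x. f x * g x)" by (rule Bochner_Integration.integrable_bound[OF L2_integrable_norm_mult[OF assms]])
     (use assms in \<open>auto simp: norm_mult dest!: L2_measurable\<close>)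

lemma L2_norm_eq_0:
  assumes "f \<in> L2 M" "L2_norm M f = 0"
  shows "AE x in M. f x = 0"
proof -
  have "(\<integral>x. (norm (f x))^2 \<partial>M) = 0" using assms(2) by (simp add: L2_norm_def)
  then have "AE x in M. (norm (f x))^2 = 0" by (subst (asm) integral_nonneg_eq_0_iff_AE[OF L2_integrable[OF assms(1)]]) auto
  then show ?thesis by simp
qed

lemma L2_norm_mult_bound:
  assumes "f \<in> L2 M" "g \<in> L2 M"
  shows "(\<integral>x. norm (f x) * norm (g x) \<partial>M) \<le> L2_norm M f * L2_norm M g"
proof -
  define a b I where "a = L2_norm M f" and "b = L2_norm M g" and "I = (\<integral>x. norm (f x) * norm (g x) \<partial>M)"
  have q: "0 \<le> t^2 * a^2 - 2 * t * I + b^2" for t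
  proof -
    have i: "integrable M (\<lambda>x. t\<^sup>2 * (norm (f x))^2)" "integrable M (\<lambda>x. 2 * t * (norm (f x) * norm (g x)))"
      "integrable M (\<lambda>x. (norm (g x))^2)" by (intro integrable_mult_right L2_integrable L2_integrable_norm_mult assms)+
    have "0 \<le> (\<integral>x. (t * norm (f x) - norm (g x))^2 \<partial>M)" by (intro Bochner_Integration.integral_nonneg) simp
    also have "\<dots> = (\<integral>x. (t^2 * (norm (f x))^2 - 2 * t * (norm (f x) * norm (g x)) + (norm (g x))^2) \<partial>M)"
      by (intro Bochner_Integration.integral_cong) (simp_all add: power2_diff power_mult_distrib)
    also have "\<dots> = t^2 * a^2 - 2 * t * I + b^2" using i by (simp add: a_def b_def I_def L2_norm_squared)
    finally show ?thesis .
  qed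
  have I0: "I \<ge> 0" unfolding I_def by (intro Bochner_Integration.integral_nonneg) simp
  have ab: "a \<ge> 0" "b \<ge> 0" by (auto simp: a_def b_def)
  show ?thesis
  proof (cases "a = 0")
    case True
    then have "AE x in M. f x = 0" using L2_norm_eq_0[OF assms(1)] by (simp add: a_def)
    then have "AE x in M. norm (f x) * norm (g x) = 0" by eventually_elim simp
    then have "I = 0" unfolding I_def by (rule integral_eq_zero_AE)
    then show ?thesis using ab by (simp add: I_def a_def b_def)
  next
    case False
    then have a: "a > 0" using ab by simp
    \<comment> \<open>The quadratic polynomial in \<open>t\<close> is minimal at this point.\<close>
    from q[of "I / a^2"] have "I\<^sup>2 \<le> (a * b)^2" using a by (simp add: field_simps power2_eq_square)
    then have "I \<le> a * b" by (rule power2_le_imp_le) (use ab in simp)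
    then show ?thesis unfolding I_def a_def b_def .
  qed
qed

lemma L2_Cauchy_Schwarz:
  assumes "f \<in> L2 M" "g \<in> L2 M"
  shows "norm (\<integral>x. f x * g x \<partial>M) \<le> L2_norm M f * L2_norm M g"
proof -
  have "norm (\<integral>x. f x * g x \<partial>M) \<le> (\<integral>x. norm (f x * g x) \<partial>M)" by (rule integral_norm_bound)
  also have "\<dots> \<le> L2_norm M f * L2_norm M g" using L2_norm_mult_bound[OF assms] by (simp add: norm_mult)
  finally show ?thesis .
qed

lemma L2_norm_cnj [simp]: "L2_norm M (\<lambda>x. cnj (f x)) = L2_norm M f" by (simp add: L2_norm_def)

lemma L2_norm_triangle:
  assumes "f \<in> L2 M" "g \<in> L2 M"
  shows "L2_norm M (\<lambda>x. f x + g x) \<le> L2_norm M f + L2_norm M g"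
proof (rule power2_le_imp_le)
  have i: "integrable M (\<lambda>x. (norm (f x))^2)" "integrable M (\<lambda>x. (norm (g x))^2)"
    "integrable M (\<lambda>x. norm (f x) * norm (g x))" by (intro L2_integrable L2_integrable_norm_mult assms)+
  have "(L2_norm M (\<lambda>x. f x + g x))^2 \<le> (\<integral>x. (norm (f x))^2 + 2 * (norm (f x) * norm (g x)) + (norm (g x))^2 \<partial>M)"
    unfolding L2_norm_squared
  proof (rule integral_mono)
    show "integrable M (\<lambda>x. (norm (f x + g x))^2)" using L2_add[OF assms] by (rule L2_integrable)
    show "integrable M (\<lambda>x. (norm (f x))^2 + 2 * (norm (f x) * norm (g x)) + (norm (g x))^2)" using i by simp
    fix x
    have "(norm (f x + g x))^2 \<le> (norm (f x) + norm (g x))^2" by (intro power_mono norm_triangle_ineq) auto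
    then show "(norm (f x + g x))^2 \<le> (norm (f x))^2 + 2 * (norm (f x) * norm (g x)) + (norm (g x))^2" by (simp add: power2_sum)
  qed
  also have "\<dots> = (L2_norm M f)^2 + 2 * (\<integral>x. norm (f x) * norm (g x) \<partial>M) + (L2_norm M g)^2" using i by (simp add: L2_norm_squared)
  also have "\<dots> \<le> (L2_norm M f + L2_norm M g)^2" using L2_norm_mult_bound[OF assms] by (simp add: power2_sum)
  finally show "(L2_norm M (\<lambda>x. f x + g x))^2 \<le> (L2_norm M f + L2_norm M g)^2" .
qed simp

lemma L2_norm_cmult: "L2_norm M (\<lambda>x. c * f x) = norm c * L2_norm M f"
  by (simp add: L2_norm_def norm_mult power_mult_distrib real_sqrt_mult)

lemma L2_norm_scaleR: "L2_norm M (\<lambda>x. c *\<^sub>R f x) = \<bar>c\<bar> * L2_norm M f"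
  using L2_norm_cmult[of M "of_real c" f] by (simp add: scaleR_conv_of_real)

lemma L2_norm_zero [simp]: "L2_norm M (\<lambda>x. 0) = 0" by (simp add: L2_norm_def)

lemma L2_norm_minus_commute: "L2_dist M f g = L2_dist M g f" by (simp add: L2_norm_def norm_minus_commute)

lemma L2_norm_triangle_diff:
  assumes "f \<in> L2 M" "g \<in> L2 M" "h \<in> L2 M"
  shows "L2_dist M f h \<le> L2_dist M f g + L2_dist M g h"
  using L2_norm_triangle[of "\<lambda>x. f x - g x" M "\<lambda>x. g x - h x"] assms by (simp add: L2_diff)

lemma L2_norm_triangle_sub:
  assumes "f \<in> L2 M" "g \<in> L2 M"
  shows "L2_norm M f \<le> L2_norm M g + L2_dist M f g" using L2_norm_triangle[of g M "\<lambda>x. f x - g x"] assms by (simp add: L2_diff)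

lemma L2_norm_sum:
  assumes "\<And>a. a \<in> A \<Longrightarrow> f a \<in> L2 M"
  shows "L2_norm M (\<lambda>x. \<Sum>a\<in>A. f a x) \<le> (\<Sum>a\<in>A. L2_norm M (f a))" using assms
proof (induction A rule: infinite_finite_induct)
  case (insert a A)
  then show ?case using L2_norm_triangle[of "f a" M "\<lambda>x. \<Sum>a\<in>A. f a x"] by (fastforce simp: L2_sum)
qed auto

lemma L2_norm_mono:
  assumes "f \<in> borel_measurable M" "g \<in> L2 M" "AE x in M. norm (f x) \<le> C * norm (g x)" "C \<ge> 0"
  shows "L2_norm M f \<le> C * L2_norm M g"
proof -
  have "L2_norm M f \<le> L2_norm M (\<lambda>x. of_real C * g x)" unfolding L2_norm_def
  proof (intro real_sqrt_le_mono integral_mono_AE L2_integrable)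
    show "f \<in> L2 M" by (rule L2_dominated[OF assms(1-3)])
    show "(\<lambda>x. of_real C * g x) \<in> L2 M" using assms(2) by (rule L2_cmult)
    show "AE x in M. (norm (f x))^2 \<le> (norm (of_real C * g x))^2" using assms(3)
    proof eventually_elim
      case (elim x)
      then have "norm (f x) \<le> norm (of_real C * g x)" using assms(4) by (simp add: norm_mult)
      then show ?case by (rule power_mono) simp
    qed
  qed
  then show ?thesis using assms(4) by (simp add: L2_norm_cmult)
qed

lemma L2_cong_AE:
  assumes "f \<in> L2 M" "g \<in> borel_measurable M" "AE x in M. g x = f x"
  shows "g \<in> L2 M" "L2_norm M g = L2_norm M f"
proof -
  show "g \<in> L2 M" by (rule L2_dominated[of _ _ f 1]) (use assms in auto)
  show "L2_norm M g = L2_norm M f" unfolding L2_norm_def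
    by (intro arg_cong[of _ _ sqrt] integral_cong_AE) (use assms in \<open>auto dest: L2_measurable\<close>)
qed

lemma L2_const: "finite_measure M \<Longrightarrow> (\<lambda>x. c) \<in> L2 M" by (simp add: L2_def finite_measure.integrable_const)

lemma L2_bounded_mult:
  assumes "f \<in> L2 M" "b \<in> borel_measurable M" "AE x in M. norm (b x) \<le> C"
  shows "(\<lambda>x. b x * f x) \<in> L2 M"
proof (rule L2_dominated[OF _ assms(1)])
  show "AE x in M. norm (b x * f x) \<le> C * norm (f x)" using assms(3) by eventually_elim (simp add: norm_mult mult_right_mono)
qed (use assms in \<open>auto dest: L2_measurable\<close>)

lemma L2_norm_tendsto:
  assumes "\<And>j. f j \<in> L2 M" "g \<in> L2 M" "(\<lambda>j. L2_dist M (f j) g) \<longlonglongrightarrow> 0"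
  shows "(\<lambda>j. L2_norm M (f j)) \<longlonglongrightarrow> L2_norm M g"
proof -
  have "\<bar>L2_norm M (f j) - L2_norm M g\<bar> \<le> L2_dist M (f j) g" for j
    using L2_norm_triangle_sub[OF assms(1)[of j] assms(2)] L2_norm_triangle_sub[OF assms(2) assms(1)[of j]]
    by (simp add: L2_norm_minus_commute[of M g] abs_le_iff)
  then have "(\<lambda>j. L2_norm M (f j) - L2_norm M g) \<longlonglongrightarrow> 0" using assms(3) by (intro Lim_null_comparison[OF _ assms(3)]) auto
  then show ?thesis by (simp add: LIM_zero_cancel)
qed

lemma L2_integral_tendsto:
  assumes f: "\<And>j. f j \<in> L2 M" "f' \<in> L2 M" "(\<lambda>j. L2_dist M (f j) f') \<longlonglongrightarrow> 0"
    and g: "\<And>j. g j \<in> L2 M" "g' \<in> L2 M" "(\<lambda>j. L2_dist M (g j) g') \<longlonglongrightarrow> 0"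
  shows "(\<lambda>j. \<integral>x. f j x * g j x \<partial>M) \<longlonglongrightarrow> (\<integral>x. f' x * g' x \<partial>M)"
proof -
  have bnd: "norm ((\<integral>x. f j x * g j x \<partial>M) - (\<integral>x. f' x * g' x \<partial>M))
      \<le> L2_dist M (f j) f' * L2_norm M (g j) + L2_norm M f' * L2_dist M (g j) g'" for j
  proof -
    have "(\<integral>x. f j x * g j x \<partial>M) - (\<integral>x. f' x * g' x \<partial>M)
        = (\<integral>x. (f j x - f' x) * g j x + f' x * (g j x - g' x) \<partial>M)"
      using f g by (subst Bochner_Integration.integral_diff[symmetric])
        (auto simp: algebra_simps intro!: L2_integrable_mult)
    also have "\<dots> = (\<integral>x. (f j x - f' x) * g j x \<partial>M) + (\<integral>x. f' x * (g j x - g' x) \<partial>M)"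
      using f g by (intro Bochner_Integration.integral_add L2_integrable_mult L2_diff)
    also have "norm \<dots> \<le> L2_dist M (f j) f' * L2_norm M (g j) + L2_norm M f' * L2_dist M (g j) g'"
      using f g by (intro order_trans[OF norm_triangle_ineq] add_mono L2_Cauchy_Schwarz L2_diff)
    finally show ?thesis .
  qed
  have "(\<lambda>j. L2_dist M (f j) f' * L2_norm M (g j) + L2_norm M f' * L2_dist M (g j) g')
     \<longlonglongrightarrow> 0 * L2_norm M g' + L2_norm M f' * 0" by (intro tendsto_intros f g L2_norm_tendsto)
  then have "(\<lambda>j. L2_dist M (f j) f' * L2_norm M (g j) + L2_norm M f' * L2_dist M (g j) g')
     \<longlonglongrightarrow> 0" by simp
  from Lim_null_comparison[OF always_eventually[OF allI[OF bnd]] this]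
  have "(\<lambda>j. (\<integral>x. f j x * g j x \<partial>M) - (\<integral>x. f' x * g' x \<partial>M)) \<longlonglongrightarrow> 0" .
  then show ?thesis by (simp add: LIM_zero_cancel)
qed

lemma L2_integral_tendsto_left:
  assumes "\<And>j. f j \<in> L2 M" "f' \<in> L2 M" "(\<lambda>j. L2_dist M (f j) f') \<longlonglongrightarrow> 0" "g \<in> L2 M"
  shows "(\<lambda>j. \<integral>x. f j x * g x \<partial>M) \<longlonglongrightarrow> (\<integral>x. f' x * g x \<partial>M)" using assms by (intro L2_integral_tendsto) auto

lemma L2_nn_integral:
  assumes "f \<in> borel_measurable M"
  shows "(\<integral>\<^sup>+x. ennreal ((norm (f x))^2) \<partial>M) \<le> ennreal (B^2) \<Longrightarrow> f \<in> L2 M"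
    and "(\<integral>\<^sup>+x. ennreal ((norm (f x))^2) \<partial>M) \<le> ennreal (B^2) \<Longrightarrow> B \<ge> 0 \<Longrightarrow> L2_norm M f \<le> B"
    and "f \<in> L2 M \<Longrightarrow> (\<integral>\<^sup>+x. ennreal ((norm (f x))^2) \<partial>M) = ennreal ((L2_norm M f)^2)"
proof -
  show 1: "f \<in> L2 M" if "(\<integral>\<^sup>+x. ennreal ((norm (f x))^2) \<partial>M) \<le> ennreal (B^2)"
    using assms that by (auto simp: L2_def integrable_iff_bounded intro: le_less_trans)
  show 2: "(\<integral>\<^sup>+x. ennreal ((norm (f x))^2) \<partial>M) = ennreal ((L2_norm M f)^2)" if "f \<in> L2 M"
    unfolding L2_norm_squared by (intro nn_integral_eq_integral L2_integrable that) simp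
  show "L2_norm M f \<le> B" if "(\<integral>\<^sup>+x. ennreal ((norm (f x))^2) \<partial>M) \<le> ennreal (B^2)" "B \<ge> 0"
    by (rule power2_le_imp_le) (use 2[OF 1[OF that(1)]] that in \<open>simp_all add: ennreal_le_iff\<close>)
qed

text \<open>On a finite measure space an L2 Cauchy sequence is Cauchy in L1 and so has an almost
  everywhere convergent subsequence. Fatou's lemma then bounds the L2 distance to its pointwise
  limit.\<close>

lemma L2_complete:
  fixes f :: "nat \<Rightarrow> 'a \<Rightarrow> complex"
  assumes fin: "finite_measure M" and f: "\<And>n. f n \<in> L2 M"
    and cauchy: "\<And>e. e > 0 \<Longrightarrow> \<exists>N. \<forall>m\<ge>N. \<forall>n\<ge>N. L2_dist M (f m) (f n) < e"
  obtains g where "g \<in> L2 M" "(\<lambda>n. L2_dist M (f n) g) \<longlonglongrightarrow> 0"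
proof -
  interpret finite_measure M by fact
  have fm [measurable]: "f n \<in> borel_measurable M" for n using f by (rule L2_measurable)
  have one: "(\<lambda>x. 1) \<in> L2 M" using fin by (rule L2_const)
  have int: "integrable M (f n)" for n using L2_integrable_mult[OF f one] by simp
  define c where "c = L2_norm M (\<lambda>x. 1) + 1"
  have c: "c > 0" by (simp add: c_def add_nonneg_pos)
  have "\<exists>N. \<forall>i\<ge>N. \<forall>j\<ge>N. (\<integral>x. norm (f i x - f j x) \<partial>M) < e" if e: "e > 0" for e
  proof -
    obtain N where N: "\<And>m n. m \<ge> N \<Longrightarrow> n \<ge> N \<Longrightarrow> L2_dist M (f m) (f n) < e / c" using cauchy[OF divide_pos_pos[OF e c]] by blast
    have "(\<integral>x. norm (f i x - f j x) \<partial>M) < e" if "i \<ge> N" "j \<ge> N" for i j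
    proof -
      have "(\<integral>x. norm (f i x - f j x) \<partial>M) \<le> L2_dist M (f i) (f j) * L2_norm M (\<lambda>x. 1)"
        using L2_norm_mult_bound[OF L2_diff[OF f f] one, of i j] by simp
      also have "\<dots> \<le> L2_dist M (f i) (f j) * c" by (intro mult_left_mono) (auto simp: c_def)
      also have "\<dots> < e" using N[OF that] c by (simp add: field_simps)
      finally show ?thesis .
    qed
    then show ?thesis by blast
  qed
  from cauchy_L1_AE_cauchy_subseq[of M f, OF int this]
  obtain r where r: "strict_mono r" "AE x in M. Cauchy (\<lambda>i. f (r i) x)" by blast
  define g where "g x = lim (\<lambda>i. f (r i) x)" for x
  have gm [measurable]: "g \<in> borel_measurable M" unfolding g_def by measurable
  have lim: "AE x in M. (\<lambda>i. f (r i) x) \<longlonglongrightarrow> g x"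
    using r(2) by eventually_elim (simp add: g_def Cauchy_convergent_iff convergent_LIMSEQ_iff)
  have bound: "(\<integral>\<^sup>+x. ennreal ((norm (f n x - g x))^2) \<partial>M) \<le> ennreal (e^2)"
    if N: "\<And>m n. m \<ge> N \<Longrightarrow> n \<ge> N \<Longrightarrow> L2_dist M (f m) (f n) < e" and n: "n \<ge> N" for n N e
  proof -
    have "(\<integral>\<^sup>+x. ennreal ((norm (f n x - g x))^2) \<partial>M)
        = (\<integral>\<^sup>+x. liminf (\<lambda>i. ennreal ((norm (f n x - f (r i) x))^2)) \<partial>M)"
    proof (intro nn_integral_cong_AE)
      show "AE x in M. ennreal ((norm (f n x - g x))^2) = liminf (\<lambda>i. ennreal ((norm (f n x - f (r i) x))^2))" using lim
      proof eventually_elim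
        case (elim x)
        have "(\<lambda>i. ennreal ((norm (f n x - f (r i) x))^2)) \<longlonglongrightarrow> ennreal ((norm (f n x - g x))^2)"
          by (intro tendsto_intros tendsto_ennrealI elim)
        from lim_imp_Liminf[OF sequentially_bot this] show ?case by simp
      qed
    qed
    also have "\<dots> \<le> liminf (\<lambda>i. \<integral>\<^sup>+x. ennreal ((norm (f n x - f (r i) x))^2) \<partial>M)" by (rule nn_integral_liminf) measurable
    also have "\<dots> \<le> ennreal (e^2)"
    proof (rule Liminf_le)
      show "\<forall>\<^sub>F i in sequentially. (\<integral>\<^sup>+x. ennreal ((norm (f n x - f (r i) x))^2) \<partial>M) \<le> ennreal (e^2)"
      proof (rule eventually_sequentiallyI[of N])
        fix i assume "i \<ge> N"
        then have "L2_dist M (f n) (f (r i)) < e" using N n seq_suble[OF r(1), of i] by (meson order_trans)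
        then show "(\<integral>\<^sup>+x. ennreal ((norm (f n x - f (r i) x))^2) \<partial>M) \<le> ennreal (e^2)"
          by (subst L2_nn_integral(3)) (auto intro!: ennreal_leI power_mono L2_diff f)
      qed
    qed simp
    finally show ?thesis .
  qed
  have gL2: "g \<in> L2 M"
  proof -
    obtain N where N: "\<And>m n. m \<ge> N \<Longrightarrow> n \<ge> N \<Longrightarrow> L2_dist M (f m) (f n) < 1" using cauchy[of 1] by auto
    have "(\<lambda>x. f N x - g x) \<in> L2 M" by (rule L2_nn_integral(1)[OF _ bound[OF N order_refl]]) auto
    from L2_diff[OF f[of N] this] show ?thesis by simp
  qed
  have "(\<lambda>n. L2_dist M (f n) g) \<longlonglongrightarrow> 0"
  proof (rule LIMSEQ_I)
    fix e :: real assume e: "e > 0"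
    then obtain N where N: "\<And>m n. m \<ge> N \<Longrightarrow> n \<ge> N \<Longrightarrow> L2_dist M (f m) (f n) < e / 2" using cauchy[of "e / 2"] by auto
    have "norm (L2_dist M (f n) g - 0) < e" if "n \<ge> N" for n
    proof -
      have "L2_dist M (f n) g \<le> e / 2" by (rule L2_nn_integral(2)[OF _ bound[OF N that]]) (use e in auto)
      then show ?thesis using e by simp
    qed
    then show "\<exists>N. \<forall>n\<ge>N. norm (L2_dist M (f n) g - 0) < e" by blast
  qed
  with gL2 show ?thesis by (rule that)
qed

lemma L2_parallelogram:
  assumes "f \<in> L2 M" "g \<in> L2 M"
  shows "(L2_dist M f g)^2
    = 2 * (L2_norm M f)^2 + 2 * (L2_norm M g)^2 - 4 * (L2_norm M (\<lambda>x. (1/2) *\<^sub>R (f x + g x)))^2"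
proof -
  have "4 * (L2_norm M (\<lambda>x. (1/2) *\<^sub>R (f x + g x)))^2 = (L2_norm M (\<lambda>x. f x + g x))^2"
    by (simp only: L2_norm_scaleR power_mult_distrib) (simp add: power2_eq_square)
  moreover have "(L2_dist M f g)^2 + (L2_norm M (\<lambda>x. f x + g x))^2
    = 2 * (L2_norm M f)^2 + 2 * (L2_norm M g)^2"
  proof -
    have i: "integrable M (\<lambda>x. (norm (f x))^2)" "integrable M (\<lambda>x. (norm (g x))^2)"
      "integrable M (\<lambda>x. (norm (f x - g x))^2)" "integrable M (\<lambda>x. (norm (f x + g x))^2)"
      using assms by (auto intro!: L2_integrable L2_diff L2_add)
    have "(norm (a - b))^2 + (norm (a + b))^2 = 2 * (norm a)^2 + 2 * (norm b)^2" for a b :: complex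
      by (simp add: power2_norm_eq_inner inner_add_left inner_add_right inner_diff_left inner_diff_right)
    then have "(\<integral>x. (norm (f x - g x))^2 + (norm (f x + g x))^2 \<partial>M) = (\<integral>x. 2 * (norm (f x))^2 + 2 * (norm (g x))^2 \<partial>M)" by simp
    then show ?thesis using i by (simp add: L2_norm_squared)
  qed
  ultimately show ?thesis by simp
qed


subsection \<open>Convex combinations of bounded sequences\<close>

text \<open>Coefficients are total functions of finite support, so that differences and means of
  coefficient families can be formed. The support lies in \<open>{j..}\<close> because combinations
  of tails keep every strong limit of the original sequence.\<close>

definition convex_coeffs :: "nat \<Rightarrow> (nat \<Rightarrow> real) set" where
  "convex_coeffs j = {c. finite {m. c m \<noteq> 0} \<and> {m. c m \<noteq> 0} \<subseteq> {j..} \<and> (\<forall>m. c m \<ge> 0) \<and> (\<Sum>m | c m \<noteq> 0. c m) = 1}"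

definition combine :: "(nat \<Rightarrow> real) \<Rightarrow> (nat \<Rightarrow> 'b) \<Rightarrow> 'b::real_vector" where
  "combine c x = (\<Sum>m | c m \<noteq> 0. c m *\<^sub>R x m)"

lemma combine_superset: "finite A \<Longrightarrow> {m. c m \<noteq> 0} \<subseteq> A \<Longrightarrow> combine c x = (\<Sum>m\<in>A. c m *\<^sub>R x m)"
  unfolding combine_def by (rule sum.mono_neutral_left) auto

lemma combine_diff_coeffs:
  assumes "finite {m. c m \<noteq> 0}" "finite {m. c' m \<noteq> 0}"
  shows "combine (\<lambda>m. c m - c' m) x = combine c x - combine c' x"
proof -
  let ?A = "{m. c m \<noteq> 0} \<union> {m. c' m \<noteq> 0}"
  have "combine (\<lambda>m. c m - c' m) x = (\<Sum>m\<in>?A. (c m - c' m) *\<^sub>R x m)" using assms by (intro combine_superset) auto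
  also have "\<dots> = (\<Sum>m\<in>?A. c m *\<^sub>R x m) - (\<Sum>m\<in>?A. c' m *\<^sub>R x m)" by (simp add: scaleR_diff_left sum_subtractf)
  also have "(\<Sum>m\<in>?A. c m *\<^sub>R x m) = combine c x" using assms by (auto intro!: combine_superset[symmetric])
  also have "(\<Sum>m\<in>?A. c' m *\<^sub>R x m) = combine c' x" using assms by (auto intro!: combine_superset[symmetric])
  finally show ?thesis .
qed

lemma combine_mean_coeffs:
  assumes "finite {m. c m \<noteq> 0}" "finite {m. c' m \<noteq> 0}"
  shows "combine (\<lambda>m. (c m + c' m) / 2) x = (1 / 2) *\<^sub>R (combine c x + combine c' x)"
proof -
  let ?A = "{m. c m \<noteq> 0} \<union> {m. c' m \<noteq> 0}"
  have "combine (\<lambda>m. (c m + c' m) / 2) x = (\<Sum>m\<in>?A. ((c m + c' m) / 2) *\<^sub>R x m)" using assms by (intro combine_superset) auto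
  also have "\<dots> = (1 / 2) *\<^sub>R ((\<Sum>m\<in>?A. c m *\<^sub>R x m) + (\<Sum>m\<in>?A. c' m *\<^sub>R x m))"
    by (simp add: scaleR_sum_right sum.distrib[symmetric] scaleR_add_left[symmetric] add_divide_distrib scaleR_add_right)
  also have "(\<Sum>m\<in>?A. c m *\<^sub>R x m) = combine c x" using assms by (auto intro!: combine_superset[symmetric])
  also have "(\<Sum>m\<in>?A. c' m *\<^sub>R x m) = combine c' x" using assms by (auto intro!: combine_superset[symmetric])
  finally show ?thesis .
qed

lemma sum_coeffs_combine: "(\<Sum>m | c m \<noteq> 0. c m) = combine c (\<lambda>m. 1 :: real)" by (simp add: combine_def)

lemma convex_coeffs_mono: "i \<le> j \<Longrightarrow> convex_coeffs j \<subseteq> convex_coeffs i" by (auto simp: convex_coeffs_def subset_iff)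

lemma convex_coeffs_mean:
  assumes "c \<in> convex_coeffs j" "c' \<in> convex_coeffs j"
  shows "(\<lambda>m. (c m + c' m) / 2) \<in> convex_coeffs j"
proof -
  have fin: "finite {m. c m \<noteq> 0}" "finite {m. c' m \<noteq> 0}" using assms by (auto simp: convex_coeffs_def)
  have "{m. (c m + c' m) / 2 \<noteq> 0} \<subseteq> {m. c m \<noteq> 0} \<union> {m. c' m \<noteq> 0}" by auto
  moreover from this have "finite {m. (c m + c' m) / 2 \<noteq> 0}" using fin finite_subset by blast
  moreover have "(\<Sum>m | (c m + c' m) / 2 \<noteq> 0. (c m + c' m) / 2) = 1" using combine_mean_coeffs[OF fin, of "\<lambda>m. 1 :: real"] assms
    unfolding sum_coeffs_combine by (simp add: convex_coeffs_def sum_coeffs_combine)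
  ultimately show ?thesis using assms by (auto simp: convex_coeffs_def)
qed

lemma unit_convex_coeffs: "(\<lambda>i. if i = j then 1 else 0) \<in> convex_coeffs j" by (auto simp: convex_coeffs_def)

lemma combine_convex_tendsto_0:
  fixes a :: "nat \<Rightarrow> real"
  assumes c: "\<And>j. c j \<in> convex_coeffs j" and a: "a \<longlonglongrightarrow> 0"
  shows "(\<lambda>j. combine (c j) a) \<longlonglongrightarrow> 0"
proof (rule LIMSEQ_I)
  fix e :: real assume e: "e > 0"
  then obtain N where N: "\<And>m. m \<ge> N \<Longrightarrow> \<bar>a m\<bar> < e / 2" using LIMSEQ_D[OF a, of "e / 2"] by auto
  have "norm (combine (c j) a - 0) < e" if j: "j \<ge> N" for j
  proof -
    have cj: "{m. c j m \<noteq> 0} \<subseteq> {j..}" "\<And>m. c j m \<ge> 0" "(\<Sum>m | c j m \<noteq> 0. c j m) = 1"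
      using c[of j] by (auto simp: convex_coeffs_def)
    have "\<bar>combine (c j) a\<bar> \<le> (\<Sum>m | c j m \<noteq> 0. \<bar>c j m * a m\<bar>)" unfolding combine_def by simp
    also have "\<dots> \<le> (\<Sum>m | c j m \<noteq> 0. c j m * (e / 2))"
    proof (intro sum_mono)
      fix m assume "m \<in> {m. c j m \<noteq> 0}"
      then have "m \<ge> N" using cj(1) j by auto
      then show "\<bar>c j m * a m\<bar> \<le> c j m * (e / 2)"
        using mult_left_mono[OF less_imp_le[OF N[of m]] cj(2)[of m]] cj(2)[of m] by (simp add: abs_mult)
    qed
    also have "\<dots> = (\<Sum>m | c j m \<noteq> 0. c j m) * (e / 2)" by (simp only: sum_distrib_right)
    also have "\<dots> < e" using cj(3) e by simp
    finally show ?thesis by simp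
  qed
  then show "\<exists>N. \<forall>j\<ge>N. norm (combine (c j) a - 0) < e" by blast
qed

text \<open>Nearly minimal convex combinations form a Cauchy sequence by the parallelogram law. This
  replaces weak compactness.\<close>

lemma convex_combination_Cauchy:
  fixes Q :: "(nat \<Rightarrow> real) \<Rightarrow> real"
  assumes nonneg: "\<And>c. 0 \<le> Q c" and bd: "\<And>m. Q (\<lambda>i. if i = m then 1 else 0) \<le> B"
    and par: "\<And>c c'. finite {m. c m \<noteq> 0} \<Longrightarrow> finite {m. c' m \<noteq> 0} \<Longrightarrow>
      Q (\<lambda>m. c m - c' m) = 2 * Q c + 2 * Q c' - 4 * Q (\<lambda>m. (c m + c' m) / 2)"
  shows "\<exists>c. (\<forall>j. c j \<in> convex_coeffs j) \<and> (\<forall>e>0. \<exists>N. \<forall>i\<ge>N. \<forall>j\<ge>N. Q (\<lambda>m. c i m - c j m) < e)"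
proof -
  \<comment> \<open>The infimum over the combinations of a tail increases with \<open>j\<close> and
    is bounded by \<open>B\<close>, so it converges.\<close>
  define d where "d j = Inf (Q ` convex_coeffs j)" for j
  have bdd: "bdd_below (Q ` convex_coeffs j)" for j using nonneg by (auto intro: bdd_belowI2[of _ 0])
  have d_le: "d j \<le> Q c" if "c \<in> convex_coeffs j" for c j unfolding d_def using that bdd by (intro cInf_lower) auto
  have ne: "Q ` convex_coeffs j \<noteq> {}" for j using unit_convex_coeffs by blast
  have inc: "incseq d"
    unfolding d_def incseq_def using convex_coeffs_mono ne bdd by (intro allI impI cInf_superset_mono image_mono)
  have "d j \<le> B" for j using d_le[OF unit_convex_coeffs] bd order_trans by blast
  from incseq_convergent[OF inc, of B] this obtain l where l: "d \<longlonglongrightarrow> l" "\<And>j. d j \<le> l" by blast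
  have "\<exists>c\<in>convex_coeffs j. Q c < d j + 1 / real (Suc j)" for j
  proof -
    have "Inf (Q ` convex_coeffs j) < d j + 1 / real (Suc j)" by (simp add: d_def)
    then show ?thesis using cInf_lessD[OF ne] by blast
  qed
  then obtain c where c: "\<And>j. c j \<in> convex_coeffs j" "\<And>j. Q (c j) < d j + 1 / real (Suc j)" by metis
  \<comment> \<open>Both families use indices from \<open>N\<close> on, so \<open>Q\<close> is at
    least \<open>d N\<close> at their mean, and the parallelogram law bounds the difference.\<close>
  have est: "Q (\<lambda>m. c i m - c j m) \<le> 4 * (l - d N) + 4 * (1 / real (Suc N))" if "N \<le> i" "N \<le> j" for N i j
  proof -
    have "c i \<in> convex_coeffs N" "c j \<in> convex_coeffs N" using c(1) convex_coeffs_mono that by blast+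
    then have "d N \<le> Q (\<lambda>m. (c i m + c j m) / 2)" by (intro d_le convex_coeffs_mean)
    moreover have "Q (\<lambda>m. c i m - c j m) = 2 * Q (c i) + 2 * Q (c j) - 4 * Q (\<lambda>m. (c i m + c j m) / 2)"
      using c(1) by (intro par) (auto simp: convex_coeffs_def)
    moreover have "Q (c i) \<le> l + 1 / real (Suc N)" "Q (c j) \<le> l + 1 / real (Suc N)"
    proof -
      have "Q (c k) \<le> l + 1 / real (Suc N)" if "N \<le> k" for k
      proof -
        have "1 / real (Suc k) \<le> 1 / real (Suc N)" using that by (simp add: field_simps)
        then show ?thesis using c(2)[of k] l(2)[of k] by linarith
      qed
      then show "Q (c i) \<le> l + 1 / real (Suc N)" "Q (c j) \<le> l + 1 / real (Suc N)" using that by auto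
    qed
    moreover have "A \<le> 4 * (l - dd) + 4 * t" if "dd \<le> q" "A = 2 * a + 2 * b - 4 * q" "a \<le> l + t" "b \<le> l + t"
      for A dd q a b t :: real using that by argo
    ultimately show ?thesis by blast
  qed
  have "(\<lambda>N. 4 * (l - d N) + 4 * (1 / real (Suc N))) \<longlonglongrightarrow> 4 * (l - l) + 4 * 0"
    by (intro tendsto_intros l(1) lim_inverse_n'[THEN LIMSEQ_Suc])
  then have lim: "(\<lambda>N. 4 * (l - d N) + 4 * (1 / real (Suc N))) \<longlonglongrightarrow> 0" by simp
  have "\<exists>N. \<forall>i\<ge>N. \<forall>j\<ge>N. Q (\<lambda>m. c i m - c j m) < e" if e: "e > 0" for e
  proof -
    have "eventually (\<lambda>N. 4 * (l - d N) + 4 * (1 / real (Suc N)) < e) sequentially" using order_tendstoD(2)[OF lim e] .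
    then obtain N where "4 * (l - d N) + 4 * (1 / real (Suc N)) < e" by (auto simp: eventually_sequentially)
    then show ?thesis using est by (meson le_less_trans)
  qed
  then show ?thesis using c(1) by blast
qed

lemma L2_combine:
  assumes "\<And>m. x m \<in> L2 M"
  shows "(\<lambda>p. combine c (\<lambda>m. x m p)) \<in> L2 M" unfolding combine_def by (intro L2_sum L2_scaleR assms)

lemma L2_combine_tendsto:
  assumes c: "\<And>j. c j \<in> convex_coeffs j" and x: "\<And>m. x m \<in> L2 M" "y \<in> L2 M"
    and lim: "(\<lambda>m. L2_norm M (\<lambda>p. x m p - y p)) \<longlonglongrightarrow> 0"
  shows "(\<lambda>j. L2_norm M (\<lambda>p. combine (c j) (\<lambda>m. x m p) - y p)) \<longlonglongrightarrow> 0"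
proof (rule Lim_null_comparison[OF always_eventually[OF allI] combine_convex_tendsto_0[OF c lim]])
  fix j
  have cj: "\<And>m. c j m \<ge> 0" "(\<Sum>m | c j m \<noteq> 0. c j m) = 1" using c[of j] by (auto simp: convex_coeffs_def)
  have "combine (c j) (\<lambda>m. x m p) - y p = (\<Sum>m | c j m \<noteq> 0. c j m *\<^sub>R (x m p - y p))" for p
    using cj(2) by (simp add: combine_def scaleR_diff_right sum_subtractf scaleR_sum_left[symmetric])
  then have "L2_norm M (\<lambda>p. combine (c j) (\<lambda>m. x m p) - y p)
      \<le> (\<Sum>m | c j m \<noteq> 0. L2_norm M (\<lambda>p. c j m *\<^sub>R (x m p - y p)))" by (simp only:) (intro L2_norm_sum L2_scaleR L2_diff x)
  also have "\<dots> = combine (c j) (\<lambda>m. L2_norm M (\<lambda>p. x m p - y p))" using cj(1) by (simp add: combine_def L2_norm_scaleR)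
  finally show "norm (L2_norm M (\<lambda>p. combine (c j) (\<lambda>m. x m p) - y p))
      \<le> combine (c j) (\<lambda>m. L2_norm M (\<lambda>p. x m p - y p))" by simp
qed

text \<open>One choice of coefficients serves all components at once, since \<open>Q\<close> adds up
  their squared norms.\<close>

lemma L2_convex_limit:
  fixes x :: "nat \<Rightarrow> 'i::finite \<Rightarrow> 'a \<Rightarrow> complex"
  assumes fin: "finite_measure M" and x: "\<And>m i. x m i \<in> L2 M"
    and bd: "\<And>m. (\<Sum>i\<in>UNIV. (L2_norm M (x m i))^2) \<le> B"
  obtains c v where "\<And>j. c j \<in> convex_coeffs j" "\<And>i. v i \<in> L2 M"
    "\<And>i. (\<lambda>j. L2_norm M (\<lambda>p. combine (c j) (\<lambda>m. x m i p) - v i p)) \<longlonglongrightarrow> 0"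
proof -
  define Q where "Q c = (\<Sum>i\<in>UNIV. (L2_norm M (\<lambda>p. combine c (\<lambda>m. x m i p)))^2)" for c
  have "\<exists>c. (\<forall>j. c j \<in> convex_coeffs j) \<and> (\<forall>e>0. \<exists>N. \<forall>i\<ge>N. \<forall>j\<ge>N. Q (\<lambda>m. c i m - c j m) < e)"
  proof (rule convex_combination_Cauchy)
    show "0 \<le> Q c" for c by (simp add: Q_def sum_nonneg)
    show "Q (\<lambda>i. if i = m then 1 else 0) \<le> B" for m using bd[of m] by (simp add: Q_def combine_def)
    fix c c' :: "nat \<Rightarrow> real" assume fin: "finite {m. c m \<noteq> 0}" "finite {m. c' m \<noteq> 0}"
    show "Q (\<lambda>m. c m - c' m) = 2 * Q c + 2 * Q c' - 4 * Q (\<lambda>m. (c m + c' m) / 2)"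
      unfolding Q_def combine_diff_coeffs[OF fin] combine_mean_coeffs[OF fin]
      by (simp add: L2_parallelogram[OF L2_combine[OF x] L2_combine[OF x]] sum.distrib sum_subtractf sum_distrib_left)
  qed
  then obtain c where c: "\<And>j. c j \<in> convex_coeffs j"
    "\<And>e. e > 0 \<Longrightarrow> \<exists>N. \<forall>i\<ge>N. \<forall>j\<ge>N. Q (\<lambda>m. c i m - c j m) < e" by blast
  have "\<exists>g. g \<in> L2 M \<and> (\<lambda>j. L2_norm M (\<lambda>p. combine (c j) (\<lambda>m. x m i p) - g p)) \<longlonglongrightarrow> 0" for i
  proof -
    have cauchy: "\<exists>N. \<forall>k\<ge>N. \<forall>l\<ge>N. L2_norm M (\<lambda>p. combine (c k) (\<lambda>m. x m i p) - combine (c l) (\<lambda>m. x m i p)) < e"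
      if e: "e > 0" for e
    proof -
      obtain N where N: "\<And>k l. k \<ge> N \<Longrightarrow> l \<ge> N \<Longrightarrow> Q (\<lambda>m. c k m - c l m) < e^2" using c(2)[of "e\<^sup>2"] e by auto
      have "L2_norm M (\<lambda>p. combine (c k) (\<lambda>m. x m i p) - combine (c l) (\<lambda>m. x m i p)) < e" if "k \<ge> N" "l \<ge> N" for k l
      proof -
        have f: "finite {m. c k m \<noteq> 0}" "finite {m. c l m \<noteq> 0}" using c(1) by (auto simp: convex_coeffs_def)
        have "(L2_norm M (\<lambda>p. combine (c k) (\<lambda>m. x m i p) - combine (c l) (\<lambda>m. x m i p)))^2 \<le> Q (\<lambda>m. c k m - c l m)"
          unfolding Q_def combine_diff_coeffs[OF f] by (intro member_le_sum) auto
        also have "\<dots> < e^2" by (rule N[OF that])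
        finally show ?thesis using e by (intro power2_less_imp_less[of _ e]) auto
      qed
      then show ?thesis by blast
    qed
    show ?thesis by (rule L2_complete[OF fin L2_combine[OF x] cauchy]) blast+
  qed
  then obtain v where "\<forall>i. v i \<in> L2 M \<and> (\<lambda>j. L2_norm M (\<lambda>p. combine (c j) (\<lambda>m. x m i p) - v i p)) \<longlonglongrightarrow> 0"
    using choice[of "\<lambda>i g. g \<in> L2 M \<and> (\<lambda>j. L2_norm M (\<lambda>p. combine (c j) (\<lambda>m. x m i p) - g p)) \<longlonglongrightarrow> 0"] by auto
  then have v: "\<And>i. v i \<in> L2 M" "\<And>i. (\<lambda>j. L2_norm M (\<lambda>p. combine (c j) (\<lambda>m. x m i p) - v i p)) \<longlonglongrightarrow> 0" by auto
  show ?thesis by (rule that[OF c(1) v])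
qed


subsection \<open>Mollification\<close>

lemma norm_integral_le_integral:
  fixes f :: "'a \<Rightarrow> 'b::{banach, second_countable_topology}"
  assumes "integrable M f" "integrable M g" "\<And>x. norm (f x) \<le> g x"
  shows "norm (\<integral>x. f x \<partial>M) \<le> (\<integral>x. g x \<partial>M)"
  by (rule order_trans[OF integral_norm_bound Bochner_Integration.integral_mono]) (use assms in auto)

lemma L2_dominated_tendsto:
  assumes "\<And>n. f n \<in> borel_measurable M" "g \<in> borel_measurable M" "integrable M w"
    and "AE x in M. (\<lambda>n. f n x) \<longlonglongrightarrow> g x" "\<And>n. AE x in M. (norm (f n x - g x))^2 \<le> w x"
  shows "(\<lambda>n. L2_dist M (f n) g) \<longlonglongrightarrow> 0"
proof -
  note [measurable] = assms(1,2)
  have "(\<lambda>n. \<integral>x. (norm (f n x - g x))^2 \<partial>M) \<longlonglongrightarrow> (\<integral>x. 0 \<partial>M)"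
  proof (rule integral_dominated_convergence[OF _ _ assms(3)])
    show "AE x in M. (\<lambda>n. (norm (f n x - g x))^2) \<longlonglongrightarrow> 0" using assms(4)
    proof eventually_elim
      case (elim x)
      have "(\<lambda>n. (norm (f n x - g x))^2) \<longlonglongrightarrow> (norm (g x - g x))^2" by (intro tendsto_intros elim)
      then show ?case by simp
    qed
    show "AE x in M. norm ((norm (f n x - g x))^2) \<le> w x" for n using assms(5)[of n] by simp
  qed measurable
  then have "(\<lambda>n. sqrt (\<integral>x. (norm (f n x - g x))^2 \<partial>M)) \<longlonglongrightarrow> sqrt 0" by (intro tendsto_real_sqrt) simp
  then show ?thesis by (simp add: L2_norm_def)
qed

lemma L2_compact_support:
  fixes g :: "'a::euclidean_space \<Rightarrow> complex"
  assumes "continuous_on UNIV g" "compact K" "\<And>x. x \<notin> K \<Longrightarrow> g x = 0"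
  shows "g \<in> L2 lborel"
proof -
  have "integrable lborel (\<lambda>x. (norm (g x))^2)"
    by (rule integrable_compact_support[of _ K]) (use assms in \<open>auto intro!: continuous_intros\<close>)
  then show ?thesis using assms(1) by (simp add: L2_def borel_measurable_continuous_onI)
qed

text \<open>For positive \<open>B\<close> this is the radial projection onto the closed ball of
  radius \<open>B\<close>; the maximum makes it the identity inside the ball.\<close>

definition clamp_norm :: "real \<Rightarrow> complex \<Rightarrow> complex" where
  "clamp_norm B z = (B / max B (norm z)) *\<^sub>R z"

lemma clamp_norm:
  assumes "B > 0"
  shows "norm (clamp_norm B z) \<le> B" "norm z \<le> B \<Longrightarrow> clamp_norm B z = z" "norm (clamp_norm B z - z) \<le> norm z"
    "continuous_on S (clamp_norm B)"
proof -
  show "norm (clamp_norm B z) \<le> B" using assms by (auto simp: clamp_norm_def max_def field_simps)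
  show "norm z \<le> B \<Longrightarrow> clamp_norm B z = z" using assms by (simp add: clamp_norm_def max_def)
  have "clamp_norm B z - z = (B / max B (norm z) - 1) *\<^sub>R z" by (simp add: clamp_norm_def algebra_simps)
  moreover have "0 \<le> B / max B (norm z)" "B / max B (norm z) \<le> 1" using assms by auto
  then have "\<bar>B / max B (norm z) - 1\<bar> \<le> 1" by linarith
  ultimately show "norm (clamp_norm B z - z) \<le> norm z" using mult_right_mono[of "\<bar>B / max B (norm z) - 1\<bar>" 1 "norm z"] by simp
  show "continuous_on S (clamp_norm B)" unfolding clamp_norm_def using assms by (intro continuous_intros) auto
qed

text \<open>Truncation makes the function bounded. Measurability supplies continuous functions that
  converge almost everywhere; clamping them and cutting them off provides the dominating function
  that turns pointwise convergence into L2 convergence.\<close>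

lemma L2_continuous_approx:
  fixes U :: "real^'n \<Rightarrow> complex"
  assumes U: "U \<in> L2 lborel" "\<And>x. x \<notin> cball 0 R \<Longrightarrow> U x = 0" and R: "R > 0" and e: "e > 0"
  shows "\<exists>g. continuous_on UNIV g \<and> (\<forall>x. x \<notin> cball 0 (2 * R) \<longrightarrow> g x = 0) \<and> dR U g < e"
proof -
  have Um [measurable]: "U \<in> borel_measurable borel" using L2_measurable[OF U(1)] by simp
  have cm [measurable]: "clamp_norm B \<in> borel_measurable borel" if "B > 0" for B
    using clamp_norm(4)[OF that] by (rule borel_measurable_continuous_onI)
  have clm [measurable]: "(\<lambda>x. clamp_norm (real (Suc n)) (U x)) \<in> borel_measurable borel" for n
    using measurable_compose[OF Um cm] by simp
  have "(\<lambda>n. nR (\<lambda>x. clamp_norm (real (Suc n)) (U x) - U x)) \<longlonglongrightarrow> 0"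
  proof (rule L2_dominated_tendsto[where w="\<lambda>x. (norm (U x))^2"])
    show "AE x in lborel. (\<lambda>n. clamp_norm (real (Suc n)) (U x)) \<longlonglongrightarrow> U x"
    proof (intro AE_I2 tendsto_eventually)
      fix x
      obtain N where N: "norm (U x) \<le> real N" using real_arch_simple by blast
      show "\<forall>\<^sub>F n in sequentially. clamp_norm (real (Suc n)) (U x) = U x"
      proof (rule eventually_sequentiallyI[of N])
        fix n assume "N \<le> n"
        then have "norm (U x) \<le> real (Suc n)" using N by linarith
        then show "clamp_norm (real (Suc n)) (U x) = U x" by (intro clamp_norm(2)) auto
      qed
    qed
    show "AE x in lborel. (norm (clamp_norm (real (Suc n)) (U x) - U x))^2 \<le> (norm (U x))^2" for n
      by (auto intro!: AE_I2 power_mono clamp_norm(3))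
  qed (use L2_integrable[OF U(1)] in auto)
  from eventually_happens'[OF sequentially_bot order_tendstoD(2)[OF this half_gt_zero[OF e]]]
  obtain n where n: "nR (\<lambda>x. clamp_norm (real (Suc n)) (U x) - U x) < e / 2" by blast
  define B where "B = real (Suc n)"
  have B: "B > 0" by (simp add: B_def)
  define V where "V x = clamp_norm B (U x)" for x
  have [measurable]: "V \<in> borel_measurable borel" unfolding V_def B_def by measurable
  have V0: "V x = 0" if "x \<notin> cball 0 R" for x using U(2)[OF that] by (simp add: V_def clamp_norm_def)
  have VL2: "V \<in> L2 lborel"
  proof (rule L2_dominated[OF _ U(1)])
    have "norm (V x) \<le> norm (U x)" for x
      using B mult_right_mono[of "B / max B (norm (U x))" 1 "norm (U x)"] by (simp add: V_def clamp_norm_def)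
    then show "AE x in lborel. norm (V x) \<le> 1 * norm (U x)" by simp
  qed simp
  have "U measurable_on UNIV" by (intro lebesgue_measurable_imp_measurable_on measurable_completion) auto
  then obtain Z g where Z: "negligible Z" "\<And>k. continuous_on UNIV (g k)"
    "\<And>x. x \<notin> Z \<Longrightarrow> (\<lambda>k::nat. g k x) \<longlonglongrightarrow> U x" unfolding measurable_on_def by auto
  define h where "h k x = bump 0 R (2 * R) x *\<^sub>R clamp_norm B (g k x)" for k x
  have cg: "continuous_on UNIV (\<lambda>x. clamp_norm B (g k x))" for k
    using continuous_on_compose2[OF clamp_norm(4)[OF B, of UNIV] Z(2)[of k]] by simp
  have hc: "continuous_on UNIV (h k)" for k
    unfolding h_def by (intro continuous_intros cg Ck_continuous[OF smooth_Ck[OF smooth_bump]])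
  have h0: "h k x = 0" if "x \<notin> cball 0 (2 * R)" for k x using bump_eq_0[of R "2 * R" x 0] that R by (simp add: h_def)
  have "(\<lambda>k. dR (h k) V) \<longlonglongrightarrow> 0"
  proof (rule L2_dominated_tendsto[where w="\<lambda>x. indicator (cball 0 (2 * R)) x * (2 * B)^2"])
    show "AE x in lborel. (\<lambda>k. h k x) \<longlonglongrightarrow> V x"
    proof -
      have "AE x in lebesgue. x \<notin> Z" using Z(1) by (intro AE_not_in) (simp add: negligible_iff_null_sets)
      then have "AE x in lborel. x \<notin> Z" by (simp add: AE_completion_iff)
      then show ?thesis
      proof eventually_elim
        case (elim x)
        have "(\<lambda>k. clamp_norm B (g k x)) \<longlonglongrightarrow> V x" unfolding V_def
          by (rule continuous_on_tendsto_compose[OF clamp_norm(4)[OF B, of UNIV] Z(3)[OF elim]]) auto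
        then have *: "(\<lambda>k. h k x) \<longlonglongrightarrow> bump 0 R (2 * R) x *\<^sub>R V x" unfolding h_def by (intro tendsto_intros)
        have "bump 0 R (2 * R) x *\<^sub>R V x = V x" using V0[of x] bump_eq_1[of R "2 * R" x 0] R by (cases "x \<in> cball 0 R") auto
        with * show ?case by simp
      qed
    qed
    fix k
    have "(norm (h k x - V x))^2 \<le> indicator (cball 0 (2 * R)) x * (2 * B)^2" for x
    proof (cases "x \<in> cball 0 (2 * R)")
      case True
      have "norm (h k x) \<le> 1 * B" unfolding h_def norm_scaleR using bump_bounds[of 0 R "2 * R" x] clamp_norm(1)[OF B]
        by (intro mult_mono) auto
      then have "norm (h k x - V x) \<le> 2 * B"
        using clamp_norm(1)[OF B, of "U x"] norm_triangle_ineq4[of "h k x" "V x"] by (simp add: V_def)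
      then have "(norm (h k x - V x))^2 \<le> (2 * B)^2" by (intro power_mono) auto
      then show ?thesis using True by simp
    next
      case False
      then have "V x = 0" using R by (intro V0) auto
      then show ?thesis using h0[OF False] False by simp
    qed
    then show "AE x in lborel. (norm (h k x - V x))^2 \<le> indicator (cball 0 (2 * R)) x * (2 * B)^2" by simp
  qed (use hc emeasure_compact_finite[of "cball (0::real^'n) (2 * R)"] in \<open>auto intro!: borel_measurable_continuous_onI\<close>)
  from eventually_happens'[OF sequentially_bot order_tendstoD(2)[OF this half_gt_zero[OF e]]]
  obtain k where k: "dR (h k) V < e / 2" by blast
  have hL2: "h k \<in> L2 lborel" by (rule L2_compact_support[OF hc compact_cball h0])
  have "dR U (h k) \<le> dR U V + dR V (h k)" by (rule L2_norm_triangle_diff[OF U(1) VL2 hL2])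
  moreover have "dR U V < e / 2"
  proof -
    have "dR V U < e / 2" using n by (simp only: V_def B_def)
    then show ?thesis by (simp only: L2_norm_minus_commute[of lborel U V])
  qed
  moreover have "dR V (h k) < e / 2" using k unfolding L2_norm_minus_commute[of lborel V "h k"] .
  ultimately have "dR U (h k) < e" by linarith
  moreover have "\<forall>x. x \<notin> cball 0 (2 * R) \<longrightarrow> h k x = 0" using h0 by simp
  ultimately show ?thesis using hc by (intro exI[of _ "h k"] conjI)
qed

lemma uniformly_continuous_compact_support:
  fixes g :: "'a::euclidean_space \<Rightarrow> 'b::real_normed_vector"
  assumes g: "continuous_on UNIV g" "\<And>x. x \<notin> cball c R \<Longrightarrow> g x = 0" and e: "e > 0"
  shows "\<exists>d>0. \<forall>x y. dist x y < d \<longrightarrow> dist (g x) (g y) < e"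
proof -
  have "uniformly_continuous_on (cball c (R + 1)) g"
    by (rule compact_uniformly_continuous[OF continuous_on_subset[OF g(1)] compact_cball]) simp
  then obtain d where d: "d > 0" "\<And>x y. x \<in> cball c (R + 1) \<Longrightarrow> y \<in> cball c (R + 1) \<Longrightarrow> dist y x < d \<Longrightarrow> dist (g y) (g x) < e"
    using e unfolding uniformly_continuous_on_def by metis
  have "dist (g x) (g y) < e" if "dist x y < min d 1" for x y
  proof (cases "x \<in> cball c R \<or> y \<in> cball c R")
    case True
    then have "x \<in> cball c (R + 1)" "y \<in> cball c (R + 1)"
      using that dist_triangle[of c x y] dist_triangle[of c y x] by (auto simp: dist_commute)
    then show ?thesis using d(2)[of y x] that by simp
  next
    case False
    then show ?thesis using g(2)[of x] g(2)[of y] e by simp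
  qed
  then show ?thesis using d(1) by (intro exI[of _ "min d 1"]) auto
qed

lemma lborel_translate:
  fixes f :: "'a::euclidean_space \<Rightarrow> ennreal"
  assumes "f \<in> borel_measurable borel"
  shows "(\<integral>\<^sup>+x. f (x - y) \<partial>lborel) = (\<integral>\<^sup>+x. f x \<partial>lborel)"
proof -
  have "(\<integral>\<^sup>+x. f x \<partial>lborel) = (\<integral>\<^sup>+x. f x \<partial>distr lborel borel ((+) (- y)))" by (simp only: lborel_distr_plus)
  also have "\<dots> = (\<integral>\<^sup>+x. f (x - y) \<partial>lborel)" using assms by (subst nn_integral_distr) auto
  finally show ?thesis ..
qed

lemma L2_translate:
  fixes U :: "'a::euclidean_space \<Rightarrow> complex"
  assumes U: "U \<in> L2 lborel"
  shows "(\<lambda>x. U (x - y)) \<in> L2 lborel" "nR (\<lambda>x. U (x - y)) = nR U"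
proof -
  have m [measurable]: "U \<in> borel_measurable borel" using L2_measurable[OF U] by simp
  have eq: "(\<integral>\<^sup>+x. ennreal ((norm (U (x - y)))^2) \<partial>lborel) = ennreal ((nR U)^2)"
    using lborel_translate[of "\<lambda>x. ennreal ((norm (U x))^2)" y] L2_nn_integral(3)[OF _ U] by simp
  show 1: "(\<lambda>x. U (x - y)) \<in> L2 lborel" by (rule L2_nn_integral(1)[where B="nR U"]) (simp_all add: eq)
  have "ennreal ((nR (\<lambda>x. U (x - y)))^2) = ennreal ((nR U)^2)" using L2_nn_integral(3)[OF _ 1] eq by simp
  then show "nR (\<lambda>x. U (x - y)) = nR U" by (simp add: power2_eq_iff_nonneg)
qed

text \<open>Uniform continuity settles the case of an approximating continuous function of compact
  support, and translation preserves the L2 norm of the error.\<close>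

lemma L2_translation_continuous:
  fixes U :: "real^'n \<Rightarrow> complex"
  assumes U: "U \<in> L2 lborel" "\<And>x. x \<notin> cball 0 R \<Longrightarrow> U x = 0" and R: "R > 0" and e: "e > 0"
  shows "\<exists>d>0. \<forall>y. norm y < d \<longrightarrow> nR (\<lambda>x. U (x - y) - U x) \<le> e"
proof -
  obtain g where g: "continuous_on UNIV g" "\<And>x. x \<notin> cball 0 (2 * R) \<Longrightarrow> g x = 0"
    "dR U g < e / 3" using L2_continuous_approx[OF U R, of "e / 3"] e by auto
  have gL2: "g \<in> L2 lborel" by (rule L2_compact_support[OF g(1) compact_cball g(2)])
  have [measurable]: "g \<in> borel_measurable borel" using g(1) by (rule borel_measurable_continuous_onI)
  define v where "v = measure lborel (cball (0::real^'n) (2 * R + 1)) + 1"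
  have v: "v > 0" by (simp add: v_def add_nonneg_pos)
  \<comment> \<open>Chosen so that \<open>v * e'\<^sup>2 = (e / 3)^2\<close>, where \<open>v\<close>
    exceeds the volume of the ball that carries the translated difference of
    \<open>g\<close>.\<close>
  define e' where "e' = e / (3 * sqrt v)"
  have e': "e' > 0" using e v by (simp add: e'_def)
  obtain d where d: "d > 0" "\<And>x y. dist x y < d \<Longrightarrow> dist (g x) (g y) < e'"
    using uniformly_continuous_compact_support[OF g(1,2) e'] by blast
  have "nR (\<lambda>x. U (x - y) - U x) \<le> e" if y: "norm y < min d 1" for y
  proof -
    have gy: "nR (\<lambda>x. g (x - y) - g x) \<le> e / 3"
    proof -
      have "(nR (\<lambda>x. g (x - y) - g x))^2 \<le> (\<integral>x. indicator (cball 0 (2 * R + 1)) (x::real^'n) * e'\<^sup>2 \<partial>lborel)"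
        unfolding L2_norm_squared
      proof (rule Bochner_Integration.integral_mono)
        have "(\<lambda>x. g (x - y) - g x) \<in> L2 lborel" using L2_diff[OF L2_translate(1)[OF gL2, of y] gL2] .
        then show "integrable lborel (\<lambda>x. (norm (g (x - y) - g x))^2)" by (rule L2_integrable)
        show "integrable lborel (\<lambda>x::real^'n. indicator (cball 0 (2 * R + 1)) x * e'\<^sup>2)"
          using emeasure_compact_finite[of "cball (0::real^'n) (2 * R + 1)"]
          by (intro integrable_mult_left integrable_real_indicator) auto
        fix x :: "real^'n"
        show "(norm (g (x - y) - g x))^2 \<le> indicator (cball 0 (2 * R + 1)) x * e'\<^sup>2"
        proof (cases "x \<in> cball 0 (2 * R + 1)")
          case True
          have "dist (x - y) x < d" using y by (simp add: dist_norm)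
          then have "norm (g (x - y) - g x) \<le> e'" using d(2)[of "x - y" x] by (simp add: dist_norm)
          then have "(norm (g (x - y) - g x))^2 \<le> e'\<^sup>2" by (intro power_mono) auto
          then show ?thesis using True by simp
        next
          case False
          then have "x \<notin> cball 0 (2 * R)" "x - y \<notin> cball 0 (2 * R)" using y norm_triangle_ineq2[of x y] by auto
          then show ?thesis using g(2) False by simp
        qed
      qed
      also have "\<dots> \<le> v * e'\<^sup>2" by (simp add: v_def distrib_right)
      also have "\<dots> = (e / 3)^2" using v by (simp add: e'_def power_divide power_mult_distrib)
      finally show ?thesis by (rule power2_le_imp_le) (use e in simp)
    qed
    note U1 = L2_translate(1)[OF U(1), of y] and g1 = L2_translate(1)[OF gL2, of y]
    have "nR (\<lambda>x. U (x - y) - g (x - y)) < e / 3"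
      by (rule ord_eq_less_trans[OF L2_translate(2)[OF L2_diff[OF U(1) gL2], of y] g(3)])
    moreover have "nR (\<lambda>x. U (x - y) - U x)
        \<le> nR (\<lambda>x. U (x - y) - g (x - y)) + nR (\<lambda>x. g (x - y) - U x)" by (rule L2_norm_triangle_diff[OF U1 g1 U(1)])
    moreover have "nR (\<lambda>x. g (x - y) - U x)
        \<le> nR (\<lambda>x. g (x - y) - g x) + dR g U" by (rule L2_norm_triangle_diff[OF g1 gL2 U(1)])
    ultimately show ?thesis using gy g(3) by (simp add: L2_norm_minus_commute[of _ g U])
  qed
  then show ?thesis using d(1) by (intro exI[of _ "min d 1"]) auto
qed

section \<open>Convolution with smooth kernels\<close>

definition convolve :: "(real^'n \<Rightarrow> real) \<Rightarrow> (real^'n \<Rightarrow> complex) \<Rightarrow> real^'n \<Rightarrow> complex" where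
  "convolve ker U x = (\<integral>z. ker (x - z) *\<^sub>R U z \<partial>lborel)"

definition mollifier :: "(real^'n \<Rightarrow> real) \<Rightarrow> bool" where
  "mollifier ker \<longleftrightarrow> smooth ker \<and> (\<forall>x. 0 \<le> ker x) \<and> (\<integral>x. ker x \<partial>lborel) = 1"

text \<open>The centre \<open>a\<close> is free because kernels shifted away from the origin are
  used near the boundary, where values must be taken from inside \<open>D\<close>.\<close>

lemma mollifier_exists:
  fixes a :: "real^'n"
  assumes r: "r > 0"
  shows "\<exists>ker. mollifier ker \<and> (\<forall>x. x \<notin> cball a r \<longrightarrow> ker x = 0)"
proof -
  define b where "b = bump a (r / 2) r"
  define I where "I = (\<integral>x. b x \<partial>lborel)"
  have bc: "continuous_on UNIV b" unfolding b_def by (rule Ck_continuous[OF smooth_Ck[OF smooth_bump]])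
  have b0: "b x = 0" if "x \<notin> cball a r" for x
    using that r bump_eq_0[of "r / 2" r x a] by (simp add: b_def dist_norm norm_minus_commute)
  have bi: "integrable lborel b" by (rule integrable_compact_support[OF bc compact_cball b0])
  have "I > 0"
  proof -
    have "I \<ge> 0" unfolding I_def by (intro Bochner_Integration.integral_nonneg) (simp add: b_def bump_bounds)
    moreover have "I \<noteq> 0"
    proof
      assume "I = 0"
      then have "AE x in lborel. b x = 0"
        unfolding I_def by (subst (asm) integral_nonneg_eq_0_iff_AE[OF bi]) (auto simp: b_def bump_bounds)
      moreover have "b x = 1" if "x \<in> ball a (r / 2)" for x
        using that r bump_eq_1[of "r / 2" r x a] by (simp add: b_def dist_norm norm_minus_commute)
      ultimately have "AE x in lborel. x \<notin> ball a (r / 2)" by (auto elim!: eventually_mono)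
      then have "emeasure lborel (ball a (r / 2)) = 0" by (subst (asm) AE_iff_measurable[of "ball a (r / 2)"]) auto
      then have "negligible (ball a (r / 2))" by (simp add: negligible_iff_emeasure0)
      then show False using r open_not_negligible[of "ball a (r / 2)"] by auto
    qed
    ultimately show ?thesis by simp
  qed
  moreover have "smooth (\<lambda>x. inverse I * b x)"
    using smooth_bump[of a "r / 2" r] unfolding smooth_def b_def by (auto intro!: Ck_mult Ck_const)
  moreover from \<open>I > 0\<close> have "(\<integral>x. inverse I * b x \<partial>lborel) = 1" by (simp add: I_def[symmetric])
  moreover have "0 \<le> inverse I * b x" for x using \<open>I > 0\<close> by (simp add: b_def bump_bounds)
  ultimately show ?thesis using b0 by (intro exI[of _ "\<lambda>x. inverse I * b x"]) (simp add: mollifier_def)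
qed

context
  fixes ker :: "real^'n \<Rightarrow> real" and c :: "real^'n" and R :: real
  assumes kerc: "continuous_on UNIV ker" and ker0: "\<And>x. x \<notin> cball c R \<Longrightarrow> ker x = 0"
begin

lemma kernel_bound: obtains C where "C \<ge> 0" "\<And>x. \<bar>ker x\<bar> \<le> C"
proof -
  obtain C where "C \<ge> 0" "\<And>x. x \<in> cball c R \<Longrightarrow> norm (ker x) \<le> C"
    by (rule continuous_on_compact_bound[OF continuous_on_subset[OF kerc] compact_cball]) auto
  then have "\<bar>ker x\<bar> \<le> C" for x using ker0[of x] by (cases "x \<in> cball c R") auto
  with \<open>C \<ge> 0\<close> show ?thesis by (rule that)
qed

lemma kernel_measurable [measurable]: "ker \<in> borel_measurable borel" using kerc by (rule borel_measurable_continuous_onI)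

lemma convolve_integrable:
  fixes U :: "real^'n \<Rightarrow> complex"
  assumes U: "integrable lborel U"
  shows "integrable lborel (\<lambda>z. ker (x - z) *\<^sub>R U z)"
proof -
  obtain C where C: "C \<ge> 0" "\<And>x. \<bar>ker x\<bar> \<le> C" using kernel_bound by blast
  have [measurable]: "U \<in> borel_measurable borel" using U by auto
  show ?thesis
  proof (rule Bochner_Integration.integrable_bound[where f="\<lambda>z. C * norm (U z)"])
    show "AE z in lborel. norm (ker (x - z) *\<^sub>R U z) \<le> norm (C * norm (U z))" using C by (auto intro!: AE_I2 mult_right_mono)
  qed (use U in auto)
qed

lemma convolve_flip:
  assumes [measurable]: "U \<in> borel_measurable borel"
  shows "convolve ker U x = (\<integral>y. ker y *\<^sub>R U (x - y) \<partial>lborel)"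
proof -
  have "lborel = distr lborel borel (\<lambda>y. x - y)" using lborel_affine[of "-1" x] by (simp add: density_1)
  then have "convolve ker U x = (\<integral>z. ker (x - z) *\<^sub>R U z \<partial>distr lborel borel (\<lambda>y. x - y))" by (simp add: convolve_def)
  also have "\<dots> = (\<integral>y. ker y *\<^sub>R U (x - y) \<partial>lborel)" by (subst integral_distr) auto
  finally show ?thesis .
qed

lemma convolve_continuous:
  assumes U: "integrable lborel U"
  shows "continuous_on UNIV (convolve ker U)"
proof -
  define I where "I = (\<integral>z. norm (U z) \<partial>lborel) + 1"
  have I: "I > 0" by (simp add: I_def add_nonneg_pos)
  have "\<exists>d>0. \<forall>y. dist y x < d \<longrightarrow> dist (convolve ker U y) (convolve ker U x) < e" if e: "e > 0" for x e
  proof -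
    obtain d where d: "d > 0" "\<And>x y. dist x y < d \<Longrightarrow> dist (ker x) (ker y) < e / I"
      using uniformly_continuous_compact_support[OF kerc ker0 divide_pos_pos[OF e I]] by blast
    have "dist (convolve ker U y) (convolve ker U x) < e" if y: "dist y x < d" for y
    proof -
      have "norm (convolve ker U y - convolve ker U x) = norm (\<integral>z. (ker (y - z) - ker (x - z)) *\<^sub>R U z \<partial>lborel)"
        unfolding convolve_def
        by (subst Bochner_Integration.integral_diff[symmetric]) (auto intro!: convolve_integrable U simp: scaleR_diff_left)
      also have "\<dots> \<le> (\<integral>z. (e / I) * norm (U z) \<partial>lborel)"
      proof (rule norm_integral_le_integral)
        show "integrable lborel (\<lambda>z. (ker (y - z) - ker (x - z)) *\<^sub>R U z)"
          unfolding scaleR_diff_left by (intro Bochner_Integration.integrable_diff convolve_integrable U)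
        fix z
        have "\<bar>ker (y - z) - ker (x - z)\<bar> \<le> e / I" using d(2)[of "y - z" "x - z"] y by (simp add: dist_norm)
        then show "norm ((ker (y - z) - ker (x - z)) *\<^sub>R U z) \<le> (e / I) * norm (U z)"
          unfolding norm_scaleR by (intro mult_right_mono) auto
      qed (use U in simp)
      also have "\<dots> = (e / I) * (I - 1)" by (simp add: I_def)
      also have "\<dots> < e" using I e by (simp add: field_simps)
      finally show ?thesis by (simp add: dist_norm)
    qed
    then show ?thesis using d(1) by blast
  qed
  then show ?thesis unfolding continuous_on_iff by auto
qed

end

lemma partial_support:
  assumes "\<And>x. x \<notin> cball c R \<Longrightarrow> f x = 0" "x \<notin> cball c R"
  shows "partial i f x = 0" by (rule partial_eq_0[of "- cball c R"]) (use assms in auto)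

text \<open>Uniform continuity of the partial derivatives of the kernel makes its first-order Taylor
  remainder small uniformly in the base point, so the remainder can be integrated against
  \<open>U\<close>.\<close>

lemma convolve_has_derivative:
  fixes ker :: "real^'n \<Rightarrow> real"
  assumes ker: "Ck 1 ker" "\<And>x. x \<notin> cball c R \<Longrightarrow> ker x = 0" and U: "integrable lborel U"
  shows "(convolve ker U has_derivative (\<lambda>h. \<Sum>i\<in>UNIV. h $ i *\<^sub>R convolve (partial i ker) U x)) (at x)"
proof -
  note kerc = Ck_continuous[OF ker(1), of UNIV]
  have pc: "continuous_on UNIV (partial i ker)" and dker: "ker differentiable (at x)" for i x using ker(1) by auto
  have p0: "partial i ker x = 0" if "x \<notin> cball c R" for i x by (rule partial_support[OF ker(2) that])
  define I where "I = (\<integral>z. norm (U z) \<partial>lborel) + 1"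
  have I: "I > 0" by (simp add: I_def add_nonneg_pos)
  have lin: "bounded_linear (\<lambda>h. \<Sum>i\<in>UNIV. h $ i *\<^sub>R convolve (partial i ker) U x)"
    by (intro bounded_linear_sum bounded_linear_scaleR_const bounded_linear_vec_nth)
  have "\<exists>d>0. \<forall>y. norm (y - x) < d \<longrightarrow> norm (convolve ker U y - convolve ker U x
      - (\<Sum>i\<in>UNIV. (y - x) $ i *\<^sub>R convolve (partial i ker) U x)) \<le> e * norm (y - x)" if e: "e > 0" for e
  proof -
    \<comment> \<open>One factor of the denominator distributes \<open>e\<close> over the
      coordinates, the other over a bound for the integral of \<open>norm (U z)\<close>.\<close>
    define e' where "e' = e / (I * real CARD('n))"
    have e': "e' > 0" using e I by (simp add: e'_def)
    have "\<exists>d>0. \<forall>x y. dist x y < d \<longrightarrow> dist (partial i ker x) (partial i ker y) < e'" for i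
      by (rule uniformly_continuous_compact_support[OF pc p0 e'])
    then obtain d where d: "\<And>i. d i > 0" "\<And>i x y. dist x y < d i \<Longrightarrow> dist (partial i ker x) (partial i ker y) < e'" by metis
    define d0 where "d0 = Min (range d)"
    have d0: "d0 > 0" "\<And>i. d0 \<le> d i" using d(1) by (auto simp: d0_def)
    have rem: "\<bar>ker (w + h) - ker w - (\<Sum>i\<in>UNIV. h $ i * partial i ker w)\<bar> \<le> (e / I) * norm h"
      if h: "norm h < d0" for w h
    proof -
      let ?f = "\<lambda>y. ker y - (\<Sum>i\<in>UNIV. (y - w) $ i * partial i ker w)"
      have "norm (?f (w + h) - ?f w) \<le> (e / I) * norm (w + h - w)"
      proof (rule differentiable_bound[where S="ball w d0" and
            f'="\<lambda>y k. \<Sum>i\<in>UNIV. k $ i *\<^sub>R (partial i ker y - partial i ker w)"])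
        fix y assume y: "y \<in> ball w d0"
        show "(?f has_derivative (\<lambda>k. \<Sum>i\<in>UNIV. k $ i *\<^sub>R (partial i ker y - partial i ker w))) (at y within ball w d0)"
          using has_derivative_at_withinI[OF has_derivative_partial[OF dker], of y "ball w d0"]
          by (auto intro!: derivative_eq_intros bounded_linear_imp_has_derivative[OF bounded_linear_vec_nth]
              simp: sum_subtractf algebra_simps)
        show "onorm (\<lambda>k. \<Sum>i\<in>UNIV. k $ i *\<^sub>R (partial i ker y - partial i ker w)) \<le> e / I"
        proof (rule onorm_bound)
          fix k :: "real^'n"
          have "norm (\<Sum>i\<in>UNIV. k $ i *\<^sub>R (partial i ker y - partial i ker w)) \<le> (\<Sum>i\<in>(UNIV::'n set). norm k * e')"
          proof (intro order_trans[OF norm_sum] sum_mono)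
            fix i
            have "dist y w < d i" using y d0(2)[of i] by (simp add: dist_commute)
            then have "\<bar>partial i ker y - partial i ker w\<bar> \<le> e'" using d(2)[of y w i] by (simp add: dist_norm)
            then show "norm (k $ i *\<^sub>R (partial i ker y - partial i ker w)) \<le> norm k * e'"
              using component_le_norm_cart[of k i] by (simp add: abs_mult mult_mono)
          qed
          also have "\<dots> = e / I * norm k" by (simp add: e'_def)
          finally show "norm (\<Sum>i\<in>UNIV. k $ i *\<^sub>R (partial i ker y - partial i ker w)) \<le> e / I * norm k" .
        qed (use e I in simp)
      qed (use h d0 in \<open>auto simp: dist_norm\<close>)
      then show ?thesis by simp
    qed
    have "norm (convolve ker U y - convolve ker U x
      - (\<Sum>i\<in>UNIV. (y - x) $ i *\<^sub>R convolve (partial i ker) U x)) \<le> e * norm (y - x)" if y: "norm (y - x) < d0" for y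
    proof -
      let ?h = "y - x"
      have int: "integrable lborel (\<lambda>z. (ker (y - z) - ker (x - z) - (\<Sum>i\<in>UNIV. ?h $ i * partial i ker (x - z))) *\<^sub>R U z)"
        unfolding scaleR_diff_left scaleR_sum_left scaleR_scaleR[symmetric]
        by (intro Bochner_Integration.integrable_diff Bochner_Integration.integrable_sum integrable_scaleR_right
            convolve_integrable[OF kerc ker(2) U] convolve_integrable[OF pc p0 U])
      have "convolve ker U y - convolve ker U x - (\<Sum>i\<in>UNIV. ?h $ i *\<^sub>R convolve (partial i ker) U x)
        = (\<integral>z. (ker (y - z) - ker (x - z) - (\<Sum>i\<in>UNIV. ?h $ i * partial i ker (x - z))) *\<^sub>R U z \<partial>lborel)"
      proof -
        note A = convolve_integrable[OF kerc ker(2) U]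
        have S: "integrable lborel (\<lambda>z. ?h $ i *\<^sub>R partial i ker (x - z) *\<^sub>R U z)" for i
          by (intro integrable_scaleR_right convolve_integrable[OF pc p0 U])
        have "(ker (y - z) - ker (x - z) - (\<Sum>i\<in>UNIV. ?h $ i * partial i ker (x - z))) *\<^sub>R U z
            = ker (y - z) *\<^sub>R U z - ker (x - z) *\<^sub>R U z - (\<Sum>i\<in>UNIV. ?h $ i *\<^sub>R partial i ker (x - z) *\<^sub>R U z)" for z
          unfolding scaleR_diff_left scaleR_sum_left scaleR_scaleR ..
        then show ?thesis unfolding convolve_def
          by (simp only: Bochner_Integration.integral_diff[OF Bochner_Integration.integrable_diff[OF A A] Bochner_Integration.integrable_sum[OF S]]
            Bochner_Integration.integral_diff[OF A A] Bochner_Integration.integral_sum[OF S] integral_scaleR_right)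
      qed
      also have "norm \<dots> \<le> (\<integral>z. ((e / I) * norm ?h) * norm (U z) \<partial>lborel)"
      proof (rule norm_integral_le_integral[OF int])
        fix z
        show "norm ((ker (y - z) - ker (x - z) - (\<Sum>i\<in>UNIV. ?h $ i * partial i ker (x - z))) *\<^sub>R U z) \<le> ((e / I) * norm ?h) * norm (U z)"
        proof -
          have "x - z + ?h = y - z" by simp
          then have "\<bar>ker (y - z) - ker (x - z) - (\<Sum>i\<in>UNIV. ?h $ i * partial i ker (x - z))\<bar> \<le> (e / I) * norm ?h"
            using rem[OF y, of "x - z"] by (simp only:)
          then show ?thesis unfolding norm_scaleR real_norm_def by (rule mult_right_mono) simp
        qed
      qed (use U in simp)
      also have "\<dots> = ((e / I) * norm ?h) * (I - 1)" by (simp add: I_def)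
      also have "\<dots> \<le> ((e / I) * norm ?h) * I" using e I by (intro mult_left_mono) auto
      also have "\<dots> = e * norm ?h" using I by simp
      finally show ?thesis .
    qed
    then show ?thesis using d0(1) by blast
  qed
  then show ?thesis using lin by (auto simp: has_derivative_at_alt)
qed

lemma partial_convolve:
  assumes "Ck 1 ker" "\<And>x. x \<notin> cball c R \<Longrightarrow> ker x = 0" "integrable lborel U"
  shows "partial i (convolve ker U) x = convolve (partial i ker) U x"
proof -
  have "(\<Sum>j\<in>UNIV. axis i (1::real) $ j *\<^sub>R convolve (partial j ker) U x)
    = (\<Sum>j\<in>UNIV. if j = i then convolve (partial j ker) U x else 0)" by (intro sum.cong) (auto simp: axis_def)
  then show ?thesis using partial_eqI[where i=i, OF convolve_has_derivative[OF assms]] by simp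
qed

text \<open>All derivatives fall on the kernel, so integrability of \<open>U\<close> is enough for
  every order \<open>k\<close>.\<close>

lemma Ck_convolve:
  "Ck k ker \<Longrightarrow> (\<And>x. x \<notin> cball c R \<Longrightarrow> ker x = 0) \<Longrightarrow> integrable lborel U \<Longrightarrow> Ck k (convolve ker U)"
proof (induction k arbitrary: ker)
  case 0
  then show ?case using convolve_continuous[of ker c R U] by simp
next
  case (Suc k)
  have C1: "Ck 1 ker" using Suc.prems(1) Ck_mono by fastforce
  have "partial i (convolve ker U) = convolve (partial i ker) U" for i using partial_convolve[OF C1 Suc.prems(2,3)] by blast
  moreover have "Ck k (convolve (partial i ker) U)" for i
    using Suc.prems by (intro Suc.IH) (auto intro: partial_support[OF Suc.prems(2)])
  moreover have "convolve ker U differentiable (at x)" for x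
    using convolve_has_derivative[OF C1 Suc.prems(2,3)] by (auto simp: differentiable_def)
  ultimately show ?case by simp
qed

text \<open>Cauchy-Schwarz with the weight split as \<open>sqrt (ker y) * sqrt (ker y)\<close>,
  followed by Fubini. The general \<open>W\<close> covers both the convolution and its difference
  from \<open>U\<close>, and the slices are bounded only where the kernel is nonzero.\<close>

lemma L2_average_bound:
  fixes W :: "real^'n \<Rightarrow> real^'n \<Rightarrow> complex"
  assumes ker: "mollifier ker" and [measurable]: "case_prod W \<in> borel_measurable (borel \<Otimes>\<^sub>M borel)"
    and B: "\<And>y. ker y \<noteq> 0 \<Longrightarrow> (\<lambda>x. W x y) \<in> L2 lborel \<and> nR (\<lambda>x. W x y) \<le> B" "B \<ge> 0"
  shows "(\<integral>\<^sup>+x. ennreal ((norm (\<integral>y. ker y *\<^sub>R W x y \<partial>lborel))^2) \<partial>lborel) \<le> ennreal (B^2)"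
proof -
  have ker': "\<And>x. 0 \<le> ker x" "(\<integral>x. ker x \<partial>lborel) = 1" using ker by (auto simp: mollifier_def)
  have [measurable]: "ker \<in> borel_measurable borel"
    using ker by (intro borel_measurable_continuous_onI Ck_continuous[of 0] smooth_Ck) (simp add: mollifier_def)
  have "integrable lborel ker" using ker'(2) not_integrable_integral_eq by fastforce
  then have ker1: "(\<integral>\<^sup>+y. ennreal (ker y) \<partial>lborel) = 1" using ker' by (subst nn_integral_eq_integral) auto
  have pt: "ennreal ((norm (\<integral>y. ker y *\<^sub>R W x y \<partial>lborel))^2) \<le> (\<integral>\<^sup>+y. ennreal (ker y) * ennreal ((norm (W x y))^2) \<partial>lborel)" for x
  proof -
    have "ennreal (norm (\<integral>y. ker y *\<^sub>R W x y \<partial>lborel)) \<le> (\<integral>\<^sup>+y. ennreal (norm (ker y *\<^sub>R W x y)) \<partial>lborel)"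
    proof (cases "integrable lborel (\<lambda>y. ker y *\<^sub>R W x y)")
      case True then show ?thesis by (rule integral_norm_bound_ennreal)
    next
      \<comment> \<open>A non-integrable integrand has integral 0 by convention.\<close>
      case False then show ?thesis by (simp add: not_integrable_integral_eq)
    qed
    also have "\<dots> = (\<integral>\<^sup>+y. ennreal (sqrt (ker y)) * ennreal (sqrt (ker y) * norm (W x y)) \<partial>lborel)"
      using ker'(1) by (intro nn_integral_cong) (simp add: ennreal_mult[symmetric] mult.assoc[symmetric])
    finally have "(ennreal (norm (\<integral>y. ker y *\<^sub>R W x y \<partial>lborel)))^2
        \<le> (\<integral>\<^sup>+y. ennreal (sqrt (ker y)) * ennreal (sqrt (ker y) * norm (W x y)) \<partial>lborel)^2" by (intro power_mono) auto
    also have "\<dots> \<le> (\<integral>\<^sup>+y. (ennreal (sqrt (ker y)))^2 \<partial>lborel) * (\<integral>\<^sup>+y. (ennreal (sqrt (ker y) * norm (W x y)))^2 \<partial>lborel)"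
      by (rule Cauchy_Schwarz_nn_integral) measurable
    also have "\<dots> = (\<integral>\<^sup>+y. ennreal (ker y) * ennreal ((norm (W x y))^2) \<partial>lborel)"
      using ker'(1) ker1 by (simp add: ennreal_power power_mult_distrib ennreal_mult)
    finally show ?thesis by (simp add: ennreal_power)
  qed
  have "(\<integral>\<^sup>+x. ennreal ((norm (\<integral>y. ker y *\<^sub>R W x y \<partial>lborel))^2) \<partial>lborel)
      \<le> (\<integral>\<^sup>+x. \<integral>\<^sup>+y. ennreal (ker y) * ennreal ((norm (W x y))^2) \<partial>lborel \<partial>lborel)" by (intro nn_integral_mono pt)
  also have "\<dots> = (\<integral>\<^sup>+y. \<integral>\<^sup>+x. ennreal (ker y) * ennreal ((norm (W x y))^2) \<partial>lborel \<partial>lborel)"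
    by (rule lborel_pair.Fubini'[symmetric]) measurable
  also have "\<dots> \<le> (\<integral>\<^sup>+y. ennreal (ker y) * ennreal (B^2) \<partial>lborel)"
  proof (rule nn_integral_mono)
    fix y
    show "(\<integral>\<^sup>+x. ennreal (ker y) * ennreal ((norm (W x y))^2) \<partial>lborel) \<le> ennreal (ker y) * ennreal (B^2)"
    proof (cases "ker y = 0")
      case False
      have "(\<integral>\<^sup>+x. ennreal ((norm (W x y))^2) \<partial>lborel) \<le> ennreal (B^2)"
        using B(1)[OF False] B(2) by (subst L2_nn_integral(3)) (auto intro!: ennreal_leI power_mono)
      then show ?thesis by (subst nn_integral_cmult) (auto intro: mult_left_mono)
    qed simp
  qed
  also have "\<dots> = ennreal (B^2)" by (simp add: nn_integral_multc ker1)
  finally show ?thesis .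
qed

lemma L2_convolve:
  fixes U :: "real^'n \<Rightarrow> complex"
  assumes ker: "mollifier ker" "\<And>x. x \<notin> cball c R \<Longrightarrow> ker x = 0" and U: "U \<in> L2 lborel" "integrable lborel U"
  shows "convolve ker U \<in> L2 lborel" "nR (convolve ker U) \<le> nR U"
    and "(\<And>y. ker y \<noteq> 0 \<Longrightarrow> nR (\<lambda>x. U (x - y) - U x) \<le> B) \<Longrightarrow> B \<ge> 0 \<Longrightarrow>
      dR (convolve ker U) U \<le> B"
proof -
  have kerc: "continuous_on UNIV ker" using ker by (intro Ck_continuous[of 0] smooth_Ck) (simp add: mollifier_def)
  have ker1: "(\<integral>x. ker x \<partial>lborel) = 1" using ker(1) by (simp add: mollifier_def)
  have keri: "integrable lborel ker" by (rule integrable_compact_support[OF kerc compact_cball ker(2)])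
  have [measurable]: "U \<in> borel_measurable borel" using L2_measurable[OF U(1)] by simp
  have flip: "convolve ker U x = (\<integral>y. ker y *\<^sub>R U (x - y) \<partial>lborel)" for x by (rule convolve_flip[OF kerc ker(2)]) measurable
  have [measurable]: "ker \<in> borel_measurable borel" using kerc by (rule borel_measurable_continuous_onI)
  have [measurable]: "convolve ker U \<in> borel_measurable borel"
    by (intro borel_measurable_continuous_onI convolve_continuous[OF kerc ker(2) U(2)])
  have 1: "(\<integral>\<^sup>+x. ennreal ((norm (convolve ker U x))^2) \<partial>lborel) \<le> ennreal ((nR U)^2)"
    unfolding flip by (rule L2_average_bound[OF ker(1)]) (simp_all add: L2_translate[OF U(1)])
  show "convolve ker U \<in> L2 lborel" by (rule L2_nn_integral(1)[OF _ 1]) simp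
  show "nR (convolve ker U) \<le> nR U" by (rule L2_nn_integral(2)[OF _ 1]) simp_all
  assume B: "\<And>y. ker y \<noteq> 0 \<Longrightarrow> nR (\<lambda>x. U (x - y) - U x) \<le> B" "B \<ge> 0"
  have "convolve ker U x - U x = (\<integral>y. ker y *\<^sub>R (U (x - y) - U x) \<partial>lborel)" for x
  proof -
    have i: "integrable lborel (\<lambda>y. ker y *\<^sub>R U (x - y))"
    proof -
      have eq: "lborel = distr lborel borel (\<lambda>y. x - y)" using lborel_affine[of "-1" x] by (simp add: density_1)
      have "integrable (distr lborel borel (\<lambda>y. x - y)) (\<lambda>z. ker (x - z) *\<^sub>R U z)"
        using convolve_integrable[OF kerc ker(2) U(2)] eq by simp
      then show ?thesis by (subst (asm) integrable_distr_eq) simp_all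
    qed
    have "(\<integral>y. ker y *\<^sub>R (U (x - y) - U x) \<partial>lborel) = convolve ker U x - (\<integral>y. ker y *\<^sub>R U x \<partial>lborel)"
      unfolding flip scaleR_diff_right using keri by (intro Bochner_Integration.integral_diff i) simp
    then show ?thesis using keri ker1 by simp
  qed
  moreover have "(\<integral>\<^sup>+x. ennreal ((norm (\<integral>y. ker y *\<^sub>R (U (x - y) - U x) \<partial>lborel))^2) \<partial>lborel) \<le> ennreal (B^2)"
    by (rule L2_average_bound[OF ker(1) _ _ B(2)]) (simp_all add: B(1) L2_diff[OF L2_translate(1)[OF U(1)] U(1)])
  ultimately show "dR (convolve ker U) U \<le> B" using B(2) by (intro L2_nn_integral(2)) auto
qed


subsection \<open>Weak derivatives\<close>

lemma Ck_reflect: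
  fixes f :: "real^'n \<Rightarrow> 'b::real_normed_vector"
  shows "Ck k f \<Longrightarrow> Ck k (\<lambda>z. f (x - z))"
    and "Ck 1 f \<Longrightarrow> partial i (\<lambda>z. f (x - z)) z = - partial i f (x - z)"
proof -
  have d: "((\<lambda>z. f (x - z)) has_derivative (\<lambda>h. frechet_derivative f (at (x - z)) (- h))) (at z)"
    if "f differentiable (at (x - z))" for f :: "real^'n \<Rightarrow> 'b" and z using that frechet_derivative_works
    by (intro has_derivative_compose[of "\<lambda>z. x - z" "\<lambda>h. - h" z UNIV f]) (auto intro!: derivative_eq_intros)
  have p: "partial i (\<lambda>z. f (x - z)) z = - partial i f (x - z)" if "f differentiable (at (x - z))"
    for f :: "real^'n \<Rightarrow> 'b" and z i
    unfolding partial_eqI[OF d[OF that]] linear_neg[OF linear_frechet_derivative[OF that]] partial_def[of i f] ..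
  show "Ck 1 f \<Longrightarrow> partial i (\<lambda>z. f (x - z)) z = - partial i f (x - z)" by (rule p, rule Ck_differentiable[of 0]) simp
  show "Ck k f \<Longrightarrow> Ck k (\<lambda>z. f (x - z))"
  proof (induction k arbitrary: f)
    case 0
    then have "continuous_on UNIV f" by simp
    then have "continuous_on UNIV (\<lambda>z. f (x - z))" by (rule continuous_on_compose2) (auto intro!: continuous_intros)
    then show ?case by simp
  next
    case (Suc k)
    have "partial i (\<lambda>z. f (x - z)) = (\<lambda>z. - partial i f (x - z))" for i using Suc.prems by (intro ext p) auto
    moreover have "Ck k (\<lambda>z. - partial i f (x - z))" for i using Suc.prems by (intro Ck_uminus Suc.IH) auto
    moreover have "(\<lambda>z. f (x - z)) differentiable (at z)" for z
      using d[of f z] Suc.prems unfolding differentiable_def[of "\<lambda>z. f (x - z)"] by auto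
    ultimately show ?case by simp
  qed
qed

lemma test_functionI:
  assumes "smooth \<phi>" "compact K" "K \<subseteq> D" "\<And>x. x \<notin> K \<Longrightarrow> \<phi> x = 0"
  shows "test_function D \<phi>"
proof -
  have sub: "closure {x. \<phi> x \<noteq> 0} \<subseteq> K" using assms(2,4) by (intro closure_minimal compact_imp_closed) auto
  then have "K \<inter> closure {x. \<phi> x \<noteq> 0} = closure {x. \<phi> x \<noteq> 0}" by blast
  then have "compact (closure {x. \<phi> x \<noteq> 0})" using compact_Int_closed[OF assms(2), of "closure {x. \<phi> x \<noteq> 0}"] by simp
  then show ?thesis using sub assms(1,3) by (simp add: test_function_def)
qed

lemma test_functionD:
  assumes "test_function D \<phi>"
  shows "Ck k \<phi>" "x \<notin> D \<Longrightarrow> \<phi> x = 0" "x \<notin> D \<Longrightarrow> partial i \<phi> x = 0"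
proof -
  let ?K = "closure {x. \<phi> x \<noteq> 0}"
  show "Ck k \<phi>" using assms by (simp add: test_function_def smooth_Ck)
  have 0: "\<phi> x = 0" if "x \<notin> ?K" for x using that closure_subset[of "{x. \<phi> x \<noteq> 0}"] by blast
  have sub: "?K \<subseteq> D" using assms by (simp add: test_function_def)
  then show "x \<notin> D \<Longrightarrow> \<phi> x = 0" using 0 by blast
  show "partial i \<phi> x = 0" if "x \<notin> D"
  proof (rule partial_eq_0[of "- ?K"])
    show "\<phi> y = 0" if "y \<in> - ?K" for y using that 0 by blast
    show "x \<in> - ?K" using that sub by blast
  qed (simp_all add: open_Compl)
qed

lemma AE_lebesgue_on_lborel:
  assumes "open D" "AE x in lborel. x \<in> D \<longrightarrow> P x"
  shows "AE x in lebesgue_on D. P x" using assms AE_completion[of "\<lambda>x. x \<in> D \<longrightarrow> P x" lborel] by (subst AE_restrict_space_iff) auto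

lemma L2_restrict:
  fixes F :: "'a::euclidean_space \<Rightarrow> complex"
  assumes D: "open D" and F: "F \<in> L2 lborel"
  shows "F \<in> L2 (lebesgue_on D)" "L2_norm (lebesgue_on D) F \<le> nR F"
    and "(\<And>x. x \<notin> D \<Longrightarrow> F x = 0) \<Longrightarrow> L2_norm (lebesgue_on D) F = nR F"
proof -
  have m [measurable]: "F \<in> borel_measurable borel" using L2_measurable[OF F] by simp
  have i: "integrable lborel (\<lambda>x. indicator D x *\<^sub>R (norm (F x))^2)"
    using D by (intro integrable_mult_indicator[of D] L2_integrable F) auto
  then have "integrable lebesgue (\<lambda>x. indicator D x *\<^sub>R (norm (F x))^2)" using D by (subst integrable_completion) auto
  then have "integrable (lebesgue_on D) (\<lambda>x. (norm (F x))^2)" using D by (subst integrable_restrict_space) auto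
  moreover have "F \<in> borel_measurable (lebesgue_on D)" by (intro measurable_restrict_space1 measurable_completion) auto
  ultimately show "F \<in> L2 (lebesgue_on D)" by (simp add: L2_def)
  have eq: "(L2_norm (lebesgue_on D) F)^2 = (\<integral>x. indicator D x *\<^sub>R (norm (F x))^2 \<partial>lborel)"
    unfolding L2_norm_squared by (rule integral_lebesgue_on_open[OF D]) measurable
  also have "\<dots> \<le> (nR F)^2"
    unfolding L2_norm_squared by (intro Bochner_Integration.integral_mono i L2_integrable F) (auto simp: indicator_def)
  finally show "L2_norm (lebesgue_on D) F \<le> nR F" by (rule power2_le_imp_le) simp
  assume z: "\<And>x. x \<notin> D \<Longrightarrow> F x = 0"
  have "(\<integral>x. indicator D x *\<^sub>R (norm (F x))^2 \<partial>lborel) = (nR F)^2"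
    unfolding L2_norm_squared by (intro Bochner_Integration.integral_cong) (auto simp: indicator_def z)
  then show "L2_norm (lebesgue_on D) F = nR F" using eq by (simp add: power2_eq_iff_nonneg)
qed

text \<open>Members of \<open>L2 (lebesgue_on D)\<close> are only Lebesgue measurable on
  \<open>D\<close>, while convolution and Fubini work with Borel functions on the whole
  space.\<close>

lemma L2_zero_extension:
  fixes U :: "'a::euclidean_space \<Rightarrow> complex"
  assumes D: "open D" and U: "U \<in> L2 (lebesgue_on D)"
  shows "\<exists>V. V \<in> L2 lborel \<and> (\<forall>x. x \<notin> D \<longrightarrow> V x = 0) \<and> (AE x in lebesgue_on D. V x = U x)"
proof -
  have "(\<lambda>x. indicator D x *\<^sub>R U x) \<in> borel_measurable lebesgue"
    using L2_measurable[OF U] D by (subst (asm) borel_measurable_restrict_space_iff) auto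
  then have "(\<lambda>x. Re (indicator D x *\<^sub>R U x)) \<in> borel_measurable lebesgue"
    "(\<lambda>x. Im (indicator D x *\<^sub>R U x)) \<in> borel_measurable lebesgue" by (simp_all only: borel_measurable_complex_iff)
  from this[THEN completion_ex_borel_measurable_real]
  obtain a b where ab: "a \<in> borel_measurable lborel" "b \<in> borel_measurable lborel"
    "AE x in lborel. Re (indicator D x *\<^sub>R U x) = a x" "AE x in lborel. Im (indicator D x *\<^sub>R U x) = b x" by blast
  have [measurable]: "a \<in> borel_measurable borel" "b \<in> borel_measurable borel" using ab by auto
  define V where "V x = indicator D x *\<^sub>R Complex (a x) (b x)" for x
  have [measurable]: "D \<in> sets borel" using D by simp
  have [measurable]: "(\<lambda>x. Complex (a x) (b x)) \<in> borel_measurable borel" by (simp add: borel_measurable_complex_iff)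
  have Vm: "V \<in> borel_measurable borel" unfolding V_def by measurable
  have ae: "AE x in lebesgue_on D. V x = U x"
  proof (rule AE_lebesgue_on_lborel[OF D])
    show "AE x in lborel. x \<in> D \<longrightarrow> V x = U x" using ab(3,4) by eventually_elim (auto simp: V_def complex_eq_iff)
  qed
  have V0: "V x = 0" if "x \<notin> D" for x using that by (simp add: V_def)
  have VL2: "V \<in> L2 (lebesgue_on D)"
    using Vm by (intro L2_cong_AE(1)[OF U _ ae] measurable_restrict_space1 measurable_completion) simp
  have "integrable lebesgue (\<lambda>x. indicator D x *\<^sub>R (norm (V x))^2)"
    using L2_integrable[OF VL2] D by (subst (asm) integrable_restrict_space) auto
  also have "(\<lambda>x. indicator D x *\<^sub>R (norm (V x))^2) = (\<lambda>x. (norm (V x))^2)"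
  proof
    show "indicator D x *\<^sub>R (norm (V x))^2 = (norm (V x))^2" for x using V0[of x] by (cases "x \<in> D") auto
  qed
  finally have "integrable lborel (\<lambda>x. (norm (V x))^2)" using Vm by (subst (asm) integrable_completion) auto
  then have "V \<in> L2 lborel" using Vm by (simp add: L2_def)
  with V0 ae show ?thesis by blast
qed

lemma is_weak_partial_L2: "is_weak_partial D i u v \<Longrightarrow> v \<in> L2 (lebesgue_on D)" by (simp add: is_weak_partial_def)

context C2_domain
begin

abbreviation "LD \<equiv> lebesgue_on D"
abbreviation "SD \<equiv> surface_measure D"
abbreviation "nD \<equiv> L2_norm LD"
abbreviation "nS \<equiv> L2_norm SD"
abbreviation "dD \<equiv> L2_dist LD"
abbreviation "dS \<equiv> L2_dist SD"

lemma finite_LD: "finite_measure LD"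
proof (rule finite_measureI)
  have "emeasure LD (space LD) = emeasure lborel D" using open_D by (simp add: emeasure_restrict_space)
  also have "\<dots> < \<infinity>" using bounded_D by (rule emeasure_bounded_finite)
  finally show "emeasure LD (space LD) \<noteq> \<infinity>" by simp
qed

lemma L2_continuous_D:
  fixes g :: "real^'n \<Rightarrow> complex"
  assumes "continuous_on UNIV g"
  shows "g \<in> L2 LD" "g \<in> L2 SD"
proof -
  have m: "g \<in> borel_measurable borel" using assms by (rule borel_measurable_continuous_onI)
  have c: "continuous_on UNIV (\<lambda>x. (norm (g x))^2)" using assms by (intro continuous_intros)
  show "g \<in> L2 LD"
    using m integrable_continuous_D[OF c] by (auto simp: L2_def intro!: measurable_restrict_space1 measurable_completion)
  show "g \<in> L2 SD" using m integrable_surface_continuous[OF c] by (auto simp: L2_def intro!: measurable_surface_measure)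
qed

lemma L2_test:
  assumes "test_function D \<phi>"
  shows "(\<lambda>x. of_real (\<phi> x) :: complex) \<in> L2 LD" "(\<lambda>x. of_real (partial i \<phi> x) :: complex) \<in> L2 LD"
proof -
  have "continuous_on UNIV \<phi>" "continuous_on UNIV (partial i \<phi>)"
    using test_functionD(1)[OF assms, of 0] test_functionD(1)[OF assms, of "Suc 0"] by auto
  then have "continuous_on UNIV (\<lambda>x. of_real (\<phi> x) :: complex)" "continuous_on UNIV (\<lambda>x. of_real (partial i \<phi> x) :: complex)"
    by (auto intro: continuous_on_of_real)
  then show "(\<lambda>x. of_real (\<phi> x) :: complex) \<in> L2 LD" "(\<lambda>x. of_real (partial i \<phi> x) :: complex) \<in> L2 LD"
    by (simp_all add: L2_continuous_D)
qed

lemma D_bound: obtains R where "R > 0" "D \<subseteq> cball 0 R"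
proof -
  obtain R where R: "R > 0" "\<forall>x\<in>D. norm x \<le> R" using bounded_D unfolding bounded_pos by blast
  then have "D \<subseteq> cball 0 R" by auto
  then show ?thesis using that R(1) by blast
qed

lemma integrable_zero_extension:
  assumes "V \<in> L2 lborel" "\<And>x. x \<notin> D \<Longrightarrow> V x = 0"
  shows "integrable lborel V"
proof -
  obtain R where R: "R > 0" "D \<subseteq> cball 0 R" by (rule D_bound)
  have "(\<lambda>x::real^'n. indicator (cball 0 R) x *\<^sub>R (1::complex)) \<in> L2 lborel"
  proof -
    have "integrable lborel (\<lambda>x::real^'n. (norm (indicator (cball 0 R) x *\<^sub>R (1::complex)))^2)"
    proof -
      have eq: "(\<lambda>x. (norm (indicator (cball 0 R) x *\<^sub>R (1::complex)))^2) = indicator (cball (0::real^'n) R)"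
        by (auto simp: indicator_def)
      show ?thesis unfolding eq using emeasure_compact_finite[of "cball (0::real^'n) R"] by (intro integrable_real_indicator) auto
    qed
    moreover have "(\<lambda>x::real^'n. indicator (cball 0 R) x *\<^sub>R (1::complex)) \<in> borel_measurable borel"
      by (intro borel_measurable_scaleR borel_measurable_indicator) auto
    ultimately show ?thesis by (simp add: L2_def)
  qed
  from L2_integrable_mult[OF this assms(1)]
  have "integrable lborel (\<lambda>x. indicator (cball 0 R) x *\<^sub>R V x)" by simp
  also have "(\<lambda>x. indicator (cball 0 R) x *\<^sub>R V x) = V"
  proof
    show "indicator (cball 0 R) x *\<^sub>R V x = V x" for x using assms(2)[of x] subsetD[OF R(2), of x] by (cases "x \<in> D") auto
  qed
  finally show ?thesis .
qed

lemma integral_zero_extension: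
  fixes g :: "real^'n \<Rightarrow> real"
  assumes V: "V \<in> L2 lborel" "\<And>x. x \<notin> D \<Longrightarrow> V x = 0" and U: "U \<in> borel_measurable LD" "AE x in LD. V x = U x"
    and g: "g \<in> borel_measurable borel"
  shows "(\<integral>x. g x *\<^sub>R V x \<partial>lborel) = (\<integral>x. g x *\<^sub>R U x \<partial>LD)"
proof -
  have [measurable]: "V \<in> borel_measurable borel" using L2_measurable[OF V(1)] by simp
  note [measurable] = g U(1)
  have gLD [measurable]: "g \<in> borel_measurable LD" "V \<in> borel_measurable LD"
    by (auto intro!: measurable_restrict_space1 measurable_completion g)
  have "(\<integral>x. g x *\<^sub>R U x \<partial>LD) = (\<integral>x. g x *\<^sub>R V x \<partial>LD)" using U(2) by (intro integral_cong_AE) auto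
  also have "\<dots> = (\<integral>x. indicator D x *\<^sub>R (g x *\<^sub>R V x) \<partial>lborel)" by (rule integral_lebesgue_on_open[OF open_D]) measurable
  also have "\<dots> = (\<integral>x. g x *\<^sub>R V x \<partial>lborel)" using V(2) by (intro Bochner_Integration.integral_cong) (auto simp: indicator_def)
  finally show ?thesis ..
qed

lemma test_function_kernel:
  assumes "smooth ker" "\<And>y. y \<notin> cball a s \<Longrightarrow> ker y = 0" "smooth \<psi>" "\<And>z. z \<notin> C \<Longrightarrow> \<psi> z = 0" "closed C"
    and "\<And>z. x - z \<in> cball a s \<Longrightarrow> z \<in> C \<Longrightarrow> z \<in> D"
  shows "test_function D (\<lambda>z. ker (x - z) * \<psi> z)"
proof (rule test_functionI[where K="cball (x - a) s \<inter> C"])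
  have mem: "z \<in> cball (x - a) s \<longleftrightarrow> x - z \<in> cball a s" for z by (simp add: dist_norm norm_minus_commute algebra_simps)
  show "smooth (\<lambda>z. ker (x - z) * \<psi> z)" using assms(1,3) unfolding smooth_def by (auto intro!: Ck_mult Ck_reflect)
  show "compact (cball (x - a) s \<inter> C)" using assms(5) by (simp add: compact_Int_closed)
  show "cball (x - a) s \<inter> C \<subseteq> D" using assms(6) mem by auto
  show "ker (x - z) * \<psi> z = 0" if "z \<notin> cball (x - a) s \<inter> C" for z using that assms(2)[of "x - z"] assms(4)[of z] mem[of z] by auto
qed

text \<open>At points whose distance from the complement exceeds \<open>1 / real (Suc m)\<close>, a
  translated kernel of smaller radius is a test function of \<open>D\<close>, so the mollification
  of \<open>V\<close> vanishes there. Shrinking the radius gives \<open>V = 0\<close> on each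
  \<open>E m\<close>, and these sets exhaust \<open>D\<close>.\<close>

lemma fundamental_lemma:
  assumes v: "v \<in> L2 LD" and 0: "\<And>\<phi>. test_function D \<phi> \<Longrightarrow> (\<integral>x. \<phi> x *\<^sub>R v x \<partial>LD) = 0"
  shows "AE x in LD. v x = 0"
proof -
  obtain V where V: "V \<in> L2 lborel" "\<And>x. x \<notin> D \<Longrightarrow> V x = 0" "AE x in LD. V x = v x" using L2_zero_extension[OF open_D v] by blast
  have Vi: "integrable lborel V" by (rule integrable_zero_extension[OF V(1,2)])
  obtain R where R: "R > 0" "D \<subseteq> cball 0 R" by (rule D_bound)
  have VR: "V x = 0" if "x \<notin> cball 0 R" for x using that R V(2) by blast
  have ne: "- D \<noteq> {}"
  proof
    assume "- D = {}"
    then have "D = UNIV" by auto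
    then show False using bounded_D not_bounded_UNIV[where 'a="real^'n"] by simp
  qed
  define E where "E m = {x. infdist x (- D) > 1 / real (Suc m)}" for m
  have E_open: "open (E m)" for m unfolding E_def by (intro open_Collect_less continuous_intros)
  have key: "AE x in lborel. x \<in> E m \<longrightarrow> V x = 0" for m
  proof -
    define W where "W x = indicator (E m) x *\<^sub>R V x" for x
    have [measurable]: "V \<in> borel_measurable borel" "E m \<in> sets borel" using L2_measurable[OF V(1)] E_open by auto
    have [measurable]: "W \<in> borel_measurable borel" unfolding W_def[abs_def] by measurable
    have WL2: "W \<in> L2 lborel" by (rule L2_dominated[of _ _ V 1]) (auto simp: W_def V(1) indicator_def)
    have "nR W \<le> e" if e: "e > 0" for e
    proof -
      have "\<exists>d>0. \<forall>y. norm y < d \<longrightarrow> nR (\<lambda>x. V (x - y) - V x) \<le> e" by (rule L2_translation_continuous[OF V(1) _ R(1) e]) (rule VR)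
      then obtain d where d: "d > 0" "\<And>y. norm y < d \<Longrightarrow> nR (\<lambda>x. V (x - y) - V x) \<le> e"
        by (elim exE conjE) (rule that, assumption, drule spec, erule mp, assumption)
      \<comment> \<open>Below \<open>d\<close>, so that the translations cost at most
        \<open>e\<close>, and below the distance from points of \<open>E m\<close> to the complement
        of \<open>D\<close>.\<close>
      define s where "s = min d (1 / real (Suc m)) / 2"
      have "s > 0" using d(1) by (simp add: s_def)
      moreover have "q / 2 < q" if "q > 0" for q :: real using that by simp
      from this[of "min d (1 / real (Suc m))"] have "s < min d (1 / real (Suc m))" using d(1) by (simp only: s_def) simp
      ultimately have s: "s > 0" "s < d" "s < 1 / real (Suc m)" by (simp_all only: min_less_iff_conj)
      obtain ker :: "real^'n \<Rightarrow> real" where ker: "mollifier ker" "\<And>x. x \<notin> cball 0 s \<Longrightarrow> ker x = 0"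
        using mollifier_exists[OF s(1), of 0] by blast
      have L2c: "dR (convolve ker V) V \<le> e"
      proof (rule L2_convolve(3)[where c=0 and R=s, OF ker(1) _ V(1) Vi])
        show "ker x = 0" if "x \<notin> cball 0 s" for x using that by (rule ker(2))
        fix y assume "ker y \<noteq> 0"
        then have "y \<in> cball 0 s" by (rule contrapos_np) (rule ker(2))
        then show "nR (\<lambda>x. V (x - y) - V x) \<le> e" using s by (intro d(2)) simp
      qed (use e in simp)
      have c0: "convolve ker V x = 0" if x: "x \<in> E m" for x
      proof -
        have sm: "smooth ker" using ker(1) by (simp add: mollifier_def)
        have "test_function D (\<lambda>z. ker (x - z) * 1)"
        proof (rule test_function_kernel[where a=0 and s=s and C=UNIV, OF sm])
          show "ker y = 0" if "y \<notin> cball 0 s" for y using that by (rule ker(2))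
          fix z assume z: "x - z \<in> cball 0 s"
          show "z \<in> D"
          proof (rule ccontr)
            assume "z \<notin> D"
            then have "infdist x (- D) \<le> dist x z" by (intro infdist_le) simp
            also have "dist x z \<le> s" using z by (simp add: dist_norm norm_minus_commute)
            finally show False using x s(3) by (simp add: E_def)
          qed
        qed (auto simp: smooth_def Ck_const)
        then have "(\<integral>z. ker (x - z) *\<^sub>R v z \<partial>LD) = 0" using 0[of "\<lambda>z. ker (x - z)"] by simp
        moreover have "(\<lambda>z. ker (x - z)) \<in> borel_measurable borel"
          by (intro borel_measurable_continuous_onI Ck_continuous[of 0] Ck_reflect smooth_Ck sm)
        ultimately show ?thesis using integral_zero_extension[OF V(1,2) L2_measurable[OF v] V(3), of "\<lambda>z. ker (x - z)"]
          by (simp add: convolve_def)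
      qed
      have cL2: "(\<lambda>x. convolve ker V x - V x) \<in> L2 lborel"
        by (rule L2_diff[OF L2_convolve(1)[where c=0 and R=s, OF ker(1) _ V(1) Vi] V(1)]) (rule ker(2))
      have "nR W \<le> 1 * dR (convolve ker V) V"
        by (rule L2_norm_mono[OF L2_measurable[OF WL2] cL2]) (auto simp: W_def indicator_def c0 intro!: AE_I2)
      with L2c show ?thesis by simp
    qed
    then have "nR W \<le> 0" using field_le_epsilon[of "nR W" 0] by simp
    then have "nR W = 0" using L2_norm_nonneg[of lborel W] by linarith
    then have "AE x in lborel. W x = 0" by (rule L2_norm_eq_0[OF WL2])
    then show ?thesis by eventually_elim (auto simp: W_def)
  qed
  have "AE x in lborel. \<forall>m. x \<in> E m \<longrightarrow> V x = 0" unfolding AE_all_countable using key by blast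
  then have "AE x in lborel. x \<in> D \<longrightarrow> V x = 0"
  proof eventually_elim
    case (elim x)
    show ?case
    proof
      assume x: "x \<in> D"
      have "infdist x (- D) > 0" using infdist_pos_not_in_closed[of "- D" x] open_D x ne by (auto simp: closed_Compl)
      then obtain m where "1 / real (Suc m) < infdist x (- D)" by (rule nat_approx_posE)
      then show "V x = 0" using elim by (auto simp: E_def)
    qed
  qed
  then have "AE x in LD. V x = 0" by (rule AE_lebesgue_on_lborel[OF open_D])
  then show ?thesis using V(3) by eventually_elim simp
qed

lemma L2_cancel_AE:
  assumes "f \<in> L2 LD" "g \<in> L2 LD"
    "\<And>\<phi>. test_function D \<phi> \<Longrightarrow> (\<integral>x. \<phi> x *\<^sub>R f x \<partial>LD) = (\<integral>x. \<phi> x *\<^sub>R g x \<partial>LD)"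
  shows "AE x in LD. f x = g x"
proof -
  have "AE x in LD. f x - g x = 0"
  proof (rule fundamental_lemma[OF L2_diff[OF assms(1,2)]])
    fix \<phi> assume \<phi>: "test_function D \<phi>"
    have "(\<integral>x. of_real (\<phi> x) * f x - of_real (\<phi> x) * g x \<partial>LD) = 0" using assms(3)[OF \<phi>]
      by (subst Bochner_Integration.integral_diff[OF L2_integrable_mult L2_integrable_mult])
         (auto intro: L2_test(1)[OF \<phi>] assms(1,2) simp: scaleR_conv_of_real)
    then show "(\<integral>x. \<phi> x *\<^sub>R (f x - g x) \<partial>LD) = 0" by (simp add: scaleR_conv_of_real right_diff_distrib)
  qed
  then show ?thesis by eventually_elim simp
qed

lemma weak_partial_unique:
  assumes "is_weak_partial D i u v" "is_weak_partial D i u v'"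
  shows "AE x in LD. v x = v' x"
proof (rule L2_cancel_AE)
  show "v \<in> L2 LD" "v' \<in> L2 LD" using assms by (auto dest: is_weak_partial_L2)
  fix \<phi> assume "test_function D \<phi>"
  then have "(\<integral>x. partial i \<phi> x *\<^sub>R u x \<partial>LD) = - (\<integral>x. \<phi> x *\<^sub>R v x \<partial>LD)"
    "(\<integral>x. partial i \<phi> x *\<^sub>R u x \<partial>LD) = - (\<integral>x. \<phi> x *\<^sub>R v' x \<partial>LD)" using assms by (auto simp: is_weak_partial_def)
  then show "(\<integral>x. \<phi> x *\<^sub>R v x \<partial>LD) = (\<integral>x. \<phi> x *\<^sub>R v' x \<partial>LD)" by simp
qed

lemma weak_partial_wpartial:
  assumes "is_weak_partial D i u v"
  shows "is_weak_partial D i u (wpartial D i u)" "AE x in LD. wpartial D i u x = v x"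
proof -
  show 1: "is_weak_partial D i u (wpartial D i u)" unfolding wpartial_def using someI[of "is_weak_partial D i u", OF assms] .
  show "AE x in LD. wpartial D i u x = v x" by (rule weak_partial_unique[OF 1 assms])
qed

lemma H1_weak_partial: "u \<in> H1 D \<Longrightarrow> is_weak_partial D i u (wpartial D i u)"
  unfolding H1_def using weak_partial_wpartial(1) by blast

lemma H1_L2: "u \<in> H1 D \<Longrightarrow> u \<in> L2 LD" "u \<in> H1 D \<Longrightarrow> wpartial D i u \<in> L2 LD"
  using H1_weak_partial is_weak_partial_L2 by (auto simp: H1_def) blast

lemma H1_I:
  assumes "u \<in> L2 LD" "\<And>i. is_weak_partial D i u (v i)"
  shows "u \<in> H1 D" using assms by (auto simp: H1_def)

lemma weak_partial_add:
  assumes u: "u \<in> L2 LD" "u' \<in> L2 LD" and w: "is_weak_partial D i u v" "is_weak_partial D i u' v'"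
  shows "is_weak_partial D i (\<lambda>x. u x + u' x) (\<lambda>x. v x + v' x)" unfolding is_weak_partial_def
proof (intro conjI allI impI)
  have v: "v \<in> L2 LD" "v' \<in> L2 LD" using w by (auto dest: is_weak_partial_L2)
  then show "(\<lambda>x. v x + v' x) \<in> L2 LD" by (rule L2_add)
  fix \<phi> assume \<phi>: "test_function D \<phi>"
  note i = L2_integrable_mult[OF L2_test(2)[OF \<phi>, of i] u(1)] L2_integrable_mult[OF L2_test(2)[OF \<phi>, of i] u(2)]
    L2_integrable_mult[OF L2_test(1)[OF \<phi>] v(1)] L2_integrable_mult[OF L2_test(1)[OF \<phi>] v(2)]
  have "(\<integral>x. partial i \<phi> x *\<^sub>R u x \<partial>LD) = - (\<integral>x. \<phi> x *\<^sub>R v x \<partial>LD)"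
    "(\<integral>x. partial i \<phi> x *\<^sub>R u' x \<partial>LD) = - (\<integral>x. \<phi> x *\<^sub>R v' x \<partial>LD)" using w \<phi> by (auto simp: is_weak_partial_def)
  then show "(\<integral>x. partial i \<phi> x *\<^sub>R (u x + u' x) \<partial>LD) = - (\<integral>x. \<phi> x *\<^sub>R (v x + v' x) \<partial>LD)"
    using i by (simp add: scaleR_conv_of_real distrib_left)
qed

lemma weak_partial_cmult:
  assumes w: "is_weak_partial D i u v"
  shows "is_weak_partial D i (\<lambda>x. c * u x) (\<lambda>x. c * v x)" unfolding is_weak_partial_def
proof (intro conjI allI impI)
  show "(\<lambda>x. c * v x) \<in> L2 LD" using w by (auto dest!: is_weak_partial_L2 intro: L2_cmult)
  fix \<phi> assume "test_function D \<phi>"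
  then have "(\<integral>x. partial i \<phi> x *\<^sub>R u x \<partial>LD) = - (\<integral>x. \<phi> x *\<^sub>R v x \<partial>LD)" using w by (simp add: is_weak_partial_def)
  then show "(\<integral>x. partial i \<phi> x *\<^sub>R (c * u x) \<partial>LD) = - (\<integral>x. \<phi> x *\<^sub>R (c * v x) \<partial>LD)"
    by (simp add: mult_scaleR_right[symmetric] del: mult_scaleR_right)
qed

lemma weak_partial_limit:
  assumes w: "\<And>j. is_weak_partial D i (u j) (v j)" and u: "\<And>j. u j \<in> L2 LD" "u' \<in> L2 LD" "v' \<in> L2 LD"
    and lim: "(\<lambda>j. dD (u j) u') \<longlonglongrightarrow> 0" "(\<lambda>j. dD (v j) v') \<longlonglongrightarrow> 0"
  shows "is_weak_partial D i u' v'" unfolding is_weak_partial_def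
proof (intro conjI allI impI)
  have vL2: "v j \<in> L2 LD" for j using w by (rule is_weak_partial_L2)
  show "v' \<in> L2 LD" by fact
  fix \<phi> assume \<phi>: "test_function D \<phi>"
  have "(\<lambda>j. \<integral>x. u j x * of_real (partial i \<phi> x) \<partial>LD) \<longlonglongrightarrow> (\<integral>x. u' x * of_real (partial i \<phi> x) \<partial>LD)"
    by (rule L2_integral_tendsto_left[OF u(1,2) lim(1) L2_test(2)[OF \<phi>]])
  moreover have "(\<lambda>j. - (\<integral>x. v j x * of_real (\<phi> x) \<partial>LD)) \<longlonglongrightarrow> - (\<integral>x. v' x * of_real (\<phi> x) \<partial>LD)"
    by (rule tendsto_minus[OF L2_integral_tendsto_left[OF vL2 u(3) lim(2) L2_test(1)[OF \<phi>]]])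
  moreover have "(\<integral>x. u j x * of_real (partial i \<phi> x) \<partial>LD) = - (\<integral>x. v j x * of_real (\<phi> x) \<partial>LD)" for j
    using w[of j] \<phi> by (simp add: is_weak_partial_def scaleR_conv_of_real mult.commute)
  ultimately show "(\<integral>x. partial i \<phi> x *\<^sub>R u' x \<partial>LD) = - (\<integral>x. \<phi> x *\<^sub>R v' x \<partial>LD)"
    using LIMSEQ_unique by (fastforce simp: scaleR_conv_of_real mult.commute)
qed

lemma gauss_green_exists:
  "\<exists>N :: real^'n \<Rightarrow> real^'n. (\<forall>i. Ck 1 (\<lambda>x. N x $ i)) \<and> (\<forall>x\<in>frontier D. outward_normal D x = N x \<and> norm (N x) = 1) \<and>
     (\<forall>(f :: real^'n \<Rightarrow> complex) i. Ck 1 f \<longrightarrow> (\<integral>x. partial i f x \<partial>LD) = (\<integral>x. N x $ i *\<^sub>R f x \<partial>SD))"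
  by (rule gauss_green) (rule exI, intro conjI ballI allI impI, simp_all del: Ck.simps One_nat_def)

text \<open>A continuously differentiable extension of the outward normal to the whole space.\<close>

definition nu :: "real^'n \<Rightarrow> real^'n" where
  "nu = (SOME N. (\<forall>i. Ck 1 (\<lambda>x. N x $ i)) \<and> (\<forall>x\<in>frontier D. outward_normal D x = N x \<and> norm (N x) = 1) \<and>
     (\<forall>(f :: real^'n \<Rightarrow> complex) i. Ck 1 f \<longrightarrow> (\<integral>x. partial i f x \<partial>LD) = (\<integral>x. N x $ i *\<^sub>R f x \<partial>SD)))"

lemma nu_C1: "Ck 1 (\<lambda>x. nu x $ i)"
  and nu_outward: "x \<in> frontier D \<Longrightarrow> outward_normal D x = nu x"
  and norm_nu: "x \<in> frontier D \<Longrightarrow> norm (nu x) = 1"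
  and nu_gauss_green: "Ck 1 f \<Longrightarrow> (\<integral>x. partial i f x \<partial>LD) = (\<integral>x. nu x $ i *\<^sub>R (f x :: complex) \<partial>SD)"
  using someI_ex[OF gauss_green_exists] unfolding nu_def[symmetric] by blast+

text \<open>The product of \<open>f\<close> with a test function vanishes on the frontier, so the
  Gauss-Green formula has no boundary term.\<close>

lemma C1_weak_partial:
  fixes f :: "real^'n \<Rightarrow> complex"
  assumes f: "Ck 1 f"
  shows "is_weak_partial D i f (partial i f)" unfolding is_weak_partial_def
proof (intro conjI allI impI)
  have fc: "continuous_on UNIV f" "continuous_on UNIV (partial i f)" using f Ck_continuous[OF f] by auto
  then show "partial i f \<in> L2 LD" by (intro L2_continuous_D)
  fix \<phi> assume \<phi>: "test_function D \<phi>"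
  note \<phi>' = test_functionD[OF \<phi>]
  have C1: "Ck 1 (\<lambda>x. \<phi> x *\<^sub>R f x)" by (intro Ck_scaleR \<phi>' f)
  have "(\<integral>x. partial i (\<lambda>x. \<phi> x *\<^sub>R f x) x \<partial>LD) = (\<integral>x. nu x $ i *\<^sub>R \<phi> x *\<^sub>R f x \<partial>SD)" by (rule nu_gauss_green[OF C1])
  also have "\<dots> = (\<integral>x. 0 \<partial>SD)"
  proof (rule Bochner_Integration.integral_cong[OF refl])
    fix x assume "x \<in> space SD"
    then have "x \<notin> D" using open_D by (simp add: space_surface_measure frontier_def interior_open)
    then show "nu x $ i *\<^sub>R \<phi> x *\<^sub>R f x = 0" using \<phi>'(2) by simp
  qed
  finally have "(\<integral>x. partial i (\<lambda>x. \<phi> x *\<^sub>R f x) x \<partial>LD) = 0" by simp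
  moreover have "partial i (\<lambda>x. \<phi> x *\<^sub>R f x) x = \<phi> x *\<^sub>R partial i f x + partial i \<phi> x *\<^sub>R f x" for x
    using f \<phi>'(1)[of 1] by (intro partial_scaleR) auto
  ultimately have "(\<integral>x. of_real (\<phi> x) * partial i f x + of_real (partial i \<phi> x) * f x \<partial>LD) = 0" by (simp add: scaleR_conv_of_real)
  then show "(\<integral>x. partial i \<phi> x *\<^sub>R f x \<partial>LD) = - (\<integral>x. \<phi> x *\<^sub>R partial i f x \<partial>LD)"
    using Bochner_Integration.integral_add[OF L2_integrable_mult[OF L2_test(1)[OF \<phi>] L2_continuous_D(1)[OF fc(2)]]
        L2_integrable_mult[OF L2_test(2)[OF \<phi>, of i] L2_continuous_D(1)[OF fc(1)]]]
    by (simp add: scaleR_conv_of_real eq_neg_iff_add_eq_0 add.commute)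
qed

end


subsection \<open>Density of smooth functions and traces\<close>

lemma (in graph_function) lipschitz:
  obtains lip where "lip \<ge> 0" "\<And>x y. x \<in> cball c R \<Longrightarrow> y \<in> cball c R \<Longrightarrow> \<bar>gr x - gr y\<bar> \<le> lip * norm (x - y)"
proof -
  obtain C where C: "C \<ge> 0" "\<And>x. x \<in> cball c R \<Longrightarrow> norm (grad gr x) \<le> C"
    by (rule continuous_on_compact_bound[OF cont_grad compact_cball]) blast
  have "norm (gr x - gr y) \<le> C * norm (x - y)" if xy: "x \<in> cball c R" "y \<in> cball c R" for x y
  proof (rule differentiable_bound[OF convex_cball _ _ xy])
    fix z assume z: "z \<in> cball c R"
    show "(gr has_derivative (\<lambda>h. \<Sum>i\<in>UNIV. h $ i *\<^sub>R partial i gr z)) (at z within cball c R)"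
      by (rule has_derivative_at_withinI[OF has_derivative_partial[OF diff]])
    show "onorm (\<lambda>h. \<Sum>i\<in>UNIV. h $ i *\<^sub>R partial i gr z) \<le> C"
    proof (rule onorm_bound[OF C(1)])
      fix h :: "real^'n"
      have "(\<Sum>i\<in>UNIV. h $ i *\<^sub>R partial i gr z) = h \<bullet> grad gr z" by (simp add: inner_vec_def grad_def)
      also have "norm \<dots> \<le> norm h * norm (grad gr z)" using Cauchy_Schwarz_ineq2[of h] by simp
      also have "\<dots> \<le> C * norm h" using mult_right_mono[OF C(2)[OF z] norm_ge_zero[of h]] by (simp add: mult.commute)
      finally show "norm (\<Sum>i\<in>UNIV. h $ i *\<^sub>R partial i gr z) \<le> C * norm h" .
    qed
  qed
  then show ?thesis using that[OF C(1)] by (simp add: real_norm_def)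
qed

context C2_domain
begin

lemma L2_continuous_mult:
  fixes a :: "real^'n \<Rightarrow> complex"
  assumes "continuous_on UNIV a"
  obtains C where "C \<ge> 0" "\<And>f. f \<in> L2 LD \<Longrightarrow> (\<lambda>x. a x * f x) \<in> L2 LD"
    "\<And>f. f \<in> L2 LD \<Longrightarrow> nD (\<lambda>x. a x * f x) \<le> C * nD f"
    "\<And>f. f \<in> L2 SD \<Longrightarrow> (\<lambda>x. a x * f x) \<in> L2 SD"
    "\<And>f. f \<in> L2 SD \<Longrightarrow> nS (\<lambda>x. a x * f x) \<le> C * nS f"
proof -
  obtain C where C: "C \<ge> 0" "\<And>x. x \<in> closure D \<Longrightarrow> norm (a x) \<le> C"
    by (rule continuous_on_compact_bound[OF continuous_on_subset[OF assms subset_UNIV] compact_closure_D]) blast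
  have CD: "AE x in LD. norm (a x) \<le> C" using C(2) closure_subset[of D] by (intro AE_I2) auto
  have CS: "AE x in SD. norm (a x) \<le> C" using C(2) by (intro AE_I2) (simp add: space_surface_measure frontier_def)
  have am: "a \<in> borel_measurable LD" "a \<in> borel_measurable SD" using L2_continuous_D[OF assms] by (auto dest: L2_measurable)
  have "norm (a x * z) \<le> C * norm z" if "norm (a x) \<le> C" for x z
    using mult_right_mono[OF that, of "norm z"] by (simp add: norm_mult)
  note bd = this
  have 1: "(\<lambda>x. a x * f x) \<in> L2 LD" "nD (\<lambda>x. a x * f x) \<le> C * nD f" if "f \<in> L2 LD" for f
  proof -
    show 2: "(\<lambda>x. a x * f x) \<in> L2 LD" by (rule L2_bounded_mult[OF that am(1) CD])
    show "nD (\<lambda>x. a x * f x) \<le> C * nD f"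
      by (rule L2_norm_mono[OF L2_measurable[OF 2] that _ C(1)]) (use CD in eventually_elim, rule bd)
  qed
  have 2: "(\<lambda>x. a x * f x) \<in> L2 SD" "nS (\<lambda>x. a x * f x) \<le> C * nS f" if "f \<in> L2 SD" for f
  proof -
    show 2: "(\<lambda>x. a x * f x) \<in> L2 SD" by (rule L2_bounded_mult[OF that am(2) CS])
    show "nS (\<lambda>x. a x * f x) \<le> C * nS f"
      by (rule L2_norm_mono[OF L2_measurable[OF 2] that _ C(1)]) (use CS in eventually_elim, rule bd)
  qed
  show ?thesis by (rule that[OF C(1) 1 2])
qed

lemma L2_mult_continuous:
  fixes a :: "real^'n \<Rightarrow> complex"
  assumes "continuous_on UNIV a" "f \<in> L2 LD"
  shows "(\<lambda>x. a x * f x) \<in> L2 LD" by (rule L2_continuous_mult[OF assms(1)]) (use assms(2) in blast)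

lemma L2_scale_continuous:
  fixes a :: "real^'n \<Rightarrow> real"
  assumes "continuous_on UNIV a" "f \<in> L2 LD"
  shows "(\<lambda>x. a x *\<^sub>R f x) \<in> L2 LD"
  using L2_mult_continuous[OF continuous_on_of_real[OF assms(1)] assms(2)] by (simp add: scaleR_conv_of_real)

text \<open>The kernel is centred at \<open>- t *\<^sub>R e\<close>, so the value of the mollified function at \<open>x\<close> only depends
  on points near \<open>x + t *\<^sub>R e\<close>, which lie inside \<open>D\<close>.\<close>

lemma density_chart:
  assumes ch: "C2_graph D c r e gr" and \<psi>: "smooth \<psi>" "\<And>x. x \<notin> cball c (3 / 4 * r) \<Longrightarrow> \<psi> x = 0"
    and u: "u \<in> L2 LD" "\<And>i. is_weak_partial D i u (v i)" and eps: "eps > 0"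
  shows "\<exists>f :: real^'n \<Rightarrow> complex. smooth f \<and> nD (\<lambda>x. f x - \<psi> x *\<^sub>R u x) \<le> eps \<and>
    (\<forall>i. nD (\<lambda>x. partial i f x - (\<psi> x *\<^sub>R v i x + partial i \<psi> x *\<^sub>R u x)) \<le> eps)"
proof -
  interpret graph_function e gr by (rule C2_graph_function[OF ch])
  have r: "r > 0" using ch by (simp add: C2_graph_def)
  obtain lip where lip: "lip \<ge> 0" "\<And>x y. x \<in> cball c r \<Longrightarrow> y \<in> cball c r \<Longrightarrow> \<bar>gr x - gr y\<bar> \<le> lip * norm (x - y)"
    using lipschitz[where c=c and R=r] by blast
  have vL2: "v i \<in> L2 LD" for i using u(2) by (rule is_weak_partial_L2)
  have \<psi>c: "continuous_on UNIV \<psi>" "continuous_on UNIV (partial i \<psi>)" for i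
    using Ck_continuous[OF smooth_Ck[OF \<psi>(1), of 0]] Ck_continuous[OF smooth_Ck[OF smooth_partial[OF \<psi>(1)], of 0]] by auto
  define g where "g i x = \<psi> x *\<^sub>R v i x + partial i \<psi> x *\<^sub>R u x" for i x
  have gL2: "g i \<in> L2 LD" for i unfolding g_def by (intro L2_add L2_scale_continuous \<psi>c vL2 u(1))
  have \<psi>uL2: "(\<lambda>x. \<psi> x *\<^sub>R u x) \<in> L2 LD" by (rule L2_scale_continuous[OF \<psi>c(1) u(1)])
  obtain U where U: "U \<in> L2 lborel" "\<And>x. x \<notin> D \<Longrightarrow> U x = 0" "AE x in LD. U x = \<psi> x *\<^sub>R u x"
    using L2_zero_extension[OF open_D \<psi>uL2] by blast
  have "\<exists>V. V \<in> L2 lborel \<and> (\<forall>x. x \<notin> D \<longrightarrow> V x = 0) \<and> (AE x in LD. V x = g i x)" for i by (rule L2_zero_extension[OF open_D gL2])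
  then obtain V where V: "\<And>i. V i \<in> L2 lborel" "\<And>i x. x \<notin> D \<Longrightarrow> V i x = 0" "\<And>i. AE x in LD. V i x = g i x" by metis
  have Ui: "integrable lborel U" by (rule integrable_zero_extension[OF U(1)]) (rule U(2))
  have Vi: "integrable lborel (V i)" for i by (rule integrable_zero_extension[OF V(1)]) (rule V(2))
  obtain R where R: "R > 0" "D \<subseteq> cball 0 R" by (rule D_bound)
  have tc: "\<exists>d>0. \<forall>y. norm y < d \<longrightarrow> nR (\<lambda>x. W (x - y) - W x) \<le> eps"
    if W: "W \<in> L2 lborel" "\<And>x. x \<notin> D \<Longrightarrow> W x = 0" for W :: "real^'n \<Rightarrow> complex"
  proof (rule L2_translation_continuous[OF W(1) _ R(1) eps])
    fix x :: "real^'n" assume "x \<notin> cball 0 R"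
    then have "x \<notin> D" using R(2) by blast
    then show "W x = 0" by (rule W(2))
  qed
  obtain d0 where d0: "d0 > 0" "\<forall>y. norm y < d0 \<longrightarrow> nR (\<lambda>x. U (x - y) - U x) \<le> eps" using tc[OF U(1,2)] by auto
  have "\<exists>d>0. \<forall>y. norm y < d \<longrightarrow> nR (\<lambda>x. V i (x - y) - V i x) \<le> eps" for i by (rule tc[OF V(1,2)])
  then obtain d where d: "\<And>i. d i > 0" "\<And>i. \<forall>y. norm y < d i \<longrightarrow> nR (\<lambda>x. V i (x - y) - V i x) \<le> eps" by metis
  \<comment> \<open>Translations shorter than \<open>q\<close> change \<open>U\<close> and every
    \<open>V i\<close> by at most \<open>eps\<close>; the bound \<open>r / 4\<close> keeps shifted
    points in the chart.\<close>
  define q where "q = min (min d0 (Min (range d))) (r / 4)"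
  have q: "q > 0" "q \<le> d0" "\<And>i. q \<le> d i" "q \<le> r / 4" using d0(1) d(1) r by (auto simp: q_def min.coboundedI1 min.coboundedI2)
  \<comment> \<open>The kernel is shifted by \<open>t\<close> and has radius \<open>s\<close>. Since
    \<open>(lip + 1) * s = t / 2\<close>, the rise by \<open>t\<close> outweighs the variation of
    the graph and of the height over a distance \<open>s\<close>.\<close>
  define t where "t = q / 4"
  define s where "s = t / (2 * (lip + 1))"
  have t: "t > 0" "4 * t \<le> q" using q(1) by (auto simp: t_def)
  have s: "s > 0" using t(1) lip(1) by (simp add: s_def)
  have s_mult: "(lip + 1) * s = t / 2" using lip(1) by (simp add: s_def divide_simps)
  have "1 * s \<le> (lip + 1) * s" using lip(1) s by (intro mult_right_mono) auto
  then have st: "s \<le> t / 2" using s_mult by simp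
  obtain ker :: "real^'n \<Rightarrow> real" where ker: "mollifier ker" "\<And>x. x \<notin> cball (- (t *\<^sub>R e)) s \<Longrightarrow> ker x = 0"
    using mollifier_exists[OF s, of "- (t *\<^sub>R e)"] by blast
  have sm: "smooth ker" using ker(1) by (simp add: mollifier_def)
  have kerq: "norm y < q" if "ker y \<noteq> 0" for y
  proof -
    have "y \<in> cball (- (t *\<^sub>R e)) s" using that ker(2)[of y] by argo
    then have "norm (y + t *\<^sub>R e) \<le> s" by (simp add: dist_norm norm_minus_commute[of "- (t *\<^sub>R e)"])
    moreover have "norm y \<le> norm (y + t *\<^sub>R e) + norm (t *\<^sub>R e)" using norm_triangle_ineq4[of "y + t *\<^sub>R e" "t *\<^sub>R e"] by simp
    ultimately show ?thesis using st t norm_e by simp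
  qed
  have inside: "z \<in> D" if x: "x \<in> D" and z: "x - z \<in> cball (- (t *\<^sub>R e)) s" "z \<in> cball c (3 / 4 * r)" for x z
  proof -
    \<comment> \<open>\<open>w\<close> is \<open>z\<close> with the shift undone and lies within
      \<open>s\<close> of \<open>x\<close>; the graph function has the same value at both, being
      constant along \<open>e\<close>.\<close>
    define w where "w = z - t *\<^sub>R e"
    have "norm (w - x) = dist (- (t *\<^sub>R e)) (x - z)" by (simp add: w_def dist_norm algebra_simps)
    then have wx: "norm (w - x) \<le> s" using z(1) by simp
    have tr: "4 * t \<le> r / 4" using t(2) q(4) by (rule order_trans)
    have "dist c w \<le> dist c z + t" using dist_triangle[of c w z] norm_e t(1) by (simp add: w_def dist_norm)
    then have w_in: "dist c w \<le> 3 / 4 * r + t" using z(2) by simp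
    then have wc: "w \<in> cball c r" using tr t(1) r by simp
    have "dist c x \<le> dist c w + s" using dist_triangle[of c x w] wx by (simp add: dist_norm)
    then have xc: "x \<in> ball c r" using w_in tr t(1) st r by simp
    have zc: "z \<in> ball c r" using z(2) r by simp
    have "gr w \<le> gr x + lip * norm (w - x)" using lip(2)[OF wc, of x] xc by simp
    also have "lip * norm (w - x) \<le> lip * s" using wx lip(1) by (rule mult_left_mono)
    finally have "gr w \<le> gr x + lip * s" by simp
    moreover have "gr z = gr w" using along_e[of w t] by (simp add: w_def)
    moreover have "gr x < x \<bullet> e" using C2_graph_mem_iff[OF ch xc] x by simp
    moreover have "x \<bullet> e \<le> w \<bullet> e + s"
    proof -
      have "\<bar>(w - x) \<bullet> e\<bar> \<le> s" using Cauchy_Schwarz_ineq2[of "w - x" e] norm_e wx by simp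
      then show ?thesis by (simp add: inner_diff_left)
    qed
    moreover have "z \<bullet> e = w \<bullet> e + t" by (simp add: w_def inner_diff_left e_e)
    moreover have "lip * s + s = t / 2" using s_mult by (simp add: distrib_right)
    ultimately have "gr z < z \<bullet> e" using t(1) by simp
    then show ?thesis using C2_graph_mem_iff[OF ch zc] by simp
  qed
  define f where "f = convolve ker U"
  have f_smooth: "smooth f"
    unfolding smooth_def f_def using Ck_convolve[where c="- (t *\<^sub>R e)" and R=s, OF smooth_Ck[OF sm] _ Ui] ker(2) by blast
  have fU: "dR f U \<le> eps" unfolding f_def
  proof (rule L2_convolve(3)[where c="- (t *\<^sub>R e)" and R=s, OF ker(1) _ U(1) Ui])
    show "nR (\<lambda>x. U (x - y) - U x) \<le> eps" if "ker y \<noteq> 0" for y using d0(2) order_less_le_trans[OF kerq[OF that] q(2)] by blast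
  qed (use ker(2) eps in auto)
  have fL2: "f \<in> L2 lborel" unfolding f_def by (rule L2_convolve(1)[OF ker(1) _ U(1) Ui]) (rule ker(2))
  have cV: "dR (convolve ker (V i)) (V i) \<le> eps" for i
  proof (rule L2_convolve(3)[where c="- (t *\<^sub>R e)" and R=s, OF ker(1) _ V(1) Vi])
    show "nR (\<lambda>x. V i (x - y) - V i x) \<le> eps" if "ker y \<noteq> 0" for y using d(2) order_less_le_trans[OF kerq[OF that] q(3)] by blast
  qed (use ker(2) eps in auto)
  have cVL2: "convolve ker (V i) \<in> L2 lborel" for i by (rule L2_convolve(1)[OF ker(1) _ V(1) Vi]) (rule ker(2))
  have pf: "partial i f x = convolve ker (V i) x" if x: "x \<in> D" for i x
  proof -
    have C1: "Ck 1 ker" using sm by (rule smooth_Ck)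
    define \<phi> where "\<phi> z = ker (x - z) * \<psi> z" for z
    have tf: "test_function D \<phi>" unfolding \<phi>_def
    proof (rule test_function_kernel[where a="- (t *\<^sub>R e)" and s=s and C="cball c (3 / 4 * r)", OF sm _ \<psi>(1)])
      show "z \<in> D" if "x - z \<in> cball (- (t *\<^sub>R e)) s" "z \<in> cball c (3 / 4 * r)" for z using inside[OF x that] .
    qed (use ker(2) \<psi>(2) in auto)
    have kerr: "continuous_on UNIV (\<lambda>z. ker (x - z))" "continuous_on UNIV (\<lambda>z. partial i ker (x - z))"
      using Ck_continuous[OF Ck_reflect(1)[OF smooth_Ck[OF sm, of 0]]]
        Ck_continuous[OF Ck_reflect(1)[OF smooth_Ck[OF smooth_partial[OF sm], of 0]]] by auto
    have p\<phi>: "partial i \<phi> z = ker (x - z) * partial i \<psi> z - partial i ker (x - z) * \<psi> z" for z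
    proof -
      have "partial i \<phi> z = ker (x - z) * partial i \<psi> z + partial i (\<lambda>z. ker (x - z)) z * \<psi> z" unfolding \<phi>_def
        by (rule partial_mult) (auto intro: smooth_differentiable[OF \<psi>(1)] Ck_differentiable[of 0] Ck_reflect(1)[OF smooth_Ck[OF sm]])
      then show ?thesis by (simp add: Ck_reflect(2)[OF C1])
    qed
    have one: "(\<lambda>x. 1 :: complex) \<in> L2 LD" by (rule L2_const[OF finite_LD])
    have int: "integrable LD h" if "h \<in> L2 LD" for h using L2_integrable_mult[OF that one] by simp
    have i1: "integrable LD (\<lambda>z. ker (x - z) *\<^sub>R g i z)" by (intro int L2_scale_continuous kerr gL2)
    have i2: "integrable LD (\<lambda>z. partial i ker (x - z) *\<^sub>R \<psi> z *\<^sub>R u z)" by (intro int L2_scale_continuous kerr \<psi>uL2)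
    have i3: "integrable LD (\<lambda>z. \<phi> z *\<^sub>R v i z)" "integrable LD (\<lambda>z. partial i \<phi> z *\<^sub>R u z)"
    proof -
      have "continuous_on UNIV \<phi>" "continuous_on UNIV (partial i \<phi>)"
        using test_functionD(1)[OF tf, of 0] test_functionD(1)[OF tf, of "Suc 0"] by auto
      then show "integrable LD (\<lambda>z. \<phi> z *\<^sub>R v i z)" "integrable LD (\<lambda>z. partial i \<phi> z *\<^sub>R u z)"
        using L2_scale_continuous vL2 u(1) int by auto
    qed
    have eq: "ker (x - z) *\<^sub>R g i z - partial i ker (x - z) *\<^sub>R \<psi> z *\<^sub>R u z = \<phi> z *\<^sub>R v i z + partial i \<phi> z *\<^sub>R u z" for z
      by (simp add: g_def p\<phi> \<phi>_def scaleR_add_right scaleR_diff_left)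
    \<comment> \<open>The weak derivative tested with \<phi> trades the derivative on the kernel for
      the function \<open>g i\<close>.\<close>
    have "(\<integral>z. \<phi> z *\<^sub>R v i z + partial i \<phi> z *\<^sub>R u z \<partial>LD) = 0" using u(2)[of i] tf i3 by (simp add: is_weak_partial_def)
    then have "(\<integral>z. ker (x - z) *\<^sub>R g i z \<partial>LD) = (\<integral>z. partial i ker (x - z) *\<^sub>R \<psi> z *\<^sub>R u z \<partial>LD)"
      using Bochner_Integration.integral_diff[OF i1 i2] unfolding eq by (simp del: scaleR_scaleR)
    moreover have "convolve ker (V i) x = (\<integral>z. ker (x - z) *\<^sub>R g i z \<partial>LD)" unfolding convolve_def
      by (rule integral_zero_extension[OF V(1) V(2) L2_measurable[OF gL2] V(3) borel_measurable_continuous_onI[OF kerr(1)]])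
    moreover have "convolve (partial i ker) U x = (\<integral>z. partial i ker (x - z) *\<^sub>R \<psi> z *\<^sub>R u z \<partial>LD)" unfolding convolve_def
      by (rule integral_zero_extension[OF U(1) U(2) L2_measurable[OF \<psi>uL2] U(3) borel_measurable_continuous_onI[OF kerr(2)]])
    moreover have "partial i f x = convolve (partial i ker) U x"
      unfolding f_def by (rule partial_convolve[OF C1 _ Ui]) (rule ker(2))
    ultimately show ?thesis by (simp del: scaleR_scaleR)
  qed
  have b1: "nD (\<lambda>x. f x - \<psi> x *\<^sub>R u x) \<le> eps"
  proof -
    have L: "(\<lambda>x. f x - U x) \<in> L2 LD" by (rule L2_restrict(1)[OF open_D L2_diff[OF fL2 U(1)]])
    have "nD (\<lambda>x. f x - \<psi> x *\<^sub>R u x) = dD f U"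
    proof (rule L2_cong_AE(2)[OF L])
      show "(\<lambda>x. f x - \<psi> x *\<^sub>R u x) \<in> borel_measurable LD"
        using L2_measurable[OF L2_diff[OF L2_restrict(1)[OF open_D fL2] \<psi>uL2]] .
      show "AE x in LD. f x - \<psi> x *\<^sub>R u x = f x - U x" using U(3) by eventually_elim simp
    qed
    also have "\<dots> \<le> eps" using L2_restrict(2)[OF open_D L2_diff[OF fL2 U(1)]] fU by (rule order_trans)
    finally show ?thesis .
  qed
  have b2: "dD (partial i f) (g i) \<le> eps" for i
  proof -
    have L: "(\<lambda>x. convolve ker (V i) x - V i x) \<in> L2 LD" by (rule L2_restrict(1)[OF open_D L2_diff[OF cVL2 V(1)]])
    have "continuous_on UNIV (partial i f)" using Ck_continuous[OF smooth_Ck[OF smooth_partial[OF f_smooth], of 0]] .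
    then have "dD (partial i f) (g i) = dD (convolve ker (V i)) (V i)"
    proof (intro L2_cong_AE(2)[OF L])
      assume "continuous_on UNIV (partial i f)"
      then show "(\<lambda>x. partial i f x - g i x) \<in> borel_measurable LD" by (intro L2_measurable L2_diff L2_continuous_D gL2)
      have "AE x in LD. x \<in> D" by (rule AE_I2) simp
      with V(3)[of i] show "AE x in LD. partial i f x - g i x = convolve ker (V i) x - V i x" by eventually_elim (simp add: pf)
    qed
    also have "\<dots> \<le> eps" using L2_restrict(2)[OF open_D L2_diff[OF cVL2 V(1)]] cV by (rule order_trans)
    finally show ?thesis .
  qed
  show ?thesis using f_smooth b1 b2 unfolding g_def by blast
qed

lemma smooth_density:
  assumes u: "u \<in> L2 LD" "\<And>i. is_weak_partial D i u (v i)" and eps: "eps > 0"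
  shows "\<exists>f :: real^'n \<Rightarrow> complex. smooth f \<and> dD f u \<le> eps \<and>
    (\<forall>i. dD (partial i f) (v i) \<le> eps)"
proof -
  obtain L c r e gr where ch: "\<And>l. l < (L::nat) \<Longrightarrow> C2_graph D (c l) (r l) (e l) (gr l)"
    and cov: "closure D \<subseteq> (\<Union>l<L. ball (c l) (r l / 2))" by (rule finite_atlas) blast
  have rpos: "r l > 0" if "l < L" for l using ch[OF that] by (simp add: C2_graph_def)
  have "\<exists>\<psi>. (\<forall>l. smooth (\<psi> l)) \<and> (\<forall>l<L. \<forall>x. x \<notin> ball (c l) (3 / 4 * r l) \<longrightarrow> \<psi> l x = (0::real)) \<and>
      (\<forall>x\<in>(\<Union>l<L. ball (c l) (r l / 2)). (\<Sum>l<L. \<psi> l x) = 1)" by (rule smooth_partition_of_unity) (rule rpos)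
  then obtain \<psi> where "(\<forall>l. smooth (\<psi> l)) \<and> (\<forall>l<L. \<forall>x. x \<notin> ball (c l) (3 / 4 * r l) \<longrightarrow> \<psi> l x = (0::real)) \<and>
      (\<forall>x\<in>(\<Union>l<L. ball (c l) (r l / 2)). (\<Sum>l<L. \<psi> l x) = 1)" ..
  then have \<psi>: "\<And>l. smooth (\<psi> l)" "\<And>l x. l < L \<Longrightarrow> x \<notin> ball (c l) (3 / 4 * r l) \<Longrightarrow> \<psi> l x = 0"
    "\<And>x. x \<in> (\<Union>l<L. ball (c l) (r l / 2)) \<Longrightarrow> (\<Sum>l<L. \<psi> l x) = 1" by blast+
  have sum1: "(\<Sum>l<L. \<psi> l x) = 1" if "x \<in> D" for x using \<psi>(3) cov closure_subset[of D] that by blast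
  \<comment> \<open>The partition of unity is constant on \<open>D\<close>, so its derivatives add
    up to zero; this cancels the product rule terms of the pieces.\<close>
  have sum0: "(\<Sum>l<L. partial i (\<psi> l) x) = 0" if x: "x \<in> D" for i x
  proof -
    have d: "\<psi> l differentiable (at x)" for l x by (rule smooth_differentiable[OF \<psi>(1)])
    have ds: "(\<lambda>x. \<Sum>l<L. \<psi> l x) differentiable (at x)" for x using d by (intro differentiable_sum) auto
    have "partial i (\<lambda>x. (\<Sum>l<L. \<psi> l x) - 1) x = 0" by (rule partial_eq_0[OF _ open_D x]) (simp add: sum1)
    moreover have "partial i (\<lambda>x. (\<Sum>l<L. \<psi> l x) - 1) x = (\<Sum>l<L. partial i (\<psi> l) x) - 0"
      using partial_diff[OF ds, of "\<lambda>x. 1" x i] d by (simp add: partial_sum)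
    ultimately show ?thesis by simp
  qed
  define eps' where "eps' = eps / (real L + 1)"
  have eps': "eps' > 0" "real L * eps' \<le> eps" using eps by (auto simp: eps'_def field_simps)
  define P where "P l f \<longleftrightarrow> smooth f \<and> nD (\<lambda>x. f x - \<psi> l x *\<^sub>R u x) \<le> eps' \<and>
    (\<forall>i. nD (\<lambda>x. partial i f x - (\<psi> l x *\<^sub>R v i x + partial i (\<psi> l) x *\<^sub>R u x)) \<le> eps')"
    for l and f :: "real^'n \<Rightarrow> complex"
  have "\<forall>l. \<exists>f. l < L \<longrightarrow> P l f"
  proof (intro allI)
    fix l show "\<exists>f. l < L \<longrightarrow> P l f"
    proof (cases "l < L")
      case True
      have "\<psi> l x = 0" if "x \<notin> cball (c l) (3 / 4 * r l)" for x using \<psi>(2)[OF True, of x] that by auto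
      from density_chart[OF ch[OF True] \<psi>(1) this u eps'(1)] show ?thesis unfolding P_def by blast
    qed simp
  qed
  from choice[OF this] obtain f where fP: "\<And>l. l < L \<Longrightarrow> P l (f l)" by blast
  then have f: "\<And>l. l < L \<Longrightarrow> smooth (f l)" "\<And>l. l < L \<Longrightarrow> nD (\<lambda>x. f l x - \<psi> l x *\<^sub>R u x) \<le> eps'"
    "\<And>l i. l < L \<Longrightarrow> nD (\<lambda>x. partial i (f l) x - (\<psi> l x *\<^sub>R v i x + partial i (\<psi> l) x *\<^sub>R u x)) \<le> eps'"
    using fP unfolding P_def by blast+
  have vL2: "v i \<in> L2 LD" for i using u(2) by (rule is_weak_partial_L2)
  have \<psi>c: "continuous_on UNIV (\<psi> l)" "continuous_on UNIV (partial i (\<psi> l))" for i l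
    using Ck_continuous[OF smooth_Ck[OF \<psi>(1), of 0]] Ck_continuous[OF smooth_Ck[OF smooth_partial[OF \<psi>(1)], of 0]] by auto
  have fc: "continuous_on UNIV (f l)" "continuous_on UNIV (partial i (f l))" if "l < L" for i l
    using Ck_continuous[OF smooth_Ck[OF f(1)[OF that], of 0]] Ck_continuous[OF smooth_Ck[OF smooth_partial[OF f(1)[OF that]], of 0]] by auto
  define F where "F x = (\<Sum>l<L. f l x)" for x
  have Fs: "smooth F" unfolding smooth_def F_def by (intro allI Ck_sum smooth_Ck f(1)) simp
  have pF: "partial i F x = (\<Sum>l<L. partial i (f l) x)" for i x
    unfolding F_def by (rule partial_sum) (use f(1) smooth_differentiable in auto)
  have "dD F u = nD (\<lambda>x. \<Sum>l<L. f l x - \<psi> l x *\<^sub>R u x)"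
  proof (rule L2_cong_AE(2))
    show "(\<lambda>x. \<Sum>l<L. f l x - \<psi> l x *\<^sub>R u x) \<in> L2 LD" by (intro L2_sum L2_diff L2_continuous_D fc L2_scale_continuous \<psi>c u(1)) simp
    show "(\<lambda>x. F x - u x) \<in> borel_measurable LD"
      unfolding F_def by (intro L2_measurable L2_sum L2_diff L2_continuous_D fc u(1)) simp
    show "AE x in LD. F x - u x = (\<Sum>l<L. f l x - \<psi> l x *\<^sub>R u x)"
      using sum1 by (intro AE_I2) (simp add: F_def sum_subtractf scaleR_sum_left[symmetric])
  qed
  also have "\<dots> \<le> (\<Sum>l<L. nD (\<lambda>x. f l x - \<psi> l x *\<^sub>R u x))"
    by (intro L2_norm_sum L2_diff L2_continuous_D fc L2_scale_continuous \<psi>c u(1)) simp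
  also have "\<dots> \<le> (\<Sum>l<L. eps')" using f(2) by (intro sum_mono) auto
  also have "\<dots> \<le> eps" using eps'(2) by simp
  finally have 1: "dD F u \<le> eps" .
  have 2: "dD (partial i F) (v i) \<le> eps" for i
  proof -
    have L: "(\<lambda>x. partial i (f l) x - (\<psi> l x *\<^sub>R v i x + partial i (\<psi> l) x *\<^sub>R u x)) \<in> L2 LD" if "l < L" for l
      by (intro L2_diff L2_add L2_continuous_D fc that L2_scale_continuous \<psi>c u(1) vL2)
    have "dD (partial i F) (v i)
      = nD (\<lambda>x. \<Sum>l<L. partial i (f l) x - (\<psi> l x *\<^sub>R v i x + partial i (\<psi> l) x *\<^sub>R u x))"
    proof (rule L2_cong_AE(2))
      show "(\<lambda>x. \<Sum>l<L. partial i (f l) x - (\<psi> l x *\<^sub>R v i x + partial i (\<psi> l) x *\<^sub>R u x)) \<in> L2 LD" by (rule L2_sum) (simp add: L)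
      show "(\<lambda>x. partial i F x - v i x) \<in> borel_measurable LD"
        unfolding pF by (intro L2_measurable L2_sum L2_diff L2_continuous_D fc vL2) simp
      show "AE x in LD. partial i F x - v i x = (\<Sum>l<L. partial i (f l) x - (\<psi> l x *\<^sub>R v i x + partial i (\<psi> l) x *\<^sub>R u x))"
        using sum1 sum0 by (intro AE_I2) (simp add: pF sum_subtractf sum.distrib scaleR_sum_left[symmetric])
    qed
    also have "\<dots> \<le> (\<Sum>l<L. nD (\<lambda>x. partial i (f l) x - (\<psi> l x *\<^sub>R v i x + partial i (\<psi> l) x *\<^sub>R u x)))"
      by (rule L2_norm_sum) (simp add: L)
    also have "\<dots> \<le> (\<Sum>l<L. eps')" using f(3) by (intro sum_mono) auto
    also have "\<dots> \<le> eps" using eps'(2) by simp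
    finally show ?thesis .
  qed
  show ?thesis using Fs 1 2 by blast
qed

end


section \<open>Traces as L2 limits of boundary values\<close>

abbreviation L2_lim :: "'a measure \<Rightarrow> (nat \<Rightarrow> 'a \<Rightarrow> complex) \<Rightarrow> ('a \<Rightarrow> complex) \<Rightarrow> bool" where
  "L2_lim M f g \<equiv> (\<lambda>j. L2_dist M (f j) g) \<longlonglongrightarrow> 0"

lemma L2_lim_add:
  assumes "\<And>j. f j \<in> L2 M" "f' \<in> L2 M" "\<And>j. g j \<in> L2 M" "g' \<in> L2 M" "L2_lim M f f'" "L2_lim M g g'"
  shows "L2_lim M (\<lambda>j x. f j x + g j x) (\<lambda>x. f' x + g' x)"
proof (rule Lim_null_comparison[OF always_eventually[OF allI] tendsto_add_zero[OF assms(5,6)]])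
  fix j
  have "L2_norm M (\<lambda>x. f j x + g j x - (f' x + g' x)) = L2_norm M (\<lambda>x. (f j x - f' x) + (g j x - g' x))"
    by (simp add: algebra_simps)
  also have "\<dots> \<le> L2_dist M (f j) f' + L2_dist M (g j) g'" by (intro L2_norm_triangle L2_diff assms)
  finally show "norm (L2_norm M (\<lambda>x. f j x + g j x - (f' x + g' x)))
      \<le> L2_dist M (f j) f' + L2_dist M (g j) g'" by simp
qed

lemma L2_lim_cong:
  assumes "\<And>j. f j \<in> L2 M" "g \<in> L2 M" "g' \<in> borel_measurable M" "AE x in M. g' x = g x" "L2_lim M f g"
  shows "L2_lim M f g'"
proof -
  have "L2_dist M (f j) g' = L2_dist M (f j) g" for j
  proof (rule L2_cong_AE(2)[OF L2_diff[OF assms(1,2)]])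
    show "(\<lambda>x. f j x - g' x) \<in> borel_measurable M" by (rule L2_measurable[OF L2_diff[OF assms(1) L2_cong_AE(1)[OF assms(2-4)]]])
    show "AE x in M. f j x - g' x = f j x - g x" using assms(4) by eventually_elim simp
  qed
  then show ?thesis using assms(5) by simp
qed

context C2_domain
begin

lemma L2_lim_mult:
  assumes a: "continuous_on UNIV a"
  shows "(\<And>j. f j \<in> L2 LD) \<Longrightarrow> g \<in> L2 LD \<Longrightarrow> L2_lim LD f g \<Longrightarrow> L2_lim LD (\<lambda>j x. a x * f j x) (\<lambda>x. a x * g x)"
    and "(\<And>j. f j \<in> L2 SD) \<Longrightarrow> g \<in> L2 SD \<Longrightarrow> L2_lim SD f g \<Longrightarrow> L2_lim SD (\<lambda>j x. a x * f j x) (\<lambda>x. a x * g x)"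
proof -
  obtain C where C: "C \<ge> 0" "\<And>f. f \<in> L2 LD \<Longrightarrow> nD (\<lambda>x. a x * f x) \<le> C * nD f"
    "\<And>f. f \<in> L2 SD \<Longrightarrow> nS (\<lambda>x. a x * f x) \<le> C * nS f" by (rule L2_continuous_mult[OF a]) blast
  show "L2_lim LD (\<lambda>j x. a x * f j x) (\<lambda>x. a x * g x)"
    if "\<And>j. f j \<in> L2 LD" "g \<in> L2 LD" and l: "L2_lim LD f g"
  proof (rule Lim_null_comparison[OF always_eventually[OF allI] tendsto_mult_right_zero[OF l, of C]])
    show "norm (nD (\<lambda>x. a x * f j x - a x * g x)) \<le> C * dD (f j) g" for j
      using C(2)[OF L2_diff[OF that(1,2)], of j] by (simp add: right_diff_distrib)
  qed
  show "L2_lim SD (\<lambda>j x. a x * f j x) (\<lambda>x. a x * g x)"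
    if "\<And>j. f j \<in> L2 SD" "g \<in> L2 SD" and l: "L2_lim SD f g"
  proof (rule Lim_null_comparison[OF always_eventually[OF allI] tendsto_mult_right_zero[OF l, of C]])
    show "norm (nS (\<lambda>x. a x * f j x - a x * g x)) \<le> C * dS (f j) g" for j
      using C(3)[OF L2_diff[OF that(1,2)], of j] by (simp add: right_diff_distrib)
  qed
qed

lemma L2_mult_continuous_surface:
  assumes "continuous_on UNIV a" "f \<in> L2 SD"
  shows "(\<lambda>x. a x * f x) \<in> L2 SD" by (rule L2_continuous_mult[OF assms(1)]) (use assms(2) in blast)

text \<open>The closure in \<open>L\<^sup>2\<close> of the triples of a continuously differentiable function, its gradient and
  its boundary values.\<close>

definition H1_trace :: "(real^'n \<Rightarrow> complex) \<Rightarrow> ('n \<Rightarrow> real^'n \<Rightarrow> complex) \<Rightarrow> (real^'n \<Rightarrow> complex) \<Rightarrow> bool" where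
  "H1_trace u v g \<longleftrightarrow> u \<in> L2 LD \<and> (\<forall>i. v i \<in> L2 LD) \<and> g \<in> L2 SD \<and>
     (\<exists>\<phi>. (\<forall>j. Ck 1 (\<phi> j)) \<and> L2_lim LD \<phi> u \<and> (\<forall>i. L2_lim LD (\<lambda>j. partial i (\<phi> j)) (v i)) \<and> L2_lim SD \<phi> g)"

lemma C1_L2:
  fixes f :: "real^'n \<Rightarrow> complex"
  assumes "Ck 1 f"
  shows "f \<in> L2 LD" "partial i f \<in> L2 LD" "f \<in> L2 SD"
proof -
  have "continuous_on UNIV f" "continuous_on UNIV (partial i f)" using assms Ck_continuous[OF assms] by auto
  then show "f \<in> L2 LD" "partial i f \<in> L2 LD" "f \<in> L2 SD" by (auto intro: L2_continuous_D)
qed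

lemma H1_traceD:
  assumes "H1_trace u v g"
  shows "u \<in> L2 LD" "v i \<in> L2 LD" "g \<in> L2 SD" using assms by (auto simp: H1_trace_def)

lemma H1_traceE:
  assumes "H1_trace u v g"
  obtains \<phi> where "\<And>j. Ck 1 (\<phi> j)" "L2_lim LD \<phi> u" "\<And>i. L2_lim LD (\<lambda>j. partial i (\<phi> j)) (v i)" "L2_lim SD \<phi> g"
  using assms unfolding H1_trace_def by blast

lemma H1_traceI:
  assumes "u \<in> L2 LD" "\<And>i. v i \<in> L2 LD" "g \<in> L2 SD"
    "\<And>j. Ck 1 (\<phi> j)" "L2_lim LD \<phi> u" "\<And>i. L2_lim LD (\<lambda>j. partial i (\<phi> j)) (v i)" "L2_lim SD \<phi> g"
  shows "H1_trace u v g" using assms unfolding H1_trace_def by blast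

lemma H1_trace_C1:
  assumes "Ck 1 f" shows "H1_trace f (\<lambda>i. partial i f) f" by (rule H1_traceI[where \<phi>="\<lambda>_. f"]) (use assms C1_L2[OF assms] in auto)

lemma H1_trace_weak_partial:
  assumes "H1_trace u v g"
  shows "is_weak_partial D i u (v i)"
proof -
  obtain \<phi> where \<phi>: "\<And>j. Ck 1 (\<phi> j)" "L2_lim LD \<phi> u" "\<And>i. L2_lim LD (\<lambda>j. partial i (\<phi> j)) (v i)"
    by (rule H1_traceE[OF assms]) blast
  show ?thesis by (rule weak_partial_limit[OF C1_weak_partial[OF \<phi>(1)] C1_L2(1)[OF \<phi>(1)] H1_traceD(1,2)[OF assms] \<phi>(2,3)])
qed

lemma H1_trace_H1: "H1_trace u v g \<Longrightarrow> u \<in> H1 D" by (rule H1_I[OF H1_traceD(1) H1_trace_weak_partial])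

lemma H1_trace_add:
  assumes 1: "H1_trace u v g" and 2: "H1_trace u' v' g'"
  shows "H1_trace (\<lambda>x. u x + u' x) (\<lambda>i x. v i x + v' i x) (\<lambda>x. g x + g' x)"
proof -
  obtain \<phi> where \<phi>: "\<And>j. Ck 1 (\<phi> j)" "L2_lim LD \<phi> u" "\<And>i. L2_lim LD (\<lambda>j. partial i (\<phi> j)) (v i)" "L2_lim SD \<phi> g"
    by (rule H1_traceE[OF 1]) blast
  obtain \<psi> where \<psi>: "\<And>j. Ck 1 (\<psi> j)" "L2_lim LD \<psi> u'" "\<And>i. L2_lim LD (\<lambda>j. partial i (\<psi> j)) (v' i)" "L2_lim SD \<psi> g'"
    by (rule H1_traceE[OF 2]) blast
  show ?thesis
  proof (rule H1_traceI[where \<phi>="\<lambda>j x. \<phi> j x + \<psi> j x"])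
    show "Ck 1 (\<lambda>x. \<phi> j x + \<psi> j x)" for j by (rule Ck_add[OF \<phi>(1) \<psi>(1)])
    have "partial i (\<lambda>x. \<phi> j x + \<psi> j x) = (\<lambda>x. partial i (\<phi> j) x + partial i (\<psi> j) x)" for i j
      using \<phi>(1)[of j] \<psi>(1)[of j] by (auto intro!: partial_add)
    then show "L2_lim LD (\<lambda>j. partial i (\<lambda>x. \<phi> j x + \<psi> j x)) (\<lambda>x. v i x + v' i x)" for i
      using L2_lim_add[OF C1_L2(2)[OF \<phi>(1)] H1_traceD(2)[OF 1] C1_L2(2)[OF \<psi>(1)] H1_traceD(2)[OF 2] \<phi>(3) \<psi>(3)] by simp
  qed (intro L2_lim_add L2_add C1_L2[OF \<phi>(1)] C1_L2[OF \<psi>(1)] H1_traceD[OF 1] H1_traceD[OF 2] \<phi>(2,4) \<psi>(2,4))+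
qed

lemma H1_trace_mult:
  assumes a: "Ck 1 a" and u: "H1_trace u v g"
  shows "H1_trace (\<lambda>x. a x * u x) (\<lambda>i x. a x * v i x + partial i a x * u x) (\<lambda>x. a x * g x)"
proof -
  obtain \<phi> where \<phi>: "\<And>j. Ck 1 (\<phi> j)" "L2_lim LD \<phi> u" "\<And>i. L2_lim LD (\<lambda>j. partial i (\<phi> j)) (v i)" "L2_lim SD \<phi> g"
    by (rule H1_traceE[OF u]) blast
  have c: "continuous_on UNIV a" "continuous_on UNIV (partial i a)" for i using a Ck_continuous[OF a] by auto
  note L = C1_L2[OF \<phi>(1)] H1_traceD[OF u]
  show ?thesis
  proof (rule H1_traceI[where \<phi>="\<lambda>j x. a x * \<phi> j x"])
    show "Ck 1 (\<lambda>x. a x * \<phi> j x)" for j by (rule Ck_mult[OF a \<phi>(1)])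
    have "partial i (\<lambda>x. a x * \<phi> j x) = (\<lambda>x. a x * partial i (\<phi> j) x + partial i a x * \<phi> j x)" for i j
      using \<phi>(1)[of j] a by (auto intro!: partial_mult)
    moreover have "L2_lim LD (\<lambda>j x. a x * partial i (\<phi> j) x + partial i a x * \<phi> j x) (\<lambda>x. a x * v i x + partial i a x * u x)" for i
      by (intro L2_lim_add L2_mult_continuous L2_lim_mult(1) c L \<phi>(2,3))
    ultimately show "L2_lim LD (\<lambda>j. partial i (\<lambda>x. a x * \<phi> j x)) (\<lambda>x. a x * v i x + partial i a x * u x)" for i by simp
    show "L2_lim LD (\<lambda>j x. a x * \<phi> j x) (\<lambda>x. a x * u x)" by (intro L2_lim_mult(1) c L \<phi>)
    show "L2_lim SD (\<lambda>j x. a x * \<phi> j x) (\<lambda>x. a x * g x)" by (intro L2_lim_mult(2) c L \<phi>)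
  qed (intro L2_add L2_mult_continuous L2_mult_continuous_surface c L)+
qed

lemma H1_trace_cmult:
  assumes "H1_trace u v g"
  shows "H1_trace (\<lambda>x. c * u x) (\<lambda>i x. c * v i x) (\<lambda>x. c * g x)" using H1_trace_mult[OF Ck_const assms, of c] by simp

lemma H1_trace_diff:
  assumes "H1_trace u v g" "H1_trace u' v' g'"
  shows "H1_trace (\<lambda>x. u x - u' x) (\<lambda>i x. v i x - v' i x) (\<lambda>x. g x - g' x)"
  using H1_trace_add[OF assms(1) H1_trace_cmult[OF assms(2), of "-1"]] by simp

lemma H1_trace_sum:
  assumes "finite A" "\<And>m. m \<in> A \<Longrightarrow> H1_trace (u m) (v m) (g m)"
  shows "H1_trace (\<lambda>x. \<Sum>m\<in>A. u m x) (\<lambda>i x. \<Sum>m\<in>A. v m i x) (\<lambda>x. \<Sum>m\<in>A. g m x)" using assms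
proof (induction A rule: finite_induct)
  case empty
  show ?case using H1_trace_C1[OF Ck_const, of 0] by simp
next
  case (insert a A)
  then show ?case using H1_trace_add[of "u a" "v a" "g a"] by simp
qed

lemma H1_trace_cnj:
  assumes u: "H1_trace u v g"
  shows "H1_trace (\<lambda>x. cnj (u x)) (\<lambda>i x. cnj (v i x)) (\<lambda>x. cnj (g x))"
proof -
  obtain \<phi> where \<phi>: "\<And>j. Ck 1 (\<phi> j)" "L2_lim LD \<phi> u" "\<And>i. L2_lim LD (\<lambda>j. partial i (\<phi> j)) (v i)" "L2_lim SD \<phi> g"
    by (rule H1_traceE[OF u]) blast
  have l: "L2_lim M (\<lambda>j x. cnj (f j x)) (\<lambda>x. cnj (f' x))" if "L2_lim M f f'" for M and f :: "nat \<Rightarrow> real^'n \<Rightarrow> complex" and f'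
    using that L2_norm_cnj[of M "\<lambda>x. f _ x - f' x"] by (simp del: L2_norm_cnj)
  show ?thesis
  proof (rule H1_traceI[where \<phi>="\<lambda>j x. cnj (\<phi> j x)"])
    show "Ck 1 (\<lambda>x. cnj (\<phi> j x))" for j by (rule Ck_bounded_linear[OF bounded_linear_cnj \<phi>(1)])
    have "partial i (\<lambda>x. cnj (\<phi> j x)) = (\<lambda>x. cnj (partial i (\<phi> j) x))" for i j
      using \<phi>(1)[of j] by (auto intro!: partial_bounded_linear[OF bounded_linear_cnj])
    then show "L2_lim LD (\<lambda>j. partial i (\<lambda>x. cnj (\<phi> j x))) (\<lambda>x. cnj (v i x))" for i using l[OF \<phi>(3)] by simp
  qed (intro L2_cnj l H1_traceD[OF u] \<phi>)+
qed

lemma H1_trace_cong: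
  assumes u: "H1_trace u v g" and v: "\<And>i. v' i \<in> borel_measurable LD" "\<And>i. AE x in LD. v' i x = v i x"
    and g: "g' \<in> borel_measurable SD" "AE x in SD. g' x = g x"
  shows "H1_trace u v' g'"
proof -
  obtain \<phi> where \<phi>: "\<And>j. Ck 1 (\<phi> j)" "L2_lim LD \<phi> u" "\<And>i. L2_lim LD (\<lambda>j. partial i (\<phi> j)) (v i)" "L2_lim SD \<phi> g"
    by (rule H1_traceE[OF u]) blast
  show ?thesis
  proof (rule H1_traceI[OF _ _ _ \<phi>(1,2)])
    show "u \<in> L2 LD" by (rule H1_traceD[OF u])
    show "v' i \<in> L2 LD" for i by (rule L2_cong_AE(1)[OF H1_traceD(2)[OF u] v])
    show "g' \<in> L2 SD" by (rule L2_cong_AE(1)[OF H1_traceD(3)[OF u] g])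
    show "L2_lim LD (\<lambda>j. partial i (\<phi> j)) (v' i)" for i by (rule L2_lim_cong[OF C1_L2(2)[OF \<phi>(1)] H1_traceD(2)[OF u] v \<phi>(3)])
    show "L2_lim SD \<phi> g'" by (rule L2_lim_cong[OF C1_L2(3)[OF \<phi>(1)] H1_traceD(3)[OF u] g \<phi>(4)])
  qed
qed

abbreviation nuc :: "'n \<Rightarrow> real^'n \<Rightarrow> complex" where "nuc i x \<equiv> of_real (nu x $ i)"

lemma nuc_C1: "Ck 1 (nuc i)" by (rule Ck_bounded_linear[OF bounded_linear_of_real nu_C1])

text \<open>The formula holds for C1 functions, and both sides are continuous in the norms that
  define \<open>H1_trace\<close>. It is bilinear; conjugates are inserted where it is
  applied.\<close>

lemma H1_trace_green:
  assumes 1: "H1_trace u v g" and 2: "H1_trace a b h"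
  shows "(\<integral>x. b i x * u x \<partial>LD) + (\<integral>x. a x * v i x \<partial>LD) = (\<integral>x. nuc i x * h x * g x \<partial>SD)"
proof -
  obtain \<phi> where \<phi>: "\<And>j. Ck 1 (\<phi> j)" "L2_lim LD \<phi> u" "\<And>i. L2_lim LD (\<lambda>j. partial i (\<phi> j)) (v i)" "L2_lim SD \<phi> g"
    by (rule H1_traceE[OF 1]) blast
  obtain \<psi> where \<psi>: "\<And>j. Ck 1 (\<psi> j)" "L2_lim LD \<psi> a" "\<And>i. L2_lim LD (\<lambda>j. partial i (\<psi> j)) (b i)" "L2_lim SD \<psi> h"
    by (rule H1_traceE[OF 2]) blast
  note L = C1_L2[OF \<phi>(1)] C1_L2[OF \<psi>(1)] H1_traceD[OF 1] H1_traceD[OF 2]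
  have "(\<lambda>j. (\<integral>x. partial i (\<psi> j) x * \<phi> j x \<partial>LD) + (\<integral>x. \<psi> j x * partial i (\<phi> j) x \<partial>LD))
      \<longlonglongrightarrow> (\<integral>x. b i x * u x \<partial>LD) + (\<integral>x. a x * v i x \<partial>LD)" by (intro tendsto_add L2_integral_tendsto L \<phi> \<psi>)
  moreover have "(\<lambda>j. \<integral>x. nuc i x * \<psi> j x * \<phi> j x \<partial>SD) \<longlonglongrightarrow> (\<integral>x. nuc i x * h x * g x \<partial>SD)"
    by (intro L2_integral_tendsto L2_lim_mult(2) L2_mult_continuous_surface Ck_continuous[OF nuc_C1] L \<phi> \<psi>)
  moreover have "(\<integral>x. partial i (\<psi> j) x * \<phi> j x \<partial>LD) + (\<integral>x. \<psi> j x * partial i (\<phi> j) x \<partial>LD)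
      = (\<integral>x. nuc i x * \<psi> j x * \<phi> j x \<partial>SD)" for j
  proof -
    have "partial i (\<lambda>x. \<psi> j x * \<phi> j x) x = partial i (\<psi> j) x * \<phi> j x + \<psi> j x * partial i (\<phi> j) x" for x
      using partial_mult[of "\<psi> j" x "\<phi> j" i] \<phi>(1)[of j] \<psi>(1)[of j] by simp
    then show ?thesis using nu_gauss_green[OF Ck_mult[OF \<psi>(1) \<phi>(1)], of i j j]
      by (simp add: Bochner_Integration.integral_add[OF L2_integrable_mult L2_integrable_mult] L scaleR_conv_of_real mult.assoc)
  qed
  ultimately show ?thesis using LIMSEQ_unique by auto
qed

text \<open>Green's formula for \<open>nuc i * u\<close> against the conjugate of \<open>u\<close>,
  summed over \<open>i\<close>, leaves the integral of the squared boundary values because the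
  normal has length one. Values and first derivatives of the extended normal enter the constant,
  which is why the extension has to be C1.\<close>

lemma trace_boundE:
  obtains C where "C \<ge> 0" "\<And>u v g. H1_trace u v g \<Longrightarrow> nS g \<le> C * (nD u + (\<Sum>i\<in>UNIV. nD (v i)))"
proof -
  have "\<forall>i. \<exists>C\<ge>0. \<forall>f\<in>L2 LD. nD (\<lambda>x. nuc i x * f x) \<le> C * nD f"
    by (intro allI, rule L2_continuous_mult[OF Ck_continuous[OF nuc_C1]]) blast
  from choice[OF this] obtain B where B: "\<And>i. B i \<ge> 0" "\<And>i f. f \<in> L2 LD \<Longrightarrow> nD (\<lambda>x. nuc i x * f x) \<le> B i * nD f" by blast
  have c: "continuous_on UNIV (partial i (nuc i))" for i using nuc_C1[of i] by simp
  have "\<forall>i. \<exists>C\<ge>0. \<forall>f\<in>L2 LD. nD (\<lambda>x. partial i (nuc i) x * f x) \<le> C * nD f" by (intro allI, rule L2_continuous_mult[OF c]) blast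
  from choice[OF this] obtain B' where B': "\<And>i. B' i \<ge> 0" "\<And>i f. f \<in> L2 LD \<Longrightarrow> nD (\<lambda>x. partial i (nuc i) x * f x) \<le> B' i * nD f" by blast
  \<comment> \<open>For each \<open>i\<close> the bound \<open>B i\<close> enters twice, since the
    gradient stands once in either factor, and \<open>B' i\<close> once, from the derivative of the
    normal.\<close>
  define K where "K = (\<Sum>i\<in>UNIV. B' i + 2 * B i)"
  have K: "K \<ge> 0" unfolding K_def using B(1) B'(1) by (intro sum_nonneg) (simp add: add_nonneg_nonneg)
  have bd: "nS g \<le> sqrt K * (nD u + (\<Sum>i\<in>UNIV. nD (v i)))" if u: "H1_trace u v g" for u v g
  proof -
    define S where "S = nD u + (\<Sum>i\<in>UNIV. nD (v i))"
    have S: "S \<ge> 0" "nD u \<le> S" "nD (v i) \<le> S" for i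
    proof -
      have "0 \<le> (\<Sum>i\<in>UNIV. nD (v i))" by (rule sum_nonneg) simp
      moreover have "nD (v i) \<le> (\<Sum>i\<in>UNIV. nD (v i))" by (rule member_le_sum) auto
      ultimately show "S \<ge> 0" "nD u \<le> S" "nD (v i) \<le> S" using L2_norm_nonneg[of LD u] unfolding S_def by linarith+
    qed
    note L = H1_traceD[OF u]
    have nuc_cont: "continuous_on UNIV (nuc i)" for i by (rule Ck_continuous[OF nuc_C1])
    have tm: "norm (\<integral>x. nuc i x * (nuc i x * g x) * cnj (g x) \<partial>SD) \<le> (B' i + 2 * B i) * S^2" for i
    proof -
      let ?w = "\<lambda>x. nuc i x * v i x + partial i (nuc i) x * u x"
      have w: "?w \<in> L2 LD" by (intro L2_add L2_mult_continuous nuc_cont c L)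
      have "nD ?w \<le> nD (\<lambda>x. nuc i x * v i x) + nD (\<lambda>x. partial i (nuc i) x * u x)"
        by (intro L2_norm_triangle L2_mult_continuous nuc_cont c L)
      also have "\<dots> \<le> B i * S + B' i * S"
        by (intro add_mono order_trans[OF B(2)[OF L(2)]] order_trans[OF B'(2)[OF L(1)]] mult_left_mono S B B')
      finally have wS: "nD ?w \<le> B i * S + B' i * S" .
      have eq: "(\<integral>x. nuc i x * (nuc i x * g x) * cnj (g x) \<partial>SD) = (\<integral>x. ?w x * cnj (u x) \<partial>LD) + (\<integral>x. (nuc i x * u x) * cnj (v i x) \<partial>LD)"
        using H1_trace_green[OF H1_trace_cnj[OF u] H1_trace_mult[OF nuc_C1[of i] u], of i] by simp
      have "norm (\<integral>x. nuc i x * (nuc i x * g x) * cnj (g x) \<partial>SD) \<le> nD ?w * nD (\<lambda>x. cnj (u x)) + nD (\<lambda>x. nuc i x * u x) * nD (\<lambda>x. cnj (v i x))"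
        unfolding eq by (rule norm_triangle_le[OF add_mono[OF L2_Cauchy_Schwarz[OF w L2_cnj[OF L(1)]]
              L2_Cauchy_Schwarz[OF L2_mult_continuous[OF nuc_cont L(1)] L2_cnj[OF L(2)]]]])
      also have "\<dots> \<le> (B i * S + B' i * S) * S + (B i * S) * S"
      proof -
        have nn: "0 \<le> B i * S" "0 \<le> B i * S + B' i * S" using S(1) B(1)[of i] B'(1)[of i] by simp_all
        show ?thesis unfolding L2_norm_cnj by (rule add_mono[OF mult_mono[OF wS S(2) nn(2) L2_norm_nonneg]
                mult_mono[OF order_trans[OF B(2)[OF L(1)] mult_left_mono[OF S(2) B(1)]] S(3) nn(1) L2_norm_nonneg]])
      qed
      finally show ?thesis by (simp add: algebra_simps power2_eq_square)
    qed
    have i: "integrable SD (\<lambda>x. nuc i x * (nuc i x * g x) * cnj (g x))" for i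
      by (intro L2_integrable_mult L2_mult_continuous_surface nuc_cont L L2_cnj)
    have "(\<Sum>i\<in>UNIV. \<integral>x. nuc i x * (nuc i x * g x) * cnj (g x) \<partial>SD) = (\<integral>x. (\<Sum>i\<in>UNIV. nuc i x * (nuc i x * g x) * cnj (g x)) \<partial>SD)"
      by (rule Bochner_Integration.integral_sum[symmetric]) (rule i)
    also have "\<dots> = (\<integral>x. complex_of_real ((norm (g x))^2) \<partial>SD)"
    proof (rule Bochner_Integration.integral_cong[OF refl])
      fix x assume "x \<in> space SD"
      then have "norm (nu x) = 1" using norm_nu by (simp add: space_surface_measure)
      then have "(\<Sum>i\<in>UNIV. nu x $ i * nu x $ i) = 1" by (simp add: norm_eq_1 inner_vec_def)
      moreover have "(\<Sum>i\<in>UNIV. nuc i x * nuc i x) = of_real (\<Sum>i\<in>UNIV. nu x $ i * nu x $ i)" by simp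
      ultimately have 1: "(\<Sum>i\<in>UNIV. nuc i x * nuc i x) = 1" by (simp only: of_real_1)
      have "(\<Sum>i\<in>UNIV. nuc i x * (nuc i x * g x) * cnj (g x)) = (\<Sum>i\<in>UNIV. nuc i x * nuc i x) * (g x * cnj (g x))"
        by (simp only: sum_distrib_right mult.assoc)
      then show "(\<Sum>i\<in>UNIV. nuc i x * (nuc i x * g x) * cnj (g x)) = complex_of_real ((norm (g x))^2)"
        using 1 by (simp only: complex_norm_square mult_1_left)
    qed
    also have "\<dots> = complex_of_real ((nS g)^2)" by (simp only: L2_norm_squared integral_complex_of_real)
    finally have "(nS g)^2 = norm (\<Sum>i\<in>UNIV. \<integral>x. nuc i x * (nuc i x * g x) * cnj (g x) \<partial>SD)" by (simp add: norm_power)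
    also have "\<dots> \<le> (\<Sum>i\<in>UNIV. (B' i + 2 * B i) * S^2)" by (rule sum_norm_le) (rule tm)
    also have "\<dots> = K * S^2" by (simp add: K_def sum_distrib_right)
    also have "\<dots> = (sqrt K * S)^2" using K by (simp add: power_mult_distrib)
    finally show ?thesis unfolding S_def[symmetric] by (rule power2_le_imp_le) (use K S in simp)
  qed
  show ?thesis by (rule that[OF real_sqrt_ge_zero[OF K] bd])
qed

text \<open>By the trace bound for differences, smooth approximations of \<open>u\<close> are also
  Cauchy on the boundary, which produces \<open>g\<close>.\<close>

lemma smooth_trace_exists:
  assumes u: "u \<in> L2 LD" "\<And>i. is_weak_partial D i u (v i)"
  shows "\<exists>\<phi> g. g \<in> L2 SD \<and> (\<forall>j. smooth (\<phi> j)) \<and> L2_lim LD \<phi> u \<and>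
    (\<forall>i. L2_lim LD (\<lambda>j. partial i (\<phi> j)) (v i)) \<and> L2_lim SD \<phi> g"
proof -
  have vL2: "v i \<in> L2 LD" for i using u(2) by (rule is_weak_partial_L2)
  define P where "P j f \<longleftrightarrow> smooth f \<and> dD f u \<le> 1 / real (Suc j) \<and>
    (\<forall>i. dD (partial i f) (v i) \<le> 1 / real (Suc j))" for j and f :: "real^'n \<Rightarrow> complex"
  have "\<forall>j. \<exists>f. P j f" unfolding P_def by (intro allI smooth_density u) simp
  from choice[OF this] obtain \<phi> where \<phi>: "\<And>j. P j (\<phi> j)" by blast
  have sm: "smooth (\<phi> j)" and d0: "dD (\<phi> j) u \<le> 1 / real (Suc j)"
    and d1: "dD (partial i (\<phi> j)) (v i) \<le> 1 / real (Suc j)" for i j using \<phi>[of j] unfolding P_def by blast+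
  have C1: "Ck 1 (\<phi> j)" for j by (rule smooth_Ck[OF sm])
  note L = C1_L2[OF C1] vL2 u(1)
  have lim: "(\<lambda>j. 1 / real (Suc j)) \<longlonglongrightarrow> 0" using LIMSEQ_inverse_real_of_nat by (simp add: inverse_eq_divide)
  have l0: "L2_lim LD \<phi> u" by (rule Lim_null_comparison[OF always_eventually[OF allI] lim]) (simp add: d0 del: of_nat_Suc)
  have l1: "L2_lim LD (\<lambda>j. partial i (\<phi> j)) (v i)" for i
    by (rule Lim_null_comparison[OF always_eventually[OF allI] lim]) (simp add: d1 del: of_nat_Suc)
  obtain C where C: "C \<ge> 0" "\<And>u v g. H1_trace u v g \<Longrightarrow> nS g \<le> C * (nD u + (\<Sum>i\<in>UNIV. nD (v i)))" by (rule trace_boundE) blast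
  define e where "e = (\<lambda>j. dD (\<phi> j) u + (\<Sum>i\<in>UNIV. dD (partial i (\<phi> j)) (v i)))"
  have "e \<longlonglongrightarrow> 0" unfolding e_def by (rule tendsto_add_zero[OF l0]) (rule tendsto_null_sum, rule l1)
  then have e: "(\<lambda>j. C * e j) \<longlonglongrightarrow> 0" by (rule tendsto_mult_right_zero)
  have bd: "dS (\<phi> j) (\<phi> m) \<le> C * e j + C * e m" for j m
  proof -
    have "dD (\<phi> j) (\<phi> m) \<le> dD (\<phi> j) u + dD (\<phi> m) u"
      using L2_norm_triangle_diff[of "\<phi> j" LD u "\<phi> m"] L by (simp add: L2_norm_minus_commute[of LD u])
    moreover have "dD (partial i (\<phi> j)) (partial i (\<phi> m))
      \<le> dD (partial i (\<phi> j)) (v i) + dD (partial i (\<phi> m)) (v i)" for i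
      using L2_norm_triangle_diff[of "partial i (\<phi> j)" LD "v i" "partial i (\<phi> m)"] L by (simp add: L2_norm_minus_commute[of LD "v i"])
    ultimately have "dD (\<phi> j) (\<phi> m) + (\<Sum>i\<in>UNIV. dD (partial i (\<phi> j)) (partial i (\<phi> m))) \<le>
       (dD (\<phi> j) u + dD (\<phi> m) u) +
       (\<Sum>i\<in>UNIV. dD (partial i (\<phi> j)) (v i) + dD (partial i (\<phi> m)) (v i))" by (intro add_mono sum_mono)
    also have "\<dots> = e j + e m" by (simp add: e_def sum.distrib)
    finally have "C * (dD (\<phi> j) (\<phi> m) + (\<Sum>i\<in>UNIV. dD (partial i (\<phi> j)) (partial i (\<phi> m)))) \<le> C * (e j + e m)"
      using C(1) by (rule mult_left_mono)
    moreover have "dS (\<phi> j) (\<phi> m) \<le> C * (dD (\<phi> j) (\<phi> m) + (\<Sum>i\<in>UNIV. dD (partial i (\<phi> j)) (partial i (\<phi> m))))"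
      by (rule C(2)[OF H1_trace_diff[OF H1_trace_C1[OF C1] H1_trace_C1[OF C1]]])
    ultimately show ?thesis by (simp add: distrib_left)
  qed
  obtain g where "g \<in> L2 SD" "L2_lim SD \<phi> g"
  proof (rule L2_complete[OF finite_surface_measure L(3)])
    fix eps :: real assume "eps > 0"
    then obtain N where N: "\<And>j. j \<ge> N \<Longrightarrow> norm (C * e j) < eps / 2" using LIMSEQ_D[OF e, of "eps / 2"] by auto
    have "dS (\<phi> j) (\<phi> m) < eps" if "j \<ge> N" "m \<ge> N" for j m
      using bd[of j m] N[OF that(1)] N[OF that(2)] by (simp only: real_norm_def)
    then show "\<exists>N. \<forall>m\<ge>N. \<forall>n\<ge>N. dS (\<phi> m) (\<phi> n) < eps" by blast
  qed
  then show ?thesis using sm l0 l1 by blast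
qed

lemma H1_norm_eq:
  assumes w: "\<And>i. is_weak_partial D i w (v i)"
  shows "H1_norm D w = sqrt ((nD w)^2 + (\<Sum>i\<in>UNIV. (nD (v i))^2))"
proof -
  have "nD (wpartial D i w) = nD (v i)" for i
    using weak_partial_wpartial[OF w[of i]] is_weak_partial_L2 w[of i] L2_measurable by (intro L2_cong_AE(2)) blast+
  then show ?thesis by (simp add: H1_norm_def)
qed

lemma H1_norm_bounds:
  assumes w: "\<And>i. is_weak_partial D i w (v i)"
  shows "nD w \<le> H1_norm D w" "nD (v i) \<le> H1_norm D w"
    "H1_norm D w \<le> nD w + (\<Sum>i\<in>UNIV. nD (v i))"
proof -
  have 0: "0 \<le> (\<Sum>i\<in>UNIV. (nD (v i))^2)" by (rule sum_nonneg) simp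
  have 1: "(nD (v i))^2 \<le> (\<Sum>i\<in>UNIV. (nD (v i))^2)" by (rule member_le_sum) auto
  show "nD w \<le> H1_norm D w" unfolding H1_norm_eq[OF w] by (rule real_le_rsqrt) (use 0 in simp)
  show "nD (v i) \<le> H1_norm D w" unfolding H1_norm_eq[OF w] by (rule real_le_rsqrt) (use 1 zero_le_power2[of "nD w"] in linarith)
  have "H1_norm D w \<le> sqrt ((nD w)^2) + sqrt (\<Sum>i\<in>UNIV. (nD (v i))^2)"
    unfolding H1_norm_eq[OF w] by (rule sqrt_add_le_add_sqrt) (use 0 in auto)
  also have "sqrt (\<Sum>i\<in>UNIV. (nD (v i))^2) \<le> (\<Sum>i\<in>UNIV. nD (v i))"
    using L2_set_le_sum[of UNIV "\<lambda>i. nD (v i)"] by (simp add: L2_set_def)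
  finally show "H1_norm D w \<le> nD w + (\<Sum>i\<in>UNIV. nD (v i))" by simp
qed

lemma weak_partial_diff:
  assumes "u \<in> L2 LD" "u' \<in> L2 LD" "is_weak_partial D i u v" "is_weak_partial D i u' v'"
  shows "is_weak_partial D i (\<lambda>x. u x - u' x) (\<lambda>x. v x - v' x)"
  using weak_partial_add[OF assms(1) L2_uminus[OF assms(2)] assms(3), of "\<lambda>x. - v' x"]
    weak_partial_cmult[OF assms(4), of "-1"] by simp

text \<open>\<open>trace\<close> is a choice, so some trace must first be shown to exist; only then
  does the chosen one come with an approximating sequence of its own.\<close>

lemma H1_trace_trace:
  assumes u: "u \<in> H1 D"
  shows "H1_trace u (\<lambda>i. wpartial D i u) (trace D u)"
proof -
  note L = H1_L2[OF u]
  have dw: "is_weak_partial D i (\<lambda>x. f x - u x) (\<lambda>x. partial i f x - wpartial D i u x)" if "smooth f" for f i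
    by (rule weak_partial_diff[OF C1_L2(1)[OF smooth_Ck[OF that]] L(1) C1_weak_partial[OF smooth_Ck[OF that]] H1_weak_partial[OF u]])
  obtain \<phi> g where \<phi>: "g \<in> L2 SD" "\<And>j. smooth (\<phi> j)" "L2_lim LD \<phi> u" "\<And>i. L2_lim LD (\<lambda>j. partial i (\<phi> j)) (wpartial D i u)" "L2_lim SD \<phi> g"
    using smooth_trace_exists[OF L(1) H1_weak_partial[OF u]] by blast
  have "(\<lambda>j. H1_norm D (\<lambda>x. \<phi> j x - u x)) \<longlonglongrightarrow> 0"
  proof (rule Lim_null_comparison[OF always_eventually[OF allI] tendsto_add_zero[OF \<phi>(3) tendsto_null_sum[OF \<phi>(4)]]])
    fix j
    have "0 \<le> H1_norm D (\<lambda>x. \<phi> j x - u x)" by (rule order_trans[OF L2_norm_nonneg H1_norm_bounds(1)[OF dw[OF \<phi>(2)]]])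
    then show "norm (H1_norm D (\<lambda>x. \<phi> j x - u x)) \<le> dD (\<phi> j) u + (\<Sum>i\<in>UNIV. dD (partial i (\<phi> j)) (wpartial D i u))"
      using H1_norm_bounds(3)[OF dw[OF \<phi>(2)]] by simp
  qed
  then have "is_trace D u g" unfolding is_trace_def using \<phi>(1,2,5) by blast
  then have "is_trace D u (trace D u)" unfolding trace_def by (rule someI[of "is_trace D u"])
  then obtain \<psi> where \<psi>: "trace D u \<in> L2 SD" "\<And>j. smooth (\<psi> j)" "(\<lambda>j. H1_norm D (\<lambda>x. \<psi> j x - u x)) \<longlonglongrightarrow> 0" "L2_lim SD \<psi> (trace D u)"
    unfolding is_trace_def by blast
  show ?thesis
  proof (rule H1_traceI[OF L(1) L(2) \<psi>(1) smooth_Ck[OF \<psi>(2)] _ _ \<psi>(4)])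
    show "L2_lim LD \<psi> u"
      by (rule Lim_null_comparison[OF always_eventually[OF allI] \<psi>(3)]) (use H1_norm_bounds(1)[OF dw[OF \<psi>(2)]] in simp)
    show "L2_lim LD (\<lambda>j. partial i (\<psi> j)) (wpartial D i u)" for i
      by (rule Lim_null_comparison[OF always_eventually[OF allI] \<psi>(3)]) (use H1_norm_bounds(2)[OF dw[OF \<psi>(2)]] in simp)
  qed
qed

text \<open>The difference of two triples over the same \<open>u\<close> has zero function and zero
  gradient, so the trace bound annihilates its boundary values.\<close>

lemma trace_eq:
  assumes u: "H1_trace u v g"
  shows "AE x in SD. trace D u x = g x"
proof -
  have H: "u \<in> H1 D" by (rule H1_trace_H1[OF u])
  obtain C where C: "C \<ge> 0" "\<And>u v g. H1_trace u v g \<Longrightarrow> nS g \<le> C * (nD u + (\<Sum>i\<in>UNIV. nD (v i)))" by (rule trace_boundE) blast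
  note d = H1_trace_diff[OF H1_trace_trace[OF H] u]
  have "dD (wpartial D i u) (v i) = nD (\<lambda>x. 0)" for i
  proof (rule L2_cong_AE(2)[OF L2_zero L2_measurable[OF H1_traceD(2)[OF d]]])
    show "AE x in LD. wpartial D i u x - v i x = 0"
      using weak_partial_wpartial(2)[OF H1_trace_weak_partial[OF u]] by eventually_elim simp
  qed
  then have "dS (trace D u) g \<le> 0" using C(2)[OF d] by simp
  then have "AE x in SD. trace D u x - g x = 0" by (intro L2_norm_eq_0[OF H1_traceD(3)[OF d]] antisym) auto
  then show ?thesis by eventually_elim simp
qed

text \<open>The approximations in \<open>H1_trace\<close> are only C1; smooth ones are wanted where
  mixed partial derivatives are exchanged.\<close>

lemma H1_trace_smooth:
  assumes u: "H1_trace u v g"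
  obtains \<phi> where "\<And>j. smooth (\<phi> j)" "L2_lim LD \<phi> u" "\<And>i. L2_lim LD (\<lambda>j. partial i (\<phi> j)) (v i)" "L2_lim SD \<phi> g"
proof -
  obtain \<phi> h where \<phi>: "h \<in> L2 SD" "\<And>j. smooth (\<phi> j)" "L2_lim LD \<phi> u" "\<And>i. L2_lim LD (\<lambda>j. partial i (\<phi> j)) (v i)" "L2_lim SD \<phi> h"
    using smooth_trace_exists[OF H1_traceD(1)[OF u] H1_trace_weak_partial[OF u]] by blast
  have "H1_trace u v h" by (rule H1_traceI[OF H1_traceD(1,2)[OF u] \<phi>(1) smooth_Ck[OF \<phi>(2)] \<phi>(3-5)])
  with u have "AE x in SD. trace D u x = g x" "AE x in SD. trace D u x = h x" by (auto intro: trace_eq)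
  then have "AE x in SD. g x = h x" by eventually_elim simp
  with \<phi>(5) have "L2_lim SD \<phi> g"
    by (rule L2_lim_cong[OF C1_L2(3)[OF smooth_Ck[OF \<phi>(2)]] \<phi>(1) L2_measurable[OF H1_traceD(3)[OF u]], rotated])
  then show ?thesis using that \<phi> by blast
qed

end


subsection \<open>The H2 estimate\<close>

context C2_domain
begin

definition ip :: "(real^'n \<Rightarrow> complex) \<Rightarrow> (real^'n \<Rightarrow> complex) \<Rightarrow> complex" where
  "ip f g = (\<integral>x. f x * cnj (g x) \<partial>LD)"

lemma ip_integrable: "f \<in> L2 LD \<Longrightarrow> g \<in> L2 LD \<Longrightarrow> integrable LD (\<lambda>x. f x * cnj (g x))" by (intro L2_integrable_mult L2_cnj)

lemma ip_add_left: "f \<in> L2 LD \<Longrightarrow> f' \<in> L2 LD \<Longrightarrow> g \<in> L2 LD \<Longrightarrow> ip (\<lambda>x. f x + f' x) g = ip f g + ip f' g"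
  unfolding ip_def by (simp add: distrib_right ip_integrable)

lemma ip_diff_left: "f \<in> L2 LD \<Longrightarrow> f' \<in> L2 LD \<Longrightarrow> g \<in> L2 LD \<Longrightarrow> ip (\<lambda>x. f x - f' x) g = ip f g - ip f' g"
  unfolding ip_def by (simp add: left_diff_distrib ip_integrable)

lemma ip_sum_left: "(\<And>a. a \<in> A \<Longrightarrow> f a \<in> L2 LD) \<Longrightarrow> g \<in> L2 LD \<Longrightarrow> ip (\<lambda>x. \<Sum>a\<in>A. f a x) g = (\<Sum>a\<in>A. ip (f a) g)"
  unfolding ip_def by (simp add: sum_distrib_right ip_integrable)

lemma cnj_ip: "cnj (ip f g) = ip g f"
  unfolding ip_def by (subst Bochner_Integration.integral_cnj[symmetric, of LD "\<lambda>x. f x * cnj (g x)"]) (simp add: mult.commute)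

lemma ip_add_right: "f \<in> L2 LD \<Longrightarrow> f' \<in> L2 LD \<Longrightarrow> g \<in> L2 LD \<Longrightarrow> ip g (\<lambda>x. f x + f' x) = ip g f + ip g f'"
  using arg_cong[OF ip_add_left[of f f' g], of cnj] by (simp add: cnj_ip)

lemma ip_diff_right: "f \<in> L2 LD \<Longrightarrow> f' \<in> L2 LD \<Longrightarrow> g \<in> L2 LD \<Longrightarrow> ip g (\<lambda>x. f x - f' x) = ip g f - ip g f'"
  using arg_cong[OF ip_diff_left[of f f' g], of cnj] by (simp add: cnj_ip)

lemma ip_sum_right: "(\<And>a. a \<in> A \<Longrightarrow> f a \<in> L2 LD) \<Longrightarrow> g \<in> L2 LD \<Longrightarrow> ip g (\<lambda>x. \<Sum>a\<in>A. f a x) = (\<Sum>a\<in>A. ip g (f a))"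
  using arg_cong[OF ip_sum_left[of A f g], of cnj] by (simp add: cnj_ip)

lemma ip_bound: "f \<in> L2 LD \<Longrightarrow> g \<in> L2 LD \<Longrightarrow> norm (ip f g) \<le> nD f * nD g"
  unfolding ip_def using L2_Cauchy_Schwarz[of f LD "\<lambda>x. cnj (g x)"] by (simp add: L2_cnj)

lemma ip_self: "ip f f = of_real ((nD f)^2)"
  unfolding ip_def L2_norm_squared integral_complex_of_real[symmetric] complex_norm_square ..

lemma ip_cong_right:
  assumes "f \<in> L2 LD" "g \<in> L2 LD" "g' \<in> L2 LD" "AE x in LD. g x = g' x"
  shows "ip f g = ip f g'" unfolding ip_def
  by (rule integral_cong_AE) (use assms ip_integrable in \<open>auto intro: borel_measurable_integrable\<close>)

lemma ip_tendsto:
  assumes "\<And>j. f j \<in> L2 LD" "f' \<in> L2 LD" "L2_lim LD f f'" "g \<in> L2 LD"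
  shows "(\<lambda>j. ip (f j) g) \<longlonglongrightarrow> ip f' g" unfolding ip_def by (rule L2_integral_tendsto_left[OF assms(1-3) L2_cnj[OF assms(4)]])

text \<open>In the application \<open>p\<close> and \<open>p'\<close> carry second derivatives,
  while \<open>s\<close> and \<open>s'\<close> contain first derivatives only.\<close>

lemma ip_perturb:
  assumes L: "p \<in> L2 LD" "s \<in> L2 LD" "p' \<in> L2 LD" "s' \<in> L2 LD"
    and "nD p \<le> P" "nD s \<le> S" "nD p' \<le> P" "nD s' \<le> S"
  shows "norm (ip (\<lambda>x. p x + s x) (\<lambda>x. p' x + s' x) - ip p p') \<le> 2 * P * S + S^2"
proof -
  have P: "P \<ge> 0" "S \<ge> 0" using assms(5,6) L2_norm_nonneg order_trans by blast+
  have "ip (\<lambda>x. p x + s x) (\<lambda>x. p' x + s' x) - ip p p' = ip p s' + (ip s p' + ip s s')"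
    by (simp add: ip_add_left ip_add_right L L2_add)
  also have "norm (ip p s' + (ip s p' + ip s s')) \<le> P * S + (S * P + S * S)"
    by (intro norm_triangle_mono order_trans[OF ip_bound] L mult_mono assms P L2_norm_nonneg)
  finally show ?thesis by (simp add: power2_eq_square algebra_simps)
qed

lemma L2_mult_uniform:
  assumes a: "\<And>i::'i::finite. continuous_on UNIV (a i)"
  shows "\<exists>C. 0 \<le> C \<and> (\<forall>i. \<forall>f\<in>L2 LD. nD (\<lambda>x. a i x * f x) \<le> C * nD f)"
proof -
  have "\<forall>i. \<exists>C\<ge>0. \<forall>f\<in>L2 LD. nD (\<lambda>x. a i x * f x) \<le> C * nD f" by (intro allI, rule L2_continuous_mult[OF a]) blast
  from choice[OF this] obtain B where B: "\<And>i. B i \<ge> 0" "\<And>i f. f \<in> L2 LD \<Longrightarrow> nD (\<lambda>x. a i x * f x) \<le> B i * nD f" by blast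
  have "B i \<le> sum B UNIV" for i by (rule member_le_sum) (use B(1) in auto)
  then have "nD (\<lambda>x. a i x * f x) \<le> sum B UNIV * nD f" if "f \<in> L2 LD" for i f
    using order_trans[OF B(2)[OF that, of i] mult_right_mono] by simp
  moreover have "0 \<le> sum B UNIV" using B(1) by (simp add: sum_nonneg)
  ultimately show ?thesis by blast
qed

lemma H1_trace_exists:
  assumes "a \<in> L2 LD" "\<And>i. is_weak_partial D i a (b i)"
  obtains h where "H1_trace a b h"
proof -
  obtain \<phi> h where \<phi>: "h \<in> L2 SD" "\<And>j. smooth (\<phi> j)" "L2_lim LD \<phi> a" "\<And>i. L2_lim LD (\<lambda>j. partial i (\<phi> j)) (b i)" "L2_lim SD \<phi> h"
    using smooth_trace_exists[OF assms] by blast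
  have "H1_trace a b h" by (rule H1_traceI[OF assms(1) is_weak_partial_L2[OF assms(2)] \<phi>(1) smooth_Ck[OF \<phi>(2)] \<phi>(3-5)])
  then show ?thesis by (rule that)
qed

lemma zero_trace_parts:
  assumes u: "H1_trace u v (\<lambda>x. 0)" and a: "a \<in> L2 LD" "\<And>i. is_weak_partial D i a (b i)"
  shows "ip (b i) u = - ip a (v i)"
proof -
  obtain h where h: "H1_trace a b h" by (rule H1_trace_exists[OF a])
  from H1_trace_green[OF H1_trace_cnj[OF u] h, of i] show ?thesis by (simp add: ip_def eq_neg_iff_add_eq_0)
qed

text \<open>For smooth \<open>f\<close> the zero trace allows the derivative on \<open>u\<close> to
  be moved to \<open>f\<close>, where mixed partial derivatives commute. The resulting identity
  contains first derivatives only, so it passes to every H1 function by density.\<close>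

lemma zero_trace_curl:
  assumes u: "H1_trace u v (\<lambda>x. 0)" and a: "a \<in> L2 LD" "\<And>i. is_weak_partial D i a (b i)"
  shows "ip (b j) (v i) = ip (b i) (v j)"
proof -
  have sm: "ip (partial j f) (v i) = ip (partial i f) (v j)" if f: "smooth f" for f
  proof -
    have C1: "Ck 1 (partial k f)" for k by (rule smooth_Ck[OF smooth_partial[OF f]])
    have e: "- ip (partial k f) (v l) = ip (partial l (partial k f)) u" for k l
      using zero_trace_parts[OF u C1_L2(1)[OF C1] C1_weak_partial[OF C1], of l k] by simp
    have "partial i (partial j f) = partial j (partial i f)" by (rule ext) (rule partial_commute[OF smooth_Ck[OF f]])
    then have "- ip (partial j f) (v i) = - ip (partial i f) (v j)" unfolding e by simp
    then show ?thesis by simp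
  qed
  obtain h where h: "H1_trace a b h" by (rule H1_trace_exists[OF a])
  obtain \<phi> where \<phi>: "\<And>j. smooth (\<phi> j)" "\<And>i. L2_lim LD (\<lambda>j. partial i (\<phi> j)) (b i)" by (rule H1_trace_smooth[OF h]) blast
  have "(\<lambda>m. ip (partial k (\<phi> m)) (v l)) \<longlonglongrightarrow> ip (b k) (v l)" for k l
    by (rule ip_tendsto[OF C1_L2(2)[OF smooth_Ck[OF \<phi>(1)]] H1_traceD(2)[OF h] \<phi>(2) H1_traceD(2)[OF u]])
  from this[of j i] this[of i j] show ?thesis unfolding sm[OF \<phi>(1)] by (rule LIMSEQ_unique)
qed

text \<open>With a test function in the role of \<open>a\<close>, the curl identity is the weak form
  of this symmetry.\<close>

lemma second_derivatives_commute:
  assumes u: "H1_trace u w (\<lambda>x. 0)" and h: "\<And>i j. is_weak_partial D j (w i) (h i j)"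
  shows "AE x in LD. h i j x = h j i x"
proof (rule L2_cancel_AE)
  show "h i j \<in> L2 LD" "h j i \<in> L2 LD" using h by (auto dest: is_weak_partial_L2)
  fix \<phi> assume \<phi>: "test_function D \<phi>"
  have C1: "Ck 1 (\<lambda>x. complex_of_real (\<phi> x))" by (rule Ck_bounded_linear[OF bounded_linear_of_real test_functionD(1)[OF \<phi>]])
  have p: "partial k (\<lambda>x. complex_of_real (\<phi> x)) = (\<lambda>x. of_real (partial k \<phi> x))" for k
    using test_functionD(1)[OF \<phi>, of 1] by (auto intro!: partial_bounded_linear bounded_linear_of_real)
  have "(\<integral>x. of_real (partial j \<phi> x) * w i x \<partial>LD) = (\<integral>x. of_real (partial i \<phi> x) * w j x \<partial>LD)"
    using zero_trace_curl[OF H1_trace_cnj[OF u, unfolded complex_cnj_zero] C1_L2(1)[OF C1] C1_weak_partial[OF C1], of j i]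
    by (simp add: ip_def p)
  then show "(\<integral>x. \<phi> x *\<^sub>R h i j x \<partial>LD) = (\<integral>x. \<phi> x *\<^sub>R h j i x \<partial>LD)"
    using h[of j i] h[of i j] \<phi> by (simp add: is_weak_partial_def scaleR_conv_of_real)
qed

text \<open>The tangential part \<open>T\<close> of the boundary gradient is the trace of
  \<open>F\<close>. Paired with \<open>F\<close>, Green's formula turns the integral of the square
  of \<open>T\<close> into volume terms that cancel by the curl identity and the symmetry of second
  derivatives. So the gradient is normal to the boundary.\<close>

lemma tangential_trace:
  assumes u: "H1_trace u w (\<lambda>x. 0)" and w: "\<And>i. H1_trace (w i) (h i) (g i)"
  shows "AE x in SD. nuc j x * g i x = nuc i x * g j x"
proof -
  define T where "T x = nuc j x * g i x - nuc i x * g j x" for x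
  define F where "F x = nuc j x * w i x - nuc i x * w j x" for x
  obtain V where "H1_trace F V T"
    using H1_trace_diff[OF H1_trace_mult[OF nuc_C1[of j] w[of i]] H1_trace_mult[OF nuc_C1[of i] w[of j]]]
    unfolding F_def T_def by blast
  then have F: "H1_trace (\<lambda>x. cnj (F x)) (\<lambda>k x. cnj (V k x)) (\<lambda>x. cnj (T x))" by (rule H1_trace_cnj)
  note LF = H1_traceD[OF F] and Lw = H1_traceD[OF w]
  have nuc_cont: "continuous_on UNIV (nuc k)" for k by (rule Ck_continuous[OF nuc_C1])
  have "(\<integral>x. cnj (V j x) * w i x \<partial>LD) = (\<integral>x. cnj (V i x) * w j x \<partial>LD)"
    using zero_trace_curl[OF H1_trace_cnj[OF u, unfolded complex_cnj_zero] LF(1) H1_trace_weak_partial[OF F], of j i] by (simp add: ip_def)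
  moreover have "(\<integral>x. cnj (F x) * h i j x \<partial>LD) = (\<integral>x. cnj (F x) * h j i x \<partial>LD)"
  proof (rule integral_cong_AE)
    show "AE x in LD. cnj (F x) * h i j x = cnj (F x) * h j i x"
      using second_derivatives_commute[OF u H1_trace_weak_partial[OF w], of i j] by eventually_elim simp
  qed (rule borel_measurable_integrable[OF L2_integrable_mult[OF LF(1) Lw(2)]])+
  ultimately have eq: "(\<integral>x. nuc j x * cnj (T x) * g i x \<partial>SD) = (\<integral>x. nuc i x * cnj (T x) * g j x \<partial>SD)"
    using H1_trace_green[OF w[of i] F, of j] H1_trace_green[OF w[of j] F, of i] by simp
  have TT: "complex_of_real ((norm (T x))^2) = nuc j x * cnj (T x) * g i x - nuc i x * cnj (T x) * g j x" for x
    unfolding complex_norm_square by (simp add: T_def algebra_simps)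
  have "complex_of_real ((nS T)^2) = (\<integral>x. nuc j x * cnj (T x) * g i x - nuc i x * cnj (T x) * g j x \<partial>SD)"
    unfolding L2_norm_squared integral_complex_of_real[symmetric] TT ..
  also have "\<dots> = 0" unfolding Bochner_Integration.integral_diff[OF
        L2_integrable_mult[OF L2_mult_continuous_surface[OF nuc_cont LF(3)] Lw(3)]
        L2_integrable_mult[OF L2_mult_continuous_surface[OF nuc_cont LF(3)] Lw(3)]] eq by simp
  finally have "nS T = 0" by simp
  moreover have "T \<in> L2 SD" using L2_cnj[OF LF(3)] by simp
  ultimately have "AE x in SD. T x = 0" by (intro L2_norm_eq_0)
  then show ?thesis unfolding T_def by eventually_elim simp
qed

text \<open>By \<open>tangential_trace\<close> the gradient equals, on the frontier, the normal
  times its normal component \<open>G\<close>. Subtracting the extension of that product leaves zero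
  trace, which opens the curl identity to the gradient itself.\<close>

lemma normal_part_zero_trace:
  assumes u: "H1_trace u w (\<lambda>x. 0)" and w: "\<And>i. H1_trace (w i) (h i) (g i)"
  defines "G \<equiv> \<lambda>x. \<Sum>k\<in>UNIV. nuc k x * w k x"
    and "Gd \<equiv> \<lambda>i x. \<Sum>k\<in>UNIV. nuc k x * h k i x + partial i (nuc k) x * w k x"
  defines "C \<equiv> \<lambda>j i x. nuc j x * Gd i x + partial i (nuc j) x * G x"
  shows "\<exists>f. H1_trace (\<lambda>x. nuc j x * G x) (C j) f"
    and "H1_trace (\<lambda>x. w j x - nuc j x * G x) (\<lambda>i x. h j i x - C j i x) (\<lambda>x. 0)"
proof -
  have "H1_trace G Gd (\<lambda>x. \<Sum>k\<in>UNIV. nuc k x * g k x)"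
    unfolding G_def Gd_def by (rule H1_trace_sum[OF finite H1_trace_mult[OF nuc_C1 w]])
  then have 1: "H1_trace (\<lambda>x. nuc j x * G x) (C j) (\<lambda>x. nuc j x * (\<Sum>k\<in>UNIV. nuc k x * g k x))"
    unfolding C_def by (rule H1_trace_mult[OF nuc_C1])
  show "\<exists>f. H1_trace (\<lambda>x. nuc j x * G x) (C j) f" by (rule exI, rule 1)
  note d = H1_trace_diff[OF w[of j] 1]
  show "H1_trace (\<lambda>x. w j x - nuc j x * G x) (\<lambda>i x. h j i x - C j i x) (\<lambda>x. 0)"
  proof (rule H1_trace_cong[OF d])
    have "AE x in SD. \<forall>k\<in>UNIV. nuc j x * g k x = nuc k x * g j x" by (rule AE_finite_allI[OF finite tangential_trace[OF u w]])
    then show "AE x in SD. 0 = g j x - nuc j x * (\<Sum>k\<in>UNIV. nuc k x * g k x)"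
    proof (rule AE_mp[OF _ AE_I2], intro impI)
      fix x assume x: "x \<in> space SD" and t: "\<forall>k\<in>UNIV. nuc j x * g k x = nuc k x * g j x"
      have "norm (nu x) = 1" using x norm_nu by (simp add: space_surface_measure)
      then have "(\<Sum>i\<in>UNIV. nu x $ i * nu x $ i) = 1" by (simp add: norm_eq_1 inner_vec_def)
      moreover have "(\<Sum>i\<in>UNIV. nuc i x * nuc i x) = of_real (\<Sum>i\<in>UNIV. nu x $ i * nu x $ i)" by simp
      ultimately have 1: "(\<Sum>i\<in>UNIV. nuc i x * nuc i x) = 1" by (simp only: of_real_1)
      have "nuc j x * (\<Sum>k\<in>UNIV. nuc k x * g k x) = (\<Sum>k\<in>UNIV. nuc k x * (nuc j x * g k x))"
        unfolding sum_distrib_left by (intro sum.cong refl) (simp only: mult.left_commute)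
      also have "\<dots> = (\<Sum>k\<in>UNIV. nuc k x * nuc k x) * g j x"
        unfolding sum_distrib_right using t by (intro sum.cong refl) (simp add: mult.assoc)
      finally show "0 = g j x - nuc j x * (\<Sum>k\<in>UNIV. nuc k x * g k x)" by (simp add: 1)
    qed
  qed (use H1_traceD(2)[OF d] in \<open>auto dest: L2_measurable\<close>)
qed

end

text \<open>The mixed term is absorbed by
  \<open>2 * (N * K * (Y * a)) \<le> Y^2 + (N * K)^2 * a^2\<close>. The final \<open>+ 1\<close> in
  the constant is there for \<open>M \<le> (M + 1)^2\<close>, which avoids a square root.\<close>

lemma quadratic_absorb:
  fixes Y d a N K :: real
  assumes "Y\<^sup>2 \<le> N * (d^2 + K * (Y * a + a^2))" "N \<ge> 0" "K \<ge> 0" "d \<ge> 0" "a \<ge> 0"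
  shows "Y \<le> (2 * N + 2 * N * K + (N * K)^2 + 1) * (d + a)"
proof (rule power2_le_imp_le)
  define M where "M = 2 * N + 2 * N * K + (N * K)^2"
  have "0 \<le> 2 * N" "0 \<le> 2 * N * K" "0 \<le> (N * K)^2" using assms by simp_all
  then have M: "M \<ge> 0" and M': "2 * N \<le> M" "2 * N * K + (N * K)^2 \<le> M" unfolding M_def by linarith+
  have "0 \<le> (Y - N * K * a)^2" by simp
  then have "2 * (N * K * (Y * a)) \<le> Y^2 + (N * K)^2 * a^2" by (simp add: power2_eq_square algebra_simps)
  then have "Y\<^sup>2 \<le> 2 * N * d^2 + (2 * N * K + (N * K)^2) * a^2" using assms(1) by (simp add: algebra_simps)
  also have "\<dots> \<le> M * d^2 + M * a^2" by (intro add_mono mult_right_mono M') simp_all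
  also have "\<dots> \<le> M * (d + a)^2" using assms(4,5) M by (simp add: power2_sum distrib_left)
  also have "\<dots> \<le> (M + 1)^2 * (d + a)^2"
  proof (rule mult_right_mono)
    show "M \<le> (M + 1)^2" using M by (simp add: power2_sum)
  qed simp
  finally show "Y\<^sup>2 \<le> ((2 * N + 2 * N * K + (N * K)^2 + 1) * (d + a))^2" unfolding M_def[symmetric] by (simp only: power_mult_distrib)
  show "0 \<le> (2 * N + 2 * N * K + (N * K)^2 + 1) * (d + a)" unfolding M_def[symmetric] using M assms by simp
qed

context C2_domain
begin

text \<open>The sum of the squared norms of the second derivatives and the squared norm of the
  Laplacian differ by \<open>cnj R\<close>, where \<open>R\<close> involves only the derivatives
  \<open>C\<close> of the normal part of the gradient. The leading part of \<open>R\<close> cancels;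
  the rest has a first derivative as a factor and is absorbed by
  \<open>quadratic_absorb\<close>.\<close>

lemma H2_estimate:
  obtains C where "C \<ge> 0" "\<And>u w h g. H1_trace u w (\<lambda>x. 0) \<Longrightarrow> (\<And>i. H1_trace (w i) (h i) (g i)) \<Longrightarrow>
    (\<Sum>i\<in>UNIV. \<Sum>j\<in>UNIV. nD (h i j)) \<le> C * (nD (\<lambda>x. \<Sum>i\<in>UNIV. h i i x) + (\<Sum>k\<in>UNIV. nD (w k)))"
proof -
  have nuc_cont: "continuous_on UNIV (nuc i)" for i by (rule Ck_continuous[OF nuc_C1])
  have dnS: "continuous_on UNIV (partial j (nuc i))" for i j using nuc_C1[of i] by simp
  from L2_mult_uniform[where a="\<lambda>i. nuc i", OF nuc_cont]
  obtain c1 where c1: "0 \<le> c1 \<and> (\<forall>i. \<forall>f\<in>L2 LD. nD (\<lambda>x. nuc i x * f x) \<le> c1 * nD f)" ..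
  from L2_mult_uniform[where a="\<lambda>ij. partial (snd ij) (nuc (fst ij))", OF dnS]
  obtain c2 where c2: "0 \<le> c2 \<and> (\<forall>ij. \<forall>f\<in>L2 LD. nD (\<lambda>x. partial (snd ij) (nuc (fst ij)) x * f x) \<le> c2 * nD f)" ..
  define c where "c = max c1 c2"
  have c: "c \<ge> 0" using c1 by (simp add: c_def le_max_iff_disj)
  have cn: "nD (\<lambda>x. nuc i x * f x) \<le> c * nD f" if "f \<in> L2 LD" for i f
  proof -
    have "nD (\<lambda>x. nuc i x * f x) \<le> c1 * nD f" using c1 that by blast
    also have "\<dots> \<le> c * nD f" by (rule mult_right_mono) (simp_all add: c_def)
    finally show ?thesis .
  qed
  have cd: "nD (\<lambda>x. partial j (nuc i) x * f x) \<le> c * nD f" if "f \<in> L2 LD" for i j f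
  proof -
    have "nD (\<lambda>x. partial (snd (i, j)) (nuc (fst (i, j))) x * f x) \<le> c2 * nD f" using conjunct2[OF c2] that by blast
    also have "\<dots> \<le> c * nD f" by (rule mult_right_mono) (simp_all add: c_def)
    finally show ?thesis by simp
  qed
  define N where "N = real CARD('n)"
  \<comment> \<open>There are \<open>N^2\<close> index pairs, each with two errors bounded by
    \<open>3 * c^4 * (Y * a + a^2)\<close>.\<close>
  define K where "K = 6 * N^2 * c^4"
  have NK: "N \<ge> 0" "K \<ge> 0" by (simp_all add: N_def K_def)
  show ?thesis
  proof (rule that)
    show "0 \<le> 2 * N^2 + 2 * N^2 * K + (N^2 * K)^2 + 1" using NK by simp
  next
    fix u w h g assume u: "H1_trace u w (\<lambda>x. 0)" and w: "\<And>i. H1_trace (w i) (h i) (g i)"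
    define Y where "Y = (\<Sum>i\<in>UNIV. \<Sum>j\<in>UNIV. nD (h i j))"
    define a where "a = (\<Sum>k\<in>UNIV. nD (w k))"
    define d where "d = nD (\<lambda>x. \<Sum>i\<in>UNIV. h i i x)"
    have a: "a \<ge> 0" and Y: "Y \<ge> 0" and d: "d \<ge> 0" by (simp_all add: a_def Y_def d_def sum_nonneg)
    define G where "G = (\<lambda>x. \<Sum>k\<in>UNIV. nuc k x * w k x)"
    define Gd where "Gd = (\<lambda>i x. \<Sum>k\<in>UNIV. nuc k x * h k i x + partial i (nuc k) x * w k x)"
    \<comment> \<open>All second derivatives sit in \<open>P\<close>; in \<open>S\<close> the
      derivative has fallen on the normal, so only first derivatives remain.\<close>
    define P where "P j i x = nuc j x * Gd i x" for j i x
    define S where "S j i x = partial i (nuc j) x * G x" for j i x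
    define C where "C j i x = P j i x + S j i x" for j i x
    have Cx: "C j = (\<lambda>i x. nuc j x * Gd i x + partial i (nuc j) x * G x)" for j by (simp add: C_def P_def S_def fun_eq_iff)
    obtain gr where gr: "H1_trace (\<lambda>x. nuc j x * G x) (C j) (gr j)" for j
    proof -
      have "\<forall>j. \<exists>f. H1_trace (\<lambda>x. nuc j x * G x) (C j) f"
        unfolding Cx G_def Gd_def by (intro allI normal_part_zero_trace(1)[OF u w])
      from choice[OF this] show ?thesis using that by blast
    qed
    have Z: "H1_trace (\<lambda>x. w j x - nuc j x * G x) (\<lambda>i x. h j i x - C j i x) (\<lambda>x. 0)" for j
      unfolding Cx G_def Gd_def by (rule normal_part_zero_trace(2)[OF u w])
    have wL: "w k \<in> L2 LD" and hL: "h i j \<in> L2 LD" for i j k using H1_traceD[OF w] by auto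
    have CL: "C i j \<in> L2 LD" for i j using H1_traceD(2)[OF gr] .
    have GL: "G \<in> L2 LD" unfolding G_def by (intro L2_sum L2_mult_continuous nuc_cont wL)
    have GdL: "Gd i \<in> L2 LD" for i unfolding Gd_def by (intro L2_sum L2_add L2_mult_continuous nuc_cont dnS wL hL)
    have PL: "P i j \<in> L2 LD" for i j unfolding P_def by (intro L2_mult_continuous nuc_cont GdL)
    have SL: "S i j \<in> L2 LD" for i j unfolding S_def by (intro L2_mult_continuous dnS GL)
    have Gn: "nD G \<le> c * a"
    proof -
      have "nD G \<le> (\<Sum>k\<in>UNIV. nD (\<lambda>x. nuc k x * w k x))" unfolding G_def by (intro L2_norm_sum L2_mult_continuous nuc_cont wL)
      also have "\<dots> \<le> (\<Sum>k\<in>UNIV. c * nD (w k))" by (intro sum_mono cn wL)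
      finally show ?thesis by (simp add: a_def sum_distrib_left)
    qed
    have Gdn: "nD (Gd i) \<le> c * (Y + a)" for i
    proof -
      have "nD (Gd i) \<le> (\<Sum>k\<in>UNIV. nD (\<lambda>x. nuc k x * h k i x + partial i (nuc k) x * w k x))"
        unfolding Gd_def by (intro L2_norm_sum L2_add L2_mult_continuous nuc_cont dnS wL hL)
      also have "\<dots> \<le> (\<Sum>k\<in>UNIV. c * nD (h k i) + c * nD (w k))"
        by (intro sum_mono order_trans[OF L2_norm_triangle] add_mono cn cd L2_mult_continuous nuc_cont dnS wL hL)
      also have "\<dots> = c * ((\<Sum>k\<in>UNIV. nD (h k i)) + a)" by (simp add: a_def sum_distrib_left sum.distrib distrib_left)
      also have "(\<Sum>k\<in>UNIV. nD (h k i)) \<le> Y" unfolding Y_def by (intro sum_mono member_le_sum) auto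
      finally show ?thesis using c by (simp add: mult_left_mono)
    qed
    have Pn: "nD (P i j) \<le> c^2 * (Y + a)" for i j
      unfolding P_def using order_trans[OF cn[OF GdL] mult_left_mono[OF Gdn c]] by (simp add: power2_eq_square mult.assoc)
    have Sn: "nD (S i j) \<le> c^2 * a" for i j
      unfolding S_def using order_trans[OF cd[OF GL] mult_left_mono[OF Gn c]] by (simp add: power2_eq_square mult.assoc)
    have per: "norm (ip (C i j) (C i' j') - ip (P i j) (P i' j')) \<le> c^4 * (2 * (Y * a) + 3 * a^2)" for i j i' j'
      using ip_perturb[OF PL[of i j] SL[of i j] PL[of i' j'] SL[of i' j'] Pn Sn Pn Sn]
      unfolding C_def[symmetric, abs_def] by (simp add: power2_eq_square power4_eq_xxxx algebra_simps C_def[abs_def])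
    \<comment> \<open>The functions with gradient \<open>h j - C j\<close> have zero trace, so the
      curl identity may exchange the indices. They are paired with \<open>w i\<close> here and with
      the normal part in the next step.\<close>
    have 1: "ip (h i j) (h j i) - ip (h i i) (h j j) = ip (h i j) (C j i) - ip (h i i) (C j j)" for i j
      using zero_trace_curl[OF Z wL H1_trace_weak_partial[OF w], of i j j i] by (simp add: ip_diff_right hL CL algebra_simps)
    have 2: "ip (C i j) (C j i) - ip (C i i) (C j j) = ip (C i j) (h j i) - ip (C i i) (h j j)" for i j
      using zero_trace_curl[OF Z H1_traceD(1)[OF gr] H1_trace_weak_partial[OF gr], of i j j i]
      by (simp add: ip_diff_right hL CL algebra_simps)
    define R where "R = (\<Sum>i\<in>UNIV. \<Sum>j\<in>UNIV. ip (C i j) (C j i) - ip (C i i) (C j j))"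
    have "(\<Sum>i\<in>UNIV. \<Sum>j\<in>UNIV. ip (h i j) (h j i) - ip (h i i) (h j j)) = (\<Sum>i\<in>UNIV. \<Sum>j\<in>UNIV. ip (h i j) (C j i) - ip (h i i) (C j j))"
      by (intro sum.cong refl 1)
    \<comment> \<open>Conjugation exchanges the two slots of \<open>ip\<close>, which turns the
      mixed products of \<open>h\<close> and \<open>C\<close> into those of the second
      identity.\<close>
    also have "\<dots> = cnj R" unfolding R_def 2 cnj_sum complex_cnj_diff cnj_ip by (rule sum.swap)
    finally have HR: "(\<Sum>i\<in>UNIV. \<Sum>j\<in>UNIV. ip (h i j) (h j i) - ip (h i i) (h j j)) = cnj R" .
    have "ip (h i j) (h j i) = of_real ((nD (h i j))^2)" for i j
      using ip_cong_right[OF hL hL hL second_derivatives_commute[OF u H1_trace_weak_partial[OF w], of j i], of i j]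
      by (simp add: ip_self)
    moreover have "(\<Sum>i\<in>UNIV. \<Sum>j\<in>UNIV. ip (h i i) (h j j)) = of_real (d^2)"
      unfolding d_def ip_self[symmetric] by (simp add: ip_sum_left ip_sum_right hL L2_sum)
    ultimately have "cnj R = of_real ((\<Sum>i\<in>UNIV. \<Sum>j\<in>UNIV. (nD (h i j))^2) - d^2)"
      unfolding HR[symmetric] by (simp add: sum_subtractf)
    then have "norm (cnj R) = \<bar>(\<Sum>i\<in>UNIV. \<Sum>j\<in>UNIV. (nD (h i j))^2) - d\<^sup>2\<bar>" by (simp only: norm_of_real)
    then have X: "(\<Sum>i\<in>UNIV. \<Sum>j\<in>UNIV. (nD (h i j))^2) \<le> d^2 + norm R" by simp
    \<comment> \<open>\<open>P\<close> has rank one and \<open>nuc\<close> is real, so the product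
      of its entries at (i, j) and (j, i) is a product of two diagonal entries. This is the
      cancellation of the leading part.\<close>
    have "(\<Sum>i\<in>UNIV. \<Sum>j\<in>UNIV. ip (P i j) (P j i)) = (\<Sum>i\<in>UNIV. \<Sum>j\<in>UNIV. ip (P j j) (P i i))"
      by (intro sum.cong refl) (simp add: ip_def P_def ac_simps)
    also have "\<dots> = (\<Sum>i\<in>UNIV. \<Sum>j\<in>UNIV. ip (P i i) (P j j))" by (rule sum.swap)
    finally have Req: "R = (\<Sum>i\<in>UNIV. \<Sum>j\<in>UNIV. (ip (C i j) (C j i) - ip (P i j) (P j i)) - (ip (C i i) (C j j) - ip (P i i) (P j j)))"
      unfolding R_def by (simp add: sum_subtractf)
    have "norm R \<le> (\<Sum>i\<in>(UNIV::'n set). \<Sum>j\<in>(UNIV::'n set). 2 * (c^4 * (2 * (Y * a) + 3 * a^2)))" unfolding Req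
    proof (rule sum_norm_le, rule sum_norm_le)
      fix i j
      have "norm ((ip (C i j) (C j i) - ip (P i j) (P j i)) - (ip (C i i) (C j j) - ip (P i i) (P j j)))
        \<le> c^4 * (2 * (Y * a) + 3 * a^2) + c^4 * (2 * (Y * a) + 3 * a^2)"
        by (rule order_trans[OF norm_triangle_ineq4 add_mono[OF per per]])
      then show "norm ((ip (C i j) (C j i) - ip (P i j) (P j i)) - (ip (C i i) (C j j) - ip (P i i) (P j j))) \<le> 2 * (c^4 * (2 * (Y * a) + 3 * a^2))"
        by (simp only: mult_2)
    qed
    also have "\<dots> = N^2 * (2 * (c^4 * (2 * (Y * a) + 3 * a^2)))" by (simp add: N_def power2_eq_square)
    also have "\<dots> \<le> K * (Y * a + a^2)"
    proof -
      have "0 \<le> N^2 * c^4 * (Y * a)" using Y a by simp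
      then show ?thesis by (simp add: K_def algebra_simps)
    qed
    finally have R: "norm R \<le> K * (Y * a + a^2)" .
    have "Y\<^sup>2 \<le> N^2 * (\<Sum>i\<in>UNIV. \<Sum>j\<in>UNIV. (nD (h i j))^2)"
    proof -
      have "Y\<^sup>2 = (\<Sum>ij\<in>UNIV. 1 * nD (h (fst ij) (snd ij)))^2"
        by (simp add: Y_def sum.cartesian_product UNIV_Times_UNIV case_prod_beta)
      also have "\<dots> \<le> (\<Sum>ij\<in>(UNIV::('n\<times>'n) set). 1\<^sup>2) * (\<Sum>ij\<in>UNIV. (nD (h (fst ij) (snd ij)))^2)" by (rule Cauchy_Schwarz_ineq_sum)
      also have "\<dots> = N^2 * (\<Sum>i\<in>UNIV. \<Sum>j\<in>UNIV. (nD (h i j))^2)"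
        by (simp add: N_def sum.cartesian_product UNIV_Times_UNIV case_prod_beta power2_eq_square)
      finally show ?thesis .
    qed
    also have "\<dots> \<le> N^2 * (d^2 + K * (Y * a + a^2))" using X R by (intro mult_left_mono) auto
    finally have "Y \<le> (2 * N^2 + 2 * N^2 * K + (N^2 * K)^2 + 1) * (d + a)" by (rule quadratic_absorb) (use NK a d in auto)
    then show "(\<Sum>i\<in>UNIV. \<Sum>j\<in>UNIV. nD (h i j)) \<le> (2 * N^2 + 2 * N^2 * K + (N^2 * K)^2 + 1)
        * (nD (\<lambda>x. \<Sum>i\<in>UNIV. h i i x) + (\<Sum>k\<in>UNIV. nD (w k)))" unfolding Y_def d_def a_def .
  qed
qed

end


subsection \<open>Rellich compactness\<close>

lemma lipschitz_of_partial_bound: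
  fixes f :: "real^'n \<Rightarrow> complex"
  assumes f: "\<And>x. f differentiable (at x)" and C: "\<And>i x. norm (partial i f x) \<le> C"
  shows "norm (f x - f y) \<le> real CARD('n) * C * norm (x - y)"
proof (rule differentiable_bound[of UNIV])
  fix z :: "real^'n"
  show "(f has_derivative (\<lambda>h. \<Sum>i\<in>UNIV. h $ i *\<^sub>R partial i f z)) (at z within UNIV)" by (rule has_derivative_partial[OF f])
  have C0: "C \<ge> 0" using norm_ge_zero C order_trans by blast
  show "onorm (\<lambda>h. \<Sum>i\<in>UNIV. h $ i *\<^sub>R partial i f z) \<le> real CARD('n) * C"
  proof (rule onorm_bound)
    fix h :: "real^'n"
    have "norm (\<Sum>i\<in>UNIV. h $ i *\<^sub>R partial i f z) \<le> (\<Sum>i\<in>(UNIV::'n set). norm h * C)"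
      by (rule sum_norm_le) (simp add: mult_mono component_le_norm_cart C)
    then show "norm (\<Sum>i\<in>UNIV. h $ i *\<^sub>R partial i f z) \<le> real CARD('n) * C * norm h" by (simp add: ac_simps)
  qed (use C0 in simp)
qed auto

text \<open>Translation by \<open>y\<close> is divided into many translations by \<open>y / k\<close>, each of which is
  compared with the derivative in direction \<open>y\<close>.\<close>

lemma translation_estimate:
  fixes f :: "real^'n \<Rightarrow> complex"
  assumes f: "Ck 1 f" "\<And>x. x \<notin> cball 0 R \<Longrightarrow> f x = 0"
  shows "nR (\<lambda>x. f (x - y) - f x) \<le> norm y * (\<Sum>i\<in>UNIV. nR (partial i f))"
proof -
  have fd: "f differentiable (at x)" and pc: "continuous_on UNIV (partial i f)" for x i using f(1) by auto
  have fc: "continuous_on UNIV f" by (rule Ck_continuous[OF f(1)])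
  have p0: "partial i f x = 0" if "x \<notin> cball 0 R" for i x by (rule partial_support[OF f(2) that])
  have fL: "f \<in> L2 lborel" by (rule L2_compact_support[OF fc compact_cball f(2)])
  have pL: "partial i f \<in> L2 lborel" for i by (rule L2_compact_support[OF pc compact_cball p0])
  have "\<forall>i. \<exists>C. \<forall>x. norm (partial i f x) \<le> C"
  proof
    fix i
    obtain C where C: "C \<ge> 0" "\<And>x. x \<in> cball 0 R \<Longrightarrow> norm (partial i f x) \<le> C"
      by (rule continuous_on_compact_bound[OF continuous_on_subset[OF pc subset_UNIV] compact_cball]) blast
    have "norm (partial i f x) \<le> C" for x using C p0[of x i] by (cases "x \<in> cball 0 R") auto
    then show "\<exists>C. \<forall>x. norm (partial i f x) \<le> C" by blast
  qed
  from choice[OF this] obtain B where B: "\<And>i x. norm (partial i f x) \<le> B i" by blast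
  have "norm (partial i f x) \<le> Max (range B)" for i x by (rule order_trans[OF B Max_ge]) auto
  from lipschitz_of_partial_bound[OF fd this]
  obtain C where C: "\<And>x y. norm (f x - f y) \<le> C * norm (x - y)" by blast
  \<comment> \<open>Minus the derivative of \<open>f\<close> in direction \<open>y\<close>: the
    limit of the rescaled differences \<open>q k\<close>.\<close>
  define g where "g x = - (\<Sum>i\<in>UNIV. y $ i *\<^sub>R partial i f x)" for x
  have gL: "g \<in> L2 lborel" unfolding g_def by (intro L2_uminus L2_sum L2_scaleR pL)
  define q where "q k x = real (Suc k) *\<^sub>R (f (x - (1 / real (Suc k)) *\<^sub>R y) - f x)" for k x
  have TL: "(\<lambda>x. f (x - z) - f x) \<in> L2 lborel" for z by (intro L2_diff L2_translate fL)
  have qL: "q k \<in> L2 lborel" for k unfolding q_def by (intro L2_scaleR TL)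
  have qC: "norm (q k x) \<le> C * norm y" for k x
  proof -
    have "norm (q k x) = real (Suc k) * norm (f (x - (1 / real (Suc k)) *\<^sub>R y) - f x)" unfolding q_def norm_scaleR by simp
    also have "\<dots> \<le> real (Suc k) * (C * norm (x - (1 / real (Suc k)) *\<^sub>R y - x))" by (intro mult_left_mono C) simp
    also have "\<dots> = C * norm y" by (simp add: field_simps)
    finally show ?thesis .
  qed
  have qg: "(\<lambda>k. q k x) \<longlonglongrightarrow> g x" for x
  proof -
    have "((\<lambda>t. f (x + t *\<^sub>R (- y))) has_vector_derivative (\<Sum>i\<in>UNIV. (- y) $ i *\<^sub>R partial i f (x + 0 *\<^sub>R (- y)))) (at 0)"
      by (rule partial_along_line[OF fd])
    then have "((\<lambda>t. f (x - t *\<^sub>R y)) has_vector_derivative g x) (at 0)" by (simp add: g_def sum_negf)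
    then have "((\<lambda>h. norm (f (x - (0 + h) *\<^sub>R y) - f (x - 0 *\<^sub>R y) - h *\<^sub>R g x) / norm h) \<longlongrightarrow> 0) (at 0)"
      unfolding has_vector_derivative_def has_derivative_at by blast
    moreover have "filterlim (\<lambda>k. 1 / real (Suc k)) (at 0) sequentially"
      unfolding filterlim_at using LIMSEQ_inverse_real_of_nat by (simp add: inverse_eq_divide)
    ultimately have "(\<lambda>k. norm (f (x - (0 + 1 / real (Suc k)) *\<^sub>R y) - f (x - 0 *\<^sub>R y) - (1 / real (Suc k)) *\<^sub>R g x) / norm (1 / real (Suc k))) \<longlonglongrightarrow> 0"
      by (rule filterlim_compose)
    moreover have "norm (f (x - (0 + 1 / real (Suc k)) *\<^sub>R y) - f (x - 0 *\<^sub>R y) - (1 / real (Suc k)) *\<^sub>R g x) / norm (1 / real (Suc k))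
        = norm (q k x - g x)" for k
    proof -
      have "q k x - g x = real (Suc k) *\<^sub>R (f (x - (1 / real (Suc k)) *\<^sub>R y) - f x - (1 / real (Suc k)) *\<^sub>R g x)"
        by (simp add: q_def scaleR_diff_right del: of_nat_Suc)
      then show ?thesis by (simp add: del: of_nat_Suc)
    qed
    ultimately show ?thesis by (simp add: tendsto_norm_zero_iff LIM_zero_iff)
  qed
  have gC: "norm (g x) \<le> C * norm y" for x using LIMSEQ_le_const2[OF tendsto_norm[OF qg[of x]]] qC by blast
  have lim: "(\<lambda>k. nR (q k)) \<longlonglongrightarrow> nR g"
  proof (rule L2_norm_tendsto[OF qL gL L2_dominated_tendsto])
    define w where "w x = (2 * (C * norm y))^2 * indicator (cball 0 (R + norm y)) x" for x :: "real^'n"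
    show "integrable lborel w" unfolding w_def using emeasure_compact_finite[of "cball (0::real^'n) (R + norm y)"]
      by (intro integrable_mult_right integrable_real_indicator) auto
    show "AE x in lborel. (norm (q k x - g x))^2 \<le> w x" for k
    proof (rule AE_I2)
      fix x
      show "(norm (q k x - g x))^2 \<le> w x"
      proof (cases "x \<in> cball 0 (R + norm y)")
        case True
        have "norm (q k x - g x) \<le> 2 * (C * norm y)" using norm_triangle_ineq4[of "q k x" "g x"] qC[of k x] gC[of x] by linarith
        then have "(norm (q k x - g x))^2 \<le> (2 * (C * norm y))^2" by (rule power_mono) simp
        then show ?thesis using True by (simp add: w_def)
      next
        case False
        then have n: "norm x > R + norm y" by simp
        have "norm ((1 / real (Suc k)) *\<^sub>R y) \<le> norm y" by (simp add: field_simps)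
        with n norm_triangle_ineq2[of x "(1 / real (Suc k)) *\<^sub>R y"] have "norm (x - (1 / real (Suc k)) *\<^sub>R y) > R" by linarith
        moreover have "norm x > R" using n norm_ge_zero[of y] by linarith
        ultimately have "q k x = 0" "g x = 0" using f(2) p0[of x] by (simp_all add: q_def g_def)
        then show ?thesis by (simp add: w_def)
      qed
    qed
    show "AE x in lborel. (\<lambda>k. q k x) \<longlonglongrightarrow> g x" by (intro AE_I2 qg)
  qed (intro L2_measurable qL gL)+
  have N: "nR (\<lambda>x. f (x - real k *\<^sub>R z) - f x) \<le> real k * nR (\<lambda>x. f (x - z) - f x)" for k z
  proof (induction k)
    case (Suc k)
    have "nR (\<lambda>x. f (x - real (Suc k) *\<^sub>R z) - f x)
      = nR (\<lambda>x. (f (x - z - real k *\<^sub>R z) - f (x - z)) + (f (x - z) - f x))" by (simp add: algebra_simps)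
    also have "\<dots> \<le> nR (\<lambda>x. f (x - z - real k *\<^sub>R z) - f (x - z)) + nR (\<lambda>x. f (x - z) - f x)"
      using L2_translate(1)[OF TL[of "real k *\<^sub>R z"], of z] by (rule L2_norm_triangle) (rule TL)
    also have "nR (\<lambda>x. f (x - z - real k *\<^sub>R z) - f (x - z)) = nR (\<lambda>x. f (x - real k *\<^sub>R z) - f x)"
      using L2_translate(2)[OF TL[of "real k *\<^sub>R z"], of z] .
    finally show ?case using Suc.IH by (simp add: algebra_simps)
  qed simp
  have "nR (\<lambda>x. f (x - y) - f x) \<le> nR (q k)" for k
    using N[of "Suc k" "(1 / real (Suc k)) *\<^sub>R y"] unfolding q_def L2_norm_scaleR by (simp del: of_nat_Suc)
  then have "nR (\<lambda>x. f (x - y) - f x) \<le> nR g" by (intro LIMSEQ_le_const[OF lim]) blast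
  also have "\<dots> = nR (\<lambda>x. \<Sum>i\<in>UNIV. y $ i *\<^sub>R partial i f x)" unfolding g_def L2_norm_def by simp
  also have "\<dots> \<le> (\<Sum>i\<in>UNIV. nR (\<lambda>x. y $ i *\<^sub>R partial i f x))" by (intro L2_norm_sum L2_scaleR pL)
  also have "\<dots> \<le> (\<Sum>i\<in>UNIV. norm y * nR (partial i f))"
    unfolding L2_norm_scaleR by (intro sum_mono mult_right_mono component_le_norm_cart) simp
  finally show ?thesis by (simp add: sum_distrib_left)
qed

context C2_domain
begin

text \<open>The hypothesis \<open>p\<close> expresses that \<open>V\<close> is the gradient of
  \<open>U\<close> on the whole space. The estimate for C1 functions is applied to a mollification
  close to \<open>U\<close>, whose derivatives are at most as large as \<open>V\<close> in
  L2.\<close>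

lemma zero_trace_mollify:
  assumes U: "U \<in> L2 lborel" "\<And>x. x \<notin> D \<Longrightarrow> U x = 0"
    and V: "\<And>i. V i \<in> L2 lborel" "\<And>i x. x \<notin> D \<Longrightarrow> V i x = 0"
    and p: "\<And>ker c R i x. mollifier ker \<Longrightarrow> \<forall>x. x \<notin> cball c R \<longrightarrow> ker x = 0 \<Longrightarrow> partial i (convolve ker U) x = convolve ker (V i) x"
  shows "nR (\<lambda>x. U (x - y) - U x) \<le> norm y * (\<Sum>i\<in>UNIV. nR (V i))"
proof (rule field_le_epsilon)
  fix e :: real assume e: "e > 0"
  have Ui: "integrable lborel U" by (rule integrable_zero_extension[OF U])
  have Vi: "integrable lborel (V i)" for i by (rule integrable_zero_extension[OF V])
  obtain R where R: "R > 0" "D \<subseteq> cball 0 R" by (rule D_bound)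
  have "\<exists>d>0. \<forall>y. norm y < d \<longrightarrow> nR (\<lambda>x. U (x - y) - U x) \<le> e / 2"
  proof (rule L2_translation_continuous[OF U(1) _ R(1)])
    fix x :: "real^'n" assume "x \<notin> cball 0 R"
    then have "x \<notin> D" using R(2) by blast
    then show "U x = 0" by (rule U(2))
  qed (use e in simp)
  then obtain d where d: "d > 0" "\<And>y. norm y < d \<Longrightarrow> nR (\<lambda>x. U (x - y) - U x) \<le> e / 2" by blast
  have d2: "d / 2 > 0" using d(1) by simp
  obtain ker :: "real^'n \<Rightarrow> real" where ker: "mollifier ker" "\<And>x. x \<notin> cball 0 (d / 2) \<Longrightarrow> ker x = 0"
    using mollifier_exists[OF d2, of "0 :: real^'n"] by blast
  have sm: "Ck k ker" for k using ker(1) by (auto simp: mollifier_def intro: smooth_Ck)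
  define f where "f = convolve ker U"
  have fL: "f \<in> L2 lborel" unfolding f_def by (rule L2_convolve(1)[OF ker U(1) Ui])
  have fU: "dR f U \<le> e / 2" unfolding f_def
  proof (rule L2_convolve(3)[where c=0 and R="d / 2", OF ker(1) _ U(1) Ui])
    fix y assume "ker y \<noteq> 0"
    then have "y \<in> cball 0 (d / 2)" using ker(2) by blast
    then show "nR (\<lambda>x. U (x - y) - U x) \<le> e / 2" using d by simp
  qed (use e ker(2) in auto)
  have "f x = 0" if x: "x \<notin> cball 0 (R + d / 2)" for x
  proof -
    have "ker (x - z) *\<^sub>R U z = 0" for z
    proof (cases "z \<in> D")
      case True
      then have "norm z \<le> R" using R(2) by auto
      then have "norm (x - z) > d / 2" using x norm_triangle_ineq2[of x z] by simp
      then show ?thesis using ker(2)[of "x - z"] by simp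
    qed (simp add: U(2))
    then show ?thesis unfolding f_def convolve_def by (simp only: integral_zero)
  qed
  note f0 = this
  have fC1: "Ck 1 f" unfolding f_def by (rule Ck_convolve[OF sm _ Ui]) (rule ker(2))
  have fy: "nR (\<lambda>x. f (x - y) - f x) \<le> norm y * (\<Sum>i\<in>UNIV. nR (partial i f))" by (rule translation_estimate[OF fC1]) (rule f0)
  have "partial i f = convolve ker (V i)" for i unfolding f_def using p[OF ker(1), of 0 "d / 2"] ker(2) by blast
  then have pn: "nR (partial i f) \<le> nR (V i)" for i
    by (simp only:) (rule L2_convolve(2)[where c=0 and R="d / 2", OF ker(1) _ V(1) Vi], rule ker(2))
  have "nR (\<lambda>x. U (x - y) - U x) = nR (\<lambda>x. (f (x - y) - f x) + ((f x - U x) - (f (x - y) - U (x - y))))"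
    by (simp add: algebra_simps)
  also have "\<dots> \<le> nR (\<lambda>x. f (x - y) - f x) + nR (\<lambda>x. (f x - U x) - (f (x - y) - U (x - y)))"
    by (intro L2_norm_triangle L2_diff L2_translate fL U(1))
  also have "nR (\<lambda>x. (f x - U x) - (f (x - y) - U (x - y))) \<le> dR f U + nR (\<lambda>x. f (x - y) - U (x - y))"
    using L2_norm_triangle_diff[of "\<lambda>x. f x - U x" lborel "\<lambda>x. 0" "\<lambda>x. f (x - y) - U (x - y)"]
      L2_diff[OF fL U(1)] L2_translate(1)[OF L2_diff[OF fL U(1)], of y]
    by (simp add: L2_zero L2_norm_minus_commute[of lborel "\<lambda>x. U (x - y)"])
  also have "nR (\<lambda>x. f (x - y) - U (x - y)) = dR f U" by (rule L2_translate(2)[OF L2_diff[OF fL U(1)]])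
  also have "nR (\<lambda>x. f (x - y) - f x) + (dR f U + dR f U)
    \<le> norm y * (\<Sum>i\<in>UNIV. nR (V i)) + (e / 2 + e / 2)" by (intro add_mono fU order_trans[OF fy] mult_left_mono sum_mono pn) simp
  finally show "nR (\<lambda>x. U (x - y) - U x) \<le> norm y * (\<Sum>i\<in>UNIV. nR (V i)) + e" by simp
qed

text \<open>Zero trace removes the boundary term even when a kernel reaches across the frontier, so
  the zero extension of \<open>v\<close> is the gradient of the zero extension of \<open>u\<close>
  on the whole space.\<close>

lemma zero_trace_extension:
  assumes u: "H1_trace u v (\<lambda>x. 0)"
  shows "\<exists>U. U \<in> L2 lborel \<and> (\<forall>x. x \<notin> D \<longrightarrow> U x = 0) \<and> (AE x in LD. U x = u x) \<and>
    (\<forall>y. nR (\<lambda>x. U (x - y) - U x) \<le> norm y * (\<Sum>i\<in>UNIV. nD (v i)))"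
proof -
  note L = H1_traceD[OF u]
  obtain U where U: "U \<in> L2 lborel" "\<And>x. x \<notin> D \<Longrightarrow> U x = 0" "AE x in LD. U x = u x" using L2_zero_extension[OF open_D L(1)] by blast
  have "\<forall>i. \<exists>V. V \<in> L2 lborel \<and> (\<forall>x. x \<notin> D \<longrightarrow> V x = 0) \<and> (AE x in LD. V x = v i x)"
    by (intro allI L2_zero_extension[OF open_D L(2)])
  from choice[OF this] obtain V where V: "\<And>i. V i \<in> L2 lborel" "\<And>i x. x \<notin> D \<Longrightarrow> V i x = 0" "\<And>i. AE x in LD. V i x = v i x" by blast
  have Vn: "nR (V i) = nD (v i)" for i
    using L2_restrict(3)[OF open_D V(1)[of i] V(2)[of _ i]] L2_cong_AE(2)[OF L(2) L2_measurable[OF L2_restrict(1)[OF open_D V(1)]] V(3)] by simp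
  have "partial i (convolve ker U) x = convolve ker (V i) x"
    if "mollifier ker" "\<forall>x. x \<notin> cball c R \<longrightarrow> ker x = 0" for ker c R i x
  proof -
    from that have ker: "mollifier ker" "\<And>x. x \<notin> cball c R \<Longrightarrow> ker x = 0" by auto
    have sm: "smooth ker" using ker(1) by (simp add: mollifier_def)
    have C1: "Ck 1 ker" by (rule smooth_Ck[OF sm])
    have c1: "Ck 1 (\<lambda>z. complex_of_real (ker (x - z)))"
      by (rule Ck_bounded_linear[OF bounded_linear_of_real Ck_reflect(1)[OF C1]])
    have p: "partial i (\<lambda>z. complex_of_real (ker (x - z))) = (\<lambda>z. - of_real (partial i ker (x - z)))" for i
    proof
      fix z
      have "(\<lambda>z. ker (x - z)) differentiable (at z)" using Ck_reflect(1)[OF C1, of x] by simp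
      then show "partial i (\<lambda>z. complex_of_real (ker (x - z))) z = - of_real (partial i ker (x - z))"
        by (subst partial_bounded_linear[OF bounded_linear_of_real]) (simp_all add: Ck_reflect(2)[OF C1])
    qed
    have kerr: "(\<lambda>z. ker (x - z)) \<in> borel_measurable borel" "(\<lambda>z. partial i ker (x - z)) \<in> borel_measurable borel"
      using Ck_continuous[OF Ck_reflect(1)[OF C1]] Ck_continuous[OF Ck_reflect(1)[OF smooth_Ck[OF smooth_partial[OF sm], of 0]]]
      by (auto intro: borel_measurable_continuous_onI)
    have "partial i (convolve ker U) x = convolve (partial i ker) U x"
      by (rule partial_convolve[OF C1 ker(2) integrable_zero_extension[OF U(1,2)]])
    also have "\<dots> = (\<integral>z. partial i ker (x - z) *\<^sub>R u z \<partial>LD)"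
      unfolding convolve_def by (rule integral_zero_extension[OF U(1,2) L2_measurable[OF L(1)] U(3) kerr(2)])
    also have "\<dots> = (\<integral>z. ker (x - z) *\<^sub>R v i z \<partial>LD)"
      using zero_trace_parts[OF H1_trace_cnj[OF u, unfolded complex_cnj_zero] C1_L2(1)[OF c1] C1_weak_partial[OF c1], of i]
      by (simp add: ip_def p scaleR_conv_of_real)
    also have "\<dots> = convolve ker (V i) x"
      unfolding convolve_def by (rule integral_zero_extension[OF V(1,2) L2_measurable[OF L(2)] V(3) kerr(1), symmetric])
    finally show ?thesis .
  qed
  note p = this
  have "nR (\<lambda>x. U (x - y) - U x) \<le> norm y * (\<Sum>i\<in>UNIV. nR (V i))" for y
    by (rule zero_trace_mollify[OF U(1) _ V(1)], erule U(2), erule V(2), rule p)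
  then show ?thesis using U unfolding Vn by blast
qed

end


section \<open>Compactness of bounded sequences with zero trace\<close>

context C2_domain
begin

lemma integral_norm_zero_extension:
  obtains C where "C \<ge> 0" "\<And>U. U \<in> L2 lborel \<Longrightarrow> (\<And>x. x \<notin> D \<Longrightarrow> U x = 0) \<Longrightarrow> (\<integral>x. norm (U x) \<partial>lborel) \<le> C * nR U"
proof
  let ?\<chi> = "\<lambda>x. indicator D x *\<^sub>R (1::complex)"
  have "integrable lborel (\<lambda>x. (norm (?\<chi> x))^2)"
  proof -
    have eq: "(\<lambda>x. (norm (?\<chi> x))^2) = indicator D" by (auto simp: indicator_def)
    show ?thesis unfolding eq using emeasure_bounded_finite[OF bounded_D] open_D by (intro integrable_real_indicator) auto
  qed
  moreover have "?\<chi> \<in> borel_measurable lborel" using open_D by (intro borel_measurable_scaleR borel_measurable_indicator) auto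
  ultimately have \<chi>: "?\<chi> \<in> L2 lborel" by (simp add: L2_def)
  show "nR ?\<chi> \<ge> 0" by simp
  fix U :: "real^'n \<Rightarrow> complex" assume U: "U \<in> L2 lborel" "\<And>x. x \<notin> D \<Longrightarrow> U x = 0"
  have nU: "norm (?\<chi> x) * norm (U x) = norm (U x)" for x using U(2)[of x] by (cases "x \<in> D") simp_all
  show "(\<integral>x. norm (U x) \<partial>lborel) \<le> nR ?\<chi> * nR U" using L2_norm_mult_bound[OF \<chi> U(1)] by (simp only: nU)
qed

lemma L2_norm_uniform_bound:
  fixes f :: "real^'n \<Rightarrow> complex"
  assumes f: "continuous_on UNIV f" "b \<ge> 0" "\<And>x. x \<in> closure D \<Longrightarrow> norm (f x) \<le> b"
  shows "nD f \<le> nD (\<lambda>x. 1) * b"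
proof -
  have "nD f \<le> b * nD (\<lambda>x. 1)"
  proof (rule L2_norm_mono[OF L2_measurable[OF L2_continuous_D(1)[OF f(1)]] L2_const[OF finite_LD] _ f(2)])
    show "AE x in LD. norm (f x) \<le> b * norm (1::complex)" using f(3) closure_subset[of D] by (intro AE_I2) auto
  qed
  then show ?thesis by (simp add: mult.commute)
qed

text \<open>For a fixed kernel the mollified functions are uniformly bounded and equicontinuous,
  because the \<open>U m\<close> are bounded in L1. Arzela-Ascoli then gives uniform and hence L2
  convergence of a subsequence on \<open>D\<close>.\<close>

lemma mollified_compact:
  assumes ker: "mollifier ker" "\<And>x. x \<notin> cball 0 r \<Longrightarrow> ker x = 0"
    and U: "\<And>m::nat. U m \<in> L2 lborel" "\<And>m x. x \<notin> D \<Longrightarrow> U m x = 0" "\<And>m. nR (U m) \<le> B" and e: "e > 0"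
  shows "\<exists>s. strict_mono (s :: nat \<Rightarrow> nat) \<and> (\<forall>m l. dD (convolve ker (U (s m))) (convolve ker (U (s l))) \<le> e)"
proof -
  have kerc: "continuous_on UNIV ker" using ker(1) by (intro Ck_continuous[of 0] smooth_Ck) (simp add: mollifier_def)
  obtain C where C: "C \<ge> 0" "\<And>U. U \<in> L2 lborel \<Longrightarrow> (\<And>x. x \<notin> D \<Longrightarrow> U x = 0) \<Longrightarrow> (\<integral>x. norm (U x) \<partial>lborel) \<le> C * nR U"
    by (rule integral_norm_zero_extension) blast
  \<comment> \<open>The summand 1 makes \<open>I\<close> positive, so that it can be divided
    by.\<close>
  define I where "I = C * B + 1"
  have "B \<ge> 0" by (rule order_trans[OF L2_norm_nonneg U(3)])
  from mult_nonneg_nonneg[OF C(1) this] have I0: "I > 0" unfolding I_def by linarith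
  have I: "(\<integral>x. norm (U m x) \<partial>lborel) \<le> I" for m
  proof -
    have "(\<integral>x. norm (U m x) \<partial>lborel) \<le> C * nR (U m)" by (rule C(2)[OF U(1)]) (rule U(2))
    also have "\<dots> \<le> C * B" by (rule mult_left_mono[OF U(3) C(1)])
    finally show ?thesis by (simp add: I_def)
  qed
  have Ui: "integrable lborel (U m)" for m by (rule integrable_zero_extension[OF U(1)]) (rule U(2))
  have ci: "integrable lborel (\<lambda>z. ker (x - z) *\<^sub>R U m z)" for m x
    by (rule convolve_integrable[where c=0 and R=r, OF kerc _ Ui]) (rule ker(2))
  have cc: "continuous_on UNIV (convolve ker (U m))" for m
    by (rule convolve_continuous[where c=0 and R=r, OF kerc _ Ui]) (rule ker(2))
  obtain K where K: "K \<ge> 0" "\<And>x. \<bar>ker x\<bar> \<le> K" by (rule kernel_bound[where c=0 and R=r, OF kerc], erule ker(2)) blast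
  have bd: "norm (convolve ker (U m) x) \<le> K * I" for m x
  proof -
    have "norm (convolve ker (U m) x) \<le> (\<integral>z. K * norm (U m z) \<partial>lborel)" unfolding convolve_def
      by (rule norm_integral_le_integral[OF ci]) (use Ui K in \<open>auto intro!: mult_right_mono\<close>)
    also have "\<dots> \<le> K * I" using mult_left_mono[OF I K(1)] by simp
    finally show ?thesis .
  qed
  have eqc: "\<exists>d>0. \<forall>m y. y \<in> closure D \<and> norm (x - y) < d \<longrightarrow> norm (convolve ker (U m) x - convolve ker (U m) y) < a"
    if a: "a > 0" for x a
  proof -
    have a': "a / (2 * I) > 0" using a I0 by simp
    obtain d where d: "d > 0" "\<And>x y. dist x y < d \<Longrightarrow> dist (ker x) (ker y) < a / (2 * I)"
      using uniformly_continuous_compact_support[where c=0 and R=r, OF kerc _ a'] ker(2) by blast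
    have "norm (convolve ker (U m) x - convolve ker (U m) y) < a" if xy: "norm (x - y) < d" for m y
    proof -
      have eq: "convolve ker (U m) x - convolve ker (U m) y = (\<integral>z. (ker (x - z) - ker (y - z)) *\<^sub>R U m z \<partial>lborel)"
        unfolding convolve_def scaleR_diff_left by (rule Bochner_Integration.integral_diff[OF ci ci, symmetric])
      have "norm (convolve ker (U m) x - convolve ker (U m) y) \<le> (\<integral>z. a / (2 * I) * norm (U m z) \<partial>lborel)" unfolding eq
      proof (rule norm_integral_le_integral)
        show "integrable lborel (\<lambda>z. (ker (x - z) - ker (y - z)) *\<^sub>R U m z)"
          unfolding scaleR_diff_left by (rule Bochner_Integration.integrable_diff[OF ci ci])
        show "norm ((ker (x - z) - ker (y - z)) *\<^sub>R U m z) \<le> a / (2 * I) * norm (U m z)" for z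
          unfolding norm_scaleR using d(2)[of "x - z" "y - z"] xy by (intro mult_right_mono) (simp_all add: dist_norm)
      qed (use Ui in simp)
      also have "\<dots> = a / (2 * I) * (\<integral>z. norm (U m z) \<partial>lborel)" by simp
      also have "\<dots> \<le> a / (2 * I) * I" using a' by (intro mult_left_mono I) simp
      also have "\<dots> < a" using I0 a by simp
      finally show ?thesis .
    qed
    then show ?thesis using d(1) by blast
  qed
  obtain g s where s: "strict_mono (s :: nat \<Rightarrow> nat)"
    "\<And>e. 0 < e \<Longrightarrow> \<exists>N. \<forall>n x. n \<ge> N \<and> x \<in> closure D \<longrightarrow> norm (convolve ker (U (s n)) x - g x) < e"
    by (rule Arzela_Ascoli[OF compact_closure_D, of "\<lambda>m. convolve ker (U m)"]) (use bd eqc in blast)+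
  define A where "A = nD (\<lambda>x. 1)"
  have A: "A \<ge> 0" by (simp add: A_def)
  define b where "b = e / (2 * (A + 1))"
  have b: "b > 0" using A e by (simp add: b_def)
  obtain N where N: "\<And>n x. n \<ge> N \<Longrightarrow> x \<in> closure D \<Longrightarrow> norm (convolve ker (U (s n)) x - g x) < b" using s(2)[OF b] by blast
  have 1: "nD (\<lambda>x. convolve ker (U (s (N + m))) x - convolve ker (U (s (N + l))) x) \<le> e" for m l
  proof -
    have "nD (\<lambda>x. convolve ker (U (s (N + m))) x - convolve ker (U (s (N + l))) x) \<le> A * (2 * b)" unfolding A_def
    proof (rule L2_norm_uniform_bound)
      fix x assume x: "x \<in> closure D"
      have "norm (convolve ker (U (s (N + m))) x - g x) < b" "norm (convolve ker (U (s (N + l))) x - g x) < b"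
        by (rule N[OF _ x], simp)+
      then show "norm (convolve ker (U (s (N + m))) x - convolve ker (U (s (N + l))) x) \<le> 2 * b"
        using norm_triangle_ineq4[of "convolve ker (U (s (N + m))) x - g x" "convolve ker (U (s (N + l))) x - g x"] by simp
    qed (use b in \<open>auto intro!: continuous_intros cc\<close>)
    also have "A * (2 * b) \<le> (A + 1) * (2 * b)" using b by simp
    also have "\<dots> = e" using A by (simp add: b_def field_simps)
    finally show ?thesis .
  qed
  have 2: "strict_mono (\<lambda>m. s (N + m))" using s(1) by (simp add: strict_mono_def)
  show ?thesis by (rule exI[of _ "\<lambda>m. s (N + m)"]) (use 1 2 in blast)
qed

text \<open>The translation estimate is uniform in \<open>m\<close>, so one kernel of radius
  \<open>r\<close> moves every function of the sequence by at most \<open>e / 3\<close>. Compactness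
  for that fixed kernel accounts for the remaining third.\<close>

lemma zero_trace_net:
  assumes u: "\<And>m. H1_trace (u m) (v m) (\<lambda>x. 0)"
    and B: "\<And>m. nD (u m) \<le> B" "\<And>m i. nD (v m i) \<le> B" and e: "e > 0"
  shows "\<exists>s. strict_mono (s :: nat \<Rightarrow> nat) \<and> (\<forall>m l. dD (u (s m)) (u (s l)) \<le> e)"
proof -
  define N where "N = real CARD('n)"
  have B0: "B \<ge> 0" by (rule order_trans[OF L2_norm_nonneg B(1)])
  define r where "r = e / (3 * (N * B + 1))"
  have "N * B \<ge> 0" using B0 by (simp add: N_def)
  then have NB: "N * B + 1 > 0" by linarith
  have r: "r > 0" using e NB by (simp add: r_def)
  have rNB: "r * (N * B) \<le> e / 3"
  proof -
    have "r * (N * B) \<le> r * (N * B + 1)" using r by simp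
    also have "\<dots> = e / 3"
    proof -
      have "e / (3 * q) * q = e / 3" if "q > 0" for q :: real using that by (simp add: field_simps)
      from this[OF NB] show ?thesis unfolding r_def .
    qed
    finally show ?thesis .
  qed
  have "\<forall>m. \<exists>U. U \<in> L2 lborel \<and> (\<forall>x. x \<notin> D \<longrightarrow> U x = 0) \<and> (AE x in LD. U x = u m x) \<and>
    (\<forall>y. nR (\<lambda>x. U (x - y) - U x) \<le> norm y * (N * B))"
  proof
    fix m
    obtain U where UV: "U \<in> L2 lborel" "\<forall>x. x \<notin> D \<longrightarrow> U x = 0" "AE x in LD. U x = u m x"
      "\<And>y. nR (\<lambda>x. U (x - y) - U x) \<le> norm y * (\<Sum>i\<in>UNIV. nD (v m i))" using zero_trace_extension[OF u[of m]] by blast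
    have "nR (\<lambda>x. U (x - y) - U x) \<le> norm y * (N * B)" for y
    proof -
      have "nR (\<lambda>x. U (x - y) - U x) \<le> norm y * (\<Sum>i\<in>UNIV. nD (v m i))" by (rule UV(4))
      also have "\<dots> \<le> norm y * (\<Sum>i\<in>(UNIV::'n set). B)" by (intro mult_left_mono sum_mono) (simp_all add: B(2))
      finally show ?thesis by (simp add: N_def)
    qed
    with UV(1-3) show "\<exists>U. U \<in> L2 lborel \<and> (\<forall>x. x \<notin> D \<longrightarrow> U x = 0) \<and> (AE x in LD. U x = u m x) \<and>
      (\<forall>y. nR (\<lambda>x. U (x - y) - U x) \<le> norm y * (N * B))" by blast
  qed
  from choice[OF this] obtain U where U: "\<And>m. U m \<in> L2 lborel" "\<And>m x. x \<notin> D \<Longrightarrow> U m x = 0" "\<And>m. AE x in LD. U m x = u m x"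
    "\<And>m y. nR (\<lambda>x. U m (x - y) - U m x) \<le> norm y * (N * B)" by blast
  have Ui: "integrable lborel (U m)" for m by (rule integrable_zero_extension[OF U(1)]) (rule U(2))
  have uL: "u m \<in> L2 LD" for m by (rule H1_traceD(1)[OF u])
  have UD: "U m \<in> L2 LD" for m by (rule L2_restrict(1)[OF open_D U(1)])
  have Un: "nR (U m) \<le> B" for m
    using L2_restrict(3)[OF open_D U(1)[of m] U(2)[of _ m]] L2_cong_AE(2)[OF uL L2_measurable[OF UD] U(3)] B(1)[of m] by simp
  obtain ker :: "real^'n \<Rightarrow> real" where ker: "mollifier ker" "\<And>x. x \<notin> cball 0 r \<Longrightarrow> ker x = 0"
    using mollifier_exists[OF r, of "0 :: real^'n"] by blast
  let ?F = "\<lambda>m. convolve ker (U m)"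
  have FL: "?F m \<in> L2 lborel" for m by (rule L2_convolve(1)[OF ker(1) _ U(1) Ui]) (rule ker(2))
  have FD: "?F m \<in> L2 LD" for m by (rule L2_restrict(1)[OF open_D FL])
  have Fu: "dD (?F m) (u m) \<le> e / 3" for m
  proof -
    have "dD (?F m) (u m) = dD (?F m) (U m)"
    proof (rule L2_cong_AE(2)[OF L2_diff[OF FD UD] L2_measurable[OF L2_diff[OF FD uL]]])
      show "AE x in LD. ?F m x - u m x = ?F m x - U m x" using U(3)[of m] by eventually_elim simp
    qed
    also have "\<dots> \<le> dR (?F m) (U m)" by (rule L2_restrict(2)[OF open_D L2_diff[OF FL U(1)]])
    also have "\<dots> \<le> r * (N * B)"
    proof (rule L2_convolve(3)[where c=0 and R=r, OF ker(1) _ U(1) Ui])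
      fix y assume "ker y \<noteq> 0"
      then have "y \<in> cball 0 r" using ker(2) by blast
      then have "norm y * (N * B) \<le> r * (N * B)" using B0 by (intro mult_right_mono) (simp_all add: N_def)
      with U(4) show "nR (\<lambda>x. U m (x - y) - U m x) \<le> r * (N * B)" by (rule order_trans)
    qed (use r B0 ker(2) in \<open>auto simp: N_def\<close>)
    also have "\<dots> \<le> e / 3" by (rule rNB)
    finally show ?thesis .
  qed
  have "e / 3 > 0" using e by simp
  then have "\<exists>s. strict_mono (s :: nat \<Rightarrow> nat) \<and> (\<forall>m l. dD (?F (s m)) (?F (s l)) \<le> e / 3)"
    by (rule mollified_compact[where r=r, OF ker(1) _ U(1) _ Un, rotated 2]) (erule ker(2), erule U(2))
  then obtain s where s: "strict_mono (s :: nat \<Rightarrow> nat)" "\<And>m l. dD (?F (s m)) (?F (s l)) \<le> e / 3" by blast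
  have "dD (u (s m)) (u (s l)) \<le> e" for m l
  proof -
    have "dD (u (s m)) (u (s l)) \<le> dD (u (s m)) (?F (s m)) + dD (?F (s m)) (u (s l))" by (rule L2_norm_triangle_diff[OF uL FD uL])
    moreover have "dD (?F (s m)) (u (s l)) \<le> dD (?F (s m)) (?F (s l)) + dD (?F (s l)) (u (s l))"
      by (rule L2_norm_triangle_diff[OF FD FD uL])
    moreover have "dD (u (s m)) (?F (s m)) \<le> e / 3" using Fu[of "s m"] by (simp add: L2_norm_minus_commute[of LD "u (s m)"])
    ultimately show ?thesis using Fu[of "s l"] s(2)[of m l] by linarith
  qed
  then show ?thesis using s(1) by blast
qed

text \<open>A diagonal sequence over the accuracies \<open>1 / real (Suc n)\<close> turns
  \<open>zero_trace_net\<close>, which serves one accuracy at a time, into the Cauchy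
  property.\<close>

lemma zero_trace_compact:
  assumes u: "\<And>m. H1_trace (u m) (v m) (\<lambda>x. 0)"
    and B: "\<And>m. nD (u m) \<le> B" "\<And>m i. nD (v m i) \<le> B"
  obtains s where "strict_mono (s :: nat \<Rightarrow> nat)" "\<And>e. e > 0 \<Longrightarrow> \<exists>N. \<forall>m\<ge>N. \<forall>l\<ge>N. dD (u (s m)) (u (s l)) < e"
proof -
  define P where "P n s \<longleftrightarrow> (\<forall>m l. dD (u (s m)) (u (s l)) \<le> 1 / real (Suc n))" for n and s :: "nat \<Rightarrow> nat"
  interpret subseqs P
  proof
    fix n and s :: "nat \<Rightarrow> nat" assume "strict_mono s"
    show "\<exists>r'. strict_mono r' \<and> P n (s \<circ> r')"
      unfolding P_def o_def using zero_trace_net[of "\<lambda>m. u (s m)" "\<lambda>m. v (s m)" B "1 / real (Suc n)"] u B by simp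
  qed
  \<comment> \<open>The diagonal sequence has property \<open>P n\<close> only from index
    \<open>Suc n\<close> on.\<close>
  have P: "P n (diagseq \<circ> ((+) (Suc n)))" for n by (rule diagseq_holds) (auto simp: P_def)
  show ?thesis
  proof (rule that[OF subseq_diagseq])
    fix e :: real assume "e > 0"
    then obtain n where n: "1 / real (Suc n) < e" by (rule nat_approx_posE)
    have "dD (u (diagseq m)) (u (diagseq l)) < e" if ml: "m \<ge> Suc n" "l \<ge> Suc n" for m l
    proof -
      obtain m' where m': "m = Suc n + m'" by (rule less_eqE[OF ml(1)])
      obtain l' where l': "l = Suc n + l'" by (rule less_eqE[OF ml(2)])
      have "dD (u (diagseq m)) (u (diagseq l)) \<le> 1 / real (Suc n)" unfolding m' l' using P[of n] unfolding P_def o_def by blast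
      then show ?thesis using n by (rule order_le_less_trans)
    qed
    then show "\<exists>N. \<forall>m\<ge>N. \<forall>l\<ge>N. dD (u (diagseq m)) (u (diagseq l)) < e" by blast
  qed
qed

end


subsection \<open>Weak limits\<close>

lemma esssup_upper_AE:
  assumes "esssup M f < \<infinity>"
  obtains C :: real where "C \<ge> 0" "AE x in M. f x \<le> ereal C"
proof -
  obtain n :: nat where n: "esssup M f < ereal (real n)" using assms less_PInf_Ex_of_nat by auto
  have "AE x in M. f x \<le> ereal (real n)" using esssup_AE[of f M] by eventually_elim (use n in simp)
  then show ?thesis using that[of "real n"] by simp
qed

lemma Linf_bound:
  assumes "f \<in> Linf M"
  obtains C :: real where "C \<ge> 0" "AE x in M. \<bar>f x\<bar> \<le> C"
proof -
  have "esssup M (\<lambda>x. ereal \<bar>f x\<bar>) < \<infinity>" using assms by (auto simp: Linf_def Linf_norm_def)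
  then obtain C where C: "C \<ge> 0" "AE x in M. ereal \<bar>f x\<bar> \<le> ereal C" by (rule esssup_upper_AE) blast
  have "AE x in M. \<bar>f x\<bar> \<le> C" using C(2) by eventually_elim simp
  then show ?thesis by (rule that[OF C(1)])
qed

lemma essinf_lower_AE:
  assumes "essinf M f > ereal c"
  obtains a where "a > c" "AE x in M. a \<le> f x"
proof -
  have "esssup M (\<lambda>x. - ereal (f x)) < ereal (- c)" using iffD1[OF ereal_less_uminus_reorder assms[unfolded essinf_def]] by simp
  from ereal_dense2[OF this] obtain z where z: "esssup M (\<lambda>x. - ereal (f x)) < ereal z" "ereal z < ereal (- c)" by blast
  have "AE x in M. - z \<le> f x" using esssup_AE[of "\<lambda>x. - ereal (f x)" M]
  proof eventually_elim
    case (elim x)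
    from this z(1) have "- ereal (f x) < ereal z" by (rule order_le_less_trans)
    then show ?case by simp
  qed
  then show ?thesis using that[of "- z"] z(2) by simp
qed

lemma not_tendsto_subseq:
  fixes x :: "nat \<Rightarrow> complex"
  assumes "\<not> x \<longlonglongrightarrow> l" "\<And>m. norm (x m) \<le> B"
  obtains r l' where "strict_mono (r :: nat \<Rightarrow> nat)" "(x \<circ> r) \<longlonglongrightarrow> l'" "l' \<noteq> l"
proof -
  obtain e where e: "e > 0" "\<And>N. \<exists>m\<ge>N. dist (x m) l \<ge> e" using assms(1) unfolding lim_sequentially by (meson not_less)
  have "infinite {m. dist (x m) l \<ge> e}" unfolding infinite_nat_iff_unbounded_le using e(2) by blast
  then obtain s where s: "strict_mono (s :: nat \<Rightarrow> nat)" "\<And>m. dist (x (s m)) l \<ge> e"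
    using infinite_enumerate[of "{m. dist (x m) l \<ge> e}"] by blast
  have "bounded (range (x \<circ> s))" using assms(2) by (auto simp: bounded_iff)
  then obtain r l' where r: "strict_mono r" "((x \<circ> s) \<circ> r) \<longlonglongrightarrow> l'" using bounded_imp_convergent_subsequence by metis
  have "e \<le> dist l' l" by (rule LIMSEQ_le_const[OF tendsto_dist[OF r(2) tendsto_const]]) (use s(2) in auto)
  then have "l' \<noteq> l" using e(1) by auto
  moreover have "strict_mono (s \<circ> r)" by (rule strict_mono_o[OF s(1) r(1)])
  ultimately show ?thesis using that r(2) by (simp add: o_assoc)
qed

lemma combine_tendsto:
  fixes x :: "nat \<Rightarrow> complex"
  assumes c: "\<And>j. c j \<in> convex_coeffs j" and x: "x \<longlonglongrightarrow> l"
  shows "(\<lambda>j. combine (c j) x) \<longlonglongrightarrow> l"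
proof -
  have 0: "(\<lambda>j. combine (c j) (\<lambda>m. norm (x m - l))) \<longlonglongrightarrow> 0"
    by (rule combine_convex_tendsto_0[OF c tendsto_norm_zero[OF LIM_zero[OF x]]])
  have "(\<lambda>j. combine (c j) x - l) \<longlonglongrightarrow> 0"
  proof (rule Lim_null_comparison[OF always_eventually[OF allI] 0])
    fix j
    have cj: "\<And>m. c j m \<ge> 0" "(\<Sum>m | c j m \<noteq> 0. c j m) = 1" using c[of j] by (auto simp: convex_coeffs_def)
    have "combine (c j) x - l = combine (c j) x - (\<Sum>m | c j m \<noteq> 0. c j m) *\<^sub>R l" by (simp add: cj(2))
    also have "\<dots> = (\<Sum>m | c j m \<noteq> 0. c j m *\<^sub>R (x m - l))"
      by (simp add: combine_def scaleR_diff_right sum_subtractf scaleR_sum_left del: scaleR_conv_of_real)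
    finally have eq: "combine (c j) x - l = (\<Sum>m | c j m \<noteq> 0. c j m *\<^sub>R (x m - l))" .
    show "norm (combine (c j) x - l) \<le> combine (c j) (\<lambda>m. norm (x m - l))"
      unfolding eq unfolding combine_def by (rule sum_norm_le) (simp add: cj(1))
  qed
  then show ?thesis by (simp add: LIM_zero_iff)
qed

context C2_domain
begin

lemma H1_trace_cong_fun:
  assumes u: "H1_trace u v g" and u': "u' \<in> borel_measurable LD" "AE x in LD. u' x = u x"
  shows "H1_trace u' v g"
proof -
  obtain \<phi> where \<phi>: "\<And>j. Ck 1 (\<phi> j)" "L2_lim LD \<phi> u" "\<And>i. L2_lim LD (\<lambda>j. partial i (\<phi> j)) (v i)" "L2_lim SD \<phi> g"
    by (rule H1_traceE[OF u]) blast
  show ?thesis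
  proof (rule H1_traceI[OF _ _ _ \<phi>(1) _ \<phi>(3,4)])
    show "u' \<in> L2 LD" by (rule L2_cong_AE(1)[OF H1_traceD(1)[OF u] u'])
    show "v i \<in> L2 LD" "g \<in> L2 SD" for i by (rule H1_traceD[OF u])+
    show "L2_lim LD \<phi> u'" by (rule L2_lim_cong[OF C1_L2(1)[OF \<phi>(1)] H1_traceD(1)[OF u] u' \<phi>(2)])
  qed
qed

lemma H2_traces:
  assumes "u \<in> H2 D"
  shows "H1_trace u (\<lambda>i. wpartial D i u) (trace D u)"
    and "H1_trace (wpartial D i u) (\<lambda>j. wpartial D j (wpartial D i u)) (trace D (wpartial D i u))"
  using assms by (auto simp: H2_def intro: H1_trace_trace)

lemma H2_H10_trace:
  assumes "u \<in> H2_H10 D"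
  shows "H1_trace u (\<lambda>i. wpartial D i u) (\<lambda>x. 0)"
proof -
  have u0: "u \<in> H2 D" "AE x in SD. trace D u x = 0" using assms by (simp_all add: H2_H10_def)
  from u0(2) have "AE x in SD. 0 = trace D u x" by eventually_elim simp
  note u = u0(1) this
  show ?thesis
    by (rule H1_trace_cong[OF H2_traces(1)[OF u(1)] L2_measurable[OF H1_traceD(2)[OF H2_traces(1)[OF u(1)]]] _ _ u(2)]) auto
qed

text \<open>\<open>wpartial\<close> and \<open>trace\<close> are chosen representatives; facts about
  explicitly given derivatives and boundary values are transferred to them here.\<close>

lemma H2_H10I:
  assumes u: "H1_trace u w (\<lambda>x. 0)" and w: "\<And>i. H1_trace (w i) (h i) (g i)"
  shows "u \<in> H2_H10 D" "AE x in LD. wpartial D i u x = w i x"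
    "AE x in LD. wpartial D j (wpartial D i u) x = h i j x" "AE x in SD. trace D (wpartial D i u) x = g i x"
proof -
  show 1: "AE x in LD. wpartial D i u x = w i x" for i by (rule weak_partial_wpartial(2)[OF H1_trace_weak_partial[OF u]])
  have H: "u \<in> H1 D" by (rule H1_trace_H1[OF u])
  have W: "H1_trace (wpartial D i u) (h i) (g i)" for i by (rule H1_trace_cong_fun[OF w L2_measurable[OF H1_L2(2)[OF H]] 1])
  show "AE x in LD. wpartial D j (wpartial D i u) x = h i j x" by (rule weak_partial_wpartial(2)[OF H1_trace_weak_partial[OF W]])
  show "AE x in SD. trace D (wpartial D i u) x = g i x" by (rule trace_eq[OF W])
  show "u \<in> H2_H10 D" using H H1_trace_H1[OF W] trace_eq[OF u] by (simp add: H2_H10_def H2_def)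
qed

lemma normal_deriv_L2:
  assumes "u \<in> H2 D"
  shows "AE x in SD. normal_deriv D u x = (\<Sum>i\<in>UNIV. nuc i x * trace D (wpartial D i u) x)"
    and "(\<lambda>x. \<Sum>i\<in>UNIV. nuc i x * trace D (wpartial D i u) x) \<in> L2 SD" "normal_deriv D u \<in> L2 SD"
proof -
  have eq: "normal_deriv D u x = (\<Sum>i\<in>UNIV. nuc i x * trace D (wpartial D i u) x)" if "x \<in> space SD" for x
    using that nu_outward[of x] by (simp add: normal_deriv_def space_surface_measure scaleR_conv_of_real)
  then show "AE x in SD. normal_deriv D u x = (\<Sum>i\<in>UNIV. nuc i x * trace D (wpartial D i u) x)" by (rule AE_I2)
  show L: "(\<lambda>x. \<Sum>i\<in>UNIV. nuc i x * trace D (wpartial D i u) x) \<in> L2 SD"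
    by (intro L2_sum L2_mult_continuous_surface Ck_continuous[OF nuc_C1] H1_traceD(3)[OF H2_traces(2)[OF assms]])
  have "normal_deriv D u \<in> borel_measurable SD"
  proof (subst measurable_cong)
    show "(\<lambda>x. \<Sum>i\<in>UNIV. nuc i x * trace D (wpartial D i u) x) \<in> borel_measurable SD" by (rule L2_measurable[OF L])
  qed (rule eq)
  then show "normal_deriv D u \<in> L2 SD" by (rule L2_cong_AE(1)[OF L]) (rule AE_I2, rule eq)
qed

text \<open>Weak derivatives pass to the limit, and the trace bound for the differences forces the
  boundary values of the limit to vanish.\<close>

lemma zero_trace_limit:
  assumes u: "\<And>j. H1_trace (u j) (v j) (\<lambda>x. 0)" and L: "u0 \<in> L2 LD" "\<And>i. v0 i \<in> L2 LD"
    and lim: "L2_lim LD u u0" "\<And>i. L2_lim LD (\<lambda>j. v j i) (v0 i)"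
  shows "H1_trace u0 v0 (\<lambda>x. 0)"
proof -
  have "is_weak_partial D i u0 (v0 i)" for i by (rule weak_partial_limit[OF H1_trace_weak_partial[OF u] H1_traceD(1)[OF u] L lim])
  then obtain g where g: "H1_trace u0 v0 g" by (rule H1_trace_exists[OF L(1)])
  obtain C where C: "C \<ge> 0" "\<And>u v g. H1_trace u v g \<Longrightarrow> nS g \<le> C * (nD u + (\<Sum>i\<in>UNIV. nD (v i)))" by (rule trace_boundE) blast
  have 0: "(\<lambda>j. C * (dD (u j) u0 + (\<Sum>i\<in>UNIV. dD (v j i) (v0 i)))) \<longlonglongrightarrow> 0"
    by (rule tendsto_mult_right_zero[OF tendsto_add_zero[OF lim(1)]]) (rule tendsto_null_sum, rule lim(2))
  have "nS (\<lambda>x. 0 - g x) \<le> 0" by (rule LIMSEQ_le_const[OF 0]) (use C(2)[OF H1_trace_diff[OF u g]] in blast)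
  moreover have "nS (\<lambda>x. 0 - g x) = nS g" by (simp add: L2_norm_def)
  ultimately have "nS g = 0" using L2_norm_nonneg[of SD g] by linarith
  from L2_norm_eq_0[OF H1_traceD(3)[OF g] this] have "AE x in SD. 0 = g x" by eventually_elim simp
  then show ?thesis by (intro H1_trace_cong[OF g L2_measurable[OF L(2)]]) auto
qed

text \<open>Suitable convex combinations of the bounded sequence \<open>h\<close> converge strongly,
  and the same combinations of \<open>w\<close> still tend to \<open>w0\<close>; weak
  differentiation is closed under strong limits.\<close>

lemma weak_partial_bounded_limit:
  assumes w: "\<And>m. is_weak_partial D j (w m) (h m)" "\<And>m. w m \<in> L2 LD" "w0 \<in> L2 LD" "L2_lim LD w w0"
    and B: "\<And>m. nD (h m) \<le> B"
  shows "\<exists>c h0. (\<forall>l. c l \<in> convex_coeffs l) \<and> is_weak_partial D j w0 h0 \<and> L2_lim LD (\<lambda>l p. combine (c l) (\<lambda>m. h m p)) h0"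
proof -
  have hL: "h m \<in> L2 LD" for m using w(1) by (rule is_weak_partial_L2)
  have bd: "(\<Sum>i\<in>(UNIV::unit set). (nD (h m))^2) \<le> B^2" for m using power_mono[OF B[of m], of 2] by simp
  obtain c and v :: "unit \<Rightarrow> real^'n \<Rightarrow> complex" where c: "\<And>l. c l \<in> convex_coeffs l" "\<And>i. v i \<in> L2 LD"
    "\<And>i. L2_lim LD (\<lambda>l p. combine (c l) (\<lambda>m. h m p)) (v i)"
    by (rule L2_convex_limit[OF finite_LD, where x="\<lambda>m (i::unit). h m" and B="B\<^sup>2"]) (rule hL, rule bd, blast)
  have wp: "is_weak_partial D j (\<lambda>p. \<Sum>m\<in>A. a m *\<^sub>R w m p) (\<lambda>p. \<Sum>m\<in>A. a m *\<^sub>R h m p)" if "finite A" for A and a :: "nat \<Rightarrow> real"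
    using that
  proof (induction A rule: finite_induct)
    case empty
    show ?case using C1_weak_partial[OF Ck_const, of j 0] by simp
  next
    case (insert m A)
    have "is_weak_partial D j (\<lambda>p. a m *\<^sub>R w m p) (\<lambda>p. a m *\<^sub>R h m p)"
      using weak_partial_cmult[OF w(1), of "of_real (a m)"] by (simp add: scaleR_conv_of_real)
    from weak_partial_add[OF L2_scaleR[OF w(2)] L2_sum this insert.IH] show ?case using insert.hyps L2_scaleR[OF w(2)] by simp
  qed
  have "is_weak_partial D j w0 (v ())"
  proof (rule weak_partial_limit[OF _ L2_combine[OF w(2)] w(3) c(2) L2_combine_tendsto[OF c(1) w(2-4)] c(3)])
    show "is_weak_partial D j (\<lambda>p. combine (c l) (\<lambda>m. w m p)) (\<lambda>p. combine (c l) (\<lambda>m. h m p))" for l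
      unfolding combine_def using c(1)[of l] by (intro wp) (simp add: convex_coeffs_def)
  qed
  with c(1,3) show ?thesis by blast
qed

text \<open>Otherwise a subsequence of the pairings has another limit \<open>l'\<close>. Convex
  combinations along it converge strongly to some weak derivative of \<open>w0\<close>, and their
  pairings tend both to \<open>l'\<close> and, by uniqueness of the weak derivative, to
  \<open>ip h0 \<psi>\<close>.\<close>

lemma weak_partial_weak_convergence:
  assumes w: "\<And>m. is_weak_partial D j (w m) (h m)" "\<And>m. w m \<in> L2 LD" "w0 \<in> L2 LD" "L2_lim LD w w0"
    and B: "\<And>m. nD (h m) \<le> B" and h0: "is_weak_partial D j w0 h0" and \<psi>: "\<psi> \<in> L2 LD"
  shows "(\<lambda>m. ip (h m) \<psi>) \<longlonglongrightarrow> ip h0 \<psi>"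
proof (rule ccontr)
  assume nt: "\<not> (\<lambda>m. ip (h m) \<psi>) \<longlonglongrightarrow> ip h0 \<psi>"
  have hL: "h m \<in> L2 LD" for m using w(1) by (rule is_weak_partial_L2)
  have h0L: "h0 \<in> L2 LD" using h0 by (rule is_weak_partial_L2)
  have "norm (ip (h m) \<psi>) \<le> B * nD \<psi>" for m by (rule order_trans[OF ip_bound[OF hL \<psi>] mult_right_mono[OF B L2_norm_nonneg]])
  then obtain r l' where r: "strict_mono (r :: nat \<Rightarrow> nat)" "((\<lambda>m. ip (h m) \<psi>) \<circ> r) \<longlonglongrightarrow> l'" "l' \<noteq> ip h0 \<psi>"
    by (rule not_tendsto_subseq[OF nt]) blast
  have "(\<lambda>m. dD (w (r m)) w0) \<longlonglongrightarrow> 0" using LIMSEQ_subseq_LIMSEQ[OF w(4) r(1)] by (simp add: o_def)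
  then obtain c h1 where c: "\<And>l. c l \<in> convex_coeffs l" "is_weak_partial D j w0 h1"
    "L2_lim LD (\<lambda>l p. combine (c l) (\<lambda>m. h (r m) p)) h1"
    using weak_partial_bounded_limit[of j "\<lambda>m. w (r m)" "\<lambda>m. h (r m)" w0 B] w(1-3) B by blast
  have h1L: "h1 \<in> L2 LD" using c(2) by (rule is_weak_partial_L2)
  have "(\<lambda>l. ip (\<lambda>p. combine (c l) (\<lambda>m. h (r m) p)) \<psi>) \<longlonglongrightarrow> ip h1 \<psi>" by (rule ip_tendsto[OF L2_combine[OF hL] h1L c(3) \<psi>])
  moreover have "ip (\<lambda>p. combine (c l) (\<lambda>m. h (r m) p)) \<psi> = combine (c l) (\<lambda>m. ip (h (r m)) \<psi>)" for l
  proof -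
    have "ip (\<lambda>p. a *\<^sub>R f p) \<psi> = a *\<^sub>R ip f \<psi>" for a f by (simp add: ip_def)
    then show ?thesis unfolding combine_def by (subst ip_sum_left) (auto intro: L2_scaleR hL \<psi>)
  qed
  moreover have "(\<lambda>l. combine (c l) (\<lambda>m. ip (h (r m)) \<psi>)) \<longlonglongrightarrow> l'" using combine_tendsto[OF c(1) r(2)] by (simp add: o_def)
  ultimately have "ip h1 \<psi> = l'" using LIMSEQ_unique by simp
  moreover have "ip h1 \<psi> = ip h0 \<psi>"
    using arg_cong[OF ip_cong_right[OF \<psi> h1L h0L weak_partial_unique[OF c(2) h0]], of cnj] by (simp add: cnj_ip)
  ultimately show False using r(3) by simp
qed

end


subsection \<open>The eigenvalue problem\<close>

locale index_domain = C2_domain D for D :: "(real^'n) set" +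
  fixes n :: "real^'n \<Rightarrow> real"
  assumes n_Linf: "n \<in> Linf (lebesgue_on D)" and n_inf: "essinf (lebesgue_on D) n > 1"
begin

definition q :: "real^'n \<Rightarrow> complex" where "q x = of_real (1 / (n x - 1))"

lemma q_bounds:
  obtains q0 q1 where "q0 > 0" "AE x in LD. q0 \<le> 1 / (n x - 1)" "AE x in LD. norm (q x) \<le> q1"
proof -
  obtain C where C: "C \<ge> 0" "AE x in LD. \<bar>n x\<bar> \<le> C" by (rule Linf_bound[OF n_Linf]) blast
  have "essinf LD n > ereal 1" using n_inf by (simp add: one_ereal_def)
  then obtain a where a: "a > 1" "AE x in LD. a \<le> n x" by (rule essinf_lower_AE) blast
  show ?thesis
  proof (rule that[of "1 / (C + 1)" "1 / (a - 1)"])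
    show "AE x in LD. 1 / (C + 1) \<le> 1 / (n x - 1)"
      using C(2) a(2) by eventually_elim (use C(1) a(1) in \<open>auto intro!: divide_left_mono mult_pos_pos\<close>)
    show "AE x in LD. norm (q x) \<le> 1 / (a - 1)" using a(2)
    proof eventually_elim
      case (elim x)
      have "norm (q x) = \<bar>1 / (n x - 1)\<bar>" unfolding q_def by (rule norm_of_real)
      also have "\<dots> = 1 / (n x - 1)" using elim a(1) by simp
      also have "\<dots> \<le> 1 / (a - 1)" using elim a(1) by (auto intro!: divide_left_mono mult_pos_pos)
      finally show ?case .
    qed
  qed (use C(1) in auto)
qed

lemma q_measurable: "q \<in> borel_measurable LD"
proof -
  have [measurable]: "n \<in> borel_measurable LD" using n_Linf by (simp add: Linf_def)
  show ?thesis unfolding q_def by measurable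
qed

lemma q_L2:
  assumes "f \<in> L2 LD" shows "(\<lambda>x. q x * f x) \<in> L2 LD"
proof -
  obtain q0 q1 where "AE x in LD. norm (q x) \<le> q1" by (rule q_bounds) blast
  then show ?thesis by (rule L2_bounded_mult[OF assms q_measurable])
qed

lemma q_norm:
  obtains q1 where "q1 \<ge> 0" "\<And>f. f \<in> L2 LD \<Longrightarrow> nD (\<lambda>x. q x * f x) \<le> q1 * nD f"
proof -
  obtain q0 q1 where q: "AE x in LD. norm (q x) \<le> q1" by (rule q_bounds) blast
  show ?thesis
  proof (rule that[of "\<bar>q1\<bar>"])
    fix f assume f: "f \<in> L2 LD"
    show "nD (\<lambda>x. q x * f x) \<le> \<bar>q1\<bar> * nD f"
    proof (rule L2_norm_mono[OF L2_measurable[OF q_L2[OF f]] f])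
      show "AE x in LD. norm (q x * f x) \<le> \<bar>q1\<bar> * norm (f x)"
        using q by eventually_elim (auto simp: norm_mult intro!: mult_right_mono)
    qed simp
  qed simp
qed

lemma q_coercive:
  obtains q0 where "q0 > 0" "\<And>f. f \<in> L2 LD \<Longrightarrow> q0 * (nD f)^2 \<le> Re (ip f (\<lambda>x. q x * f x))"
proof -
  obtain q0 q1 where q: "q0 > 0" "AE x in LD. q0 \<le> 1 / (n x - 1)" by (rule q_bounds) blast
  show ?thesis
  proof (rule that[OF q(1)])
    fix f assume f: "f \<in> L2 LD"
    have i: "integrable LD (\<lambda>x. f x * cnj (q x * f x))" by (rule ip_integrable[OF f q_L2[OF f]])
    have "f x * cnj (q x * f x) = of_real (1 / (n x - 1) * (norm (f x))^2)" for x
      unfolding of_real_mult complex_norm_square by (simp add: q_def)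
    then have Re: "Re (f x * cnj (q x * f x)) = 1 / (n x - 1) * (norm (f x))^2" for x by (simp only: Re_complex_of_real)
    have "q0 * (nD f)^2 = (\<integral>x. q0 * (norm (f x))^2 \<partial>LD)" by (simp add: L2_norm_squared)
    also have "\<dots> \<le> (\<integral>x. Re (f x * cnj (q x * f x)) \<partial>LD)"
    proof (rule integral_mono_AE)
      show "integrable LD (\<lambda>x. q0 * (norm (f x))^2)" using L2_integrable[OF f] by simp
      show "integrable LD (\<lambda>x. Re (f x * cnj (q x * f x)))" using i by (rule integrable_Re)
      show "AE x in LD. q0 * (norm (f x))^2 \<le> Re (f x * cnj (q x * f x))"
        unfolding Re using q(2) by eventually_elim (rule mult_right_mono, assumption, simp)
    qed
    also have "\<dots> = Re (ip f (\<lambda>x. q x * f x))" unfolding ip_def by (rule integral_Re[OF i])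
    finally show "q0 * (nD f)^2 \<le> Re (ip f (\<lambda>x. q x * f x))" .
  qed
qed

lemma laplacian_L2: "u \<in> H2 D \<Longrightarrow> laplacian D u \<in> L2 LD"
  using L2_sum[of UNIV "\<lambda>i. wpartial D i (wpartial D i u)" LD] H1_traceD(2)[OF H2_traces(2)] by (simp add: laplacian_def[abs_def])

text \<open>The form is expanded into single pairings because they behave differently in the limit:
  some factors converge strongly, the Laplacian at first only weakly.\<close>

lemma form_A0_ip:
  assumes u: "u \<in> H2 D" and \<phi>: "\<phi> \<in> H2 D"
  shows "form_A0 D n k u \<phi> = ip (laplacian D u) (\<lambda>x. q x * laplacian D \<phi> x)
    + of_real (k^2) * (ip u (\<lambda>x. q x * laplacian D \<phi> x) + ip (laplacian D u) (\<lambda>x. q x * \<phi> x))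
    + of_real (k^4) * (ip u (\<lambda>x. q x * \<phi> x) + ip u \<phi>)"
proof -
  have L: "u \<in> L2 LD" "\<phi> \<in> L2 LD" using H1_traceD(1)[OF H2_traces(1)] u \<phi> by auto
  note Lu = laplacian_L2[OF u] and L\<phi> = laplacian_L2[OF \<phi>]
  let ?I = "\<lambda>f g. integrable LD (\<lambda>x. f x * cnj (g x))"
  have I: "integrable LD (\<lambda>x. laplacian D u x * cnj (q x * laplacian D \<phi> x))" "integrable LD (\<lambda>x. u x * cnj (q x * laplacian D \<phi> x))"
    "integrable LD (\<lambda>x. laplacian D u x * cnj (q x * \<phi> x))" "integrable LD (\<lambda>x. u x * cnj (q x * \<phi> x))" "integrable LD (\<lambda>x. u x * cnj (\<phi> x))"
    by (rule ip_integrable; intro L Lu L\<phi> q_L2)+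
  have cq: "cnj (q x) = q x" for x by (simp add: q_def)
  have "form_A0 D n k u \<phi> = (\<integral>x. laplacian D u x * cnj (q x * laplacian D \<phi> x)
    + of_real (k^2) * (u x * cnj (q x * laplacian D \<phi> x) + laplacian D u x * cnj (q x * \<phi> x))
    + of_real (k^4) * (u x * cnj (q x * \<phi> x) + u x * cnj (\<phi> x)) \<partial>LD)" unfolding form_A0_def q_def[symmetric]
    by (intro Bochner_Integration.integral_cong refl) (simp add: cq algebra_simps power2_eq_square power4_eq_xxxx)
  also have "\<dots> = ip (laplacian D u) (\<lambda>x. q x * laplacian D \<phi> x)
    + of_real (k^2) * (ip u (\<lambda>x. q x * laplacian D \<phi> x) + ip (laplacian D u) (\<lambda>x. q x * \<phi> x))
    + of_real (k^4) * (ip u (\<lambda>x. q x * \<phi> x) + ip u \<phi>)" unfolding ip_def using I by (simp del: complex_cnj_mult)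
  finally show ?thesis .
qed

lemma form_B_ip:
  assumes u: "u \<in> H1 D" and \<phi>: "\<phi> \<in> H1 D"
  shows "form_B D u \<phi> = (\<Sum>i\<in>UNIV. ip (wpartial D i u) (wpartial D i \<phi>))" unfolding form_B_def ip_def
  by (rule Bochner_Integration.integral_sum) (rule ip_integrable[OF H1_L2(2)[OF u] H1_L2(2)[OF \<phi>]])

text \<open>Integration by parts against \<open>u\<close> itself has no boundary term. It bounds the
  gradient by the product of the norms of Laplacian and function, which upgrades L2 convergence to
  H1 convergence.\<close>

lemma dirichlet_identity:
  assumes u: "H1_trace u w (\<lambda>x. 0)" and w: "\<And>i. H1_trace (w i) (h i) (g i)"
  shows "of_real (\<Sum>i\<in>UNIV. (nD (w i))^2) = - ip (\<lambda>x. \<Sum>i\<in>UNIV. h i i x) u"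
proof -
  have "ip (h i i) u = - of_real ((nD (w i))^2)" for i
    using zero_trace_parts[OF u H1_traceD(1)[OF w] H1_trace_weak_partial[OF w], of i i] by (simp add: ip_self)
  moreover have "ip (\<lambda>x. \<Sum>i\<in>UNIV. h i i x) u = (\<Sum>i\<in>UNIV. ip (h i i) u)"
    by (rule ip_sum_left) (rule H1_traceD[OF w] H1_traceD[OF u])+
  ultimately show ?thesis by (simp add: sum_negf)
qed

text \<open>The weight \<open>k\<^sup>2 / \<eta>\<close> is large where \<open>\<eta>\<close> is small, so the boundary term of the form controls the
  normal derivative.\<close>

lemma boundary_term:
  assumes \<eta>: "admissible D \<eta>" and N: "N \<in> L2 SD" and N': "N' \<in> borel_measurable SD" "AE x in SD. N' x = N x"
  shows "(\<integral>x. of_real (k^2 / \<eta> x) * N x * cnj (N' x) \<partial>SD) = of_real (k^2 * (\<integral>x. (norm (N x))^2 / \<eta> x \<partial>SD))"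
    and "0 \<le> (\<integral>x. (norm (N x))^2 / \<eta> x \<partial>SD)"
    and "Linf_norm SD \<eta> \<le> ereal e \<Longrightarrow> (nS N)^2 \<le> e * (\<integral>x. (norm (N x))^2 / \<eta> x \<partial>SD)"
proof -
  have [measurable]: "\<eta> \<in> borel_measurable SD" using \<eta> by (simp add: admissible_def Linf_def)
  note [measurable] = L2_measurable[OF N] N'(1)
  obtain a where a: "a > 0" "AE x in SD. a \<le> \<eta> x" using \<eta> essinf_lower_AE[of 0 SD \<eta>] by (auto simp: admissible_def zero_ereal_def)
  \<comment> \<open>The positive lower bound \<open>a\<close> of \<eta> bounds the weight, so the
    integral is a genuine one and not a default value.\<close>
  have i: "integrable SD (\<lambda>x. (norm (N x))^2 / \<eta> x)"
  proof (rule Bochner_Integration.integrable_bound)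
    show "integrable SD (\<lambda>x. 1 / a * (norm (N x))^2)" using L2_integrable[OF N] by simp
    show "AE x in SD. norm ((norm (N x))^2 / \<eta> x) \<le> norm (1 / a * (norm (N x))^2)"
      using a(2) by eventually_elim (use a(1) in \<open>auto intro!: divide_left_mono mult_pos_pos\<close>)
  qed measurable
  have "(\<integral>x. of_real (k^2 / \<eta> x) * N x * cnj (N' x) \<partial>SD) = (\<integral>x. complex_of_real (k^2 * ((norm (N x))^2 / \<eta> x)) \<partial>SD)"
  proof (rule integral_cong_AE)
    have eq: "of_real (k^2 / \<eta> x) * N x * cnj (N x) = complex_of_real (k^2 * ((norm (N x))^2 / \<eta> x))" for x
      unfolding mult.assoc complex_norm_square[symmetric] by simp
    show "AE x in SD. of_real (k^2 / \<eta> x) * N x * cnj (N' x) = complex_of_real (k^2 * ((norm (N x))^2 / \<eta> x))"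
      using N'(2) by eventually_elim (simp only: eq)
    have "(\<lambda>x. cnj (N' x)) \<in> borel_measurable SD"
      by (rule measurable_compose[OF N'(1) borel_measurable_continuous_onI[OF continuous_on_cnj[OF continuous_on_id]]])
    then show "(\<lambda>x. of_real (k^2 / \<eta> x) * N x * cnj (N' x)) \<in> borel_measurable SD" by measurable
  qed measurable
  also have "\<dots> = of_real (k^2 * (\<integral>x. (norm (N x))^2 / \<eta> x \<partial>SD))" unfolding integral_complex_of_real integral_mult_right_zero ..
  finally show "(\<integral>x. of_real (k^2 / \<eta> x) * N x * cnj (N' x) \<partial>SD) = of_real (k^2 * (\<integral>x. (norm (N x))^2 / \<eta> x \<partial>SD))" .
  show "0 \<le> (\<integral>x. (norm (N x))^2 / \<eta> x \<partial>SD)" by (rule integral_nonneg_AE) (use a in \<open>auto elim!: eventually_mono\<close>)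
  show "(nS N)^2 \<le> e * (\<integral>x. (norm (N x))^2 / \<eta> x \<partial>SD)" if e: "Linf_norm SD \<eta> \<le> ereal e"
  proof -
    have "AE x in SD. \<eta> x \<le> e" using esssup_AE[of "\<lambda>x. ereal \<bar>\<eta> x\<bar>" SD]
    proof eventually_elim
      case (elim x)
      then have "ereal \<bar>\<eta> x\<bar> \<le> ereal e" using e unfolding Linf_norm_def by (rule order_trans)
      then show ?case by simp
    qed
    \<comment> \<open>Where \<eta> lies between 0 and \<open>e\<close>, its reciprocal is at least
      that of \<open>e\<close>.\<close>
    with a(2) have "AE x in SD. (norm (N x))^2 \<le> e * ((norm (N x))^2 / \<eta> x)"
    proof eventually_elim
      case (elim x)
      then have \<eta>x: "\<eta> x > 0" using a(1) by simp
      have "(norm (N x))^2 = \<eta> x * ((norm (N x))^2 / \<eta> x)" using \<eta>x by simp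
      also have "\<dots> \<le> e * ((norm (N x))^2 / \<eta> x)" using elim(2) \<eta>x by (intro mult_right_mono) auto
      finally show ?case .
    qed
    then have "(\<integral>x. (norm (N x))^2 \<partial>SD) \<le> (\<integral>x. e * ((norm (N x))^2 / \<eta> x) \<partial>SD)"
      by (rule integral_mono_AE[OF L2_integrable[OF N] integrable_mult_right[OF i]])
    then show ?thesis unfolding L2_norm_squared by (simp only: integral_mult_right_zero)
  qed
qed

end


lemma L2_norm_uminus: "L2_norm M (\<lambda>x. - f x) = L2_norm M f" by (simp add: L2_norm_def)

section \<open>Normal derivatives, vanishing gradients and energy bounds\<close>

context C2_domain
begin

text \<open>Green's formula expresses a boundary pairing with the normal derivative through pairings
  in \<open>D\<close> with first and second derivatives, so weak convergence inside \<open>D\<close>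
  carries over to the normal derivative.\<close>

lemma normal_pairing:
  assumes a: "H1_trace a b f" and w: "\<And>i. H1_trace (w i) (h i) (g i)"
  shows "(\<Sum>i\<in>UNIV. ip (w i) (b i) + ip (h i i) a) = (\<integral>x. (\<Sum>i\<in>UNIV. nuc i x * g i x) * cnj (f x) \<partial>SD)"
proof -
  note L = H1_traceD(3)[OF H1_trace_cnj[OF a]] H1_traceD(3)[OF w]
  have "(\<integral>x. (\<Sum>i\<in>UNIV. nuc i x * g i x) * cnj (f x) \<partial>SD) = (\<integral>x. (\<Sum>i\<in>UNIV. nuc i x * cnj (f x) * g i x) \<partial>SD)"
    unfolding sum_distrib_right by (intro Bochner_Integration.integral_cong sum.cong refl) (simp only: ac_simps)
  also have "\<dots> = (\<Sum>i\<in>UNIV. \<integral>x. nuc i x * cnj (f x) * g i x \<partial>SD)" by (rule Bochner_Integration.integral_sum)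
       (rule L2_integrable_mult[OF L2_mult_continuous_surface[OF Ck_continuous[OF nuc_C1] L(1)] L(2)])
  also have "\<dots> = (\<Sum>i\<in>UNIV. ip (w i) (b i) + ip (h i i) a)"
    by (intro sum.cong refl, subst H1_trace_green[OF w H1_trace_cnj[OF a], symmetric]) (simp add: ip_def mult.commute)
  finally show ?thesis ..
qed

text \<open>As in the proof of Poincare's inequality: integrating \<open>x $ i * u\<close> by parts
  against \<open>u\<close> produces the squared norm of \<open>u\<close>, while every other term
  contains the gradient. Any one coordinate direction will do.\<close>

lemma zero_gradient:
  assumes u: "H1_trace u w (\<lambda>x. 0)" and w: "\<And>i. nD (w i) = 0"
  shows "nD u = 0"
proof -
  note L = H1_traceD[OF u]
  fix i :: 'n
  let ?x = "\<lambda>x::real^'n. complex_of_real (x $ i)"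
  have bl: "bounded_linear ?x" by (rule bounded_linear_compose[OF bounded_linear_of_real bounded_linear_vec_nth])
  have C1: "Ck 1 ?x" by (rule Ck_linear[OF bl])
  have p: "partial i ?x x = 1" for x using partial_eqI[OF bounded_linear_imp_has_derivative[OF bl]] by simp
  note a = H1_trace_mult[OF C1 u]
  obtain C where C: "C \<ge> 0" "\<And>f. f \<in> L2 LD \<Longrightarrow> nD (\<lambda>x. ?x x * f x) \<le> C * nD f"
    by (rule L2_continuous_mult[OF Ck_continuous[OF C1]]) blast
  have xL: "(\<lambda>x. ?x x * f x) \<in> L2 LD" if "f \<in> L2 LD" for f by (rule L2_mult_continuous[OF Ck_continuous[OF C1] that])
  have "ip (\<lambda>x. ?x x * w i x + u x) u = - ip (\<lambda>x. ?x x * u x) (w i)"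
    using zero_trace_parts[OF u H1_traceD(1)[OF a] H1_trace_weak_partial[OF a], of i] by (simp add: p)
  moreover have "ip (\<lambda>x. ?x x * w i x + u x) u = ip (\<lambda>x. ?x x * w i x) u + of_real ((nD u)^2)"
    by (simp add: ip_add_left xL L ip_self)
  moreover have "ip (\<lambda>x. ?x x * u x) (w i) = 0" using ip_bound[OF xL[OF L(1)] L(2), of i] by (simp add: w)
  moreover have "ip (\<lambda>x. ?x x * w i x) u = 0"
  proof -
    have "nD (\<lambda>x. ?x x * w i x) = 0" using C(2)[OF L(2), of i] by (intro antisym) (simp_all add: w)
    then show ?thesis using ip_bound[OF xL[OF L(2)] L(1), of i] by simp
  qed
  ultimately have "complex_of_real ((nD u)^2) = 0" by simp
  then show ?thesis by simp
qed

lemma H2_norm_le: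
  assumes u: "H1_trace u w (\<lambda>x. 0)" and w: "\<And>i. H1_trace (w i) (h i) (g i)"
  shows "0 \<le> H2_norm D u" "H2_norm D u \<le> nD u + (\<Sum>i\<in>UNIV. nD (w i)) + (\<Sum>i\<in>UNIV. \<Sum>j\<in>UNIV. nD (h i j))"
proof -
  note H = H2_H10I[OF u w]
  have u2: "u \<in> H2 D" using H(1) by (simp add: H2_H10_def)
  have 1: "nD (wpartial D i u) = nD (w i)" for i
    by (rule L2_cong_AE(2)[OF H1_traceD(2)[OF u] L2_measurable[OF H1_traceD(2)[OF H2_traces(1)[OF u2]]] H(2)])
  have 2: "nD (wpartial D j (wpartial D i u)) = nD (h i j)" for i j
    by (rule L2_cong_AE(2)[OF H1_traceD(2)[OF w] L2_measurable[OF H1_traceD(2)[OF H2_traces(2)[OF u2]]] H(3)])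
  define a where "a = nD u"
  define b where "b = (\<Sum>i\<in>UNIV. (nD (w i))^2)"
  define c where "c = (\<Sum>ij\<in>UNIV. (nD (h (fst ij) (snd ij)))^2)"
  have pos: "a \<ge> 0" "b \<ge> 0" "c \<ge> 0" by (simp_all add: a_def b_def c_def sum_nonneg)
  have eq: "H2_norm D u = sqrt (a^2 + b + c)"
    by (simp add: H2_norm_def 1 2 a_def b_def c_def sum.cartesian_product UNIV_Times_UNIV case_prod_beta)
  show "0 \<le> H2_norm D u" unfolding eq using pos by simp
  have "sqrt (a^2 + b + c) \<le> sqrt (a^2 + b) + sqrt c" by (rule sqrt_add_le_add_sqrt) (use pos in simp_all)
  also have "sqrt (a^2 + b) \<le> sqrt (a^2) + sqrt b" by (rule sqrt_add_le_add_sqrt) (use pos in simp_all)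
  also have "sqrt b \<le> (\<Sum>i\<in>UNIV. nD (w i))" using L2_set_le_sum[of UNIV "\<lambda>i. nD (w i)"] by (simp add: L2_set_def b_def)
  also have "sqrt c \<le> (\<Sum>i\<in>UNIV. \<Sum>j\<in>UNIV. nD (h i j))" using L2_set_le_sum[of UNIV "\<lambda>ij. nD (h (fst ij) (snd ij))"]
    by (simp add: L2_set_def c_def sum.cartesian_product UNIV_Times_UNIV case_prod_beta)
  finally show "H2_norm D u \<le> nD u + (\<Sum>i\<in>UNIV. nD (w i)) + (\<Sum>i\<in>UNIV. \<Sum>j\<in>UNIV. nD (h i j))"
    unfolding eq using pos by (simp add: a_def)
qed

lemma ip_tendsto_0:
  assumes f: "\<And>j. f j \<in> L2 LD" "\<And>j. nD (f j) \<le> B" and z: "\<And>j. z j \<in> L2 LD" "(\<lambda>j. nD (z j)) \<longlonglongrightarrow> 0"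
  shows "(\<lambda>j. ip (f j) (z j)) \<longlonglongrightarrow> 0"
proof (rule Lim_null_comparison[OF always_eventually[OF allI] tendsto_mult_right_zero[OF z(2), of B]])
  show "norm (ip (f j) (z j)) \<le> B * nD (z j)" for j
    by (rule order_trans[OF ip_bound[OF f(1) z(1)] mult_right_mono[OF f(2) L2_norm_nonneg]])
qed

end

context index_domain
begin

lemma ip_q:
  "ip (\<lambda>x. q x * f x) g = ip f (\<lambda>x. q x * g x)"
proof -
  have "cnj (q x) = q x" for x by (simp add: q_def)
  then show ?thesis unfolding ip_def by (intro Bochner_Integration.integral_cong refl) (simp add: ac_simps)
qed

lemma form_A0_self:
  fixes k :: real
  assumes u: "u \<in> H2 D"
  defines "F \<equiv> \<lambda>x. laplacian D u x + of_real (k^2) * u x"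
  shows "F \<in> L2 LD" "Re (form_A0 D n k u u) = Re (ip F (\<lambda>x. q x * F x)) + k^4 * (nD u)^2"
proof -
  have uL: "u \<in> L2 LD" by (rule H1_traceD(1)[OF H2_traces(1)[OF u]])
  show F: "F \<in> L2 LD" unfolding F_def by (intro L2_add L2_cmult laplacian_L2 u uL)
  have cq: "cnj (q x) = q x" for x by (simp add: q_def)
  have "form_A0 D n k u u = (\<integral>x. F x * cnj (q x * F x) + of_real (k^4) * (u x * cnj (u x)) \<partial>LD)"
    unfolding form_A0_def q_def[symmetric] F_def by (intro Bochner_Integration.integral_cong refl) (simp add: cq algebra_simps)
  also have "\<dots> = ip F (\<lambda>x. q x * F x) + of_real (k^4) * ip u u"
    unfolding ip_def using ip_integrable[OF F q_L2[OF F]] ip_integrable[OF uL uL] by (simp del: complex_cnj_mult)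
  finally have eq: "form_A0 D n k u u = ip F (\<lambda>x. q x * F x) + of_real (k^4 * (nD u)^2)" by (simp only: ip_self of_real_mult)
  show "Re (form_A0 D n k u u) = Re (ip F (\<lambda>x. q x * F x)) + k^4 * (nD u)^2" unfolding eq plus_complex.sel Re_complex_of_real ..
qed

text \<open>With \<open>u\<close> as test function the gradient term is at most \<open>k^2\<close>
  by the normalization, and the other terms are nonnegative. The boundary term carries the same
  factor \<open>k^2\<close>, which cancels, so the bound on the normal derivative does not
  degenerate for small \<open>k\<close>.\<close>

lemma eigen_energy:
  assumes adm: "admissible D \<eta>" and eig: "eigenpair D n \<eta> k u" and one: "H1_norm D u = 1"
  defines "F \<equiv> \<lambda>x. laplacian D u x + of_real (k^2) * u x"
  shows "Re (ip F (\<lambda>x. q x * F x)) \<le> k^2"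
    and "Linf_norm SD \<eta> \<le> ereal e \<Longrightarrow> e \<ge> 0 \<Longrightarrow> (nS (normal_deriv D u))^2 \<le> e"
proof -
  have k: "k > 0" and u10: "u \<in> H2_H10 D"
    and eq: "form_A D n \<eta> k u u - of_real (k^2) * form_B D u u = 0" using eig by (auto simp: eigenpair_def)
  have u: "u \<in> H2 D" using u10 by (simp add: H2_H10_def)
  define J where "J = (\<integral>x. (norm (normal_deriv D u x))^2 / \<eta> x \<partial>SD)"
  note N = normal_deriv_L2(3)[OF u]
  have refl_AE: "AE x in SD. normal_deriv D u x = normal_deriv D u x" by simp
  note bt = boundary_term[OF adm N L2_measurable[OF N] refl_AE]
  have J: "J \<ge> 0" unfolding J_def by (rule bt(2))
  have uH1: "u \<in> H1 D" using u by (simp add: H2_def)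
  have fB: "form_B D u u = of_real (\<Sum>i\<in>UNIV. (nD (wpartial D i u))^2)" unfolding form_B_ip[OF uH1 uH1] by (simp add: ip_self)
  define S where "S = (\<Sum>i\<in>UNIV. (nD (wpartial D i u))^2)"
  have n1: "(nD u)^2 + S = 1" using one by (simp add: H1_norm_def S_def)
  have "form_A0 D n k u u + of_real (k^2 * J) = of_real (k^2 * S)"
    using eq unfolding form_A_def bt(1) fB J_def[symmetric] S_def[symmetric] by simp
  then have "Re (form_A0 D n k u u + of_real (k^2 * J)) = Re (of_real (k^2 * S))" by (rule arg_cong)
  then have e0: "Re (ip F (\<lambda>x. q x * F x)) + k^4 * (nD u)^2 + k^2 * J = k^2 * S"
    unfolding plus_complex.sel Re_complex_of_real form_A0_self(2)[OF u] F_def .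
  have F: "F \<in> L2 LD" unfolding F_def by (rule form_A0_self(1)[OF u])
  have FF: "0 \<le> Re (ip F (\<lambda>x. q x * F x))"
  proof -
    obtain q0 where "q0 > 0" "\<And>f. f \<in> L2 LD \<Longrightarrow> q0 * (nD f)^2 \<le> Re (ip f (\<lambda>x. q x * f x))" by (rule q_coercive) blast
    then show ?thesis using F order_trans[of 0 "q0 * (nD F)^2"] by simp
  qed
  have "S \<le> 1" using n1 zero_le_power2[of "nD u"] by linarith
  then have S1: "k\<^sup>2 * S \<le> k^2 * 1" by (rule mult_left_mono) simp
  have p4: "0 \<le> k^4 * (nD u)^2" by simp
  have kJ: "0 \<le> k^2 * J" using J by simp
  show "Re (ip F (\<lambda>x. q x * F x)) \<le> k^2" using e0 S1 p4 kJ by linarith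
  have "k\<^sup>2 * J \<le> k^2 * 1" using e0 S1 p4 FF by linarith
  then have J1: "J \<le> 1" using k by (simp only: mult_le_cancel_left_pos zero_less_power)
  show "(nS (normal_deriv D u))^2 \<le> e" if "Linf_norm SD \<eta> \<le> ereal e" "e \<ge> 0"
    using bt(3)[OF that(1)] mult_left_mono[OF J1 that(2)] unfolding J_def[symmetric] by linarith
qed

end


section \<open>Passage to the limit in the eigenvalue problem\<close>

context index_domain
begin

text \<open>The test function is fixed, so weak convergence of the Laplacians suffices; everything
  else converges strongly.\<close>

lemma form_tendsto:
  assumes u: "\<And>m. u m \<in> H2 D" "u0 \<in> H2 D" and \<phi>: "\<phi> \<in> H2 D" and k: "k \<longlonglongrightarrow> k0"
    and lim: "L2_lim LD u u0" "\<And>i. L2_lim LD (\<lambda>m. wpartial D i (u m)) (wpartial D i u0)"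
    and lap: "\<And>\<psi>. \<psi> \<in> L2 LD \<Longrightarrow> (\<lambda>m. ip (laplacian D (u m)) \<psi>) \<longlonglongrightarrow> ip (laplacian D u0) \<psi>"
  shows "(\<lambda>m. form_A0 D n (k m) (u m) \<phi> - of_real ((k m)^2) * form_B D (u m) \<phi>)
    \<longlonglongrightarrow> form_A0 D n k0 u0 \<phi> - of_real (k0^2) * form_B D u0 \<phi>"
proof -
  note L = H1_traceD(1)[OF H2_traces(1)]
  note W = H1_traceD(2)[OF H2_traces(1)]
  have H: "v \<in> H1 D" if "v \<in> H2 D" for v using that by (simp add: H2_def)
  note it = ip_tendsto[OF L[OF u(1)] L[OF u(2)] lim(1)]
  show ?thesis
    unfolding form_A0_ip[OF u(1) \<phi>] form_A0_ip[OF u(2) \<phi>] form_B_ip[OF H[OF u(1)] H[OF \<phi>]] form_B_ip[OF H[OF u(2)] H[OF \<phi>]]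
    by (intro tendsto_intros k lap it q_L2 laplacian_L2 \<phi> L[OF \<phi>] ip_tendsto[OF W[OF u(1)] W[OF u(2)] lim(2)] W[OF \<phi>])
qed

text \<open>The convergence of \<open>k\<close> and the Cauchy property of \<open>u\<close> in L2
  are arranged beforehand by passing to a subsequence; from here on the whole sequence converges and
  no further selection is made.\<close>

lemma eigenpair_limit:
  fixes \<eta> :: "nat \<Rightarrow> real^'n \<Rightarrow> real" and k :: "nat \<Rightarrow> real" and u :: "nat \<Rightarrow> real^'n \<Rightarrow> complex"
  assumes adm: "\<And>m. admissible D (\<eta> m)"
    and eta_lim: "(\<lambda>m. Linf_norm SD (\<eta> m)) \<longlonglongrightarrow> 0"
    and eig: "\<And>m. eigenpair D n (\<eta> m) (k m) (u m)" and one: "\<And>m. H1_norm D (u m) = 1" and klim: "k \<longlonglongrightarrow> k0"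
    and cauchy: "\<And>e. e > 0 \<Longrightarrow> \<exists>N. \<forall>m\<ge>N. \<forall>l\<ge>N. dD (u m) (u l) < e"
  shows "\<exists>u0. eigenpair0 D n k0 u0 \<and> (\<lambda>m. H2_norm D (\<lambda>x. u m x - u0 x)) \<longlonglongrightarrow> 0"
proof -
  have kpos: "k m > 0" and uH10: "u m \<in> H2_H10 D" for m using eig[of m] by (auto simp: eigenpair_def)
  have uH2: "u m \<in> H2 D" for m using uH10 by (simp add: H2_H10_def)
  define w where "w m i = wpartial D i (u m)" for m i
  define h where "h m i j = wpartial D j (w m i)" for m i j
  define g where "g m i = trace D (w m i)" for m i
  define lap where "lap m = laplacian D (u m)" for m
  have lap: "lap m = (\<lambda>x. \<Sum>i\<in>UNIV. h m i i x)" for m by (simp add: lap_def laplacian_def[abs_def] h_def w_def)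
  have Tu: "H1_trace (u m) (w m) (\<lambda>x. 0)" for m using H2_H10_trace[OF uH10[of m]] by (simp add: w_def[abs_def])
  have Tw: "H1_trace (w m i) (h m i) (g m i)" for m i using H2_traces(2)[OF uH2[of m]] by (simp add: w_def h_def[abs_def] g_def)
  note Lu = H1_traceD(1)[OF Tu] and Lw = H1_traceD(2)[OF Tu] and Lh = H1_traceD(2)[OF Tw]
  have Llap: "lap m \<in> L2 LD" for m unfolding lap_def by (rule laplacian_L2[OF uH2])
  have u1: "nD (u m) \<le> 1" and w1: "nD (w m i) \<le> 1" for m i using H1_norm_bounds(1,2)[OF H1_trace_weak_partial[OF Tu]] one by auto
  obtain q0 where q0: "q0 > 0" "\<And>f. f \<in> L2 LD \<Longrightarrow> q0 * (nD f)^2 \<le> Re (ip f (\<lambda>x. q x * f x))" by (rule q_coercive) blast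
  obtain q1 where q1: "q1 \<ge> 0" "\<And>f. f \<in> L2 LD \<Longrightarrow> nD (\<lambda>x. q x * f x) \<le> q1 * nD f" by (rule q_norm) blast

  \<comment> \<open>Kept in terms of \<open>k m\<close>, because it is used a second time to show
    that the Laplacians tend to 0 if \<open>k m\<close> does.\<close>
  have lap_k: "nD (lap m) \<le> sqrt ((k m)^2 / q0) + (k m)^2" for m
  proof -
    let ?F = "\<lambda>x. lap m x + of_real ((k m)^2) * u m x"
    have F: "?F \<in> L2 LD" by (intro L2_add L2_cmult Llap Lu)
    have "q0 * (nD ?F)^2 \<le> (k m)^2" using q0(2)[OF F] eigen_energy(1)[OF adm eig one, of m] unfolding lap_def by linarith
    then have "(nD ?F)^2 \<le> (k m)^2 / q0" using q0(1) by (simp add: field_simps)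
    then have 1: "nD ?F \<le> sqrt ((k m)^2 / q0)" by (rule real_le_rsqrt)
    have "nD (lap m) \<le> nD ?F + dD (lap m) ?F" by (rule L2_norm_triangle_sub[OF Llap F])
    also have "dD (lap m) ?F = nD (\<lambda>x. - (of_real ((k m)^2) * u m x))" by simp
    also have "\<dots> = (k m)^2 * nD (u m)" using L2_norm_cmult[of LD "- of_real ((k m)^2)" "u m"] by (simp add: norm_power)
    also have "\<dots> \<le> (k m)^2 * 1" by (rule mult_left_mono[OF u1]) simp
    finally show ?thesis using 1 by linarith
  qed
  have "(\<lambda>m. sqrt ((k m)^2 / q0) + (k m)^2) \<longlonglongrightarrow> sqrt (k0^2 / q0) + k0^2" using q0(1) by (intro tendsto_intros klim) simp
  then have "Bseq (\<lambda>m. sqrt ((k m)^2 / q0) + (k m)^2)" by (rule convergent_imp_Bseq[OF convergentI])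
  then obtain B where Bs: "\<And>m. norm (sqrt ((k m)^2 / q0) + (k m)^2) \<le> B" unfolding Bseq_def by blast
  have B: "nD (lap m) \<le> B" for m
    using lap_k[of m] abs_ge_self[of "sqrt ((k m)^2 / q0) + (k m)^2"] Bs[of m] unfolding real_norm_def by linarith
  have B0: "B \<ge> 0" by (rule order_trans[OF L2_norm_nonneg B])
  obtain C where C: "C \<ge> 0" "\<And>u w h g. H1_trace u w (\<lambda>x. 0) \<Longrightarrow> (\<And>i. H1_trace (w i) (h i) (g i)) \<Longrightarrow>
    (\<Sum>i\<in>UNIV. \<Sum>j\<in>UNIV. nD (h i j)) \<le> C * (nD (\<lambda>x. \<Sum>i\<in>UNIV. h i i x) + (\<Sum>k\<in>UNIV. nD (w k)))" by (rule H2_estimate) blast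
  define B3 where "B3 = C * (B + real CARD('n))"
  have h3: "nD (h m i j) \<le> B3" for m i j
  proof -
    have "nD (h m i j) \<le> (\<Sum>j\<in>UNIV. nD (h m i j))" by (rule member_le_sum) auto
    also have "\<dots> \<le> (\<Sum>i\<in>UNIV. \<Sum>j\<in>UNIV. nD (h m i j))"
      by (rule member_le_sum[of i UNIV "\<lambda>i. \<Sum>j\<in>UNIV. nD (h m i j)"]) (auto intro: sum_nonneg)
    also have "\<dots> \<le> C * (nD (lap m) + (\<Sum>k\<in>UNIV. nD (w m k)))" unfolding lap by (rule C(2)[OF Tu Tw])
    also have "\<dots> \<le> C * (B + (\<Sum>k\<in>(UNIV::'n set). 1))" by (intro mult_left_mono add_mono sum_mono B w1 C(1))
    finally show ?thesis by (simp add: B3_def)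
  qed

  \<comment> \<open>The Laplacians are only bounded, but paired with differences of the Cauchy
    sequence \<open>u\<close> they make the gradients Cauchy.\<close>
  have grad_diff: "(dD (w m i) (w l i))^2 \<le> 2 * B * dD (u m) (u l)" for m l i
  proof -
    note Td = H1_trace_diff[OF Tu Tu, of m l, unfolded diff_self]
    have d: "of_real (\<Sum>i\<in>UNIV. (dD (w m i) (w l i))^2) = - ip (\<lambda>x. \<Sum>i\<in>UNIV. h m i i x - h l i i x) (\<lambda>x. u m x - u l x)"
      by (rule dirichlet_identity[OF Td H1_trace_diff[OF Tw Tw]])
    have "(dD (w m i) (w l i))^2 \<le> (\<Sum>i\<in>UNIV. (dD (w m i) (w l i))^2)" by (rule member_le_sum) auto
    also have "\<dots> \<le> norm (complex_of_real (\<Sum>i\<in>UNIV. (dD (w m i) (w l i))^2))" unfolding norm_of_real by (rule abs_ge_self)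
    also have "\<dots> = norm (ip (\<lambda>x. lap m x - lap l x) (\<lambda>x. u m x - u l x))" unfolding d lap norm_minus_cancel sum_subtractf ..
    also have "\<dots> \<le> dD (lap m) (lap l) * dD (u m) (u l)" by (rule ip_bound[OF L2_diff[OF Llap Llap] L2_diff[OF Lu Lu]])
    also have "\<dots> \<le> 2 * B * dD (u m) (u l)"
    proof (rule mult_right_mono[OF _ L2_norm_nonneg])
      have "dD (lap m) (lap l) \<le> nD (lap m) + nD (lap l)"
        using L2_norm_triangle_diff[OF Llap L2_zero Llap, of m l] by (simp add: L2_norm_uminus)
      then show "dD (lap m) (lap l) \<le> 2 * B" using B[of m] B[of l] by linarith
    qed
    finally show ?thesis .
  qed
  obtain u0' where u0': "u0' \<in> L2 LD" "L2_lim LD u u0'" by (rule L2_complete[OF finite_LD Lu cauchy]) blast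
  have "\<exists>w0. w0 \<in> L2 LD \<and> L2_lim LD (\<lambda>m. w m i) w0" for i
  proof -
    have "\<exists>N. \<forall>m\<ge>N. \<forall>l\<ge>N. dD (w m i) (w l i) < e" if e: "e > 0" for e
    proof -
      have "e\<^sup>2 / (2 * B + 1) > 0" using e B0 by simp
      then obtain N where N: "\<And>m l. m \<ge> N \<Longrightarrow> l \<ge> N \<Longrightarrow> dD (u m) (u l) < e^2 / (2 * B + 1)" using cauchy by meson
      have "dD (w m i) (w l i) < e" if ml: "m \<ge> N" "l \<ge> N" for m l
      proof (rule power2_less_imp_less)
        have "(dD (w m i) (w l i))^2 \<le> 2 * B * dD (u m) (u l)" by (rule grad_diff)
        also have "\<dots> \<le> (2 * B + 1) * dD (u m) (u l)" by (rule mult_right_mono) simp_all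
        also have "\<dots> < (2 * B + 1) * (e^2 / (2 * B + 1))" by (rule mult_strict_left_mono[OF N[OF ml]]) (use B0 in simp)
        also have "\<dots> = e^2" using B0 by simp
        finally show "(dD (w m i) (w l i))^2 < e^2" .
      qed (use e in simp)
      then show ?thesis by blast
    qed
    note c = this
    show ?thesis by (rule L2_complete[OF finite_LD Lw c]) blast+
  qed
  then have "\<forall>i. \<exists>w0. w0 \<in> L2 LD \<and> L2_lim LD (\<lambda>m. w m i) w0" by blast
  from choice[OF this] obtain w0' where w0': "\<And>i. w0' i \<in> L2 LD" "\<And>i. L2_lim LD (\<lambda>m. w m i) (w0' i)" by blast
  have T0': "H1_trace u0' w0' (\<lambda>x. 0)" by (rule zero_trace_limit[OF Tu u0'(1) w0'(1) u0'(2) w0'(2)])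
  have "\<exists>h0. is_weak_partial D j (w0' i) h0" for i j using weak_partial_bounded_limit[of j "\<lambda>m. w m i" "\<lambda>m. h m i j" "w0' i" B3]
      H1_trace_weak_partial[OF Tw] Lw w0' h3 by blast
  then have "\<forall>i. \<exists>h. \<forall>j. is_weak_partial D j (w0' i) (h j)" by (intro allI choice)
  from choice[OF this] obtain h0' where h0': "\<And>i j. is_weak_partial D j (w0' i) (h0' i j)" by blast
  have "\<forall>i. \<exists>g. H1_trace (w0' i) (h0' i) g" by (intro allI, rule H1_trace_exists[OF w0'(1) h0'], rule exI)
  from choice[OF this] obtain g0' where Tw0': "\<And>i. H1_trace (w0' i) (h0' i) (g0' i)" by blast
  note H0 = H2_H10I[OF T0' Tw0']

  \<comment> \<open>The limits found so far are replaced by the representatives that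
    \<open>wpartial\<close> and \<open>trace\<close> choose for \<open>u0'\<close>, since the forms
    are written in these.\<close>
  define w0 where "w0 i = wpartial D i u0'" for i
  define h0 where "h0 i j = wpartial D j (w0 i)" for i j
  define g0 where "g0 i = trace D (w0 i)" for i
  define lap0 where "lap0 = laplacian D u0'"
  have u0H2: "u0' \<in> H2 D" using H0(1) by (simp add: H2_H10_def)
  have lap0: "lap0 = (\<lambda>x. \<Sum>i\<in>UNIV. h0 i i x)" by (simp add: lap0_def laplacian_def[abs_def] h0_def w0_def)
  have T0: "H1_trace u0' w0 (\<lambda>x. 0)" using H2_H10_trace[OF H0(1)] by (simp add: w0_def[abs_def])
  have Tw0: "H1_trace (w0 i) (h0 i) (g0 i)" for i using H2_traces(2)[OF u0H2] by (simp add: w0_def h0_def[abs_def] g0_def)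
  note Lw0 = H1_traceD(2)[OF T0] and Lh0 = H1_traceD(2)[OF Tw0]
  have Llap0: "lap0 \<in> L2 LD" unfolding lap0_def by (rule laplacian_L2[OF u0H2])
  have wlim: "L2_lim LD (\<lambda>m. w m i) (w0 i)" for i
    by (rule L2_lim_cong[OF Lw w0'(1) L2_measurable[OF Lw0] _ w0'(2)]) (use H0(2) in \<open>simp add: w0_def\<close>)
  have hlim: "(\<lambda>m. ip (h m i j) \<psi>) \<longlonglongrightarrow> ip (h0 i j) \<psi>" if "\<psi> \<in> L2 LD" for i j \<psi>
    by (rule weak_partial_weak_convergence[OF H1_trace_weak_partial[OF Tw] Lw Lw0 wlim h3 H1_trace_weak_partial[OF Tw0] that])
  have laplim: "(\<lambda>m. ip (lap m) \<psi>) \<longlonglongrightarrow> ip lap0 \<psi>" if "\<psi> \<in> L2 LD" for \<psi>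
    unfolding lap lap0 ip_sum_left[OF Lh that] ip_sum_left[OF Lh0 that] by (intro tendsto_sum hlim that)

  have N_lim: "(\<lambda>m. nS (normal_deriv D (u m))) \<longlonglongrightarrow> 0"
  proof (rule LIMSEQ_I)
    fix e :: real assume e: "e > 0"
    then have "(0::ereal) < ereal ((e / 2)^2)" by simp
    from order_tendstoD(2)[OF eta_lim this] obtain M where M: "\<And>m. m \<ge> M \<Longrightarrow> Linf_norm SD (\<eta> m) < ereal ((e / 2)^2)"
      unfolding eventually_sequentially by blast
    have "nS (normal_deriv D (u m)) < e" if "m \<ge> M" for m
    proof -
      have "(nS (normal_deriv D (u m)))^2 \<le> (e / 2)^2"
        by (rule eigen_energy(2)[OF adm eig one order_less_imp_le[OF M[OF that]]]) simp
      then have "nS (normal_deriv D (u m)) \<le> e / 2" by (rule power2_le_imp_le) (use e in simp)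
      then show ?thesis using e by simp
    qed
    then show "\<exists>M. \<forall>m\<ge>M. norm (nS (normal_deriv D (u m)) - 0) < e" by auto
  qed
  have N0: "AE x in SD. normal_deriv D u0' x = 0"
  proof -
    let ?N = "\<lambda>x. \<Sum>i\<in>UNIV. nuc i x * g0 i x"
    have NL: "?N \<in> L2 SD" using normal_deriv_L2(2)[OF u0H2] by (simp add: g0_def w0_def)
    \<comment> \<open>The normal derivative of the limit is itself the trace of an H1 function, so
      it can be paired with itself.\<close>
    obtain a b where a: "H1_trace a b ?N"
      by (rule that, rule H1_trace_sum[OF finite_class.finite_UNIV], rule H1_trace_mult[OF nuc_C1 Tw0])
    have "(\<lambda>m. \<Sum>i\<in>UNIV. ip (w m i) (b i) + ip (h m i i) a) \<longlonglongrightarrow> (\<Sum>i\<in>UNIV. ip (w0 i) (b i) + ip (h0 i i) a)"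
      by (intro tendsto_sum tendsto_add ip_tendsto[OF Lw Lw0 wlim] hlim H1_traceD[OF a])
    moreover have "(\<lambda>m. \<Sum>i\<in>UNIV. ip (w m i) (b i) + ip (h m i i) a) \<longlonglongrightarrow> 0"
    proof (rule Lim_null_comparison[OF always_eventually[OF allI] tendsto_mult_left_zero[OF N_lim, of "nS ?N"]])
      fix m
      let ?Nm = "\<lambda>x. \<Sum>i\<in>UNIV. nuc i x * g m i x"
      have NmL: "?Nm \<in> L2 SD" using normal_deriv_L2(2)[OF uH2[of m]] by (simp add: g_def w_def)
      have nn: "nS (normal_deriv D (u m)) = nS ?Nm"
        by (rule L2_cong_AE(2)[OF NmL L2_measurable[OF normal_deriv_L2(3)[OF uH2]]]) (use normal_deriv_L2(1)[OF uH2[of m]] in \<open>simp add: g_def w_def\<close>)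
      show "norm (\<Sum>i\<in>UNIV. ip (w m i) (b i) + ip (h m i i) a) \<le> nS (normal_deriv D (u m)) * nS ?N"
        unfolding normal_pairing[OF a Tw] nn using L2_Cauchy_Schwarz[OF NmL L2_cnj[OF NL]] unfolding L2_norm_cnj .
    qed
    ultimately have "(\<integral>x. ?N x * cnj (?N x) \<partial>SD) = 0" unfolding normal_pairing[OF a Tw0] by (rule LIMSEQ_unique)
    moreover have "(\<integral>x. ?N x * cnj (?N x) \<partial>SD) = of_real ((nS ?N)^2)"
      unfolding L2_norm_squared integral_complex_of_real[symmetric] complex_norm_square ..
    ultimately have "nS ?N = 0" by simp
    from L2_norm_eq_0[OF NL this] normal_deriv_L2(1)[OF u0H2] show ?thesis unfolding g0_def w0_def by eventually_elim simp
  qed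
  have u0H20: "u0' \<in> H20 D" using H0(1) N0 by (simp add: H20_def H2_H10_def)

  have eq0: "form_A0 D n k0 u0' \<phi> - of_real (k0^2) * form_B D u0' \<phi> = 0" if \<phi>: "\<phi> \<in> H20 D" for \<phi>
  proof -
    have \<phi>': "\<phi> \<in> H2_H10 D" "\<phi> \<in> H2 D" "AE x in SD. normal_deriv D \<phi> x = 0" using \<phi> by (auto simp: H20_def H2_H10_def)
    have "form_A0 D n (k m) (u m) \<phi> - of_real ((k m)^2) * form_B D (u m) \<phi> = 0" for m
    proof -
      have "(\<integral>x. of_real ((k m)^2 / \<eta> m x) * normal_deriv D (u m) x * cnj (normal_deriv D \<phi> x) \<partial>SD) = 0"
        by (rule integral_eq_zero_AE) (use \<phi>'(3) in \<open>eventually_elim, simp\<close>)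
      then show ?thesis using eig[of m] \<phi>'(1) unfolding eigenpair_def form_A_def by auto
    qed
    moreover have "(\<lambda>m. form_A0 D n (k m) (u m) \<phi> - of_real ((k m)^2) * form_B D (u m) \<phi>)
      \<longlonglongrightarrow> form_A0 D n k0 u0' \<phi> - of_real (k0^2) * form_B D u0' \<phi>" by (rule form_tendsto[OF uH2 u0H2 \<phi>'(2) klim u0'(2)])
         (use wlim laplim in \<open>simp_all add: w_def w0_def lap_def lap0_def\<close>)
    ultimately show ?thesis by (simp add: LIMSEQ_const_iff)
  qed

  \<comment> \<open>Strong H1 convergence carries the normalization over to the limit, which keeps
    the limit from being zero.\<close>
  have E: "(nD u0')^2 + (\<Sum>i\<in>UNIV. (nD (w0 i))^2) = 1"
  proof -
    have "(\<lambda>m. (nD (u m))^2 + (\<Sum>i\<in>UNIV. (nD (w m i))^2)) \<longlonglongrightarrow> (nD u0')^2 + (\<Sum>i\<in>UNIV. (nD (w0 i))^2)"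
      by (intro tendsto_add tendsto_power tendsto_sum L2_norm_tendsto[OF Lu u0'] L2_norm_tendsto[OF Lw Lw0 wlim])
    moreover have "(nD (u m))^2 + (\<Sum>i\<in>UNIV. (nD (w m i))^2) = 1" for m using one[of m] by (simp add: H1_norm_def w_def)
    ultimately show ?thesis by (simp add: LIMSEQ_const_iff)
  qed
  have grad0: "(\<Sum>i\<in>UNIV. (nD (w0 i))^2) = 0" if "nD lap0 * nD u0' = 0"
  proof -
    have "complex_of_real (\<Sum>i\<in>UNIV. (nD (w0 i))^2) = - ip lap0 u0'" unfolding lap0 by (rule dirichlet_identity[OF T0 Tw0])
    also have "ip lap0 u0' = 0" using ip_bound[OF Llap0 u0'(1)] that by simp
    finally show ?thesis unfolding minus_zero of_real_eq_0_iff .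
  qed
  have nz: "nD u0' \<noteq> 0"
  proof
    assume z: "nD u0' = 0"
    then have "(\<Sum>i\<in>UNIV. (nD (w0 i))^2) = 0" by (intro grad0) simp
    then show False using E z by simp
  qed
  have k0: "k0 > 0"
  proof (rule ccontr)
    assume "\<not> k0 > 0"
    moreover have "k0 \<ge> 0" by (rule LIMSEQ_le_const[OF klim]) (use kpos less_imp_le in blast)
    ultimately have "k0 = 0" by simp
    \<comment> \<open>For \<open>k0 = 0\<close> the bound \<open>lap_k\<close> tends to 0, so the
      weak limit of the Laplacians is 0.\<close>
    have 0: "(\<lambda>m. sqrt ((k m)^2 / q0) + (k m)^2) \<longlonglongrightarrow> 0"
      using \<open>(\<lambda>m. sqrt ((k m)^2 / q0) + (k m)^2) \<longlonglongrightarrow> sqrt (k0^2 / q0) + k0\<^sup>2\<close> \<open>k0 = 0\<close> by simp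
    have l0: "(\<lambda>m. nD (lap m)) \<longlonglongrightarrow> 0" by (rule Lim_null_comparison[OF always_eventually[OF allI] 0]) (simp add: lap_k)
    have "ip lap0 lap0 = 0"
    proof (rule LIMSEQ_unique[OF laplim[OF Llap0]])
      show "(\<lambda>m. ip (lap m) lap0) \<longlonglongrightarrow> 0"
      proof (rule Lim_null_comparison[OF always_eventually[OF allI] tendsto_mult_left_zero[OF l0, of "nD lap0"]])
        show "norm (ip (lap m) lap0) \<le> nD (lap m) * nD lap0" for m by (rule ip_bound[OF Llap Llap0])
      qed
    qed
    then have z: "nD lap0 = 0" by (simp add: ip_self)
    then have "(\<Sum>i\<in>UNIV. (nD (w0 i))^2) = 0" by (intro grad0) simp
    then have "nD (w0 i) = 0" for i by (simp add: sum_nonneg_eq_0_iff)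
    then have "nD u0' = 0" by (rule zero_gradient[OF T0])
    with nz show False ..
  qed
  have "\<not> (AE x in LD. u0' x = 0)"
  proof
    assume "AE x in LD. u0' x = 0"
    then have "nD u0' = nD (\<lambda>x. 0)" by (rule L2_cong_AE(2)[OF L2_zero L2_measurable[OF u0'(1)]])
    with nz show False by simp
  qed
  with k0 u0H20 eq0 have ep: "eigenpair0 D n k0 u0'" by (simp add: eigenpair0_def)

  define z where "z m x = u m x - u0' x" for m x
  define d where "d m x = lap m x - lap0 x" for m x
  have Tz: "H1_trace (z m) (\<lambda>i x. w m i x - w0 i x) (\<lambda>x. 0)" for m
    using H1_trace_diff[OF Tu T0, of m] by (simp add: z_def[abs_def])
  have Twz: "H1_trace (\<lambda>x. w m i x - w0 i x) (\<lambda>j x. h m i j x - h0 i j x) (\<lambda>x. g m i x - g0 i x)" for m i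
    by (rule H1_trace_diff[OF Tw Tw0])
  note Hz = H2_H10I[OF Tz Twz]
  have zH2: "z m \<in> H2 D" for m using Hz(1) by (simp add: H2_H10_def)
  have zL: "z m \<in> L2 LD" and dL: "d m \<in> L2 LD" for m
    using L2_diff[OF Lu u0'(1)] L2_diff[OF Llap Llap0] by (simp_all add: z_def[abs_def] d_def[abs_def])
  have zlim: "(\<lambda>m. nD (z m)) \<longlonglongrightarrow> 0" using u0'(2) by (simp add: z_def[abs_def])
  have dB: "nD (d m) \<le> B + nD lap0" for m using L2_norm_triangle_diff[OF Llap L2_zero Llap0, of m] B[of m]
    by (simp add: d_def[abs_def] L2_norm_uminus)
  have lz: "AE x in LD. laplacian D (z m) x = d m x" for m
  proof -
    have "AE x in LD. \<forall>i\<in>UNIV. wpartial D i (wpartial D i (z m)) x = h m i i x - h0 i i x"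
      by (rule AE_finite_allI[OF finite Hz(3)])
    then show ?thesis by eventually_elim (simp add: laplacian_def d_def lap lap0 sum_subtractf)
  qed
  \<comment> \<open>The limit has zero normal derivative, so \<open>z m\<close> and
    \<open>u m\<close> share theirs, and the boundary term of their pairing becomes an integral of a
    nonnegative function.\<close>
  have nz: "AE x in SD. normal_deriv D (z m) x = normal_deriv D (u m) x" for m
  proof -
    have "AE x in SD. \<forall>i\<in>UNIV. trace D (wpartial D i (z m)) x = g m i x - g0 i x" by (rule AE_finite_allI[OF finite Hz(4)])
    with normal_deriv_L2(1)[OF zH2[of m]] normal_deriv_L2(1)[OF uH2[of m]] normal_deriv_L2(1)[OF u0H2] N0
    show ?thesis
    proof eventually_elim
      case (elim x)
      have "normal_deriv D (z m) x = (\<Sum>i\<in>UNIV. nuc i x * g m i x) - (\<Sum>i\<in>UNIV. nuc i x * g0 i x)"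
        using elim(1,5) by (simp add: right_diff_distrib sum_subtractf)
      then show ?case using elim(2,3,4) by (simp add: g_def w_def g0_def w0_def)
    qed
  qed
  have qd: "ip f (\<lambda>x. q x * laplacian D (z m) x) = ip f (\<lambda>x. q x * d m x)" if f: "f \<in> L2 LD" for f m
  proof (rule ip_cong_right[OF f q_L2[OF laplacian_L2[OF zH2]] q_L2[OF dL]])
    show "AE x in LD. q x * laplacian D (z m) x = q x * d m x" using lz[of m] by eventually_elim simp
  qed
  \<comment> \<open>\<open>q\<close> is real and can be moved between the slots of
    \<open>ip\<close>, so the weak convergence of the Laplacians survives multiplication by
    \<open>q\<close>.\<close>
  have weak: "(\<lambda>m. ip f (\<lambda>x. q x * d m x)) \<longlonglongrightarrow> 0" if f: "f \<in> L2 LD" for f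
  proof -
    have "(\<lambda>m. cnj (ip (lap m) (\<lambda>x. q x * f x) - ip lap0 (\<lambda>x. q x * f x))) \<longlonglongrightarrow> cnj (ip lap0 (\<lambda>x. q x * f x) - ip lap0 (\<lambda>x. q x * f x))"
      by (intro tendsto_intros laplim q_L2 f)
    moreover have "cnj (ip (lap m) (\<lambda>x. q x * f x) - ip lap0 (\<lambda>x. q x * f x)) = ip f (\<lambda>x. q x * d m x)" for m
    proof -
      have "ip (d m) (\<lambda>x. q x * f x) = ip (lap m) (\<lambda>x. q x * f x) - ip lap0 (\<lambda>x. q x * f x)"
        using ip_diff_left[OF Llap Llap0 q_L2[OF f], of m] by (simp add: d_def[abs_def])
      from this[symmetric] show ?thesis by (simp only: cnj_ip ip_q)
    qed
    ultimately show ?thesis by simp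
  qed
  have qzB: "nD (\<lambda>x. q x * d m x) \<le> q1 * (B + nD lap0)" for m by (rule order_trans[OF q1(2)[OF dL] mult_left_mono[OF dB q1(1)]])
  have qzlim: "(\<lambda>m. nD (\<lambda>x. q x * z m x)) \<longlonglongrightarrow> 0"
    by (rule Lim_null_comparison[OF always_eventually[OF allI] tendsto_mult_right_zero[OF zlim, of q1]]) (simp add: q1(2) zL)
  \<comment> \<open>This collects everything in the equation for \<open>u m\<close> tested with
    \<open>z m\<close>, apart from the quadratic term in \<open>d m\<close> and the boundary term.
    Each summand pairs a bounded sequence with one tending strongly to 0, or a fixed function with
    one tending weakly to 0.\<close>
  define r where "r m = of_real ((k m)^2) * (\<Sum>i\<in>UNIV. ip (w m i) (\<lambda>x. w m i x - w0 i x))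
    - (ip lap0 (\<lambda>x. q x * d m x)
      + of_real ((k m)^2) * ((cnj (ip (\<lambda>x. q x * d m x) (z m)) + ip u0' (\<lambda>x. q x * d m x)) + ip (lap m) (\<lambda>x. q x * z m x))
      + of_real ((k m)^4) * (ip (u m) (\<lambda>x. q x * z m x) + ip (u m) (z m)))" for m
  have rlim: "r \<longlonglongrightarrow> 0"
  proof -
    have "r \<longlonglongrightarrow> of_real (k0^2) * (\<Sum>i\<in>(UNIV::'n set). 0)
      - (0 + of_real (k0^2) * ((cnj 0 + 0) + 0) + of_real (k0^4) * (0 + 0))" unfolding r_def
      by (intro tendsto_intros klim weak Llap0 u0'(1) ip_tendsto_0[OF Lw w1 L2_diff[OF Lw Lw0] wlim]
          ip_tendsto_0[OF q_L2[OF dL] qzB zL zlim] ip_tendsto_0[OF Llap B q_L2[OF zL] qzlim]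
          ip_tendsto_0[OF Lu u1 q_L2[OF zL] qzlim] ip_tendsto_0[OF Lu u1 zL zlim])
    then show ?thesis by simp
  qed
  have key: "q0 * (nD (d m))^2 \<le> Re (r m)" for m
  proof -
    have zH1: "z m \<in> H1 D" "u m \<in> H1 D" using zH2 uH2 by (auto simp: H2_def)
    note bt = boundary_term[OF adm normal_deriv_L2(3)[OF uH2] L2_measurable[OF normal_deriv_L2(3)[OF zH2]] nz]
    have "form_A D n (\<eta> m) (k m) (u m) (z m) - of_real ((k m)^2) * form_B D (u m) (z m) = 0"
      using eig[of m] Hz(1) by (simp add: eigenpair_def)
    moreover define J where "J = (\<integral>x. (norm (normal_deriv D (u m) x))^2 / \<eta> m x \<partial>SD)"
    ultimately have A: "form_A0 D n (k m) (u m) (z m) + of_real ((k m)^2 * J) - of_real ((k m)^2) * form_B D (u m) (z m) = 0"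
      unfolding form_A_def bt(1) J_def by simp
    have J: "J \<ge> 0" unfolding J_def by (rule bt(2))
    have B: "form_B D (u m) (z m) = (\<Sum>i\<in>UNIV. ip (w m i) (\<lambda>x. w m i x - w0 i x))"
      unfolding form_B_ip[OF zH1(2,1)] w_def[symmetric]
      by (intro sum.cong refl ip_cong_right[OF Lw H1_L2(2)[OF zH1(1)] L2_diff[OF Lw Lw0] Hz(2)])
    have e1: "ip (lap m) (\<lambda>x. q x * d m x) = ip (d m) (\<lambda>x. q x * d m x) + ip lap0 (\<lambda>x. q x * d m x)"
      unfolding ip_add_left[OF dL Llap0 q_L2[OF dL], symmetric] by (simp add: d_def)
    have e2: "ip (u m) (\<lambda>x. q x * d m x) = cnj (ip (\<lambda>x. q x * d m x) (z m)) + ip u0' (\<lambda>x. q x * d m x)"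
      unfolding cnj_ip ip_add_left[OF zL u0'(1) q_L2[OF dL], symmetric] by (simp add: z_def)
    have "form_A0 D n (k m) (u m) (z m) = of_real ((k m)^2) * form_B D (u m) (z m) - r m + ip (d m) (\<lambda>x. q x * d m x)"
      unfolding form_A0_ip[OF uH2 zH2] lap_def[symmetric] qd[OF Llap] qd[OF Lu] e1 e2 B r_def by (simp add: algebra_simps)
    with A have "ip (d m) (\<lambda>x. q x * d m x) + of_real ((k m)^2 * J) = r m" by (simp add: algebra_simps)
    from arg_cong[OF this, of Re] have "Re (ip (d m) (\<lambda>x. q x * d m x)) + (k m)^2 * J = Re (r m)"
      unfolding plus_complex.sel Re_complex_of_real .
    moreover have "0 \<le> (k m)^2 * J" using J by simp
    ultimately show ?thesis using q0(2)[OF dL, of m] by linarith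
  qed
  have "(\<lambda>m. (nD (d m))^2) \<longlonglongrightarrow> 0"
  proof (rule Lim_null_comparison[OF always_eventually[OF allI]])
    show "(\<lambda>m. Re (r m) / q0) \<longlonglongrightarrow> 0" using tendsto_divide[OF tendsto_Re[OF rlim] tendsto_const, of q0] q0(1) by simp
    show "norm ((nD (d m))^2) \<le> Re (r m) / q0" for m using key[of m] q0(1) by (simp add: field_simps)
  qed
  then have dlim: "(\<lambda>m. nD (d m)) \<longlonglongrightarrow> 0" using tendsto_real_sqrt by fastforce
  have strong: "(\<lambda>m. H2_norm D (\<lambda>x. u m x - u0' x)) \<longlonglongrightarrow> 0"
  proof (rule Lim_null_comparison[OF always_eventually[OF allI]])
    let ?W = "\<lambda>m. \<Sum>i\<in>UNIV. dD (w m i) (w0 i)"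
    have W: "?W \<longlonglongrightarrow> 0" by (rule tendsto_null_sum) (rule wlim)
    show "(\<lambda>m. nD (z m) + ?W m + C * (nD (d m) + ?W m)) \<longlonglongrightarrow> 0"
      by (rule tendsto_add_zero[OF tendsto_add_zero[OF zlim W] tendsto_mult_right_zero[OF tendsto_add_zero[OF dlim W]]])
    fix m
    have "(\<Sum>i\<in>UNIV. \<Sum>j\<in>UNIV. dD (h m i j) (h0 i j)) \<le> C * (nD (d m) + ?W m)"
      using C(2)[OF Tz Twz, of m] by (simp add: d_def[abs_def] lap lap0 sum_subtractf)
    then show "norm (H2_norm D (\<lambda>x. u m x - u0' x)) \<le> nD (z m) + ?W m + C * (nD (d m) + ?W m)"
      using H2_norm_le[OF Tz Twz, of m] unfolding z_def[symmetric] by simp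
  qed
  show ?thesis by (rule exI[of _ u0'], rule conjI[OF ep strong])
qed

lemma eigenpair_subsequence:
  fixes \<eta> :: "nat \<Rightarrow> real^'n \<Rightarrow> real" and k :: "nat \<Rightarrow> real" and u :: "nat \<Rightarrow> real^'n \<Rightarrow> complex"
  assumes adm: "\<And>m. admissible D (\<eta> m)"
    and eta_lim: "(\<lambda>m. Linf_norm SD (\<eta> m)) \<longlonglongrightarrow> 0"
    and eig: "\<And>m. eigenpair D n (\<eta> m) (k m) (u m)" and normalized: "\<And>m. H1_norm D (u m) = 1"
    and bdd: "bounded (range k)"
  shows "\<exists>s k0 u0. strict_mono (s :: nat \<Rightarrow> nat) \<and> eigenpair0 D n k0 u0 \<and>
           (\<lambda>m. k (s m)) \<longlonglongrightarrow> k0 \<and> (\<lambda>m. H2_norm D (\<lambda>x. u (s m) x - u0 x)) \<longlonglongrightarrow> 0"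
proof -
  obtain k0 r where r: "strict_mono (r :: nat \<Rightarrow> nat)" "(k \<circ> r) \<longlonglongrightarrow> k0" using bounded_imp_convergent_subsequence[OF bdd] by blast
  have T: "H1_trace (u m) (\<lambda>i. wpartial D i (u m)) (\<lambda>x. 0)" for m
    using eig[of m] by (intro H2_H10_trace) (simp add: eigenpair_def)
  have B: "nD (u m) \<le> 1" "nD (wpartial D i (u m)) \<le> 1" for m i
    using H1_norm_bounds(1,2)[OF H1_trace_weak_partial[OF T]] normalized by auto
  obtain t where t: "strict_mono (t :: nat \<Rightarrow> nat)"
    "\<And>e. e > 0 \<Longrightarrow> \<exists>N. \<forall>m\<ge>N. \<forall>l\<ge>N. dD (u (r (t m))) (u (r (t l))) < e"
    by (rule zero_trace_compact[of "\<lambda>m. u (r m)" "\<lambda>m i. wpartial D i (u (r m))" 1, OF T B]) blast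
  have s: "strict_mono (\<lambda>m. r (t m))" using strict_mono_o[OF r(1) t(1)] by (simp add: o_def)
  have klim: "(\<lambda>m. k (r (t m))) \<longlonglongrightarrow> k0" using LIMSEQ_subseq_LIMSEQ[OF r(2) t(1)] by (simp add: o_def)
  have elim: "(\<lambda>m. Linf_norm SD (\<eta> (r (t m)))) \<longlonglongrightarrow> 0" using LIMSEQ_subseq_LIMSEQ[OF eta_lim s] by (simp add: o_def)
  obtain u0 where "eigenpair0 D n k0 u0" "(\<lambda>m. H2_norm D (\<lambda>x. u (r (t m)) x - u0 x)) \<longlonglongrightarrow> 0"
    using eigenpair_limit[OF adm elim eig normalized klim t(2)] by blast
  with s klim show ?thesis by (intro exI[of _ "\<lambda>m. r (t m)"] exI[of _ k0] exI[of _ u0]) simp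
qed

end

theorem theorem3p4:
  fixes D :: "(real^'n) set"
    and n :: "real^'n \<Rightarrow> real"
    and \<eta> :: "nat \<Rightarrow> real^'n \<Rightarrow> real"
    and k :: "nat \<Rightarrow> real"
    and u :: "nat \<Rightarrow> real^'n \<Rightarrow> complex"
  assumes dim: "CARD('n) \<in> {2, 3}"
    and D: "bounded D" "open D" "simply_connected D" "C2_boundary D"
    and n: "n \<in> Linf (lebesgue_on D)" "essinf (lebesgue_on D) n > 1"
    and adm: "\<And>m. admissible D (\<eta> m)"
    and eta_lim: "(\<lambda>m. Linf_norm (surface_measure D) (\<eta> m)) \<longlonglongrightarrow> 0"
    and eig: "\<And>m. eigenpair D n (\<eta> m) (k m) (u m)"
    and normalized: "\<And>m. H1_norm D (u m) = 1"
    and bdd: "bounded (range k)"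
  shows "\<exists>s k0 u0. strict_mono (s :: nat \<Rightarrow> nat) \<and> eigenpair0 D n k0 u0 \<and>
           (\<lambda>m. k (s m)) \<longlonglongrightarrow> k0 \<and>
           (\<lambda>m. H2_norm D (\<lambda>x. u (s m) x - u0 x)) \<longlonglongrightarrow> 0"
proof -
  have "index_domain D n" by unfold_locales (rule D n)+
  then show ?thesis by (rule index_domain.eigenpair_subsequence[OF _ adm eta_lim eig normalized bdd])
qed

end
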